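(* Let $A=(a_{ij})_{1\le i,j\le n}$ satisfy $a_{ij}=a_{ji}\ge0$ for $1\le i,j\le n$. Let $1\le m<n$, $c_1,\dots,c_m>0$, and let $\vec u=(c_1,\dots,c_m,0,\dots,0)U\in\mathbb{R}^nU$ be a semi-vector nonnegative solution of the system $-\Delta u_i+\lambda u_i=\sum_{j=1}^n a_{ij}u_iu_j^2$ in $\Omega$, $u_i\in H$, $1\le i\le n$. Put $c_{m+1}=\cdots=c_n=0$ and define $B=(b_{ij})_{1\le i,j\le n}$ by $$b_{ij}=\begin{cases}2a_{ii}c_i^2+\sum_{k=1}^na_{ik}c_k^2 & \text{if } i=j,\\ 2a_{ij}c_ic_j & \text{if } i\ne j,\end{cases}$$ and $A_m=(a_{ij})_{1\le i,j\le m}$. Let $f(x)=\max\{i\in\mathbb{N}\mid\omega_i<x\}$, with $f(x)=0$ if $\{i\in\mathbb{N}\mid\omega_i<x\}=\emptyset$. Then the Morse index of $\vec u$ equals $$\text{(the number of positive eigenvalues of }A_m)+\sum_{i=m+1}^nf(b_{ii}).$$ If $U$ is nondegenerate in $H$, the linearized kernel of the system at $\vec u$ is spanned by $$\Big\{\Big(\frac{\gamma_1}{c_1},\dots,\frac{\gamma_m}{c_m},0,\dots,0\Big)U\ \Big|\ A_m(\gamma_1,\dots,\gamma_m)^T=0\Big\}$$ and the sets $E_k=\{e_k\psi_{i}\mid i\in\mathbb{N},\ b_{kk}=\omega_{i}\}$, $k=m+1,\dots,n$, where $\{e_k\}_{k=1}^n$ is the standard basis of $\mathbb{R}^n$ and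 $E_k$ is empty if $b_{kk}\notin\{\omega_1,\omega_2,\dots\}$. Thus, $\vec u$ is nondegenerate if $U$ is nondegenerate in $H$, $\det(A_m)\ne0$ and $b_{kk}\notin\{\omega_1,\omega_2,\dots\}$ for $k=m+1,\dots,n$.
   Context: $\Omega\subset\mathbb{R}^N$ is a domain, $N\le 3$, $\lambda>0$. $H=H^1_0(\Omega)$, except that if $\Omega=\mathbb{R}^N$ then $H$ is the subspace of radially symmetric functions in $H^1(\mathbb{R}^N)$; $\mathbf{H}=H^n$. $U\in H$ is a least energy positive solution of the scalar equation $\Delta u-\lambda u+u^3=0$ in $\Omega$, $u=0$ on $\partial\Omega$ (so $U$ has Morse index $1$). $U$ is nondegenerate in $H$ if $\psi=0$ is the only $\psi\in H$ with $\Delta\psi-\lambda\psi+3U^2\psi=0$. $\mathbb{R}^nU=\{\vec cU\mid \vec c\in\mathbb{R}^n\}$. $\omega_1=1<\omega_2\le\omega_3\le\cdots$ are the eigenvalues, listed with multiplicity, with corresponding (linearly independent) eigenfunctions $\{\psi_i\}_{i=1}^\infty$, of the problem $\Delta\psi_i-\lambda\psi_i+\omega_iU^2\psi_i=0$, $\psi_i\in H$. The energy functional is $I(\vec u)=\frac12\sum_{i=1}^n\int_\Omega(|\nabla u_i|^2+\lambda u_i^2)\,dx-\frac14\int_\Omega\sum_{i,j=1}^na_{ij}u_i^2u_j^2\,dx$ on $\mathbf{H}$. A semi-vector nonnegative solution is a solution with all $u_i\ge0$, with $u_i>0$ for some $i$ and $u_j=0$ for some $j$. The Morse index of a solution $\vec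 u$ is the maximal dimension of a subspace $W\subset\mathbf{H}$ with $I''(\vec u)(\vec\phi,\vec\phi)<0$ for all $\vec\phi\in W\setminus\{0\}$. The linearized kernel of the system at $\vec u$ is $\{\vec\varphi\in\mathbf{H}\mid I''(\vec u)(\vec\varphi,\vec\psi)=0\ \forall\vec\psi\in\mathbf{H}\}$; $\vec u$ is nondegenerate if this kernel is $\{0\}$. Eigenvalues of symmetric matrices are counted with multiplicity. *)

theory Defs
  imports "HOL-Analysis.Analysis" "HOL-Library.Extended_Nat" "Jordan_Normal_Form.Char_Poly"
begin

(* Conventions. Functions on \<Omega> are HOL functions on the whole space of which only the
   restriction to \<Omega>, up to Lebesgue null sets, matters: everything below is invariant under
   changes on null sets and outside \<Omega>, and "= 0" in a function space means "= 0 almost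
   everywhere in \<Omega>". Elements of H^n are families indexed by {1..n}; values at
   other indices are irrelevant. *)

section \<open>Sobolev spaces\<close>

primrec Ck :: "nat \<Rightarrow> ('a::euclidean_space \<Rightarrow> real) \<Rightarrow> bool" where
  "Ck 0 f \<longleftrightarrow> continuous_on UNIV f"
| "Ck (Suc k) f \<longleftrightarrow>
     (\<exists>f'. (\<forall>x. (f has_derivative f' x) (at x)) \<and> (\<forall>b\<in>Basis. Ck k (\<lambda>x. f' x b)))"

definition test_functions :: "'a::euclidean_space set \<Rightarrow> ('a \<Rightarrow> real) set" where
  "test_functions \<Omega> = {\<phi>. (\<forall>k. Ck k \<phi>) \<and> compact (closure {x. \<phi> x \<noteq> 0})
                          \<and> closure {x. \<phi> x \<noteq> 0} \<subseteq> \<Omega>}"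

definition L2 :: "'a::euclidean_space set \<Rightarrow> ('a \<Rightarrow> 'b::euclidean_space) set" where
  "L2 \<Omega> = {u \<in> borel_measurable (lebesgue_on \<Omega>). integrable (lebesgue_on \<Omega>) (\<lambda>x. (norm (u x))\<^sup>2)}"

definition has_weak_gradient ::
  "'a::euclidean_space set \<Rightarrow> ('a \<Rightarrow> real) \<Rightarrow> ('a \<Rightarrow> 'a) \<Rightarrow> bool" where
  "has_weak_gradient \<Omega> u g \<longleftrightarrow>
     (\<forall>\<phi>\<in>test_functions \<Omega>. \<forall>b\<in>Basis.
        (\<integral>x. u x * frechet_derivative \<phi> (at x) b \<partial>lebesgue_on \<Omega>)
          = - (\<integral>x. (g x \<bullet> b) * \<phi> x \<partial>lebesgue_on \<Omega>))"

definition H1 :: "'a::euclidean_space set \<Rightarrow> ('a \<Rightarrow> real) set" where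
  "H1 \<Omega> = {u \<in> L2 \<Omega>. \<exists>g\<in>L2 \<Omega>. has_weak_gradient \<Omega> u g}"

(* Determined up to a null set in \<Omega> when u is in H1 and \<Omega> is open. *)
definition weak_gradient :: "'a::euclidean_space set \<Rightarrow> ('a \<Rightarrow> real) \<Rightarrow> 'a \<Rightarrow> 'a" where
  "weak_gradient \<Omega> u = (SOME g. g \<in> L2 \<Omega> \<and> has_weak_gradient \<Omega> u g)"

definition H1_norm :: "'a::euclidean_space set \<Rightarrow> ('a \<Rightarrow> real) \<Rightarrow> real" where
  "H1_norm \<Omega> u = sqrt (\<integral>x. (u x)\<^sup>2 + (norm (weak_gradient \<Omega> u x))\<^sup>2 \<partial>lebesgue_on \<Omega>)"

definition H1_0 :: "'a::euclidean_space set \<Rightarrow> ('a \<Rightarrow> real) set" where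
  "H1_0 \<Omega> = {u \<in> H1 \<Omega>. \<exists>\<phi>::nat \<Rightarrow> 'a \<Rightarrow> real. (\<forall>k. \<phi> k \<in> test_functions \<Omega>) \<and>
                (\<lambda>k. H1_norm \<Omega> (\<lambda>x. u x - \<phi> k x)) \<longlonglongrightarrow> 0}"

definition H1_radial :: "('a::euclidean_space \<Rightarrow> real) set" where
  "H1_radial = {u \<in> H1 UNIV. \<exists>h::real \<Rightarrow> real. AE x in lebesgue. u x = h (norm x)}"

definition Hspace :: "'a::euclidean_space set \<Rightarrow> ('a \<Rightarrow> real) set" where
  "Hspace \<Omega> = (if \<Omega> = UNIV then H1_radial else H1_0 \<Omega>)"

definition Hvec :: "'a::euclidean_space set \<Rightarrow> nat \<Rightarrow> (nat \<Rightarrow> 'a \<Rightarrow> real) set" where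
  "Hvec \<Omega> n = {u. \<forall>i\<in>{1..n}. u i \<in> Hspace \<Omega>}"

definition vzero :: "'a::euclidean_space set \<Rightarrow> nat \<Rightarrow> (nat \<Rightarrow> 'a \<Rightarrow> real) \<Rightarrow> bool" where
  "vzero \<Omega> n u \<longleftrightarrow> (\<forall>i\<in>{1..n}. AE x in lebesgue_on \<Omega>. u i x = 0)"

definition ae_span ::
  "'a::euclidean_space set \<Rightarrow> nat \<Rightarrow> (nat \<Rightarrow> 'a \<Rightarrow> real) set \<Rightarrow> (nat \<Rightarrow> 'a \<Rightarrow> real) set" where
  "ae_span \<Omega> n S = {\<phi>. \<exists>F r. finite F \<and> F \<subseteq> S \<and>
       vzero \<Omega> n (\<lambda>i x. \<phi> i x - (\<Sum>w\<in>F. r w * w i x))}"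

section \<open>The system and its energy\<close>

definition energy ::
  "'a::euclidean_space set \<Rightarrow> real \<Rightarrow> nat \<Rightarrow> (nat \<Rightarrow> nat \<Rightarrow> real) \<Rightarrow> (nat \<Rightarrow> 'a \<Rightarrow> real) \<Rightarrow> real" where
  "energy \<Omega> lam n a u =
     1/2 * (\<Sum>i=1..n. \<integral>x. (norm (weak_gradient \<Omega> (u i) x))\<^sup>2 + lam * (u i x)\<^sup>2 \<partial>lebesgue_on \<Omega>)
     - 1/4 * (\<integral>x. (\<Sum>i=1..n. \<Sum>j=1..n. a i j * (u i x)\<^sup>2 * (u j x)\<^sup>2) \<partial>lebesgue_on \<Omega>)"

definition energy'' ::
  "'a::euclidean_space set \<Rightarrow> real \<Rightarrow> nat \<Rightarrow> (nat \<Rightarrow> nat \<Rightarrow> real) \<Rightarrow> (nat \<Rightarrow> 'a \<Rightarrow> real)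
     \<Rightarrow> (nat \<Rightarrow> 'a \<Rightarrow> real) \<Rightarrow> (nat \<Rightarrow> 'a \<Rightarrow> real) \<Rightarrow> real" where
  "energy'' \<Omega> lam n a u \<phi> \<psi> =
     deriv (\<lambda>s. deriv (\<lambda>t. energy \<Omega> lam n a (\<lambda>i x. u i x + s * \<phi> i x + t * \<psi> i x)) 0) 0"

(* Weak form of - Laplace u_i + lam u_i = sum_j a_ij u_i u_j^2, tested against H; for
   \<Omega> = UNIV this is the Euler-Lagrange equation within the radial functions. *)
definition system_solution ::
  "'a::euclidean_space set \<Rightarrow> real \<Rightarrow> nat \<Rightarrow> (nat \<Rightarrow> nat \<Rightarrow> real) \<Rightarrow> (nat \<Rightarrow> 'a \<Rightarrow> real) \<Rightarrow> bool" where
  "system_solution \<Omega> lam n a u \<longleftrightarrow> u \<in> Hvec \<Omega> n \<and>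
     (\<forall>i\<in>{1..n}. \<forall>v\<in>Hspace \<Omega>.
        (\<integral>x. weak_gradient \<Omega> (u i) x \<bullet> weak_gradient \<Omega> v x + lam * u i x * v x \<partial>lebesgue_on \<Omega>)
          = (\<integral>x. (\<Sum>j=1..n. a i j * u i x * (u j x)\<^sup>2) * v x \<partial>lebesgue_on \<Omega>))"

definition semi_vector_nonneg_solution ::
  "'a::euclidean_space set \<Rightarrow> real \<Rightarrow> nat \<Rightarrow> (nat \<Rightarrow> nat \<Rightarrow> real) \<Rightarrow> (nat \<Rightarrow> 'a \<Rightarrow> real) \<Rightarrow> bool" where
  "semi_vector_nonneg_solution \<Omega> lam n a u \<longleftrightarrow> system_solution \<Omega> lam n a u \<and>
     (\<forall>i\<in>{1..n}. AE x in lebesgue_on \<Omega>. u i x \<ge> 0) \<and>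
     (\<exists>i\<in>{1..n}. AE x in lebesgue_on \<Omega>. u i x > 0) \<and>
     (\<exists>j\<in>{1..n}. AE x in lebesgue_on \<Omega>. u j x = 0)"

(* The supremum runs over the dimensions k of the finite-dimensional negative definite subspaces,
   each given by a basis W 0, ..., W (k - 1). *)
definition morse_index ::
  "'a::euclidean_space set \<Rightarrow> real \<Rightarrow> nat \<Rightarrow> (nat \<Rightarrow> nat \<Rightarrow> real) \<Rightarrow> (nat \<Rightarrow> 'a \<Rightarrow> real) \<Rightarrow> enat" where
  "morse_index \<Omega> lam n a u = (SUP k \<in> {k. \<exists>W::nat \<Rightarrow> nat \<Rightarrow> 'a \<Rightarrow> real.
       (\<forall>p<k. W p \<in> Hvec \<Omega> n) \<and>
       (\<forall>r::nat \<Rightarrow> real. vzero \<Omega> n (\<lambda>i x. \<Sum>p<k. r p * W p i x) \<longrightarrow> (\<forall>p<k. r p = 0)) \<and>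
       (\<forall>r::nat \<Rightarrow> real. let \<phi> = (\<lambda>i x. \<Sum>p<k. r p * W p i x) in
          \<not> vzero \<Omega> n \<phi> \<longrightarrow> energy'' \<Omega> lam n a u \<phi> \<phi> < 0)}. enat k)"

definition linearized_kernel ::
  "'a::euclidean_space set \<Rightarrow> real \<Rightarrow> nat \<Rightarrow> (nat \<Rightarrow> nat \<Rightarrow> real) \<Rightarrow> (nat \<Rightarrow> 'a \<Rightarrow> real)
     \<Rightarrow> (nat \<Rightarrow> 'a \<Rightarrow> real) set" where
  "linearized_kernel \<Omega> lam n a u =
     {\<phi> \<in> Hvec \<Omega> n. \<forall>\<psi>\<in>Hvec \<Omega> n. energy'' \<Omega> lam n a u \<phi> \<psi> = 0}"

definition system_nondegenerate ::
  "'a::euclidean_space set \<Rightarrow> real \<Rightarrow> nat \<Rightarrow> (nat \<Rightarrow> nat \<Rightarrow> real) \<Rightarrow> (nat \<Rightarrow> 'a \<Rightarrow> real) \<Rightarrow> bool" where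
  "system_nondegenerate \<Omega> lam n a u \<longleftrightarrow> (\<forall>\<phi>\<in>linearized_kernel \<Omega> lam n a u. vzero \<Omega> n \<phi>)"

section \<open>The scalar equation\<close>

(* The scalar equation is the system with n = 1 and a_11 = 1. *)

abbreviation scalar_solution :: "'a::euclidean_space set \<Rightarrow> real \<Rightarrow> ('a \<Rightarrow> real) \<Rightarrow> bool" where
  "scalar_solution \<Omega> lam U \<equiv> system_solution \<Omega> lam 1 (\<lambda>_ _. 1) (\<lambda>_. U)"

abbreviation scalar_energy :: "'a::euclidean_space set \<Rightarrow> real \<Rightarrow> ('a \<Rightarrow> real) \<Rightarrow> real" where
  "scalar_energy \<Omega> lam U \<equiv> energy \<Omega> lam 1 (\<lambda>_ _. 1) (\<lambda>_. U)"

abbreviation scalar_morse_index :: "'a::euclidean_space set \<Rightarrow> real \<Rightarrow> ('a \<Rightarrow> real) \<Rightarrow> enat" where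
  "scalar_morse_index \<Omega> lam U \<equiv> morse_index \<Omega> lam 1 (\<lambda>_ _. 1) (\<lambda>_. U)"

definition least_energy_positive_solution ::
  "'a::euclidean_space set \<Rightarrow> real \<Rightarrow> ('a \<Rightarrow> real) \<Rightarrow> bool" where
  "least_energy_positive_solution \<Omega> lam U \<longleftrightarrow> scalar_solution \<Omega> lam U \<and>
     (AE x in lebesgue_on \<Omega>. U x > 0) \<and>
     (\<forall>V. scalar_solution \<Omega> lam V \<and> \<not> (AE x in lebesgue_on \<Omega>. V x = 0)
        \<longrightarrow> scalar_energy \<Omega> lam U \<le> scalar_energy \<Omega> lam V)"

(* Weak form, in H, of Laplace p - lam p + mu U^2 p = 0. *)
definition weighted_eigen_eq ::
  "'a::euclidean_space set \<Rightarrow> real \<Rightarrow> ('a \<Rightarrow> real) \<Rightarrow> real \<Rightarrow> ('a \<Rightarrow> real) \<Rightarrow> bool" where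
  "weighted_eigen_eq \<Omega> lam U mu p \<longleftrightarrow> p \<in> Hspace \<Omega> \<and>
     (\<forall>v\<in>Hspace \<Omega>.
        (\<integral>x. weak_gradient \<Omega> p x \<bullet> weak_gradient \<Omega> v x + lam * p x * v x \<partial>lebesgue_on \<Omega>)
          = mu * (\<integral>x. (U x)\<^sup>2 * p x * v x \<partial>lebesgue_on \<Omega>))"

definition scalar_nondegenerate ::
  "'a::euclidean_space set \<Rightarrow> real \<Rightarrow> ('a \<Rightarrow> real) \<Rightarrow> bool" where
  "scalar_nondegenerate \<Omega> lam U \<longleftrightarrow>
     (\<forall>p. weighted_eigen_eq \<Omega> lam U 3 p \<longrightarrow> (AE x in lebesgue_on \<Omega>. p x = 0))"

(* \<omega> i, i = 1, 2, ..., lists the eigenvalues with multiplicity: the \<psi> i are linearly independent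
   eigenfunctions, and those with \<omega> i = mu span the solutions for the parameter mu. *)
definition eigen_listing ::
  "'a::euclidean_space set \<Rightarrow> real \<Rightarrow> ('a \<Rightarrow> real) \<Rightarrow> (nat \<Rightarrow> real) \<Rightarrow> (nat \<Rightarrow> 'a \<Rightarrow> real) \<Rightarrow> bool" where
  "eigen_listing \<Omega> lam U \<omega> \<psi> \<longleftrightarrow>
     \<omega> 1 = 1 \<and> \<omega> 1 < \<omega> 2 \<and> (\<forall>i\<ge>2. \<omega> i \<le> \<omega> (i + 1)) \<and>
     (\<forall>i\<ge>1. weighted_eigen_eq \<Omega> lam U (\<omega> i) (\<psi> i)) \<and>
     (\<forall>F r. finite F \<and> F \<subseteq> {1..} \<and> (AE x in lebesgue_on \<Omega>. (\<Sum>i\<in>F. r i * \<psi> i x) = 0)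
        \<longrightarrow> (\<forall>i\<in>F. r i = 0)) \<and>
     (\<forall>mu p. weighted_eigen_eq \<Omega> lam U mu p \<longrightarrow>
        (\<exists>F r. finite F \<and> F \<subseteq> {i. 1 \<le> i \<and> \<omega> i = mu} \<and>
           (AE x in lebesgue_on \<Omega>. p x = (\<Sum>i\<in>F. r i * \<psi> i x))))"

definition eigen_count :: "(nat \<Rightarrow> real) \<Rightarrow> real \<Rightarrow> nat" where
  "eigen_count \<omega> x =
     (if {i. 1 \<le> i \<and> \<omega> i < x} = {} then 0 else Max {i. 1 \<le> i \<and> \<omega> i < x})"

section \<open>Matrices\<close>

definition Bcoeff :: "nat \<Rightarrow> (nat \<Rightarrow> nat \<Rightarrow> real) \<Rightarrow> (nat \<Rightarrow> real) \<Rightarrow> nat \<Rightarrow> nat \<Rightarrow> real" where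
  "Bcoeff n a c i j =
     (if i = j then 2 * a i i * (c i)\<^sup>2 + (\<Sum>k=1..n. a i k * (c k)\<^sup>2) else 2 * a i j * c i * c j)"

(* Matrices of the Jordan_Normal_Form library are indexed from 0. *)
definition leading_block :: "nat \<Rightarrow> (nat \<Rightarrow> nat \<Rightarrow> real) \<Rightarrow> real mat" where
  "leading_block m a = Matrix.mat m m (\<lambda>(i, j). a (i + 1) (j + 1))"

definition num_pos_eigenvalues :: "real mat \<Rightarrow> nat" where
  "num_pos_eigenvalues M = (\<Sum>x | eigenvalue M x \<and> x > 0. order x (char_poly M))"

end

(*
  Writing P for the energy form of the operator - Laplace + lam and B for the form with weight U^2,
  the second variation at (c_1, ..., c_m, 0, ..., 0) U splits: the last n - m components contribute
  the scalar forms P - b_kk B, and the first m, since the system at u reads sum_j a_ij c_j^2 = 1,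
  contribute P - B on each component minus twice the coupling by the matrix (a_ij c_i c_j).
  Split off from each of these m components its B-orthogonal projection onto U. As U has Morse
  index 1, P >= 3 B on the B-orthogonal complement of U (that is, omega_2 >= 3), while the entrywise
  nonnegative matrix (a_ij c_i c_j) has the positive eigenvector c with eigenvalue 1,
  so the coupling is at most B there (Schur's test) and the block is nonnegative. What remains on
  R^m U is - 2 A_m up to the congruence by diag(c), and it is the negative directions and the
  kernel of this finite matrix together with those of P - b_kk B that are counted.

  The eigenvalues below a bound are finite in number, and an eigenfunction expansion is replaced by
  the following: if P - b B were negative somewhere on the B-orthogonal complement of the
  eigenfunctions below b, then maximizing B / P on that complement would yield a further eigenvalue
  below b. The maximum is attained because U^2 makes B compact relative to P; this rests on the
  embedding of H^1 in L^4 in dimension at most 3, which is proved by telescoping the averages of a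
  function over dyadic cells.
*)
theory Submission imports Defs begin

text \<open>The spectral part is carried out for two nonnegative forms \<open>P\<close> and
  \<open>B\<close> on a bare space of functions in which nothing is identified almost everywhere.
  Definiteness is replaced by one fact: a vector on which a nonnegative form vanishes is orthogonal
  to everything. Applied to forms such as \<open>\<mu> P - B\<close> or \<open>P - 3 B\<close> it
  turns extremals into eigenvectors. Compactness is encoded quantitatively: up to
  \<open>e P\<close>, the form \<open>B\<close> is controlled by finitely many functionals. This
  inequality yields the maximizer, the finiteness of the spectrum below a bound and, for matrices,
  the spectral theorem. In \<open>H\<close> it comes from the weight: U^2 lies in L^2, so up to a
  small L^2 error it is bounded with bounded support, and on a ball the functionals are integrals
  over small grid cells. The listing only exhausts each eigenspace; its completeness is not given.
  The index is therefore pinned from two sides: negativity on a span, and nonnegativity under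
  equally many linear conditions, which a larger subspace always meets.\<close>

no_notation scalar_prod (infix \<open>\<bullet>\<close> 70)

section \<open>Nonnegative forms on spaces of functions\<close>

text \<open>Only semidefinite, because functions that agree almost everywhere are not identified.
  Addition and scaling are merged into \<open>u + r v\<close>, so that each instance has one closure
  and one linearity property to check.\<close>

locale pos_form =
  fixes H :: "('x \<Rightarrow> real) set" and Q :: "('x \<Rightarrow> real) \<Rightarrow> ('x \<Rightarrow> real) \<Rightarrow> real"
  assumes zero_mem: "(\<lambda>_. 0) \<in> H"
    and lincomb_mem: "u \<in> H \<Longrightarrow> v \<in> H \<Longrightarrow> (\<lambda>x. u x + r * v x) \<in> H"
    and sym: "u \<in> H \<Longrightarrow> v \<in> H \<Longrightarrow> Q u v = Q v u"
    and lincomb: "u \<in> H \<Longrightarrow> v \<in> H \<Longrightarrow> w \<in> H \<Longrightarrow> Q (\<lambda>x. u x + r * v x) w = Q u w + r * Q v w"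
    and nonneg: "u \<in> H \<Longrightarrow> 0 \<le> Q u u"
begin

lemma diff_mem: "u \<in> H \<Longrightarrow> v \<in> H \<Longrightarrow> (\<lambda>x. u x - v x) \<in> H"
  using lincomb_mem[of u v "-1"] by simp

lemma scale_mem: "u \<in> H \<Longrightarrow> (\<lambda>x. r * u x) \<in> H"
  using lincomb_mem[OF zero_mem, of u r] by simp

lemma sum_mem: "finite F \<Longrightarrow> (\<And>i. i \<in> F \<Longrightarrow> f i \<in> H) \<Longrightarrow> (\<lambda>x. \<Sum>i\<in>F. r i * f i x) \<in> H"
proof (induction F rule: finite_induct)
  case empty
  then show ?case by (simp add: zero_mem)
next
  case (insert i F)
  then have "(\<lambda>x. (\<Sum>i\<in>F. r i * f i x) + r i * f i x) \<in> H"
    by (intro lincomb_mem) auto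
  then show ?case using insert by (simp add: add.commute)
qed

lemma zero_left: "w \<in> H \<Longrightarrow> Q (\<lambda>_. 0) w = 0"
  using lincomb[OF zero_mem zero_mem, of w 1] by simp

lemma scale_left: "u \<in> H \<Longrightarrow> w \<in> H \<Longrightarrow> Q (\<lambda>x. r * u x) w = r * Q u w"
  using lincomb[OF zero_mem, of u w r] zero_left by simp

lemma diff_left: "u \<in> H \<Longrightarrow> v \<in> H \<Longrightarrow> w \<in> H \<Longrightarrow> Q (\<lambda>x. u x - v x) w = Q u w - Q v w"
  using lincomb[of u v w "-1"] by simp

lemma diff_right: "u \<in> H \<Longrightarrow> v \<in> H \<Longrightarrow> w \<in> H \<Longrightarrow> Q w (\<lambda>x. u x - v x) = Q w u - Q w v"
  using diff_left[of u v w] sym[of w "\<lambda>x. u x - v x"] sym[of w u] sym[of w v] diff_mem[of u v] by simp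

lemma lincomb_right:
  "u \<in> H \<Longrightarrow> v \<in> H \<Longrightarrow> w \<in> H \<Longrightarrow> Q w (\<lambda>x. u x + r * v x) = Q w u + r * Q w v"
  using lincomb[of u v w r] sym[of w "\<lambda>x. u x + r * v x"] sym[of w u] sym[of w v]
    lincomb_mem[of u v r] by simp

lemma scale_right: "u \<in> H \<Longrightarrow> w \<in> H \<Longrightarrow> Q w (\<lambda>x. r * u x) = r * Q w u"
  using scale_left[of u w r] sym[of w "\<lambda>x. r * u x"] sym[of w u] scale_mem[of u r] by simp

lemma sum_left:
  "finite F \<Longrightarrow> (\<And>i. i \<in> F \<Longrightarrow> f i \<in> H) \<Longrightarrow> w \<in> H \<Longrightarrow>
    Q (\<lambda>x. \<Sum>i\<in>F. r i * f i x) w = (\<Sum>i\<in>F. r i * Q (f i) w)"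
proof (induction F rule: finite_induct)
  case empty
  then show ?case by (simp add: zero_left)
next
  case (insert i F)
  then have "Q (\<lambda>x. (\<Sum>i\<in>F. r i * f i x) + r i * f i x) w
      = Q (\<lambda>x. \<Sum>i\<in>F. r i * f i x) w + r i * Q (f i) w"
    by (intro lincomb sum_mem) auto
  then show ?case using insert by (simp add: add.commute)
qed

lemma sum_right:
  "finite F \<Longrightarrow> (\<And>i. i \<in> F \<Longrightarrow> f i \<in> H) \<Longrightarrow> w \<in> H \<Longrightarrow>
    Q w (\<lambda>x. \<Sum>i\<in>F. r i * f i x) = (\<Sum>i\<in>F. r i * Q w (f i))"
proof -
  assume *: "finite F" "\<And>i. i \<in> F \<Longrightarrow> f i \<in> H" "w \<in> H"
  have "Q w (\<lambda>x. \<Sum>i\<in>F. r i * f i x) = Q (\<lambda>x. \<Sum>i\<in>F. r i * f i x) w"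
    by (rule sym) (auto intro: * sum_mem)
  also have "\<dots> = (\<Sum>i\<in>F. r i * Q (f i) w)"
    by (rule sum_left) (use * in auto)
  also have "\<dots> = (\<Sum>i\<in>F. r i * Q w (f i))"
    by (intro sum.cong refl) (use * in \<open>simp add: sym[of _ w]\<close>)
  finally show ?thesis .
qed

lemma quadratic: "u \<in> H \<Longrightarrow> v \<in> H \<Longrightarrow>
    Q (\<lambda>x. u x + r * v x) (\<lambda>x. u x + r * v x) = Q u u + 2 * r * Q u v + r\<^sup>2 * Q v v"
proof -
  assume u: "u \<in> H" and v: "v \<in> H"
  have "Q (\<lambda>x. u x + r * v x) (\<lambda>x. u x + r * v x)
      = Q u u + r * Q u v + r * (Q v u + r * Q v v)"
    by (simp add: lincomb lincomb_right lincomb_mem u v)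
  then show ?thesis
    using sym[OF u v] by (simp add: algebra_simps power2_eq_square)
qed

lemma Cauchy_Schwarz: assumes u: "u \<in> H" and v: "v \<in> H" shows "(Q u v)\<^sup>2 \<le> Q u u * Q v v"
proof -
  have nn: "0 \<le> Q u u + 2 * r * Q u v + r\<^sup>2 * Q v v" for r
    using quadratic[OF u v, of r] nonneg[OF lincomb_mem[OF u v, of r]] by simp
  show ?thesis
  proof (cases "Q v v = 0")
    case True
    have "Q u v = 0"
    proof (rule ccontr)
      assume ne: "Q u v \<noteq> 0"
      \<comment> \<open>With \<open>Q v v = 0\<close> the quadratic is affine in \<open>r\<close>;
        this \<open>r\<close> drives it to -1.\<close>
      have "0 \<le> Q u u + 2 * (- (Q u u + 1) / (2 * Q u v)) * Q u v"
        using nn[of "- (Q u u + 1) / (2 * Q u v)"] True by simp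
      also have "\<dots> = -1" using ne by (simp add: field_simps)
      finally show False by simp
    qed
    then show ?thesis using True by simp
  next
    case False
    then have pos: "Q v v > 0" using nonneg[OF v] by simp
    \<comment> \<open>This \<open>r\<close> minimizes the quadratic.\<close>
    have "0 \<le> Q u u + 2 * (- Q u v / Q v v) * Q u v + (- Q u v / Q v v)\<^sup>2 * Q v v"
      by (rule nn)
    also have "\<dots> = Q u u - (Q u v)\<^sup>2 / Q v v"
      using pos by (simp add: field_simps power2_eq_square)
    finally show ?thesis using pos by (simp add: field_simps)
  qed
qed

text \<open>The substitute for definiteness, immediate from Cauchy-Schwarz. For a difference of two
  forms that is nonnegative on a subspace, it is the Euler-Lagrange equation of an extremal.\<close>

lemma null_left: "u \<in> H \<Longrightarrow> v \<in> H \<Longrightarrow> Q u u = 0 \<Longrightarrow> Q u v = 0"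
  using Cauchy_Schwarz[of u v] by simp

lemma diff_le: assumes u: "u \<in> H" and v: "v \<in> H"
  shows "Q (\<lambda>x. u x - v x) (\<lambda>x. u x - v x) \<le> 2 * Q u u + 2 * Q v v"
proof -
  have "0 \<le> Q u u + 2 * 1 * Q u v + 1\<^sup>2 * Q v v"
    using quadratic[OF u v, of 1] nonneg[OF lincomb_mem[OF u v, of 1]] by simp
  moreover have "Q (\<lambda>x. u x - v x) (\<lambda>x. u x - v x) = Q u u - 2 * Q u v + Q v v"
    using quadratic[OF u v, of "-1"] by simp
  ultimately show ?thesis by simp
qed

text \<open>Gram-Schmidt by induction rather than inversion of the Gram matrix, which may be
  singular: the \<open>f i\<close> can be dependent and \<open>Q\<close> is only semidefinite. The
  coefficients need not be unique.\<close>

lemma projection: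
  assumes "finite I" "\<And>i. i \<in> I \<Longrightarrow> f i \<in> H" "v \<in> H"
  shows "\<exists>r. \<forall>j\<in>I. Q (\<lambda>x. v x - (\<Sum>i\<in>I. r i * f i x)) (f j) = 0"
  using assms
proof (induction I arbitrary: v rule: finite_induct)
  case empty
  then show ?case by simp
next
  case (insert k I)
  have fI: "\<And>i. i \<in> I \<Longrightarrow> f i \<in> H" and fk: "f k \<in> H" using insert by auto
  obtain r where r: "\<forall>j\<in>I. Q (\<lambda>x. v x - (\<Sum>i\<in>I. r i * f i x)) (f j) = 0"
    using insert.IH[OF fI] insert.prems by blast
  obtain s where s: "\<forall>j\<in>I. Q (\<lambda>x. f k x - (\<Sum>i\<in>I. s i * f i x)) (f j) = 0"
    using insert.IH[OF fI fk] by blast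
  let ?p = "\<lambda>x. \<Sum>i\<in>I. s i * f i x"
  let ?q = "\<lambda>x. f k x - ?p x" and ?w = "\<lambda>x. v x - (\<Sum>i\<in>I. r i * f i x)"
  have p: "?p \<in> H" by (rule sum_mem) (use insert fI in auto)
  have q: "?q \<in> H" by (rule diff_mem[OF fk p])
  have w: "?w \<in> H" by (rule diff_mem, fact, rule sum_mem) (use insert fI in auto)
  have perp: "Q y ?p = 0" if "\<forall>j\<in>I. Q y (f j) = 0" "y \<in> H" for y
    using sum_right[OF insert(1) fI that(2), where r = s] that by simp
  \<comment> \<open>If the new direction \<open>?q\<close> is null, then \<open>null_left\<close>
    already gives \<open>Q ?w ?q = 0\<close>, and the coefficient 0 is right.\<close>
  define t where "t = (if Q ?q ?q = 0 then 0 else Q ?w ?q / Q ?q ?q)"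
  let ?z = "\<lambda>x. ?w x + (- t) * ?q x"
  have z: "?z \<in> H" by (rule lincomb_mem[OF w q])
  have zI: "\<forall>j\<in>I. Q ?z (f j) = 0"
    using r s lincomb[OF w q fI, of _ "-t"] by simp
  have "Q ?z ?q = Q ?w ?q - t * Q ?q ?q"
    using lincomb[OF w q q, of "-t"] by simp
  also have "\<dots> = 0"
    using null_left[OF q w] sym[OF q w] by (auto simp: t_def)
  finally have "Q ?z (f k) = 0"
    using perp[OF zI z] diff_right[OF fk p z] by simp
  with zI have all: "\<forall>j\<in>insert k I. Q ?z (f j) = 0" by simp
  define r' where "r' = (\<lambda>i. if i = k then t else r i - t * s i)"
  have "?z = (\<lambda>x. v x - (\<Sum>i\<in>insert k I. r' i * f i x))"
  proof
    fix x
    have "(\<Sum>i\<in>I. r' i * f i x) = (\<Sum>i\<in>I. r i * f i x - t * (s i * f i x))"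
      by (intro sum.cong) (use insert in \<open>auto simp: r'_def algebra_simps\<close>)
    also have "\<dots> = (\<Sum>i\<in>I. r i * f i x) - t * ?p x"
      by (simp add: sum_subtractf sum_distrib_left)
    finally have "(\<Sum>i\<in>insert k I. r' i * f i x) = t * f k x + ((\<Sum>i\<in>I. r i * f i x) - t * ?p x)"
      using insert(1,2) by (simp add: r'_def)
    then show "?z x = v x - (\<Sum>i\<in>insert k I. r' i * f i x)"
      by (simp add: right_diff_distrib)
  qed
  then show ?case using all by auto
qed

end

text \<open>The last assumption says that \<open>B\<close> is compact relative to \<open>P\<close>,
  in the form of an inequality of Ehrling type: apart from an arbitrarily small multiple of
  \<open>P\<close>, the form \<open>B\<close> is governed by finitely many \<open>P\<close>-bounded
  linear functionals.\<close>

locale compact_pair = P: pos_form H P + B: pos_form H B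
  for H :: "('x \<Rightarrow> real) set" and P B +
  assumes B_bound: "\<exists>C\<ge>0. \<forall>u\<in>H. B u u \<le> C * P u u"
    and complete: "\<And>f. (\<And>k::nat. f k \<in> H) \<Longrightarrow>
      (\<And>e. e > 0 \<Longrightarrow> \<exists>N. \<forall>k\<ge>N. \<forall>l\<ge>N. P (\<lambda>x. f k x - f l x) (\<lambda>x. f k x - f l x) < e) \<Longrightarrow>
      \<exists>u\<in>H. (\<lambda>k. P (\<lambda>x. f k x - u x) (\<lambda>x. f k x - u x)) \<longlonglongrightarrow> 0"
    and compact: "\<And>e. e > 0 \<Longrightarrow> \<exists>(p::nat) l C. C \<ge> 0 \<and>
      (\<forall>i<p. \<forall>u\<in>H. \<forall>v\<in>H. \<forall>r. l i (\<lambda>x. u x + r * v x) = l i u + r * l i v) \<and>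
      (\<forall>i<p. \<exists>D\<ge>0. \<forall>u\<in>H. (l i u)\<^sup>2 \<le> D * P u u) \<and>
      (\<forall>u\<in>H. B u u \<le> e * P u u + C * (\<Sum>i<p. (l i u)\<^sup>2))"

lemma common_convergent_subseq:
  fixes b :: "nat \<Rightarrow> nat \<Rightarrow> real"
  assumes "\<And>i. i < p \<Longrightarrow> Bseq (b i)"
  shows "\<exists>r. strict_mono (r::nat \<Rightarrow> nat) \<and> (\<forall>i<p. convergent (\<lambda>k. b i (r k)))"
  using assms
proof (induction p)
  case 0
  show ?case by (auto intro: exI[of _ id] strict_mono_id)
next
  case (Suc p)
  obtain r where r: "strict_mono (r::nat \<Rightarrow> nat)" "\<forall>i<p. convergent (\<lambda>k. b i (r k))"
    using Suc by auto
  have "Bseq (\<lambda>k. b p (r k))"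
    using Suc.prems[of p] by (auto simp: Bseq_def)
  then have "bounded (range (\<lambda>k. b p (r k)))"
    by (simp add: Bseq_eq_bounded)
  then obtain l s where s: "strict_mono (s::nat \<Rightarrow> nat)" "((\<lambda>k. b p (r k)) \<circ> s) \<longlonglongrightarrow> l"
    using bounded_imp_convergent_subsequence by blast
  have "convergent (\<lambda>k. b i ((r \<circ> s) k))" if "i < Suc p" for i
  proof (cases "i = p")
    case True
    then show ?thesis using s(2) by (auto simp: convergent_def o_def)
  next
    case False
    then have "convergent (\<lambda>k. b i (r k))" using r that by auto
    then show ?thesis
      using convergent_subseq_convergent[OF _ s(1)] by (fastforce simp: o_def)
  qed
  then show ?case using strict_mono_o[OF r(1) s(1)] by blast
qed

section \<open>Maximizing the Rayleigh quotient\<close>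

context compact_pair begin

text \<open>A maximizing sequence of the Rayleigh quotient is Cauchy, with no weak compactness needed:
  \<open>N = \<mu> P - B\<close> is nonnegative and small along it, hence small on differences, and the compactness
  assumption with \<open>e = \<mu>/2\<close> bounds \<open>P\<close> by \<open>N\<close> and finitely many functionals.\<close>
lemma Rayleigh_maximizer:
  assumes S: "S \<subseteq> H" and u0: "u0 \<in> H" "\<And>w. w \<in> S \<Longrightarrow> B u0 w = 0" "B u0 u0 > 0"
  defines "M \<equiv> {v\<in>H. \<forall>w\<in>S. B v w = 0}"
  obtains u \<mu> where "u \<in> M" "\<mu> > 0" "P u u > 0" "\<And>v. v \<in> M \<Longrightarrow> B u v = \<mu> * P u v"
    "\<And>v. v \<in> M \<Longrightarrow> B v v \<le> \<mu> * P v v"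
proof -
  obtain C where C: "C \<ge> 0" "\<And>u. u \<in> H \<Longrightarrow> B u u \<le> C * P u u" using B_bound by blast
  have MH: "v \<in> H" if "v \<in> M" for v using that by (simp add: M_def)
  have M_lin: "(\<lambda>x. u x + r * v x) \<in> M" if "u \<in> M" "v \<in> M" for u v r
    using that S by (auto simp: M_def P.lincomb_mem B.lincomb subset_iff)
  have M_zero: "(\<lambda>_. 0) \<in> M"
    using S by (auto simp: M_def P.zero_mem B.zero_left)
  interpret PM: pos_form M P
    by unfold_locales (blast intro: M_zero M_lin P.sym P.lincomb P.nonneg MH)+
  have u0M: "u0 \<in> M" using u0 by (simp add: M_def)
  define X where "X = {B v v |v. v \<in> M \<and> P v v = 1}"
  have normalize: "B v v / P v v \<in> X" if v: "v \<in> M" "P v v > 0" for v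
  proof -
    define t where "t = 1 / sqrt (P v v)"
    have t: "t * t = 1 / P v v" using v(2) by (simp add: t_def)
    let ?w = "\<lambda>x. t * v x"
    have w: "?w \<in> M" using PM.scale_mem[OF v(1)] .
    have "P ?w ?w = t * t * P v v" "B ?w ?w = t * t * B v v"
      using P.scale_left[OF MH[OF v(1)] MH[OF w], of t] P.scale_right[OF MH[OF v(1)] MH[OF v(1)], of t]
        B.scale_left[OF MH[OF v(1)] MH[OF w], of t] B.scale_right[OF MH[OF v(1)] MH[OF v(1)], of t]
      by simp_all
    then have "P ?w ?w = 1" "B ?w ?w = B v v / P v v" using t v(2) by simp_all
    then show ?thesis using w unfolding X_def mem_Collect_eq by (intro exI[of _ ?w]) simp
  qed
  have u0P: "P u0 u0 > 0"
    using C(2)[OF u0(1)] u0(3) C(1) P.nonneg[OF u0(1)] by (cases "P u0 u0 = 0") auto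
  have X_bdd: "bdd_above X"
  proof
    fix y assume "y \<in> X"
    then obtain v where "v \<in> M" "P v v = 1" "y = B v v" by (auto simp: X_def)
    then show "y \<le> C" using C(2)[OF MH[of v]] by simp
  qed
  define \<mu> where "\<mu> = Sup X"
  have X_le: "x \<le> \<mu>" if "x \<in> X" for x unfolding \<mu>_def by (rule cSup_upper[OF that X_bdd])
  have "0 < B u0 u0 / P u0 u0" using u0(3) u0P by simp
  then have \<mu>: "\<mu> > 0" using X_le[OF normalize[OF u0M u0P]] by linarith
  have le: "B v v \<le> \<mu> * P v v" if v: "v \<in> M" for v
  proof (cases "P v v = 0")
    case True
    then show ?thesis using C(2)[OF MH[OF v]] by simp
  next
    case False
    then have "P v v > 0" using P.nonneg[OF MH[OF v]] by simp
    then show ?thesis using X_le[OF normalize[OF v]] by (simp add: field_simps)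
  qed
  define N where "N = (\<lambda>u v. \<mu> * P u v - B u v)"
  interpret N: pos_form M N
  proof
    show "N u v = N v u" if "u \<in> M" "v \<in> M" for u v
      using P.sym[OF MH MH, OF that] B.sym[OF MH MH, OF that] by (simp add: N_def)
  qed (auto simp: N_def le M_lin M_zero MH P.lincomb B.lincomb algebra_simps)
  have ex: "\<exists>v. v \<in> M \<and> P v v = 1 \<and> B v v > \<mu> - inverse (real (Suc k))" for k
  proof -
    have "X \<noteq> {}" using normalize[OF u0M u0P] by auto
    moreover have "\<mu> - inverse (real (Suc k)) < Sup X" by (simp add: \<mu>_def)
    ultimately have "\<exists>x\<in>X. \<mu> - inverse (real (Suc k)) < x" by (meson less_cSupD)
    then show ?thesis by (auto simp: X_def)
  qed
  then obtain f where f: "\<And>k. f k \<in> M" "\<And>k. P (f k) (f k) = 1"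
    "\<And>k. B (f k) (f k) > \<mu> - inverse (real (Suc k))" by metis
  have \<mu>2: "\<mu> / 2 > 0" using \<mu> by simp
  obtain p :: nat and l K where K: "K \<ge> 0"
    and l': "\<forall>i<p. \<forall>u\<in>H. \<forall>v\<in>H. \<forall>r. l i (\<lambda>x. u x + r * v x) = l i u + r * l i v"
      "\<forall>i<p. \<exists>D\<ge>0. \<forall>u\<in>H. (l i u)\<^sup>2 \<le> D * P u u"
      "\<forall>u\<in>H. B u u \<le> \<mu> / 2 * P u u + K * (\<Sum>i<p. (l i u)\<^sup>2)"
    using compact[OF \<mu>2] by (elim exE conjE) (rule that)
  have l: "\<And>i u v r. i < p \<Longrightarrow> u \<in> H \<Longrightarrow> v \<in> H \<Longrightarrow> l i (\<lambda>x. u x + r * v x) = l i u + r * l i v"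
      "\<And>i. i < p \<Longrightarrow> \<exists>D\<ge>0. \<forall>u\<in>H. (l i u)\<^sup>2 \<le> D * P u u"
      "\<And>u. u \<in> H \<Longrightarrow> B u u \<le> \<mu> / 2 * P u u + K * (\<Sum>i<p. (l i u)\<^sup>2)"
    using l' by simp_all
  have "Bseq (\<lambda>k. l i (f k))" if i: "i < p" for i
  proof -
    obtain D where D: "D \<ge> 0" "\<forall>u\<in>H. (l i u)\<^sup>2 \<le> D * P u u" using l(2)[OF i] by blast
    have "norm (l i (f k)) \<le> sqrt D" for k
    proof -
      have "(l i (f k))\<^sup>2 \<le> D" using bspec[OF D(2) MH[OF f(1)[of k]]] f(2)[of k] by simp
      then show ?thesis using real_le_rsqrt[of "\<bar>l i (f k)\<bar>" D] by simp
    qed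
    then show ?thesis by (rule BseqI')
  qed
  then obtain r where r: "strict_mono (r::nat \<Rightarrow> nat)" "\<forall>i<p. convergent (\<lambda>k. l i (f (r k)))"
    using common_convergent_subseq[of p "\<lambda>i k. l i (f k)"] by blast
  then obtain a where a: "\<And>i. i < p \<Longrightarrow> (\<lambda>k. l i (f (r k))) \<longlonglongrightarrow> a i"
    unfolding convergent_def by metis
  let ?g = "\<lambda>k. f (r k)" and ?s = "\<lambda>k. inverse (real (Suc (r k)))"
  have s: "?s \<longlonglongrightarrow> 0"
    using LIMSEQ_subseq_LIMSEQ[OF LIMSEQ_inverse_real_of_nat r(1)] by (simp add: o_def)
  have Ng: "N (?g k) (?g k) \<le> ?s k" for k
    using f(2,3)[of "r k"] by (simp add: N_def)
  have gM: "?g k \<in> M" and gH: "?g k \<in> H" for k using f(1) MH by auto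
  have main: "\<mu> / 2 * P (\<lambda>x. ?g k x - ?g j x) (\<lambda>x. ?g k x - ?g j x)
      \<le> 2 * ?s k + 2 * ?s j + K * (\<Sum>i<p. (l i (?g k) - l i (?g j))\<^sup>2)" for k j
  proof -
    let ?d = "\<lambda>x. ?g k x - ?g j x"
    have "?d \<in> H" by (rule P.diff_mem[OF gH gH])
    then have "B ?d ?d \<le> \<mu> / 2 * P ?d ?d + K * (\<Sum>i<p. (l i ?d)\<^sup>2)" by (rule l(3))
    moreover have "N ?d ?d \<le> 2 * ?s k + 2 * ?s j"
      using N.diff_le[OF gM gM, of k j] Ng[of k] Ng[of j] by linarith
    moreover have "l i ?d = l i (?g k) - l i (?g j)" if "i < p" for i
      using l(1)[OF that gH gH, of k "-1" j] by simp
    then have "(\<Sum>i<p. (l i ?d)\<^sup>2) = (\<Sum>i<p. (l i (?g k) - l i (?g j))\<^sup>2)"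
      by (intro sum.cong) auto
    ultimately show ?thesis by (simp add: N_def)
  qed
  have Cauchy: "\<exists>n. \<forall>k\<ge>n. \<forall>j\<ge>n. P (\<lambda>x. ?g k x - ?g j x) (\<lambda>x. ?g k x - ?g j x) < e"
    if e: "e > 0" for e
  proof -
    have fst: "filterlim fst sequentially (sequentially \<times>\<^sub>F sequentially)"
      and snd: "filterlim snd sequentially (sequentially \<times>\<^sub>F sequentially)"
      by (rule filterlim_fst filterlim_snd)+
    have "((\<lambda>z. 2 * ?s (fst z) + 2 * ?s (snd z)
          + K * (\<Sum>i<p. (l i (?g (fst z)) - l i (?g (snd z)))\<^sup>2))
        \<longlongrightarrow> 2 * 0 + 2 * 0 + K * (\<Sum>i<p. (a i - a i)\<^sup>2)) (sequentially \<times>\<^sub>F sequentially)"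
      by (intro tendsto_intros filterlim_compose[OF s fst] filterlim_compose[OF s snd]
          filterlim_compose[OF a fst] filterlim_compose[OF a snd]) auto
    then have "\<forall>\<^sub>F z in sequentially \<times>\<^sub>F sequentially. 2 * ?s (fst z) + 2 * ?s (snd z)
          + K * (\<Sum>i<p. (l i (?g (fst z)) - l i (?g (snd z)))\<^sup>2) < \<mu> / 2 * e"
      by (rule order_tendstoD(2)) (use \<mu> e in simp)
    then obtain n where n: "\<And>k j. k \<ge> n \<Longrightarrow> j \<ge> n \<Longrightarrow> 2 * ?s k + 2 * ?s j
          + K * (\<Sum>i<p. (l i (?g k) - l i (?g j))\<^sup>2) < \<mu> / 2 * e"
      unfolding eventually_prod_sequentially by auto
    have "P (\<lambda>x. ?g k x - ?g j x) (\<lambda>x. ?g k x - ?g j x) < e" if kj: "k \<ge> n" "j \<ge> n" for k j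
    proof -
      have "\<mu> / 2 * P (\<lambda>x. ?g k x - ?g j x) (\<lambda>x. ?g k x - ?g j x) < \<mu> / 2 * e"
        by (rule le_less_trans[OF main n[OF kj]])
      then show ?thesis using \<mu> by simp
    qed
    then show ?thesis by blast
  qed
  obtain u where u: "u \<in> H" "(\<lambda>k. P (\<lambda>x. ?g k x - u x) (\<lambda>x. ?g k x - u x)) \<longlonglongrightarrow> 0"
    using complete[of ?g, OF gH Cauchy] by blast
  let ?d = "\<lambda>k x. ?g k x - u x"
  have dH: "?d k \<in> H" for k by (rule P.diff_mem[OF gH u(1)])
  \<comment> \<open>\<open>M\<close> is closed under \<open>P\<close>-limits because
    \<open>B\<close> is bounded by \<open>P\<close>.\<close>
  have uM: "u \<in> M"
    unfolding M_def
  proof (intro CollectI conjI u(1) ballI)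
    fix w assume w: "w \<in> S"
    then have wH: "w \<in> H" using S by auto
    have "(B u w)\<^sup>2 \<le> C * P (?d k) (?d k) * B w w" for k
    proof -
      have "B (?d k) w = - B u w"
        using B.diff_left[OF gH u(1) wH, of k] gM[of k] w by (simp add: M_def)
      then have "(B u w)\<^sup>2 \<le> B (?d k) (?d k) * B w w"
        using B.Cauchy_Schwarz[OF dH wH, of k] by simp
      also have "\<dots> \<le> C * P (?d k) (?d k) * B w w"
        by (intro mult_right_mono C(2) dH B.nonneg wH)
      finally show ?thesis .
    qed
    moreover have "(\<lambda>k. C * P (?d k) (?d k) * B w w) \<longlonglongrightarrow> C * 0 * B w w"
      by (intro tendsto_intros u(2))
    ultimately have "(B u w)\<^sup>2 \<le> C * 0 * B w w"
      by (intro LIMSEQ_le_const) auto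
    then show "B u w = 0" by simp
  qed
  \<comment> \<open>The limit must not be trivial. From \<open>P (?g k) (?g k) = 1\<close> and the
    parallelogram bound any value up to 1/2 follows, and positivity is all that matters.\<close>
  have "1 / 2 \<le> P u u"
  proof -
    have "1 / 2 - P (?d k) (?d k) \<le> P u u" for k
    proof -
      have "P (?g k) (?g k) \<le> 2 * P u u + 2 * P (?d k) (?d k)"
        using P.quadratic[OF u(1) dH, of 1 k] P.quadratic[OF u(1) dH, of "-1" k]
          P.nonneg[OF P.lincomb_mem[OF u(1) dH, of "-1" k]] by simp
      then show ?thesis using f(2) by simp
    qed
    moreover have "(\<lambda>k. 1 / 2 - P (?d k) (?d k)) \<longlonglongrightarrow> 1 / 2 - 0"
      by (intro tendsto_intros u(2))
    ultimately show ?thesis by (intro LIMSEQ_le_const2[of _ "1/2"]) auto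
  qed
  moreover have "N u u \<le> 0"
  proof -
    have "N u u \<le> 2 * ?s k + 2 * \<mu> * P (?d k) (?d k)" for k
    proof -
      have dM: "?d k \<in> M" by (rule PM.diff_mem[OF gM uM])
      have "N u u = N (\<lambda>x. ?g k x - ?d k x) (\<lambda>x. ?g k x - ?d k x)" by simp
      also have "\<dots> \<le> 2 * N (?g k) (?g k) + 2 * N (?d k) (?d k)"
        by (rule N.diff_le[OF gM dM])
      finally show ?thesis
        using Ng[of k] B.nonneg[OF dH, of k] by (simp add: N_def)
    qed
    moreover have "(\<lambda>k. 2 * ?s k + 2 * \<mu> * P (?d k) (?d k)) \<longlonglongrightarrow> 2 * 0 + 2 * \<mu> * 0"
      by (intro tendsto_intros u(2) s)
    ultimately have "N u u \<le> 2 * 0 + 2 * \<mu> * 0"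
      by (intro LIMSEQ_le_const) auto
    then show ?thesis by simp
  qed
  \<comment> \<open>\<open>u\<close> is a null vector of the nonnegative form \<open>N\<close>, so
    \<open>N u v = 0\<close> on \<open>M\<close>, which is the eigenvalue equation tested within
    \<open>M\<close>.\<close>
  then have "N u u = 0" using N.nonneg[OF uM] by simp
  then have "B u v = \<mu> * P u v" if "v \<in> M" for v
    using N.null_left[OF uM that] by (simp add: N_def)
  ultimately show thesis using that[OF uM \<mu>] le by simp
qed

text \<open>The maximizer satisfies its equation only against the complement \<open>M\<close>. It
  extends to all of \<open>H\<close>: on the span of the \<open>f i\<close> both sides vanish, since
  an eigenvector with nonzero \<open>\<kappa> i\<close> that is \<open>B\<close>-orthogonal to
  \<open>u\<close> is also \<open>P\<close>-orthogonal to it, and \<open>projection\<close> splits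
  every \<open>v\<close>. The eigenvalue is written as \<open>B = \<mu> P\<close>, the reciprocal of
  the convention \<open>P = \<omega> B\<close>.\<close>

lemma next_eigenvector:
  assumes I: "finite I" "\<And>i. i \<in> I \<Longrightarrow> f i \<in> H"
    "\<And>i. i \<in> I \<Longrightarrow> \<kappa> i \<noteq> 0" "\<And>i v. i \<in> I \<Longrightarrow> v \<in> H \<Longrightarrow> B (f i) v = \<kappa> i * P (f i) v"
    and u0: "u0 \<in> H" "\<And>i. i \<in> I \<Longrightarrow> B u0 (f i) = 0" "B u0 u0 > 0"
  obtains u \<mu> where "u \<in> H" "\<mu> > 0" "P u u > 0" "\<And>i. i \<in> I \<Longrightarrow> B u (f i) = 0"
    "\<And>v. v \<in> H \<Longrightarrow> B u v = \<mu> * P u v" "B u0 u0 \<le> \<mu> * P u0 u0"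
proof -
  obtain u \<mu> where u: "u \<in> {v\<in>H. \<forall>w\<in>f ` I. B v w = 0}" "\<mu> > 0" "P u u > 0"
    "\<And>v. v \<in> {v\<in>H. \<forall>w\<in>f ` I. B v w = 0} \<Longrightarrow> B u v = \<mu> * P u v"
    "\<And>v. v \<in> {v\<in>H. \<forall>w\<in>f ` I. B v w = 0} \<Longrightarrow> B v v \<le> \<mu> * P v v"
    using Rayleigh_maximizer[of "f ` I" u0] I(2) u0 by blast
  then have uH: "u \<in> H" and uI: "\<And>i. i \<in> I \<Longrightarrow> B u (f i) = 0" by auto
  have PI: "P u (f i) = 0" if "i \<in> I" for i
    using uI[OF that] I(3)[OF that] I(4)[OF that uH] P.sym[OF uH I(2)[OF that]]
      B.sym[OF uH I(2)[OF that]] by simp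
  have "B u v = \<mu> * P u v" if v: "v \<in> H" for v
  proof -
    obtain r where r: "\<forall>j\<in>I. B (\<lambda>x. v x - (\<Sum>i\<in>I. r i * f i x)) (f j) = 0"
      using B.projection[of I f v] I(1,2) v by blast
    let ?p = "\<lambda>x. \<Sum>i\<in>I. r i * f i x"
    have p: "?p \<in> H" by (rule P.sum_mem[OF I(1,2)])
    have "B u (\<lambda>x. v x - ?p x) = \<mu> * P u (\<lambda>x. v x - ?p x)"
      by (rule u(4)) (use r P.diff_mem[OF v p] in auto)
    moreover have "B u ?p = 0" "P u ?p = 0"
      using B.sum_right[OF I(1,2) uH] P.sum_right[OF I(1,2) uH] uI PI by simp_all
    ultimately show ?thesis
      using B.diff_right[OF v p uH] P.diff_right[OF v p uH] by simp
  qed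
  moreover have "B u0 u0 \<le> \<mu> * P u0 u0" by (rule u(5)) (use u0 in auto)
  ultimately show thesis using that uH u(2,3) uI by blast
qed

end

text \<open>Gaussian elimination. All dimension counts rest on it: the finiteness of the spectrum
  below a bound, the vector orthogonal to an incomplete eigenbasis, and the upper bound of the Morse
  index.\<close>

lemma underdetermined_system:
  fixes c :: "'l \<Rightarrow> 'k \<Rightarrow> real"
  assumes "finite L" "finite K" "card L < card K"
  shows "\<exists>r. (\<exists>p\<in>K. r p \<noteq> 0) \<and> (\<forall>l\<in>L. (\<Sum>p\<in>K. c l p * r p) = 0)"
  using assms
proof (induction L arbitrary: K c rule: finite_induct)
  case empty
  then have "K \<noteq> {}" by auto
  then show ?case by (auto intro!: exI[of _ "\<lambda>_. 1"])
next
  case (insert l L)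
  show ?case
  proof (cases "\<forall>p\<in>K. c l p = 0")
    case True
    have "card L < card K" using insert by simp
    then obtain r where "\<exists>p\<in>K. r p \<noteq> 0" "\<forall>l\<in>L. (\<Sum>p\<in>K. c l p * r p) = 0"
      using insert by blast
    then show ?thesis using True by (intro exI[of _ r]) auto
  next
    case False
    then obtain q where q: "q \<in> K" "c l q \<noteq> 0" by blast
    let ?K = "K - {q}"
    \<comment> \<open>The remaining equations after unknown \<open>q\<close> has been eliminated by
      means of equation \<open>l\<close>.\<close>
    define d where "d = (\<lambda>l' p. c l' p - c l' q * c l p / c l q)"
    have "card L < card ?K" using insert q by simp
    then obtain r where r: "\<exists>p\<in>?K. r p \<noteq> 0" "\<forall>l\<in>L. (\<Sum>p\<in>?K. d l p * r p) = 0"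
      using insert.IH[of ?K d] insert.prems by blast
    define s where "s = - (\<Sum>p\<in>?K. c l p * r p) / c l q"
    define r' where "r' = r(q := s)"
    have split: "(\<Sum>p\<in>K. c l' p * r' p) = c l' q * s + (\<Sum>p\<in>?K. c l' p * r p)" for l'
    proof -
      have "(\<Sum>p\<in>K. c l' p * r' p) = c l' q * r' q + (\<Sum>p\<in>?K. c l' p * r' p)"
        using insert.prems q by (simp add: sum.remove)
      then show ?thesis by (simp add: r'_def)
    qed
    have "(\<Sum>p\<in>K. c l' p * r' p) = 0" if "l' \<in> L" for l'
    proof -
      have "0 = (\<Sum>p\<in>?K. c l' p * r p - c l' q / c l q * (c l p * r p))"
        using r(2) that by (simp add: d_def algebra_simps)
      also have "\<dots> = (\<Sum>p\<in>?K. c l' p * r p) - c l' q / c l q * (\<Sum>p\<in>?K. c l p * r p)"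
        by (simp add: sum_subtractf sum_distrib_left)
      finally show ?thesis using split by (simp add: s_def)
    qed
    moreover have "(\<Sum>p\<in>K. c l p * r' p) = 0" using split q by (simp add: s_def)
    moreover have "\<exists>p\<in>K. r' p \<noteq> 0" using r(1) by (auto simp: r'_def)
    ultimately show ?thesis by blast
  qed
qed

text \<open>The abstract form of a listing with multiplicity. Eigenfunctions within one eigenspace
  need not be \<open>B\<close>-orthogonal, and both independence and exhaustion are stated modulo
  \<open>B\<close>-null functions. \<open>all_eig\<close> speaks of one eigenvalue at a
  time.\<close>

locale eigen_family = compact_pair H P B
  for H :: "('x \<Rightarrow> real) set" and P B +
  fixes J :: "nat set" and \<omega> :: "nat \<Rightarrow> real" and \<psi> :: "nat \<Rightarrow> 'x \<Rightarrow> real"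
  assumes eig_mem: "i \<in> J \<Longrightarrow> \<psi> i \<in> H"
    and eig: "i \<in> J \<Longrightarrow> v \<in> H \<Longrightarrow> P (\<psi> i) v = \<omega> i * B (\<psi> i) v"
    and eig_pos: "i \<in> J \<Longrightarrow> \<omega> i > 0"
    and indep: "finite F \<Longrightarrow> F \<subseteq> J \<Longrightarrow>
      B (\<lambda>x. \<Sum>i\<in>F. r i * \<psi> i x) (\<lambda>x. \<Sum>i\<in>F. r i * \<psi> i x) = 0 \<Longrightarrow> i \<in> F \<Longrightarrow> r i = 0"
    and all_eig: "p \<in> H \<Longrightarrow> (\<And>v. v \<in> H \<Longrightarrow> P p v = \<mu> * B p v) \<Longrightarrow>
      \<exists>F r. finite F \<and> F \<subseteq> {i\<in>J. \<omega> i = \<mu>} \<and>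
        B (\<lambda>x. p x - (\<Sum>i\<in>F. r i * \<psi> i x)) (\<lambda>x. p x - (\<Sum>i\<in>F. r i * \<psi> i x)) = 0"
begin

lemma eig_orth: "i \<in> J \<Longrightarrow> j \<in> J \<Longrightarrow> \<omega> i \<noteq> \<omega> j \<Longrightarrow> B (\<psi> i) (\<psi> j) = 0"
  using eig[of i "\<psi> j"] eig[of j "\<psi> i"] eig_mem P.sym[of "\<psi> i" "\<psi> j"] B.sym[of "\<psi> i" "\<psi> j"] by simp

text \<open>Rescaling the coefficients by \<open>sqrt (b - \<omega> i)\<close> turns \<open>b B - P\<close> on the span into \<open>B\<close>.\<close>
lemma negative_on_span:
  assumes F: "finite F" "F \<subseteq> {i\<in>J. \<omega> i < b}" and r: "\<exists>i\<in>F. r i \<noteq> 0"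
  defines "v \<equiv> (\<lambda>x. \<Sum>i\<in>F. r i * \<psi> i x)"
  shows "P v v < b * B v v"
proof -
  have FJ: "\<And>i. i \<in> F \<Longrightarrow> \<psi> i \<in> H" "\<And>i. i \<in> F \<Longrightarrow> i \<in> J" "\<And>i. i \<in> F \<Longrightarrow> \<omega> i < b"
    using F eig_mem by auto
  have vH: "v \<in> H" unfolding v_def by (rule P.sum_mem[OF F(1) FJ(1)])
  define s where "s = (\<lambda>i. sqrt (b - \<omega> i) * r i)"
  let ?w = "\<lambda>x. \<Sum>i\<in>F. s i * \<psi> i x"
  have wH: "?w \<in> H" by (rule P.sum_mem[OF F(1) FJ(1)])
  have "P v v = (\<Sum>i\<in>F. r i * (\<Sum>j\<in>F. r j * P (\<psi> i) (\<psi> j)))"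
    using P.sum_left[OF F(1) FJ(1) vH, where r = r] P.sum_right[OF F(1) FJ(1) FJ(1), where r = r]
    by (simp add: v_def)
  moreover have "B v v = (\<Sum>i\<in>F. r i * (\<Sum>j\<in>F. r j * B (\<psi> i) (\<psi> j)))"
    using B.sum_left[OF F(1) FJ(1) vH, where r = r] B.sum_right[OF F(1) FJ(1) FJ(1), where r = r]
    by (simp add: v_def)
  moreover have "B ?w ?w = (\<Sum>i\<in>F. s i * (\<Sum>j\<in>F. s j * B (\<psi> i) (\<psi> j)))"
    using B.sum_left[OF F(1) FJ(1) wH, where r = s] B.sum_right[OF F(1) FJ(1) FJ(1), where r = s]
    by simp
  moreover have "s i * (s j * B (\<psi> i) (\<psi> j)) = r i * (r j * (b * B (\<psi> i) (\<psi> j) - P (\<psi> i) (\<psi> j)))"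
    if ij: "i \<in> F" "j \<in> F" for i j
  \<comment> \<open>Only pairs with equal eigenvalues contribute, and for these the two square roots
    multiply to \<open>b - \<omega> j\<close>.\<close>
  proof (cases "\<omega> i = \<omega> j")
    case True
    have "s i * (s j * B (\<psi> i) (\<psi> j)) = (sqrt (b - \<omega> j) * sqrt (b - \<omega> j)) * (r i * r j * B (\<psi> i) (\<psi> j))"
      unfolding s_def True by (simp add: mult_ac)
    also have "\<dots> = (b - \<omega> j) * (r i * r j * B (\<psi> i) (\<psi> j))"
      using FJ(3)[OF ij(2)] by simp
    finally show ?thesis using eig[OF FJ(2)[OF ij(1)] FJ(1)[OF ij(2)]] True
      by (simp add: algebra_simps)
  next
    case False
    then show ?thesis using eig_orth FJ(2) ij eig[OF FJ(2)[OF ij(1)] FJ(1)[OF ij(2)]] by simp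
  qed
  then have "(\<Sum>i\<in>F. s i * (\<Sum>j\<in>F. s j * B (\<psi> i) (\<psi> j)))
      = (\<Sum>i\<in>F. r i * (\<Sum>j\<in>F. r j * (b * B (\<psi> i) (\<psi> j) - P (\<psi> i) (\<psi> j))))"
    unfolding sum_distrib_left by (intro sum.cong refl) auto
  ultimately have eq: "B ?w ?w = b * B v v - P v v"
    by (simp add: sum_distrib_left sum_subtractf algebra_simps)
  have "B ?w ?w \<noteq> 0"
  proof
    assume "B ?w ?w = 0"
    then have "\<And>i. i \<in> F \<Longrightarrow> s i = 0"
      using indep[OF F(1), of s] FJ(2) by blast
    then have "\<And>i. i \<in> F \<Longrightarrow> r i = 0" using FJ(3) by (fastforce simp: s_def)
    then show False using r by blast
  qed
  then show ?thesis using eq B.nonneg[OF wH] by simp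
qed

text \<open>Compactness with \<open>e = 1 / b\<close> involves some number \<open>p\<close> of
  functionals. Among \<open>p + 1\<close> eigenfunctions below \<open>b\<close> some nontrivial
  combination is annihilated by all of them, so that \<open>b B \<le> P\<close> there, against
  \<open>negative_on_span\<close>.\<close>

lemma finite_eigenvalues_below: "finite {i\<in>J. \<omega> i < b}"
proof (cases "b > 0")
  case False
  then have "{i\<in>J. \<omega> i < b} = {}" using eig_pos by fastforce
  then show ?thesis by (rule ssubst) simp
next
  case True
  have b: "1 / b > 0" using True by simp
  obtain p :: nat and l K where K: "K \<ge> 0"
    and l': "\<forall>i<p. \<forall>u\<in>H. \<forall>v\<in>H. \<forall>r. l i (\<lambda>x. u x + r * v x) = l i u + r * l i v"
      "\<forall>i<p. \<exists>D\<ge>0. \<forall>u\<in>H. (l i u)\<^sup>2 \<le> D * P u u"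
      "\<forall>u\<in>H. B u u \<le> 1 / b * P u u + K * (\<Sum>i<p. (l i u)\<^sup>2)"
    using compact[OF b] by (elim exE conjE) (rule that)
  have l: "\<And>i u v r. i < p \<Longrightarrow> u \<in> H \<Longrightarrow> v \<in> H \<Longrightarrow> l i (\<lambda>x. u x + r * v x) = l i u + r * l i v"
      "\<And>u. u \<in> H \<Longrightarrow> B u u \<le> 1 / b * P u u + K * (\<Sum>i<p. (l i u)\<^sup>2)"
    using l' by simp_all
  show ?thesis
  proof (rule ccontr)
    assume "infinite {i\<in>J. \<omega> i < b}"
    then obtain F where F: "finite F" "card F = Suc p" "F \<subseteq> {i\<in>J. \<omega> i < b}"
      using infinite_arbitrarily_large by blast
    have FJ: "\<And>i. i \<in> F \<Longrightarrow> \<psi> i \<in> H" using F eig_mem by auto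
    have lsum: "l i (\<lambda>x. \<Sum>j\<in>F. r j * \<psi> j x) = (\<Sum>j\<in>F. l i (\<psi> j) * r j)" if i: "i < p" for i r
      using F(1) FJ
    proof (induction F rule: finite_induct)
      case empty
      show ?case using l(1)[OF i P.zero_mem P.zero_mem, of 1] by simp
    next
      case (insert j F)
      then have "l i (\<lambda>x. (\<Sum>j\<in>F. r j * \<psi> j x) + r j * \<psi> j x)
          = l i (\<lambda>x. \<Sum>j\<in>F. r j * \<psi> j x) + r j * l i (\<psi> j)"
        by (intro l(1)[OF i] P.sum_mem) auto
      then show ?case using insert by (simp add: algebra_simps)
    qed
    obtain r where r: "\<exists>j\<in>F. r j \<noteq> 0" "\<forall>i\<in>{..<p}. (\<Sum>j\<in>F. l i (\<psi> j) * r j) = 0"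
      using underdetermined_system[of "{..<p}" F "\<lambda>i j. l i (\<psi> j)"] F by auto
    let ?v = "\<lambda>x. \<Sum>j\<in>F. r j * \<psi> j x"
    have "B ?v ?v \<le> 1 / b * P ?v ?v + K * (\<Sum>i<p. (l i ?v)\<^sup>2)"
      by (rule l(2)) (rule P.sum_mem[OF F(1) FJ])
    also have "(\<Sum>i<p. (l i ?v)\<^sup>2) = 0" using lsum r(2) by simp
    finally have "b * B ?v ?v \<le> P ?v ?v" using True by (simp add: field_simps)
    then show False using negative_on_span[OF F(1,3) r(1)] by simp
  qed
qed

text \<open>The eigenvector found on the complement has eigenvalue \<open>1 / \<mu> < b\<close>. By
  \<open>all_eig\<close> it agrees up to a \<open>B\<close>-null function with a combination of
  listed eigenfunctions to all of which it is orthogonal, so \<open>B u u = 0\<close>, whereas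
  \<open>B u u = \<mu> * P u u > 0\<close>.\<close>

lemma nonneg_on_complement:
  assumes v: "v \<in> H" "\<And>i. i \<in> J \<Longrightarrow> \<omega> i < b \<Longrightarrow> B v (\<psi> i) = 0"
  shows "b * B v v \<le> P v v"
proof (rule ccontr)
  assume less: "\<not> b * B v v \<le> P v v"
  then have pos: "b * B v v > 0" using P.nonneg[OF v(1)] by simp
  then have b: "b > 0" and Bv: "B v v > 0"
    using B.nonneg[OF v(1)] by (auto simp: zero_less_mult_iff)
  let ?I = "{i\<in>J. \<omega> i < b}"
  obtain u \<mu> where u: "u \<in> H" "\<mu> > 0" "P u u > 0" "\<And>i. i \<in> ?I \<Longrightarrow> B u (\<psi> i) = 0"
    "\<And>v. v \<in> H \<Longrightarrow> B u v = \<mu> * P u v" "B v v \<le> \<mu> * P v v"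
  proof (rule next_eigenvector[of ?I \<psi> "\<lambda>i. 1 / \<omega> i" v])
    show "finite ?I" by (rule finite_eigenvalues_below)
    show "\<psi> i \<in> H" "1 / \<omega> i \<noteq> 0" if "i \<in> ?I" for i using that eig_mem eig_pos by fastforce+
    show "B (\<psi> i) w = 1 / \<omega> i * P (\<psi> i) w" if "i \<in> ?I" "w \<in> H" for i w
      using that eig eig_pos by force
  qed (use v Bv in auto)
  \<comment> \<open>Together with \<open>B v v \<le> \<mu> * P v v\<close> the violation at
    \<open>v\<close> forces \<open>\<mu> * b > 1\<close>.\<close>
  have "\<mu> * P v v < \<mu> * (b * B v v)" using less u(2) by simp
  then have "1 * B v v < (\<mu> * b) * B v v" using u(6) by (simp add: mult.assoc)
  then have "1 < \<mu> * b" using Bv by (metis mult_less_cancel_right_pos)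
  then have mu: "1 / \<mu> < b" using u(2) by (simp add: field_simps)
  obtain F r where F: "finite F" "F \<subseteq> {i\<in>J. \<omega> i = 1 / \<mu>}"
    "B (\<lambda>x. u x - (\<Sum>i\<in>F. r i * \<psi> i x)) (\<lambda>x. u x - (\<Sum>i\<in>F. r i * \<psi> i x)) = 0"
    using all_eig[of u "1 / \<mu>"] u by auto
  have FJ: "\<And>i. i \<in> F \<Longrightarrow> \<psi> i \<in> H" using F eig_mem by auto
  have p: "(\<lambda>x. \<Sum>i\<in>F. r i * \<psi> i x) \<in> H" by (rule P.sum_mem[OF F(1) FJ])
  have "B (\<lambda>x. u x - (\<Sum>i\<in>F. r i * \<psi> i x)) u = 0"
    by (rule B.null_left[OF P.diff_mem[OF u(1) p] u(1) F(3)])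
  then have "B u u = B (\<lambda>x. \<Sum>i\<in>F. r i * \<psi> i x) u" using B.diff_left[OF u(1) p u(1)] by simp
  also have "\<dots> = (\<Sum>i\<in>F. r i * B (\<psi> i) u)" by (rule B.sum_left[OF F(1) FJ u(1)])
  also have "\<dots> = 0"
  proof (intro sum.neutral ballI)
    fix i assume i: "i \<in> F"
    then have "B u (\<psi> i) = 0" using F(2) mu by (intro u(4)) auto
    then show "r i * B (\<psi> i) u = 0" using B.sym[OF u(1) FJ[OF i]] by simp
  qed
  finally show False using u(5)[OF u(1)] u(2,3) by simp
qed

end

section \<open>Real symmetric matrices\<close>

text \<open>Adding \<open>K = 1 + \<Sum> \<bar>a i j\<bar>\<close> times the Euclidean form makes
  the matrix form positive on \<open>I\<close>, so that the maximization for pairs of forms applies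
  to matrices. Coordinates outside \<open>I\<close> are invisible, which semidefiniteness permits;
  the functionals required by compactness are the coordinates in \<open>I\<close>.\<close>

lemma compact_pair_shifted_matrix:
  fixes a :: "'i \<Rightarrow> 'i \<Rightarrow> real"
  assumes I: "finite I" and a_sym: "\<And>i j. i \<in> I \<Longrightarrow> j \<in> I \<Longrightarrow> a i j = a j i"
  defines "P \<equiv> (\<lambda>x y. \<Sum>i\<in>I. x i * y i)"
  obtains K where "compact_pair UNIV P (\<lambda>x y. (\<Sum>i\<in>I. \<Sum>j\<in>I. a i j * x i * y j) + K * P x y)"
    "\<And>x. P x x \<le> (\<Sum>i\<in>I. \<Sum>j\<in>I. a i j * x i * x j) + K * P x x"
proof -
  define T where "T = (\<lambda>x y. \<Sum>i\<in>I. \<Sum>j\<in>I. a i j * x i * y j)"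
  define S where "S = (\<Sum>i\<in>I. \<Sum>j\<in>I. \<bar>a i j\<bar>)"
  define K where "K = 1 + S"
  have S: "0 \<le> S" by (auto simp: S_def intro!: sum_nonneg)
  have P_nonneg: "0 \<le> P x x" for x by (auto simp: P_def intro!: sum_nonneg)
  have comp: "(x i)\<^sup>2 \<le> P x x" if "i \<in> I" for x i
    using member_le_sum[of i I "\<lambda>i. x i * x i"] I that by (simp add: P_def power2_eq_square)
  have "\<bar>x i * x j\<bar> \<le> P x x" if "i \<in> I" "j \<in> I" for x i j
  proof -
    have "2 * \<bar>x i * x j\<bar> \<le> (x i)\<^sup>2 + (x j)\<^sup>2"
      using sum_squares_bound[of "\<bar>x i\<bar>" "\<bar>x j\<bar>"] by (simp add: abs_mult)
    then show ?thesis using comp[OF that(1), of x] comp[OF that(2), of x] by linarith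
  qed
  then have "\<bar>T x x\<bar> \<le> (\<Sum>i\<in>I. \<Sum>j\<in>I. \<bar>a i j\<bar> * P x x)" for x
    unfolding T_def
    by (intro order_trans[OF sum_abs] sum_mono) (auto simp: abs_mult mult.assoc intro!: mult_left_mono)
  then have T: "\<bar>T x x\<bar> \<le> S * P x x" for x by (simp add: S_def sum_distrib_right)
  let ?B = "\<lambda>x y. T x y + K * P x y"
  have lower: "P x x \<le> ?B x x" for x
    using T[of x] by (simp add: K_def abs_le_iff algebra_simps)
  have upper: "?B x x \<le> (1 + 2 * S) * P x x" for x
    using T[of x] by (simp add: K_def abs_le_iff algebra_simps)
  have T_sym: "T x y = T y x" for x y
    unfolding T_def by (subst sum.swap, intro sum.cong refl) (simp add: a_sym mult_ac)
  have P_lin: "P (\<lambda>i. x i + r * y i) z = P x z + r * P y z" for x y z r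
    by (simp add: P_def algebra_simps sum.distrib sum_distrib_left)
  have T_lin: "T (\<lambda>i. x i + r * y i) z = T x z + r * T y z" for x y z r
    by (simp add: T_def algebra_simps sum.distrib sum_distrib_left)
  interpret P: pos_form UNIV P
    by unfold_locales (auto simp: P_lin P_nonneg, simp add: P_def mult.commute)
  interpret B: pos_form UNIV ?B
    by unfold_locales (auto simp: P_lin T_lin T_sym P.sym algebra_simps intro: order_trans[OF P_nonneg lower])
  have "compact_pair UNIV P ?B"
  proof (unfold_locales, goal_cases)
    case 1
    show ?case using upper S by (intro exI[of _ "1 + 2 * S"]) auto
  next
    case (2 f)
    have "Cauchy (\<lambda>k. f k i)" if i: "i \<in> I" for i
    proof (rule CauchyI)
      fix e :: real assume e: "e > 0"
      then obtain N where N: "\<forall>k\<ge>N. \<forall>l\<ge>N. P (\<lambda>x. f k x - f l x) (\<lambda>x. f k x - f l x) < e\<^sup>2"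
        using 2(2)[of "e\<^sup>2"] by auto
      have "norm (f k i - f l i) < e" if "k \<ge> N" "l \<ge> N" for k l
      proof -
        have "(f k i - f l i)\<^sup>2 < e\<^sup>2"
          using comp[OF i, of "\<lambda>x. f k x - f l x"] N that by fastforce
        then show ?thesis using e by (metis abs_of_pos power2_less_imp_less abs_ge_zero power2_abs real_norm_def order_less_imp_le)
      qed
      then show "\<exists>M. \<forall>m\<ge>M. \<forall>n\<ge>M. norm (f m i - f n i) < e" by blast
    qed
    then have "\<forall>i\<in>I. \<exists>l. (\<lambda>k. f k i) \<longlonglongrightarrow> l"
      using Cauchy_convergent convergent_def by blast
    then obtain u where u: "\<And>i. i \<in> I \<Longrightarrow> (\<lambda>k. f k i) \<longlonglongrightarrow> u i" by metis
    have "(\<lambda>k. P (\<lambda>x. f k x - u x) (\<lambda>x. f k x - u x)) \<longlonglongrightarrow> (\<Sum>i\<in>I. (u i - u i) * (u i - u i))"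
      unfolding P_def by (intro tendsto_intros u)
    then show ?case by auto
  next
    case (3 e)
    obtain h where h: "bij_betw h {..<card I} I" using ex_bij_betw_nat_finite[OF I] by (auto simp: atLeast0LessThan)
    have hI: "h i \<in> I" if "i < card I" for i using h that by (auto simp: bij_betw_def)
    have Ph: "P x x = (\<Sum>i<card I. (x (h i))\<^sup>2)" for x
      unfolding P_def by (subst sum.reindex_bij_betw[OF h, symmetric]) (simp add: power2_eq_square)
    have "?B x x \<le> e * P x x + (1 + 2 * S) * (\<Sum>i<card I. (x (h i))\<^sup>2)" for x
    proof -
      have "0 \<le> e * P x x" using P_nonneg[of x] 3 by simp
      then show ?thesis using upper[of x] unfolding Ph[symmetric] by linarith
    qed
    then show ?case using S comp[OF hI]
      by (intro exI[of _ "card I"] exI[of _ "\<lambda>i x. x (h i)"] exI[of _ "1 + 2 * S"])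
        (auto intro!: exI[of _ 1])
  qed
  then show thesis using that[of K] lower unfolding T_def by blast
qed

text \<open>The spectral theorem by the same maximization. While \<open>k < card I\<close> there is
  a nonzero vector orthogonal to the eigenvectors found so far, and \<open>next_eigenvector\<close>
  for the shifted form adds one more, which is then shifted back and normalized.\<close>

lemma symmetric_eigenbasis:
  fixes a :: "'i \<Rightarrow> 'i \<Rightarrow> real"
  assumes I: "finite I" and a_sym: "\<And>i j. i \<in> I \<Longrightarrow> j \<in> I \<Longrightarrow> a i j = a j i"
  shows "k \<le> card I \<Longrightarrow> \<exists>v \<kappa>. (\<forall>l<k. \<forall>i\<in>I. (\<Sum>j\<in>I. a i j * v l j) = \<kappa> l * v l i) \<and>
    (\<forall>l<k. \<forall>l'<k. (\<Sum>i\<in>I. v l i * v l' i) = (if l = l' then 1 else 0))"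
proof (induction k)
  case 0
  then show ?case by simp
next
  case (Suc k)
  then have "k \<le> card I" by simp
  from Suc.IH[OF this] obtain v \<kappa> where v': "\<forall>l<k. \<forall>i\<in>I. (\<Sum>j\<in>I. a i j * v l j) = \<kappa> l * v l i"
    "\<forall>l<k. \<forall>l'<k. (\<Sum>i\<in>I. v l i * v l' i) = (if l = l' then 1 else 0)"
    by blast
  have v: "\<And>l i. l < k \<Longrightarrow> i \<in> I \<Longrightarrow> (\<Sum>j\<in>I. a i j * v l j) = \<kappa> l * v l i"
    "\<And>l l'. l < k \<Longrightarrow> l' < k \<Longrightarrow> (\<Sum>i\<in>I. v l i * v l' i) = (if l = l' then 1 else 0)"
    using v' by blast+
  define P where "P = (\<lambda>x y. \<Sum>i\<in>I. x i * y i :: real)"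
  obtain K where K: "compact_pair UNIV P (\<lambda>x y. (\<Sum>i\<in>I. \<Sum>j\<in>I. a i j * x i * y j) + K * P x y)"
    "\<And>x. P x x \<le> (\<Sum>i\<in>I. \<Sum>j\<in>I. a i j * x i * x j) + K * P x x"
    using compact_pair_shifted_matrix[of I a] I a_sym unfolding P_def by blast
  define B where "B = (\<lambda>x y. (\<Sum>i\<in>I. \<Sum>j\<in>I. a i j * x i * y j) + K * P x y)"
  interpret compact_pair UNIV P B using K(1) by (simp add: B_def)
  have Bv: "B (v l) x = (\<kappa> l + K) * P (v l) x" if l: "l < k" for l x
  proof -
    have "(\<Sum>i\<in>I. \<Sum>j\<in>I. a i j * v l i * x j) = (\<Sum>j\<in>I. (\<Sum>i\<in>I. a j i * v l i) * x j)"
      by (subst sum.swap) (simp add: sum_distrib_right a_sym)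
    also have "\<dots> = \<kappa> l * P (v l) x"
      using v(1)[OF l] by (simp add: P_def sum_distrib_left mult_ac)
    finally show ?thesis by (simp add: B_def algebra_simps)
  qed
  \<comment> \<open>The shift keeps every eigenvalue of \<open>B\<close> at least 1, and
    \<open>next_eigenvector\<close> asks for nonzero ones.\<close>
  have ne: "\<kappa> l + K \<noteq> 0" if l: "l < k" for l
  proof -
    have "P (v l) (v l) = 1" using v(2)[OF l l] by (simp add: P_def)
    then show ?thesis using K(2)[of "v l"] Bv[OF l, of "v l"] by (simp add: B_def)
  qed
  obtain u0 where u0: "\<exists>i\<in>I. u0 i \<noteq> 0" "\<And>l. l < k \<Longrightarrow> (\<Sum>i\<in>I. v l i * u0 i) = 0"
    using underdetermined_system[of "{..<k}" I v] I Suc.prems by auto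
  have "P u0 u0 > 0"
  proof -
    obtain i where i: "i \<in> I" "u0 i \<noteq> 0" using u0 by blast
    have "0 < u0 i * u0 i" using i(2) by (metis not_real_square_gt_zero)
    also have "\<dots> \<le> P u0 u0"
      unfolding P_def using I i(1) by (intro member_le_sum) auto
    finally show ?thesis .
  qed
  then have Bu0: "B u0 u0 > 0" using K(2)[of u0] by (simp add: B_def)
  have Bu0v: "B u0 (v l) = 0" if "l < k" for l
    using Bv[OF that, of u0] u0(2)[OF that] B.sym[of u0 "v l"] by (simp add: P_def)
  obtain u \<mu> where u: "\<mu> > 0" "P u u > 0" "\<And>l. l \<in> {..<k} \<Longrightarrow> B u (v l) = 0"
    "\<And>x. x \<in> UNIV \<Longrightarrow> B u x = \<mu> * P u x"
  proof (rule next_eigenvector[of "{..<k}" v "\<lambda>l. \<kappa> l + K" u0])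
    show "B (v l) x = (\<kappa> l + K) * P (v l) x" if "l \<in> {..<k}" for l x using Bv that by simp
  qed (use ne Bu0 Bu0v in auto)
  have Pu: "P u (v l) = 0" if "l < k" for l using u(1) u(3)[of l] u(4)[of "v l"] that by simp
  have eig: "(\<Sum>j\<in>I. a i j * u j) = (\<mu> - K) * u i" if i: "i \<in> I" for i
  proof -
    \<comment> \<open>Testing against coordinate vectors turns the identity of forms into the
      eigenvalue equation of the matrix.\<close>
    have d: "(\<Sum>j\<in>I. f j * (if j = i then 1 else 0)) = f i" for f :: "'i \<Rightarrow> real"
      using I i by (simp add: if_distrib[of "\<lambda>x. _ * x"] cong: if_cong)
    have "(\<Sum>j\<in>I. a j i * u j) + K * u i = \<mu> * u i"
      using u(4)[of "\<lambda>j. if j = i then 1 else 0"] by (simp add: B_def P_def d)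
    moreover have "(\<Sum>j\<in>I. a j i * u j) = (\<Sum>j\<in>I. a i j * u j)"
      by (intro sum.cong) (use a_sym i in auto)
    ultimately show ?thesis by (simp add: algebra_simps)
  qed
  define t where "t = 1 / sqrt (P u u)"
  have t: "t * t * P u u = 1" using u(2) by (simp add: t_def)
  define v' where "v' = v(k := (\<lambda>i. t * u i))"
  define \<kappa>' where "\<kappa>' = \<kappa>(k := \<mu> - K)"
  have "(\<Sum>j\<in>I. a i j * v' l j) = \<kappa>' l * v' l i" if "l < Suc k" "i \<in> I" for l i
  proof (cases "l = k")
    case True
    have "(\<Sum>j\<in>I. a i j * (t * u j)) = t * (\<Sum>j\<in>I. a i j * u j)"
      by (simp add: sum_distrib_left mult_ac)
    then show ?thesis using True eig[OF that(2)] by (simp add: v'_def \<kappa>'_def)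
  qed (use that v(1) in \<open>auto simp: v'_def \<kappa>'_def\<close>)
  moreover have "(\<Sum>i\<in>I. v' l i * v' l' i) = (if l = l' then 1 else 0)" if "l < Suc k" "l' < Suc k" for l l'
  proof -
    have "P (\<lambda>i. t * u i) (\<lambda>i. t * u i) = 1"
      using t P.scale_left[of u "\<lambda>i. t * u i" t] P.scale_right[of u u t] by simp
    moreover have "P (\<lambda>i. t * u i) (v l) = 0" "P (v l) (\<lambda>i. t * u i) = 0" if "l < k" for l
      using Pu[OF that] P.scale_left[of u "v l" t] P.sym[of "v l" "\<lambda>i. t * u i"] by simp_all
    ultimately show ?thesis
      using that v(2) unfolding P_def v'_def by (cases "l = k"; cases "l' = k") auto
  qed
  ultimately show ?case by blast
qed

lemma order_prod_linear:
  fixes \<kappa> :: "'i \<Rightarrow> real"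
  assumes "finite S"
  shows "order x (\<Prod>i\<in>S. [:- \<kappa> i, 1:]) = card {i\<in>S. \<kappa> i = x}"
  using assms
proof (induction S rule: finite_induct)
  case empty
  then show ?case by (simp add: order_0I)
next
  case (insert k S)
  have "order x [:- \<kappa> k, 1:] = (if \<kappa> k = x then 1 else 0)"
    using order_power_n_n[of x 1] by (auto intro!: order_0I)
  moreover have "{i\<in>insert k S. \<kappa> i = x} = (if \<kappa> k = x then {k} else {}) \<union> {i\<in>S. \<kappa> i = x}" by auto
  moreover have "order x ([:- \<kappa> k, 1:] * (\<Prod>i\<in>S. [:- \<kappa> i, 1:]))
      = order x [:- \<kappa> k, 1:] + order x (\<Prod>i\<in>S. [:- \<kappa> i, 1:])"
    by (rule order_mult) (use insert in \<open>simp del: mult_pCons_left mult_pCons_right\<close>)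
  ultimately show ?case using insert by (auto simp del: mult_pCons_left mult_pCons_right)
qed

text \<open>Links two views of the spectrum: roots of the characteristic polynomial with
  multiplicity, for matrices indexed from 0, and the diagonal expression of the quadratic form, in
  components indexed from 1. The orthonormal eigenvectors provide the similarity to a diagonal
  matrix.\<close>

lemma leading_block_diagonalization:
  assumes a_sym: "\<And>i j. i \<in> {1..m} \<Longrightarrow> j \<in> {1..m} \<Longrightarrow> a i j = a j i"
  obtains v \<kappa> where
    "\<And>l i. l < m \<Longrightarrow> i \<in> {1..m} \<Longrightarrow> (\<Sum>j=1..m. a i j * v l j) = \<kappa> l * v l i"
    "\<And>l l'. l < m \<Longrightarrow> l' < m \<Longrightarrow> (\<Sum>i=1..m. v l i * v l' i) = (if l = l' then 1 else 0)"
    "\<And>x. (\<Sum>i=1..m. \<Sum>j=1..m. a i j * x i * x j) = (\<Sum>l<m. \<kappa> l * (\<Sum>i=1..m. v l i * x i)\<^sup>2)"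
    "num_pos_eigenvalues (leading_block m a) = card {l\<in>{..<m}. \<kappa> l > 0}"
proof -
  have "m \<le> card {1..m}" by simp
  then obtain v \<kappa> where v': "\<forall>l<m. \<forall>i\<in>{1..m}. (\<Sum>j=1..m. a i j * v l j) = \<kappa> l * v l i"
    "\<forall>l<m. \<forall>l'<m. (\<Sum>i=1..m. v l i * v l' i) = (if l = l' then 1 else 0)"
    using symmetric_eigenbasis[of "{1..m}" a m, OF _ a_sym] by blast
  have v: "\<And>l i. l < m \<Longrightarrow> i \<in> {1..m} \<Longrightarrow> (\<Sum>j=1..m. a i j * v l j) = \<kappa> l * v l i"
    "\<And>l l'. l < m \<Longrightarrow> l' < m \<Longrightarrow> (\<Sum>i=1..m. v l i * v l' i) = (if l = l' then 1 else 0)"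
    using v' by blast+
  define A where "A = leading_block m a"
  define V where "V = Matrix.mat m m (\<lambda>(i, l). v l (Suc i))"
  define W where "W = Matrix.mat m m (\<lambda>(l, i). v l (Suc i))"
  define D where "D = Matrix.mat m m (\<lambda>(i, j). if i = j then \<kappa> i else 0)"
  have car: "A \<in> carrier_mat m m" "V \<in> carrier_mat m m" "W \<in> carrier_mat m m" "D \<in> carrier_mat m m"
    by (auto simp: A_def leading_block_def V_def W_def D_def)
  have shift: "(\<Sum>i=1..m. f i) = (\<Sum>i=0..<m. f (Suc i))" for f :: "nat \<Rightarrow> real"
    by (simp add: sum.atLeast_Suc_atMost_Suc_shift[symmetric] image_Suc_atLeastLessThan
        sum.reindex[of Suc, unfolded o_def, symmetric] atLeastLessThanSuc_atLeastAtMost)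
  have WV: "W * V = 1\<^sub>m m"
  proof (rule eq_matI)
    fix i j assume "i < dim_row (1\<^sub>m m)" "j < dim_col (1\<^sub>m m)"
    then have ij: "i < m" "j < m" by auto
    then show "(W * V) $$ (i, j) = 1\<^sub>m m $$ (i, j)"
      using v(2)[OF ij] unfolding shift by (simp add: W_def V_def scalar_prod_def)
  qed (use car in auto)
  \<comment> \<open>For square matrices a one-sided inverse is two-sided: an orthonormal system of
    full size is complete.\<close>
  have VW: "V * W = 1\<^sub>m m" by (rule mat_mult_left_right_inverse[OF car(3,2) WV])
  have "A * V = V * D"
  proof (rule eq_matI)
    fix i j assume "i < dim_row (V * D)" "j < dim_col (V * D)"
    then have ij: "i < m" "j < m" using car by auto
    have "(A * V) $$ (i, j) = (\<Sum>k=0..<m. a (Suc i) (Suc k) * v j (Suc k))"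
      using ij by (simp add: A_def leading_block_def V_def scalar_prod_def)
    also have "\<dots> = \<kappa> j * v j (Suc i)" using v(1)[of j "Suc i"] ij unfolding shift by simp
    also have "\<dots> = (V * D) $$ (i, j)"
      using ij by (simp add: V_def D_def scalar_prod_def if_distrib[of "\<lambda>x. _ * x"] cong: if_cong)
    finally show "(A * V) $$ (i, j) = (V * D) $$ (i, j)" .
  qed (use car in auto)
  then have "V * D * W = A * V * W" by simp
  also have "\<dots> = A * (V * W)" using car by (intro assoc_mult_mat)
  also have "\<dots> = A" using VW car by simp
  finally have "similar_mat_wit A D V W"
    by (intro similar_mat_witI[OF VW WV _ car(1,4,2,3)]) (rule HOL.sym)
  then have "char_poly A = char_poly D"
    by (intro char_poly_similar) (auto simp: similar_mat_def)
  also have "\<dots> = (\<Prod>x\<leftarrow>diag_mat D. [:- x, 1:])"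
    using car(4) by (rule char_poly_upper_triangular) (auto simp: D_def)
  also have "diag_mat D = map \<kappa> [0..<m]" by (auto simp: diag_mat_def D_def)
  also have "(\<Prod>x\<leftarrow>map \<kappa> [0..<m]. [:- x, 1:]) = (\<Prod>i\<in>{..<m}. [:- \<kappa> i, 1:])"
    by (simp add: o_def prod.distinct_set_conv_list[symmetric] atLeast0LessThan)
  finally have cp: "char_poly A = (\<Prod>i\<in>{..<m}. [:- \<kappa> i, 1:])" .
  have ev: "eigenvalue A x \<longleftrightarrow> x \<in> \<kappa> ` {..<m}" for x
    unfolding eigenvalue_root_char_poly[OF car(1)] cp poly_prod by auto
  let ?S = "{l\<in>{..<m}. \<kappa> l > 0}"
  \<comment> \<open>The order of a root is the number of indices carrying that value, so summing
    orders over distinct values counts indices.\<close>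
  have "num_pos_eigenvalues A = (\<Sum>x\<in>\<kappa> ` ?S. card {l\<in>?S. \<kappa> l = x})"
    unfolding num_pos_eigenvalues_def ev cp
    by (rule sum.cong) (auto simp: order_prod_linear intro!: arg_cong[where f = card])
  also have "\<dots> = card ?S"
    using sum.image_gen[of ?S "\<lambda>_. 1::nat" \<kappa>] by simp
  finally have num: "num_pos_eigenvalues (leading_block m a) = card ?S" by (simp add: A_def)
  have complete: "(\<Sum>l<m. v l i * v l j) = (if i = j then 1 else 0)" if "i \<in> {1..m}" "j \<in> {1..m}" for i j
  proof -
    have "(V * W) $$ (i - 1, j - 1) = 1\<^sub>m m $$ (i - 1, j - 1)" using VW by simp
    moreover have "i - 1 < m" "j - 1 < m" "Suc (i - 1) = i" "Suc (j - 1) = j" using that by auto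
    ultimately show ?thesis
      by (simp add: V_def W_def scalar_prod_def atLeast0LessThan eq_diff_iff)
  qed
  have "(\<Sum>i=1..m. \<Sum>j=1..m. a i j * x i * x j) = (\<Sum>l<m. \<kappa> l * (\<Sum>i=1..m. v l i * x i)\<^sup>2)" for x
  proof -
    define y where "y = (\<lambda>l. \<Sum>i=1..m. v l i * x i)"
    have x: "(\<Sum>l<m. v l j * y l) = x j" if j: "j \<in> {1..m}" for j
    proof -
      have "(\<Sum>l<m. v l j * y l) = (\<Sum>i=1..m. (\<Sum>l<m. v l j * v l i) * x i)"
        unfolding y_def sum_distrib_left sum_distrib_right
        by (subst sum.swap) (simp add: mult_ac)
      also have "\<dots> = (\<Sum>i=1..m. (if j = i then 1 else 0) * x i)"
        by (intro sum.cong refl) (simp add: complete[OF j])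
      finally show ?thesis using j by (simp add: if_distrib[of "\<lambda>t. t * _"] cong: if_cong)
    qed
    have "\<kappa> l * (y l)\<^sup>2 = (\<Sum>i=1..m. (\<kappa> l * v l i) * x i * y l)" for l
    proof -
      have "\<kappa> l * (y l)\<^sup>2 = \<kappa> l * ((\<Sum>i=1..m. v l i * x i) * y l)"
        by (simp add: power2_eq_square y_def)
      then show ?thesis by (simp add: sum_distrib_left sum_distrib_right mult_ac)
    qed
    then have "(\<Sum>l<m. \<kappa> l * (y l)\<^sup>2) = (\<Sum>l<m. \<Sum>i=1..m. (\<kappa> l * v l i) * x i * y l)"
      by simp
    also have "\<dots> = (\<Sum>l<m. \<Sum>i=1..m. (\<Sum>j=1..m. a i j * v l j) * x i * y l)"
      by (intro sum.cong refl) (use v(1) in auto)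
    also have "\<dots> = (\<Sum>l<m. \<Sum>i=1..m. \<Sum>j=1..m. a i j * x i * (v l j * y l))"
      by (simp add: sum_distrib_left sum_distrib_right mult_ac)
    also have "\<dots> = (\<Sum>i=1..m. \<Sum>l<m. \<Sum>j=1..m. a i j * x i * (v l j * y l))"
      by (rule sum.swap)
    also have "\<dots> = (\<Sum>i=1..m. \<Sum>j=1..m. \<Sum>l<m. a i j * x i * (v l j * y l))"
      by (rule sum.cong[OF refl], rule sum.swap)
    also have "\<dots> = (\<Sum>i=1..m. \<Sum>j=1..m. a i j * x i * x j)"
      by (intro sum.cong refl) (simp add: sum_distrib_left[symmetric] x)
    finally show ?thesis by (simp add: y_def)
  qed
  then show thesis using that[OF v] num by blast
qed

section \<open>Square-integrable functions\<close>

text \<open>\<open>L2\<close> with an arbitrary measure, since functions move between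
  \<open>lebesgue_on \<Omega>\<close> and \<open>lborel\<close>: translation and Fubini arguments
  live on the latter.\<close>

definition square_integrable :: "'a measure \<Rightarrow> ('a \<Rightarrow> 'b::euclidean_space) \<Rightarrow> bool" where
  "square_integrable M f \<longleftrightarrow> f \<in> borel_measurable M \<and> integrable M (\<lambda>x. (norm (f x))\<^sup>2)"

lemma L2_iff: "u \<in> L2 \<Omega> \<longleftrightarrow> square_integrable (lebesgue_on \<Omega>) u"
  by (simp add: L2_def square_integrable_def)

lemma square_integrable_inner:
  assumes f: "square_integrable M f" and g: "square_integrable M g"
  shows "integrable M (\<lambda>x. f x \<bullet> g x)"
proof (rule Bochner_Integration.integrable_bound)
  show "integrable M (\<lambda>x. (norm (f x))\<^sup>2 + (norm (g x))\<^sup>2)"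
    using f g by (auto simp: square_integrable_def)
  have "\<bar>f x \<bullet> g x\<bar> \<le> (norm (f x))\<^sup>2 + (norm (g x))\<^sup>2" for x
  proof -
    have "\<bar>f x \<bullet> g x\<bar> \<le> norm (f x) * norm (g x)" by (rule Cauchy_Schwarz_ineq2)
    also have "\<dots> \<le> (norm (f x))\<^sup>2 + (norm (g x))\<^sup>2"
      using sum_squares_bound[of "norm (f x)" "norm (g x)"] mult_nonneg_nonneg[of "norm (f x)" "norm (g x)", OF norm_ge_zero norm_ge_zero]
      by linarith
    finally show ?thesis .
  qed
  then show "AE x in M. norm (f x \<bullet> g x) \<le> norm ((norm (f x))\<^sup>2 + (norm (g x))\<^sup>2)" by simp
  show "(\<lambda>x. f x \<bullet> g x) \<in> borel_measurable M"
    using f g by (auto simp: square_integrable_def)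
qed

lemma square_integrable_mult:
  fixes f g :: "'a \<Rightarrow> real"
  shows "square_integrable M f \<Longrightarrow> square_integrable M g \<Longrightarrow> integrable M (\<lambda>x. f x * g x)"
  using square_integrable_inner[of M f g] by simp

lemma square_integrable_dominated:
  assumes g: "square_integrable M g" and f: "f \<in> borel_measurable M"
    and le: "AE x in M. norm (f x) \<le> C * norm (g x)"
  shows "square_integrable M f"
  unfolding square_integrable_def
proof (intro conjI f, rule Bochner_Integration.integrable_bound)
  show "integrable M (\<lambda>x. C\<^sup>2 * (norm (g x))\<^sup>2)" using g by (simp add: square_integrable_def)
  show "AE x in M. norm ((norm (f x))\<^sup>2) \<le> norm (C\<^sup>2 * (norm (g x))\<^sup>2)"
    using le
  proof eventually_elim
    case (elim x)
    then have "(norm (f x))\<^sup>2 \<le> (C * norm (g x))\<^sup>2" by (intro power_mono) auto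
    then show ?case by (simp add: power_mult_distrib)
  qed
qed (use f in simp)

lemma square_integrable_add:
  assumes f: "square_integrable M f" and g: "square_integrable M g"
  shows "square_integrable M (\<lambda>x. f x + r *\<^sub>R g x)"
  unfolding square_integrable_def
proof (intro conjI, goal_cases)
  case 1
  then show ?case using f g by (auto simp: square_integrable_def)
next
  case 2
  have "(norm (f x + r *\<^sub>R g x))\<^sup>2 = (norm (f x))\<^sup>2 + 2 * r * (f x \<bullet> g x) + r\<^sup>2 * (norm (g x))\<^sup>2" for x
    unfolding power2_norm_eq_inner by (simp add: algebra_simps inner_commute power2_eq_square)
  then show ?case
    using f g square_integrable_inner[OF f g] by (simp add: square_integrable_def)
qed

lemma square_integrable_scaleR:
  "square_integrable M g \<Longrightarrow> square_integrable M (\<lambda>x. r *\<^sub>R g x)"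
  by (rule square_integrable_dominated[where C = "\<bar>r\<bar>" and g = g]) (auto simp: square_integrable_def)

lemma square_integrable_diff:
  "square_integrable M f \<Longrightarrow> square_integrable M g \<Longrightarrow> square_integrable M (\<lambda>x. f x - g x)"
  using square_integrable_add[of M f g "-1"] by simp

lemma square_integrable_inner_const:
  "square_integrable M g \<Longrightarrow> square_integrable M (\<lambda>x. g x \<bullet> z)"
  by (rule square_integrable_dominated[where C = "norm z" and g = g])
    (auto simp: square_integrable_def mult.commute[of "norm z"] Cauchy_Schwarz_ineq2)

lemma pos_form_L2:
  "pos_form {f::'a \<Rightarrow> real. square_integrable M f} (\<lambda>f g. \<integral>x. f x * g x \<partial>M)"
proof
  show "(\<lambda>_. 0) \<in> {f::'a \<Rightarrow> real. square_integrable M f}" by (simp add: square_integrable_def)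
  show "(\<lambda>x. u x + r * v x) \<in> {f. square_integrable M f}"
    if "u \<in> {f. square_integrable M f}" "v \<in> {f. square_integrable M f}" for u v and r :: real
    using square_integrable_add[of M u v r] that by simp
  show "(\<integral>x. u x * v x \<partial>M) = (\<integral>x. v x * u x \<partial>M)" for u v :: "'a \<Rightarrow> real" by (simp add: mult.commute)
  show "(\<integral>x. (u x + r * v x) * w x \<partial>M) = (\<integral>x. u x * w x \<partial>M) + r * (\<integral>x. v x * w x \<partial>M)"
    if "u \<in> {f. square_integrable M f}" "v \<in> {f. square_integrable M f}" "w \<in> {f. square_integrable M f}"
    for u v w and r :: real
    using that square_integrable_mult[of M u w] square_integrable_mult[of M v w]
    by (simp add: algebra_simps)
  show "0 \<le> (\<integral>x. u x * u x \<partial>M)" for u :: "'a \<Rightarrow> real" by simp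
qed

lemma L2_Cauchy_Schwarz:
  fixes f g :: "'a \<Rightarrow> real"
  assumes "square_integrable M f" "square_integrable M g"
  shows "(\<integral>x. f x * g x \<partial>M)\<^sup>2 \<le> (\<integral>x. (f x)\<^sup>2 \<partial>M) * (\<integral>x. (g x)\<^sup>2 \<partial>M)"
  using pos_form.Cauchy_Schwarz[OF pos_form_L2, of f M g] assms by (simp add: power2_eq_square)

lemma L2_norm_diff_le:
  assumes "square_integrable M f" "square_integrable M g"
  shows "(\<integral>x. (norm (f x - g x))\<^sup>2 \<partial>M) \<le> 2 * (\<integral>x. (norm (f x))\<^sup>2 \<partial>M) + 2 * (\<integral>x. (norm (g x))\<^sup>2 \<partial>M)"
proof -
  have int: "integrable M (\<lambda>x. (norm (f x - g x))\<^sup>2)" "integrable M (\<lambda>x. (norm (f x))\<^sup>2)"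
    "integrable M (\<lambda>x. (norm (g x))\<^sup>2)"
    using assms square_integrable_diff[OF assms] by (auto simp: square_integrable_def)
  have "(norm (f x - g x))\<^sup>2 \<le> 2 * (norm (f x))\<^sup>2 + 2 * (norm (g x))\<^sup>2" for x
  proof -
    have "(norm (f x - g x))\<^sup>2 \<le> (norm (f x) + norm (g x))\<^sup>2"
      by (intro power_mono norm_triangle_ineq4) auto
    also have "\<dots> \<le> 2 * (norm (f x))\<^sup>2 + 2 * (norm (g x))\<^sup>2"
      using sum_squares_bound[of "norm (f x)" "norm (g x)"] by (simp add: power2_sum)
    finally show ?thesis .
  qed
  then have "(\<integral>x. (norm (f x - g x))\<^sup>2 \<partial>M) \<le> (\<integral>x. 2 * (norm (f x))\<^sup>2 + 2 * (norm (g x))\<^sup>2 \<partial>M)"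
    using int by (intro integral_mono) auto
  then show ?thesis using int by simp
qed

lemma L2_norm_inner_le:
  assumes "square_integrable M g"
  shows "(\<integral>x. (g x \<bullet> z)\<^sup>2 \<partial>M) \<le> (norm z)\<^sup>2 * (\<integral>x. (norm (g x))\<^sup>2 \<partial>M)"
proof -
  have "(g x \<bullet> z)\<^sup>2 \<le> (norm z)\<^sup>2 * (norm (g x))\<^sup>2" for x
    using Cauchy_Schwarz_ineq[of "g x" z] by (simp add: power2_norm_eq_inner mult.commute)
  then have "(\<integral>x. (g x \<bullet> z)\<^sup>2 \<partial>M) \<le> (\<integral>x. (norm z)\<^sup>2 * (norm (g x))\<^sup>2 \<partial>M)"
    using assms square_integrable_inner_const[OF assms, of z]
    by (intro integral_mono) (auto simp: square_integrable_def)
  then show ?thesis by simp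
qed

lemma Fatou_bound:
  fixes h :: "nat \<Rightarrow> 'a \<Rightarrow> real"
  assumes h: "\<And>k. integrable M (h k)" "\<And>k x. 0 \<le> h k x" "\<forall>\<^sub>F k in sequentially. (\<integral>x. h k x \<partial>M) \<le> C"
    and lim: "g \<in> borel_measurable M" "AE x in M. (\<lambda>k. h k x) \<longlonglongrightarrow> g x"
  shows "integrable M g" "(\<integral>x. g x \<partial>M) \<le> C"
proof -
  have [measurable]: "h k \<in> borel_measurable M" for k using h(1)[of k] by simp
  have C: "0 \<le> C"
  proof -
    obtain k where "(\<integral>x. h k x \<partial>M) \<le> C" using eventually_happens[OF h(3)] by auto
    moreover have "0 \<le> (\<integral>x. h k x \<partial>M)" using h(2) by simp
    ultimately show ?thesis by simp
  qed
  have g: "AE x in M. 0 \<le> g x"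
    using lim(2) by eventually_elim (rule LIMSEQ_le_const, use h(2) in auto)
  have "(\<integral>\<^sup>+x. ennreal (g x) \<partial>M) = (\<integral>\<^sup>+x. liminf (\<lambda>k. ennreal (h k x)) \<partial>M)"
    using lim(2) by (intro nn_integral_cong_AE, eventually_elim)
      (simp add: lim_imp_Liminf[OF _ tendsto_ennrealI])
  also have "\<dots> \<le> liminf (\<lambda>k. \<integral>\<^sup>+x. ennreal (h k x) \<partial>M)" by (rule nn_integral_liminf) simp
  also have "\<dots> = liminf (\<lambda>k. ennreal (\<integral>x. h k x \<partial>M))"
    using h by (simp add: nn_integral_eq_integral)
  also have "\<dots> \<le> liminf (\<lambda>k. ennreal C)"
    by (intro Liminf_mono) (use h(3) in \<open>auto elim!: eventually_mono intro: ennreal_leI\<close>)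
  also have "\<dots> = ennreal C" by (simp add: Liminf_const)
  finally have le: "(\<integral>\<^sup>+x. ennreal (g x) \<partial>M) \<le> ennreal C" .
  show int: "integrable M g"
    by (rule integrableI_nonneg[OF lim(1) g]) (use le in \<open>simp add: order_le_less_trans\<close>)
  show "(\<integral>x. g x \<partial>M) \<le> C"
    using le C by (simp add: nn_integral_eq_integral[OF int g])
qed

text \<open>The sum has a finite integral and is therefore finite almost everywhere. This turns
  geometric decay of integrals into pointwise convergence.\<close>

lemma AE_summable:
  fixes h :: "nat \<Rightarrow> 'a \<Rightarrow> real"
  assumes h: "\<And>k. integrable M (h k)" "\<And>k x. 0 \<le> h k x" "\<And>k. (\<integral>x. h k x \<partial>M) \<le> b k" "summable b"
  shows "AE x in M. summable (\<lambda>k. h k x)"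
proof -
  have [measurable]: "h k \<in> borel_measurable M" for k using h(1)[of k] by simp
  have b: "0 \<le> b k" for k
    using h(3)[of k] Bochner_Integration.integral_nonneg[of M "h k"] h(2) by (meson order_trans)
  have "(\<integral>\<^sup>+x. (\<Sum>k. ennreal (h k x)) \<partial>M) = (\<Sum>k. \<integral>\<^sup>+x. ennreal (h k x) \<partial>M)"
    by (rule nn_integral_suminf) simp
  also have "\<dots> \<le> (\<Sum>k. ennreal (b k))"
    using h by (intro suminf_le) (auto simp: nn_integral_eq_integral intro!: ennreal_leI)
  also have "\<dots> < \<infinity>" using h(4) b by (simp add: ennreal_suminf_neq_top less_top)
  finally have "AE x in M. (\<Sum>k. ennreal (h k x)) \<noteq> \<infinity>"
    by (intro nn_integral_PInf_AE) auto
  then show ?thesis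
    by eventually_elim (use h(2) in \<open>auto intro: summable_suminf_not_top\<close>)
qed

text \<open>Riesz-Fischer. The almost everywhere convergent subsequence is part of the conclusion
  because radial symmetry is a pointwise property that has to pass to limits.\<close>

lemma L2_complete:
  fixes f :: "nat \<Rightarrow> 'a \<Rightarrow> 'b::euclidean_space"
  assumes f: "\<And>k. square_integrable M (f k)"
    and Cauchy: "\<And>e. e > 0 \<Longrightarrow> \<exists>N. \<forall>k\<ge>N. \<forall>l\<ge>N. (\<integral>x. (norm (f k x - f l x))\<^sup>2 \<partial>M) < e"
  obtains u r where "square_integrable M u" "(\<lambda>k. \<integral>x. (norm (f k x - u x))\<^sup>2 \<partial>M) \<longlonglongrightarrow> 0"
    "strict_mono (r::nat \<Rightarrow> nat)" "AE x in M. (\<lambda>k. f (r k) x) \<longlonglongrightarrow> u x"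
proof -
  have [measurable]: "f k \<in> borel_measurable M" for k using f[of k] by (simp add: square_integrable_def)
  define D where "D = (\<lambda>k l. \<integral>x. (norm (f k x - f l x))\<^sup>2 \<partial>M)"
  have "\<exists>N. \<forall>k\<ge>N. \<forall>l\<ge>N. D k l < (1/4)^j" for j
    using Cauchy[of "(1/4)^j"] by (simp add: D_def)
  then obtain N where N: "\<And>j k l. k \<ge> N j \<Longrightarrow> l \<ge> N j \<Longrightarrow> D k l < (1/4)^j" by metis
  define r where "r = rec_nat (N 0) (\<lambda>j r. max (Suc r) (N (Suc j)))"
  have r_Suc: "r (Suc j) = max (Suc (r j)) (N (Suc j))" and r_0: "r 0 = N 0" for j
    by (simp_all add: r_def)
  have r: "strict_mono r" by (rule strict_monoI_Suc) (simp add: r_Suc)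
  have rN: "r j \<ge> N j" for j by (cases j) (auto simp: r_Suc r_0)
  have sq: "integrable M (\<lambda>x. (norm (f k x - f l x))\<^sup>2)" for k l
    using square_integrable_diff[OF f f] by (simp add: square_integrable_def)
  let ?d = "\<lambda>j x. norm (f (r (Suc j)) x - f (r j) x)"
  \<comment> \<open>The integrals of the squares are at most \<open>(1/4)^j\<close>, so the weight
    \<open>2^j\<close> still leaves a summable bound; the weight is spent below to pass from squares
    to norms.\<close>
  have "AE x in M. summable (\<lambda>j. 2^j * (?d j x)\<^sup>2)"
  proof (rule AE_summable)
    show "integrable M (\<lambda>x. 2^j * (?d j x)\<^sup>2)" for j using sq by simp
    have "D (r (Suc j)) (r j) \<le> (1/4)^j" for j
      using N[of j "r (Suc j)" "r j"] rN[of j] strict_monoD[OF r, of j "Suc j"] by simp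
    then have "2^j * D (r (Suc j)) (r j) \<le> 2^j * (1/4)^j" for j by simp
    then show "(\<integral>x. 2^j * (?d j x)\<^sup>2 \<partial>M) \<le> (1/2)^j" for j
      by (simp add: D_def power_mult_distrib[symmetric])
    show "summable (\<lambda>j. (1/2::real)^j)" by (rule summable_geometric) simp
  qed simp
  then have AE_conv: "AE x in M. convergent (\<lambda>j. f (r j) x)"
  proof eventually_elim
    case (elim x)
    have "summable (\<lambda>j. f (r (Suc j)) x - f (r j) x)"
    proof (rule summable_norm_cancel, rule summable_comparison_test')
      have "summable (\<lambda>j. (1/2)^j + 2^j * (?d j x)\<^sup>2)"
        by (intro summable_add elim summable_geometric) simp
      then show "summable (\<lambda>j. (1/2)^j + 2^j * (?d j x)\<^sup>2)" .
      \<comment> \<open>AM-GM: a geometric term plus the weighted square dominates the increment, so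
        the telescoping series converges absolutely.\<close>
      show "norm (?d j x) \<le> (1/2)^j + 2^j * (?d j x)\<^sup>2" if "j \<ge> 0" for j
      proof -
        have "0 \<le> (1/2)^j * (1 - 2^j * ?d j x)\<^sup>2" by simp
        also have "\<dots> = (1/2)^j - 2 * ((1/2)^j * 2^j) * ?d j x + ((1/2)^j * 2^j) * 2^j * (?d j x)\<^sup>2"
          by (simp only: power2_eq_square) (simp add: algebra_simps)
        also have "(1/2::real)^j * 2^j = 1" by (simp add: power_mult_distrib[symmetric])
        finally show ?thesis using norm_ge_zero[of "f (r (Suc j)) x - f (r j) x"]
          unfolding real_norm_def abs_norm_cancel by linarith
      qed
    qed
    then have "convergent (\<lambda>n. \<Sum>j<n. f (r (Suc j)) x - f (r j) x)"
      by (simp add: summable_iff_convergent)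
    then have "convergent (\<lambda>n. f (r n) x - f (r 0) x)"
      by (simp only: sum_lessThan_telescope[of "\<lambda>j. f (r j) x" for x])
    then have "convergent (\<lambda>n. (f (r n) x - f (r 0) x) + f (r 0) x)"
      by (intro convergent_add convergent_const)
    then show ?case by simp
  qed
  define u where "u = (\<lambda>x. lim (\<lambda>j. f (r j) x))"
  have [measurable]: "u \<in> borel_measurable M" unfolding u_def by measurable
  have lim: "AE x in M. (\<lambda>j. f (r j) x) \<longlonglongrightarrow> u x"
    using AE_conv by eventually_elim (simp add: u_def convergent_LIMSEQ_iff)
  have bound: "integrable M (\<lambda>x. (norm (f k x - u x))\<^sup>2)"
    "(\<integral>x. (norm (f k x - u x))\<^sup>2 \<partial>M) \<le> (1/4)^j" if k: "k \<ge> N j" for k j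
  proof -
    have ev: "\<forall>\<^sub>F i in sequentially. (\<integral>x. (norm (f k x - f (r i) x))\<^sup>2 \<partial>M) \<le> (1/4)^j"
      using eventually_ge_at_top[of "N j"]
    proof eventually_elim
      case (elim i)
      then have "r i \<ge> N j" using strict_mono_imp_increasing[OF r, of i] by linarith
      then show ?case using N[OF k, of "r i"] by (simp add: D_def)
    qed
    have AE: "AE x in M. (\<lambda>i. (norm (f k x - f (r i) x))\<^sup>2) \<longlonglongrightarrow> (norm (f k x - u x))\<^sup>2"
      using lim by eventually_elim (intro tendsto_intros)
    show "integrable M (\<lambda>x. (norm (f k x - u x))\<^sup>2)"
      "(\<integral>x. (norm (f k x - u x))\<^sup>2 \<partial>M) \<le> (1/4)^j"
      by (rule Fatou_bound[where h = "\<lambda>i x. (norm (f k x - f (r i) x))\<^sup>2"]; use sq ev AE in simp)+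
  qed
  have "square_integrable M (\<lambda>x. f (N 0) x - u x)"
    using bound(1)[of 0 "N 0"] by (simp add: square_integrable_def)
  from square_integrable_diff[OF f this, of "N 0"] have u: "square_integrable M u" by simp
  have "(\<lambda>k. \<integral>x. (norm (f k x - u x))\<^sup>2 \<partial>M) \<longlonglongrightarrow> 0"
  proof (rule LIMSEQ_I)
    fix e :: real assume "e > 0"
    then obtain j where j: "(1/4::real)^j < e" using real_arch_pow_inv[of e "1/4"] by auto
    have "norm ((\<integral>x. (norm (f k x - u x))\<^sup>2 \<partial>M) - 0) < e" if "k \<ge> N j" for k
      using bound(2)[OF that] j by simp
    then show "\<exists>no. \<forall>n\<ge>no. norm ((\<integral>x. (norm (f n x - u x))\<^sup>2 \<partial>M) - 0) < e" by blast
  qed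
  then show thesis using that[OF u _ r lim] by blast
qed

section \<open>Test functions\<close>

lemma Ck_const: "Ck k (\<lambda>_. c)"
proof (induction k arbitrary: c)
  case (Suc k)
  show ?case unfolding Ck.simps by (rule exI[of _ "\<lambda>_ _. 0"]) (auto intro: Suc)
qed simp

lemma Ck_Suc_imp: "Ck (Suc k) f \<Longrightarrow> Ck k f"
proof (induction k arbitrary: f)
  case 0
  then obtain f' where "\<And>x. (f has_derivative f' x) (at x)" by auto
  then show ?case
    by (auto intro!: continuous_at_imp_continuous_on intro: has_derivative_continuous)
next
  case (Suc k)
  then obtain f' where f': "\<forall>x. (f has_derivative f' x) (at x)" "\<forall>b\<in>Basis. Ck (Suc k) (\<lambda>x. f' x b)"
    unfolding Ck.simps(2)[of "Suc k"] by blast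
  then have "\<forall>b\<in>Basis. Ck k (\<lambda>x. f' x b)" using Suc.IH by blast
  then show ?case using f'(1) unfolding Ck.simps(2)[of k] by blast
qed

lemma Ck_add: "Ck k f \<Longrightarrow> Ck k g \<Longrightarrow> Ck k (\<lambda>x. f x + g x)"
proof (induction k arbitrary: f g)
  case 0
  then show ?case by (auto intro: continuous_on_add)
next
  case (Suc k)
  obtain f' where f': "\<And>x. (f has_derivative f' x) (at x)" "\<And>b. b \<in> Basis \<Longrightarrow> Ck k (\<lambda>x. f' x b)"
    using Suc.prems(1) by auto
  obtain g' where g': "\<And>x. (g has_derivative g' x) (at x)" "\<And>b. b \<in> Basis \<Longrightarrow> Ck k (\<lambda>x. g' x b)"
    using Suc.prems(2) by auto
  show ?case unfolding Ck.simps
    by (rule exI[of _ "\<lambda>x h. f' x h + g' x h"]) (auto intro!: has_derivative_add f' g' Suc.IH)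
qed

lemma Ck_mult: "Ck k f \<Longrightarrow> Ck k g \<Longrightarrow> Ck k (\<lambda>x. f x * g x)"
proof (induction k arbitrary: f g)
  case 0
  then show ?case by (auto intro: continuous_on_mult)
next
  case (Suc k)
  obtain f' where f': "\<And>x. (f has_derivative f' x) (at x)" "\<And>b. b \<in> Basis \<Longrightarrow> Ck k (\<lambda>x. f' x b)"
    using Suc.prems(1) by auto
  obtain g' where g': "\<And>x. (g has_derivative g' x) (at x)" "\<And>b. b \<in> Basis \<Longrightarrow> Ck k (\<lambda>x. g' x b)"
    using Suc.prems(2) by auto
  have k: "Ck k f" "Ck k g" using Suc.prems by (auto dest!: Ck_Suc_imp simp del: Ck.simps)
  show ?case unfolding Ck.simps
    by (rule exI[of _ "\<lambda>x h. f x * g' x h + f' x h * g x"])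
      (auto intro!: has_derivative_mult f' g' Suc.IH Ck_add k)
qed

lemma Ck_prod: "finite I \<Longrightarrow> (\<And>i. i \<in> I \<Longrightarrow> Ck k (f i)) \<Longrightarrow> Ck k (\<lambda>x. \<Prod>i\<in>I. f i x)"
  by (induction I rule: finite_induct) (auto intro: Ck_const Ck_mult)

lemma Ck_sum: "finite I \<Longrightarrow> (\<And>i. i \<in> I \<Longrightarrow> Ck k (f i)) \<Longrightarrow> Ck k (\<lambda>x. \<Sum>i\<in>I. f i x)"
  by (induction I rule: finite_induct) (auto intro: Ck_const Ck_add)

lemma Ck_translate: "Ck k f \<Longrightarrow> Ck k (\<lambda>x. f (x + z))"
proof (induction k arbitrary: f)
  case 0
  have "continuous_on UNIV (f \<circ> (\<lambda>x. x + z))"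
    by (rule continuous_on_compose) (use 0 in \<open>auto intro!: continuous_intros intro: continuous_on_subset\<close>)
  then show ?case by (simp add: o_def)
next
  case (Suc k)
  then obtain f' where f': "\<And>x. (f has_derivative f' x) (at x)" "\<And>b. b \<in> Basis \<Longrightarrow> Ck k (\<lambda>x. f' x b)"
    by auto
  have "((\<lambda>x. f (x + z)) has_derivative f' (x + z)) (at x)" for x
  proof -
    have "((\<lambda>x. x + z) has_derivative (\<lambda>h. h)) (at x)" by (auto intro!: derivative_eq_intros)
    from has_derivative_compose[OF this f'(1)] show ?thesis .
  qed
  then show ?case unfolding Ck.simps
    by (intro exI[of _ "\<lambda>x. f' (x + z)"]) (auto intro!: Suc.IH f')
qed

text \<open>The functions \<open>p(1/t) exp(-1/t)\<close>, extended by 0. The family is closed under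
  differentiation, so a single induction over all polynomials gives smoothness of every
  order.\<close>

definition flat :: "real poly \<Rightarrow> real \<Rightarrow> real" where
  "flat p t = (if t > 0 then poly p (1 / t) * exp (- (1 / t)) else 0)"

lemma poly_exp_tendsto_0: "((\<lambda>s::real. poly p s * exp (- s)) \<longlongrightarrow> 0) at_top"
proof -
  have "((\<lambda>s::real. \<Sum>i\<le>degree p. coeff p i * (s ^ i / exp s)) \<longlongrightarrow> (\<Sum>i\<le>degree p. coeff p i * 0)) at_top"
    by (intro tendsto_intros tendsto_power_div_exp_0)
  moreover have "(\<Sum>i\<le>degree p. coeff p i * (s ^ i / exp s)) = poly p s * exp (- s)" for s
    by (simp add: poly_altdef sum_distrib_right exp_minus divide_inverse mult.assoc)
  ultimately show ?thesis by simp
qed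

text \<open>With \<open>s = 1 / t\<close>, whose derivative is \<open>- s * s\<close>, the
  derivative of \<open>p(s) exp(-s)\<close> is \<open>s * s * (p(s) - p'(s)) * exp(-s)\<close>; this
  is where the polynomial comes from.\<close>

lemma flat_has_derivative: "(flat p has_real_derivative flat ([:0, 0, 1:] * (p - pderiv p)) t) (at t)"
proof (cases t "0::real" rule: linorder_cases)
  case less
  have "((\<lambda>_. 0) has_real_derivative flat ([:0, 0, 1:] * (p - pderiv p)) t) (at t)"
    using less by (simp add: flat_def)
  then show ?thesis
    by (rule has_field_derivative_transform_within_open[where S = "{..<0}"]) (use less in \<open>auto simp: flat_def\<close>)
next
  case greater
  have "((\<lambda>t. poly p (1 / t) * exp (- (1 / t))) has_real_derivative
      flat ([:0, 0, 1:] * (p - pderiv p)) t) (at t)"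
    using greater
    by (auto intro!: derivative_eq_intros poly_DERIV[THEN DERIV_chain2]
        simp: flat_def field_simps power2_eq_square)
  then show ?thesis
    by (rule has_field_derivative_transform_within_open[where S = "{0<..}"]) (use greater in \<open>auto simp: flat_def\<close>)
next
  case equal
  \<comment> \<open>The difference quotient at 0 is \<open>s * p(s) * exp(-s)\<close> with
    \<open>s = 1 / h\<close>, again a polynomial times the exponential.\<close>
  have right: "((\<lambda>h. flat p h / h) \<longlongrightarrow> 0) (at_right 0)"
  proof -
    have "((\<lambda>h. poly (pCons 0 p) (inverse h) * exp (- inverse h)) \<longlongrightarrow> 0) (at_right (0::real))"
      by (rule filterlim_compose[OF poly_exp_tendsto_0 filterlim_inverse_at_top_right])
    then show ?thesis
      by (rule tendsto_cong[THEN iffD1, rotated])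
        (auto simp: eventually_at_right_field flat_def field_simps intro!: exI[of _ 1])
  qed
  have left: "((\<lambda>h. flat p h / h) \<longlongrightarrow> 0) (at_left 0)"
    by (rule tendsto_eventually) (auto simp: eventually_at_left_field flat_def intro!: exI[of _ "-1"])
  have "((\<lambda>h. flat p h / h) \<longlongrightarrow> 0) (at 0)"
    using left right by (rule filterlim_split_at)
  then show ?thesis using equal by (simp add: DERIV_def flat_def)
qed

lemma Ck_flat: "Ck k (\<lambda>x. flat p (c * (x \<bullet> b) + d))"
proof (induction k arbitrary: p)
  case 0
  have "continuous_on UNIV (flat p)"
    by (intro DERIV_continuous_on[OF has_field_derivative_at_within[OF flat_has_derivative]])
  then have "continuous_on UNIV (flat p \<circ> (\<lambda>x. c * (x \<bullet> b) + d))"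
    by (intro continuous_on_compose) (auto intro!: continuous_intros intro: continuous_on_subset)
  then show ?case by (simp add: o_def)
next
  case (Suc k)
  let ?q = "[:0, 0, 1:] * (p - pderiv p)"
  have "((\<lambda>x. flat p (c * (x \<bullet> b) + d)) has_derivative (\<lambda>h. flat ?q (c * (x \<bullet> b) + d) * (c * (h \<bullet> b)))) (at x)" for x
  proof -
    have "((\<lambda>x. c * (x \<bullet> b) + d) has_derivative (\<lambda>h. c * (h \<bullet> b))) (at x)"
      by (auto intro!: derivative_eq_intros)
    from has_derivative_compose[OF this flat_has_derivative[unfolded has_field_derivative_def]]
    show ?thesis by simp
  qed
  then show ?case unfolding Ck.simps
    by (intro exI[of _ "\<lambda>x h. flat ?q (c * (x \<bullet> b) + d) * (c * (h \<bullet> b))"]) (auto intro!: Ck_mult Ck_const Suc)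
qed

text \<open>Any compact set containing the points where the function is nonzero will do, which
  avoids computing closures for sums, products and translates.\<close>

lemma test_functions_iff:
  "\<phi> \<in> test_functions \<Omega> \<longleftrightarrow>
    (\<forall>k. Ck k \<phi>) \<and> (\<exists>K. compact K \<and> K \<subseteq> \<Omega> \<and> (\<forall>x. x \<notin> K \<longrightarrow> \<phi> x = 0))"
proof
  assume "\<phi> \<in> test_functions \<Omega>"
  then show "(\<forall>k. Ck k \<phi>) \<and> (\<exists>K. compact K \<and> K \<subseteq> \<Omega> \<and> (\<forall>x. x \<notin> K \<longrightarrow> \<phi> x = 0))"
    unfolding test_functions_def using closure_subset[of "{x. \<phi> x \<noteq> 0}"]
    by (auto intro!: exI[of _ "closure {x. \<phi> x \<noteq> 0}"])
next
  assume *: "(\<forall>k. Ck k \<phi>) \<and> (\<exists>K. compact K \<and> K \<subseteq> \<Omega> \<and> (\<forall>x. x \<notin> K \<longrightarrow> \<phi> x = 0))"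
  then obtain K where K: "compact K" "K \<subseteq> \<Omega>" "\<And>x. x \<notin> K \<Longrightarrow> \<phi> x = 0" by blast
  then have sub: "closure {x. \<phi> x \<noteq> 0} \<subseteq> K"
    by (intro closure_minimal) (auto intro: compact_imp_closed)
  then have "compact (K \<inter> closure {x. \<phi> x \<noteq> 0})" using K(1) by (intro compact_Int_closed) auto
  then show "\<phi> \<in> test_functions \<Omega>"
    using * sub K(2) by (auto simp: test_functions_def Int_absorb1)
qed

lemma test_functions_Ck: "\<phi> \<in> test_functions \<Omega> \<Longrightarrow> Ck k \<phi>"
  by (simp add: test_functions_iff)

lemma test_functions_mono: "\<phi> \<in> test_functions \<Omega> \<Longrightarrow> \<Omega> \<subseteq> \<Omega>' \<Longrightarrow> \<phi> \<in> test_functions \<Omega>'"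
  unfolding test_functions_iff by blast

lemma test_functions_zero: "(\<lambda>_. 0) \<in> test_functions \<Omega>"
  by (auto simp: test_functions_iff Ck_const intro: exI[of _ "{}"])

lemma test_functions_add_scaled:
  assumes "\<phi> \<in> test_functions \<Omega>" "\<xi> \<in> test_functions \<Omega>"
  shows "(\<lambda>x. \<phi> x + r * \<xi> x) \<in> test_functions \<Omega>"
proof -
  obtain K L where "compact K" "K \<subseteq> \<Omega>" "\<And>x. x \<notin> K \<Longrightarrow> \<phi> x = 0"
    "compact L" "L \<subseteq> \<Omega>" "\<And>x. x \<notin> L \<Longrightarrow> \<xi> x = 0"
    using assms by (metis test_functions_iff)
  then show ?thesis using assms unfolding test_functions_iff
    by (auto intro!: Ck_add Ck_mult Ck_const exI[of _ "K \<union> L"])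
qed

lemma test_functions_mult:
  assumes "\<phi> \<in> test_functions \<Omega>" "\<And>k. Ck k \<xi>"
  shows "(\<lambda>x. \<phi> x * \<xi> x) \<in> test_functions \<Omega>"
  using assms unfolding test_functions_iff by (auto intro!: Ck_mult)

lemma test_functions_translate:
  assumes "\<phi> \<in> test_functions UNIV"
  shows "(\<lambda>x. \<phi> (x + z)) \<in> test_functions UNIV"
proof -
  obtain K where K: "compact K" "\<And>x. x \<notin> K \<Longrightarrow> \<phi> x = 0"
    using assms by (auto simp: test_functions_iff)
  have "compact ((\<lambda>x. x - z) ` K)" using K(1) by (rule compact_translation_subtract)
  moreover have "\<phi> (x + z) = 0" if "x \<notin> (\<lambda>x. x - z) ` K" for x
    using that by (intro K(2)) (force simp: image_iff algebra_simps)
  ultimately show ?thesis using assms unfolding test_functions_iff by (auto intro!: Ck_translate)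
qed

lemma test_functions_has_derivative:
  assumes "\<phi> \<in> test_functions \<Omega>"
  shows "(\<phi> has_derivative frechet_derivative \<phi> (at x)) (at x)"
proof -
  obtain f' where "\<And>x. (\<phi> has_derivative f' x) (at x)" using test_functions_Ck[OF assms, of 1] by auto
  then show ?thesis by (metis frechet_derivative_works differentiableI)
qed

lemma test_functions_partial_sum:
  assumes "\<phi> \<in> test_functions \<Omega>"
  shows "frechet_derivative \<phi> (at x) z = (\<Sum>b\<in>Basis. (z \<bullet> b) * frechet_derivative \<phi> (at x) b)"
proof -
  interpret linear "frechet_derivative \<phi> (at x)"
    by (rule has_derivative_linear[OF test_functions_has_derivative[OF assms]])
  have "frechet_derivative \<phi> (at x) (\<Sum>b\<in>Basis. (z \<bullet> b) *\<^sub>R b)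
      = (\<Sum>b\<in>Basis. (z \<bullet> b) * frechet_derivative \<phi> (at x) b)"
    by (simp add: sum scaleR)
  then show ?thesis by (simp add: euclidean_representation)
qed

lemma test_functions_deriv:
  assumes \<phi>: "\<phi> \<in> test_functions \<Omega>"
  shows "(\<lambda>x. frechet_derivative \<phi> (at x) z) \<in> test_functions \<Omega>"
proof -
  obtain K where K: "compact K" "K \<subseteq> \<Omega>" "\<And>x. x \<notin> K \<Longrightarrow> \<phi> x = 0"
    using \<phi> by (auto simp: test_functions_iff)
  have "Ck k (\<lambda>x. frechet_derivative \<phi> (at x) b)" if b: "b \<in> Basis" for k b
  proof -
    obtain f' where f': "\<And>x. (\<phi> has_derivative f' x) (at x)" "\<And>b. b \<in> Basis \<Longrightarrow> Ck k (\<lambda>x. f' x b)"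
      using test_functions_Ck[OF \<phi>, of "Suc k"] by auto
    then have "frechet_derivative \<phi> (at x) = f' x" for x by (metis frechet_derivative_at)
    then show ?thesis using f'(2)[OF b] by simp
  qed
  then have Ck: "Ck k (\<lambda>x. frechet_derivative \<phi> (at x) z)" for k
    unfolding test_functions_partial_sum[OF \<phi>, of _ z] by (intro Ck_sum Ck_mult Ck_const) auto
  have "frechet_derivative \<phi> (at x) z = 0" if x: "x \<notin> K" for x
  proof -
    have "open (- K)" using K(1) by (simp add: compact_imp_closed open_Compl)
    have "(\<phi> has_derivative (\<lambda>_. 0)) (at x)"
      by (rule has_derivative_transform_within_open[OF _ \<open>open (- K)\<close>, of "\<lambda>_. 0"])
        (use x K(3) in auto)
    then show ?thesis using frechet_derivative_at by metis
  qed
  then show ?thesis using K Ck unfolding test_functions_iff by blast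
qed

lemma test_functions_continuous: "\<phi> \<in> test_functions \<Omega> \<Longrightarrow> continuous_on UNIV \<phi>"
  using test_functions_Ck[of \<phi> \<Omega> 0] by simp

lemma test_functions_measurable [measurable_dest]: "\<phi> \<in> test_functions \<Omega> \<Longrightarrow> \<phi> \<in> borel_measurable borel"
  by (intro borel_measurable_continuous_onI test_functions_continuous)

lemma test_functions_bounded:
  assumes "\<phi> \<in> test_functions \<Omega>"
  obtains K M where "compact K" "K \<subseteq> \<Omega>" "0 \<le> M" "\<And>x. \<bar>\<phi> x\<bar> \<le> M * indicator K x"
proof -
  obtain K where K: "compact K" "K \<subseteq> \<Omega>" "\<And>x. x \<notin> K \<Longrightarrow> \<phi> x = 0"
    using assms by (auto simp: test_functions_iff)
  have "bounded (\<phi> ` K)"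
    using test_functions_continuous[OF assms] K(1)
    by (intro compact_imp_bounded compact_continuous_image) (auto intro: continuous_on_subset)
  then obtain M where M: "\<And>x. x \<in> K \<Longrightarrow> \<bar>\<phi> x\<bar> \<le> M" by (auto simp: bounded_iff)
  have "\<bar>\<phi> x\<bar> \<le> \<bar>M\<bar> * indicator K x" for x
    using M[of x] K(3)[of x] by (auto simp: indicator_def)
  then show thesis using that[of K "\<bar>M\<bar>"] K by auto
qed

lemma square_integrable_indicator_compact:
  "compact K \<Longrightarrow> square_integrable lborel (\<lambda>x. indicator K x :: real)"
proof -
  assume K: "compact K"
  have "integrable lborel (indicator K :: _ \<Rightarrow> real)"
    using K emeasure_compact_finite[OF K] by (intro integrable_real_indicator) (auto intro: borel_compact)
  moreover have "(\<lambda>x. (norm (indicator K x :: real))\<^sup>2) = indicator K" by (auto simp: indicator_def)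
  ultimately show ?thesis using K by (auto simp: square_integrable_def borel_compact)
qed

lemma test_functions_square_integrable:
  assumes "\<phi> \<in> test_functions \<Omega>"
  shows "square_integrable lborel \<phi>"
proof -
  obtain K M where K: "compact K" "K \<subseteq> \<Omega>" "0 \<le> M" "\<And>x. \<bar>\<phi> x\<bar> \<le> M * indicator K x"
    using test_functions_bounded[OF assms] by blast
  show ?thesis
    by (rule square_integrable_dominated[OF square_integrable_indicator_compact[OF K(1)], where C = M])
      (use K test_functions_measurable[OF assms] in auto)
qed

text \<open>A product over coordinates of \<open>exp (- 1 / (j s))\<close>, where \<open>s\<close>
  is the signed distance to a face and \<open>j = k + 1\<close>, cut off at
  \<open>s \<le> 0\<close>. It tends to 1 inside the open box and vanishes outside, so supports
  never leave the closed box.\<close>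

lemma box_indicator_test_functions:
  fixes l r :: "'a::euclidean_space"
  assumes "cbox l r \<subseteq> \<Omega>"
  obtains \<rho> :: "nat \<Rightarrow> 'a \<Rightarrow> real" where "\<And>k. \<rho> k \<in> test_functions \<Omega>"
    "\<And>k x. 0 \<le> \<rho> k x \<and> \<rho> k x \<le> indicator (cbox l r) x"
    "\<And>x. (\<lambda>k. \<rho> k x) \<longlonglongrightarrow> indicator (box l r) x"
proof -
  define \<eta> where "\<eta> = flat 1"
  have \<eta>: "0 \<le> \<eta> t" "\<eta> t \<le> 1" "t \<le> 0 \<Longrightarrow> \<eta> t = 0" for t by (auto simp: \<eta>_def flat_def)
  have \<eta>_lim: "(\<lambda>k. \<eta> (real (Suc k) * s)) \<longlonglongrightarrow> (if s > 0 then 1 else 0)" for s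
  proof (cases "s > 0")
    case True
    have "(\<lambda>k. exp (- (inverse (real (Suc k)) * (1 / s)))) \<longlonglongrightarrow> exp (- (0 * (1 / s)))"
      by (intro tendsto_intros LIMSEQ_inverse_real_of_nat)
    moreover have "\<eta> (real (Suc k) * s) = exp (- (inverse (real (Suc k)) * (1 / s)))" for k
    proof -
      have "0 < real (Suc k) * s" using True by simp
      then show ?thesis unfolding \<eta>_def flat_def by (simp add: inverse_eq_divide del: of_nat_Suc)
    qed
    ultimately show ?thesis using True by simp
  next
    case False
    then have "real (Suc k) * s \<le> 0" for k by (simp add: mult_nonneg_nonpos)
    then have "\<eta> (real (Suc k) * s) = 0" for k by (rule \<eta>(3))
    then show ?thesis using False by simp
  qed
  define \<rho> where "\<rho> = (\<lambda>k x. \<Prod>b\<in>Basis.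
    \<eta> (real (Suc k) * (x \<bullet> b) + (- real (Suc k) * (l \<bullet> b))) * \<eta> (- real (Suc k) * (x \<bullet> b) + real (Suc k) * (r \<bullet> b)))"
  have arg: "real (Suc k) * (x \<bullet> b) + (- real (Suc k) * (l \<bullet> b)) = real (Suc k) * (x \<bullet> b - l \<bullet> b)"
    "- real (Suc k) * (x \<bullet> b) + real (Suc k) * (r \<bullet> b) = real (Suc k) * (r \<bullet> b - x \<bullet> b)" for k x b
    by (simp_all add: algebra_simps)
  have zero: "\<rho> k x = 0" if x: "x \<notin> box l r" for k x
  proof -
    obtain b where b: "b \<in> Basis" "x \<bullet> b \<le> l \<bullet> b \<or> r \<bullet> b \<le> x \<bullet> b"
      using x by (auto simp: mem_box not_less)
    then have "real (Suc k) * (x \<bullet> b - l \<bullet> b) \<le> 0 \<or> real (Suc k) * (r \<bullet> b - x \<bullet> b) \<le> 0"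
      using mult_nonneg_nonpos[of "real (Suc k)" "x \<bullet> b - l \<bullet> b"]
        mult_nonneg_nonpos[of "real (Suc k)" "r \<bullet> b - x \<bullet> b"] by linarith
    then show ?thesis unfolding \<rho>_def arg using b(1) \<eta>(3) by (intro prod_zero) auto
  qed
  have Ck: "Ck k (\<rho> j)" for k j
    unfolding \<rho>_def \<eta>_def by (intro Ck_prod Ck_mult Ck_flat) auto
  have "x \<notin> cbox l r \<Longrightarrow> \<rho> k x = 0" for k x using zero box_subset_cbox by blast
  then have "\<rho> k \<in> test_functions \<Omega>" for k
    unfolding test_functions_iff using Ck assms by (auto intro!: exI[of _ "cbox l r"])
  moreover have "0 \<le> \<rho> k x \<and> \<rho> k x \<le> indicator (cbox l r) x" for k x
  proof (cases "x \<in> box l r")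
    case True
    have "0 \<le> \<rho> k x" unfolding \<rho>_def by (intro prod_nonneg mult_nonneg_nonneg \<eta>)
    moreover have "\<rho> k x \<le> (\<Prod>b\<in>(Basis::'a set). 1)" unfolding \<rho>_def
      by (intro prod_mono conjI mult_nonneg_nonneg mult_le_one \<eta>)
    moreover have "x \<in> cbox l r" using True box_subset_cbox by blast
    ultimately show ?thesis by simp
  qed (simp add: zero)
  moreover have "(\<lambda>k. \<rho> k x) \<longlonglongrightarrow> indicator (box l r) x" for x
  proof -
    have "(\<lambda>k. \<rho> k x) \<longlonglongrightarrow> (\<Prod>b\<in>Basis. (if x \<bullet> b - l \<bullet> b > 0 then 1 else 0) * (if r \<bullet> b - x \<bullet> b > 0 then 1 else 0))"
      unfolding \<rho>_def arg by (intro tendsto_prod tendsto_mult \<eta>_lim)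
    moreover have "(\<Prod>b\<in>Basis. (if x \<bullet> b - l \<bullet> b > 0 then 1 else 0) * (if r \<bullet> b - x \<bullet> b > 0 then 1 else 0))
        = (indicator (box l r) x :: real)"
      by (cases "x \<in> box l r") (auto simp: mem_box intro!: prod.neutral)
    ultimately show ?thesis by simp
  qed
  ultimately show thesis using that by blast
qed

section \<open>Density of test functions\<close>

text \<open>The closure is taken on the whole space, with \<open>e\<close> bounding the square of
  the distance.\<close>

definition L2_closure :: "'a::euclidean_space set \<Rightarrow> ('a \<Rightarrow> real) set" where
  "L2_closure \<Omega> = {f. square_integrable lborel f \<and>
    (\<forall>e>0. \<exists>\<phi>\<in>test_functions \<Omega>. (\<integral>x. (f x - \<phi> x)\<^sup>2 \<partial>lborel) < e)}"

lemma L2_closure_limit: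
  assumes f: "square_integrable lborel f"
    and g: "\<And>k::nat. g k \<in> L2_closure \<Omega>" "(\<lambda>k. \<integral>x. (f x - g k x)\<^sup>2 \<partial>lborel) \<longlonglongrightarrow> 0"
  shows "f \<in> L2_closure \<Omega>"
proof -
  have "\<exists>\<phi>\<in>test_functions \<Omega>. (\<integral>x. (f x - \<phi> x)\<^sup>2 \<partial>lborel) < e" if e: "e > 0" for e
  proof -
    have "\<forall>\<^sub>F k in sequentially. (\<integral>x. (f x - g k x)\<^sup>2 \<partial>lborel) < e / 4"
      using g(2) e by (intro order_tendstoD(2)[where a = "e / 4"]) auto
    then obtain k where k: "(\<integral>x. (f x - g k x)\<^sup>2 \<partial>lborel) < e / 4"
      using eventually_happens by fastforce
    have gk: "square_integrable lborel (g k)" using g(1)[of k] by (simp add: L2_closure_def)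
    have "e / 4 > 0" using e by simp
    then obtain \<phi> where \<phi>: "\<phi> \<in> test_functions \<Omega>" "(\<integral>x. (g k x - \<phi> x)\<^sup>2 \<partial>lborel) < e / 4"
      using g(1)[of k] unfolding L2_closure_def by blast
    have "(\<integral>x. (norm ((f x - g k x) - (\<phi> x - g k x)))\<^sup>2 \<partial>lborel)
        \<le> 2 * (\<integral>x. (norm (f x - g k x))\<^sup>2 \<partial>lborel) + 2 * (\<integral>x. (norm (\<phi> x - g k x))\<^sup>2 \<partial>lborel)"
      by (intro L2_norm_diff_le square_integrable_diff f gk test_functions_square_integrable[OF \<phi>(1)])
    then have "(\<integral>x. (f x - \<phi> x)\<^sup>2 \<partial>lborel) < e"
      using k \<phi>(2) by (simp add: power2_commute[of "\<phi> _"])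
    then show ?thesis using \<phi>(1) by blast
  qed
  then show ?thesis using f by (simp add: L2_closure_def)
qed

lemma test_functions_L2_closure: "\<phi> \<in> test_functions \<Omega> \<Longrightarrow> \<phi> \<in> L2_closure \<Omega>"
  by (auto simp: L2_closure_def test_functions_square_integrable intro!: bexI[of _ \<phi>])

lemma L2_closure_add:
  assumes f: "f \<in> L2_closure \<Omega>" and g: "g \<in> L2_closure \<Omega>"
  shows "(\<lambda>x. f x + r * g x) \<in> L2_closure \<Omega>"
proof -
  have sq: "square_integrable lborel f" "square_integrable lborel g" using f g by (auto simp: L2_closure_def)
  have "\<exists>\<phi>\<in>test_functions \<Omega>. (\<integral>x. (f x + r * g x - \<phi> x)\<^sup>2 \<partial>lborel) < e" if e: "e > 0" for e
  proof -
    have e4: "e / 4 > 0" using e by simp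
    obtain \<phi> where \<phi>: "\<phi> \<in> test_functions \<Omega>" "(\<integral>x. (f x - \<phi> x)\<^sup>2 \<partial>lborel) < e / 4"
      using f e4 unfolding L2_closure_def by blast
    \<comment> \<open>The summand 1 covers \<open>r = 0\<close>.\<close>
    have "e / (4 * (r\<^sup>2 + 1)) > 0" using e by (simp add: add_nonneg_pos)
    then obtain \<xi> where \<xi>: "\<xi> \<in> test_functions \<Omega>" "(\<integral>x. (g x - \<xi> x)\<^sup>2 \<partial>lborel) < e / (4 * (r\<^sup>2 + 1))"
      using g unfolding L2_closure_def by blast
    have s: "square_integrable lborel (\<lambda>x. g x - \<xi> x)" "square_integrable lborel (\<lambda>x. f x - \<phi> x)"
      by (intro square_integrable_diff sq test_functions_square_integrable[OF \<xi>(1)] test_functions_square_integrable[OF \<phi>(1)])+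
    have "(\<integral>x. (norm ((f x - \<phi> x) - (- r) *\<^sub>R (g x - \<xi> x)))\<^sup>2 \<partial>lborel)
        \<le> 2 * (\<integral>x. (norm (f x - \<phi> x))\<^sup>2 \<partial>lborel) + 2 * (\<integral>x. (norm ((- r) *\<^sub>R (g x - \<xi> x)))\<^sup>2 \<partial>lborel)"
      by (intro L2_norm_diff_le square_integrable_scaleR s)
    moreover have "(norm ((f x - \<phi> x) - (- r) *\<^sub>R (g x - \<xi> x)))\<^sup>2 = (f x + r * g x - (\<phi> x + r * \<xi> x))\<^sup>2"
      "(norm ((- r) *\<^sub>R (g x - \<xi> x)))\<^sup>2 = r\<^sup>2 * (g x - \<xi> x)\<^sup>2" for x
      by (simp_all add: algebra_simps power2_eq_square)
    ultimately have "(\<integral>x. (f x + r * g x - (\<phi> x + r * \<xi> x))\<^sup>2 \<partial>lborel)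
        \<le> 2 * (\<integral>x. (f x - \<phi> x)\<^sup>2 \<partial>lborel) + 2 * (r\<^sup>2 * (\<integral>x. (g x - \<xi> x)\<^sup>2 \<partial>lborel))"
      by simp
    moreover have "r\<^sup>2 * (\<integral>x. (g x - \<xi> x)\<^sup>2 \<partial>lborel) \<le> r\<^sup>2 * (e / (4 * (r\<^sup>2 + 1)))"
      using \<xi>(2) by (intro mult_left_mono) auto
    moreover have "r\<^sup>2 * (e / (4 * (r\<^sup>2 + 1))) \<le> e / 4"
    proof -
      have pos: "r\<^sup>2 + 1 > 0" by (simp add: add_nonneg_pos)
      have "r\<^sup>2 * (e / (4 * (r\<^sup>2 + 1))) \<le> (r\<^sup>2 + 1) * (e / (4 * (r\<^sup>2 + 1)))"
        using pos e by (intro mult_right_mono) auto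
      also have "q * (e / (4 * q)) = e / 4" if "q > 0" for q :: real
        using that by (simp add: field_simps)
      then have "(r\<^sup>2 + 1) * (e / (4 * (r\<^sup>2 + 1))) = e / 4" using pos by blast
      finally show ?thesis .
    qed
    ultimately have "(\<integral>x. (f x + r * g x - (\<phi> x + r * \<xi> x))\<^sup>2 \<partial>lborel) < e"
      using \<phi>(2) by linarith
    then show ?thesis using test_functions_add_scaled[OF \<phi>(1) \<xi>(1), of r]
      by (intro bexI[of _ "\<lambda>x. \<phi> x + r * \<xi> x"])
  qed
  then show ?thesis using square_integrable_add[OF sq, of r] by (simp add: L2_closure_def)
qed

text \<open>Dominated convergence. Each enlargement of the class, from boxes to Borel sets, simple
  functions and exhaustions of the domain, is a pointwise limit of this kind.\<close>

lemma L2_closure_dominated: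
  assumes g: "\<And>k::nat. g k \<in> L2_closure \<Omega>" and w: "square_integrable lborel (w :: _ \<Rightarrow> real)"
    and le: "\<And>k x. \<bar>g k x\<bar> \<le> \<bar>w x\<bar>"
    and f: "f \<in> borel_measurable borel" "AE x in lborel. (\<lambda>k. g k x) \<longlonglongrightarrow> f x"
  shows "f \<in> L2_closure \<Omega>"
proof -
  have [measurable]: "g k \<in> borel_measurable borel" for k
    using g[of k] by (simp add: L2_closure_def square_integrable_def)
  note f(1)[measurable]
  have wi: "integrable lborel (\<lambda>x. (w x)\<^sup>2)" using w by (simp add: square_integrable_def)
  have fw: "AE x in lborel. \<bar>f x\<bar> \<le> \<bar>w x\<bar>"
    using f(2) by eventually_elim (rule LIMSEQ_le_const2[OF tendsto_rabs], use le in auto)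
  have fsq: "square_integrable lborel f"
    by (rule square_integrable_dominated[OF w, where C = 1]) (use f fw in auto)
  have "(\<lambda>k. \<integral>x. (f x - g k x)\<^sup>2 \<partial>lborel) \<longlonglongrightarrow> (\<integral>x. 0 \<partial>(lborel :: 'a measure))"
  proof (rule integral_dominated_convergence)
    show "integrable lborel (\<lambda>x. 4 * (w x)\<^sup>2)" using wi by simp
    show "AE x in lborel. (\<lambda>k. (f x - g k x)\<^sup>2) \<longlonglongrightarrow> 0"
      using f(2)
    proof eventually_elim
      case (elim x)
      have "(\<lambda>k. (f x - g k x)\<^sup>2) \<longlonglongrightarrow> (f x - f x)\<^sup>2" by (intro tendsto_intros elim)
      then show ?case by simp
    qed
    show "AE x in lborel. norm ((f x - g k x)\<^sup>2) \<le> 4 * (w x)\<^sup>2" for k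
      using fw
    proof eventually_elim
      case (elim x)
      have "\<bar>f x - g k x\<bar> \<le> 2 * \<bar>w x\<bar>" using elim le[of k x] by linarith
      then have "\<bar>f x - g k x\<bar>\<^sup>2 \<le> (2 * \<bar>w x\<bar>)\<^sup>2" by (intro power_mono) auto
      then show ?case by (simp add: power_mult_distrib)
    qed
  qed auto
  then show ?thesis by (intro L2_closure_limit[OF fsq g]) simp
qed

lemma L2_closure_sum:
  "finite F \<Longrightarrow> (\<And>i. i \<in> F \<Longrightarrow> f i \<in> L2_closure \<Omega>) \<Longrightarrow> (\<lambda>x. \<Sum>i\<in>F. r i * f i x) \<in> L2_closure \<Omega>"
proof (induction F rule: finite_induct)
  case empty
  then show ?case by (simp add: test_functions_L2_closure test_functions_zero)
next
  case (insert i F)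
  then show ?case using L2_closure_add[of "\<lambda>x. \<Sum>i\<in>F. r i * f i x" \<Omega> "f i" "r i"]
    by (simp add: add.commute)
qed

lemma AE_cbox_iff_box: "AE x in lborel. x \<in> cbox l r \<longleftrightarrow> x \<in> box l r"
proof -
  have "cbox l r - box l r \<in> null_sets lborel"
    using negligible_frontier_interval[of l r] null_sets_completion_iff[of "cbox l r - box l r" lborel]
    by (simp add: negligible_iff_null_sets)
  then have "AE x in lborel. x \<notin> cbox l r - box l r" by (rule AE_not_in)
  then show ?thesis by eventually_elim (use box_subset_cbox in auto)
qed

text \<open>Dynkin's argument: open boxes form a generator stable under intersection, and
  complements and disjoint unions stay in the closure. Cutting with one fixed closed box keeps
  everything inside the domain and below one square-integrable function.\<close>

lemma L2_closure_indicator: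
  fixes l r :: "'a::euclidean_space"
  assumes sub: "cbox l r \<subseteq> \<Omega>" and A: "A \<in> sets borel"
  shows "(\<lambda>x. indicator (A \<inter> cbox l r) x :: real) \<in> L2_closure \<Omega>"
proof -
  have w: "square_integrable lborel (\<lambda>x. indicator (cbox l r) x :: real)"
    by (simp add: square_integrable_indicator_compact)
  let ?G = "range (\<lambda>(a, b). box a b :: 'a set)"
  have on_box: "(\<lambda>x. indicator (box a b \<inter> cbox l r) x :: real) \<in> L2_closure \<Omega>" for a b
  proof -
    define c where "c = (\<Sum>i\<in>Basis. max (a \<bullet> i) (l \<bullet> i) *\<^sub>R i)"
    define d where "d = (\<Sum>i\<in>Basis. min (b \<bullet> i) (r \<bullet> i) *\<^sub>R i)"
    have cd: "box a b \<inter> box l r = box c d" by (simp add: box_Int_box c_def d_def)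
    have cdl: "cbox c d \<subseteq> cbox l r" by (auto simp: mem_box c_def d_def)
    obtain \<rho> :: "nat \<Rightarrow> 'a \<Rightarrow> real" where \<rho>: "\<And>k. \<rho> k \<in> test_functions \<Omega>"
      "\<And>k x. 0 \<le> \<rho> k x \<and> \<rho> k x \<le> indicator (cbox c d) x"
      "\<And>x. (\<lambda>k. \<rho> k x) \<longlonglongrightarrow> indicator (box c d) x"
      using box_indicator_test_functions[of c d \<Omega>] cdl sub by blast
    show ?thesis
    proof (rule L2_closure_dominated[OF test_functions_L2_closure[OF \<rho>(1)] w])
      show "\<bar>\<rho> k x\<bar> \<le> \<bar>indicator (cbox l r) x\<bar>" for k x
      proof -
        have "indicator (cbox c d) x \<le> (indicator (cbox l r) x :: real)"
          using cdl by (auto simp: indicator_def)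
        then show ?thesis using \<rho>(2)[of k x] by simp
      qed
      show "AE x in lborel. (\<lambda>k. \<rho> k x) \<longlonglongrightarrow> indicator (box a b \<inter> cbox l r) x"
        using AE_cbox_iff_box[of l r]
      proof eventually_elim
        case (elim x)
        then have "indicator (box a b \<inter> cbox l r) x = (indicator (box c d) x :: real)"
          using cd by (auto simp: indicator_def)
        then show ?case using \<rho>(3)[of x] by simp
      qed
    qed simp
  qed
  have all: "(\<lambda>x. indicator (cbox l r) x :: real) \<in> L2_closure \<Omega>"
  proof (rule L2_closure_dominated[where g = "\<lambda>k x. indicator (box l r \<inter> cbox l r) x", OF on_box w])
    show "AE x in lborel. (\<lambda>k. indicator (box l r \<inter> cbox l r) x) \<longlonglongrightarrow> (indicator (cbox l r) x :: real)"
      using AE_cbox_iff_box[of l r] by eventually_elim (auto simp: indicator_def)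
  qed (auto simp: indicator_def)
  have "Int_stable ?G" by (auto simp: Int_stable_def box_Int_box)
  moreover have "?G \<subseteq> Pow UNIV" by simp
  moreover have "A \<in> sigma_sets UNIV ?G" using A by (subst (asm) borel_eq_box) simp
  ultimately show ?thesis
  proof (induction rule: sigma_sets_induct_disjoint)
    case (basic A)
    then show ?case using on_box by auto
  next
    case empty
    then show ?case using test_functions_L2_closure[OF test_functions_zero] by simp
  next
    case (compl A)
    have "(\<lambda>x. indicator (cbox l r) x + (-1) * indicator (A \<inter> cbox l r) x :: real) \<in> L2_closure \<Omega>"
      by (rule L2_closure_add[OF all compl.IH])
    moreover have "indicator (cbox l r) x + (-1) * indicator (A \<inter> cbox l r) x
        = (indicator ((UNIV - A) \<inter> cbox l r) x :: real)" for x by (auto simp: indicator_def)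
    ultimately show ?case by simp
  next
    case (union A)
    have borel: "A i \<in> sets borel" for i using union by (subst borel_eq_box) auto
    have "(\<lambda>x. indicator ((\<Union>i<k. A i) \<inter> cbox l r) x :: real) \<in> L2_closure \<Omega>" for k
    proof -
      have "indicator ((\<Union>i<k. A i) \<inter> cbox l r) x = (\<Sum>i<k. 1 * indicator (A i \<inter> cbox l r) x :: real)" for x
      proof -
        have "(\<Union>i<k. A i) \<inter> cbox l r = (\<Union>i<k. A i \<inter> cbox l r)" by auto
        moreover have "disjoint_family_on (\<lambda>i. A i \<inter> cbox l r) {..<k}"
          using union.hyps(1) by (auto simp: disjoint_family_on_def)
        ultimately show ?thesis by (simp only: mult_1 indicator_UN_disjoint[OF finite_lessThan])
      qed
      then show ?thesis using L2_closure_sum[of "{..<k}" "\<lambda>i x. indicator (A i \<inter> cbox l r) x" \<Omega> "\<lambda>_. 1"] union.IH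
        by simp
    qed
    then show ?case
    proof (rule L2_closure_dominated[OF _ w])
      have "\<forall>\<^sub>F k in sequentially. indicator ((\<Union>i<k. A i) \<inter> cbox l r) x
          = (indicator ((\<Union>i. A i) \<inter> cbox l r) x :: real)" for x
      proof (cases "x \<in> (\<Union>i. A i)")
        case True
        then obtain i where "x \<in> A i" by blast
        show ?thesis using eventually_gt_at_top[of i]
          by (rule eventually_mono) (use \<open>x \<in> A i\<close> in \<open>auto simp: indicator_def\<close>)
      qed (auto simp: indicator_def)
      then show "AE x in lborel. (\<lambda>k. indicator ((\<Union>i<k. A i) \<inter> cbox l r) x)
          \<longlonglongrightarrow> (indicator (\<Union> (range A) \<inter> cbox l r) x :: real)"
        by (auto intro: tendsto_eventually)
    qed (use borel in \<open>auto simp: indicator_def\<close>)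
  qed
qed

text \<open>On a closed box inside the domain simple functions suffice, as their level sets are
  Borel. A countable cover of the domain by such boxes, made disjoint, reduces the general case to
  that one.\<close>

theorem test_functions_dense:
  fixes f :: "'a::euclidean_space \<Rightarrow> real"
  assumes \<Omega>: "open \<Omega>" and f: "square_integrable lborel f" "\<And>x. x \<notin> \<Omega> \<Longrightarrow> f x = 0"
  shows "f \<in> L2_closure \<Omega>"
proof -
  have on_box: "g \<in> L2_closure \<Omega>"
    if lr: "cbox l r \<subseteq> \<Omega>" and g: "square_integrable lborel g" "\<And>x. x \<notin> cbox l r \<Longrightarrow> g x = 0"
    for l r and g :: "'a \<Rightarrow> real"
  proof -
    have gm: "g \<in> borel_measurable lborel" using g by (simp add: square_integrable_def)
    obtain s where s: "\<And>i. simple_function lborel (s i)" "\<And>x. (\<lambda>i. s i x) \<longlonglongrightarrow> g x"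
      "\<And>i x. \<bar>s i x\<bar> \<le> 2 * \<bar>g x\<bar>"
      using borel_measurable_implies_sequence_metric[OF gm, of 0] by (auto simp: dist_real_def)
    have "s i \<in> L2_closure \<Omega>" for i
    proof -
      have fin: "finite (range (s i))" using simple_functionD(1)[OF s(1), of i] by simp
      have "s i -` {y} \<in> sets borel" for y using simple_functionD(2)[OF s(1), of i "{y}"] by simp
      then have "(\<lambda>x. \<Sum>y\<in>range (s i). y * indicator (s i -` {y} \<inter> cbox l r) x) \<in> L2_closure \<Omega>"
        by (intro L2_closure_sum fin L2_closure_indicator[OF lr])
      moreover have "(\<Sum>y\<in>range (s i). y * indicator (s i -` {y} \<inter> cbox l r) x) = s i x" for x
      proof (cases "x \<in> cbox l r")
        case True
        then have "(\<Sum>y\<in>range (s i). y * indicator (s i -` {y} \<inter> cbox l r) x)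
            = (\<Sum>y\<in>range (s i). if y = s i x then y else 0)"
          by (intro sum.cong) (auto simp: indicator_def)
        then show ?thesis using fin by simp
      next
        case False
        then show ?thesis using s(3)[of i x] g(2)[of x] by simp
      qed
      ultimately show ?thesis by simp
    qed
    then show ?thesis
      by (rule L2_closure_dominated[where w = "\<lambda>x. 2 * g x" and g = s])
        (use s gm square_integrable_scaleR[OF g(1), of 2] in \<open>auto simp: abs_mult\<close>)
  qed
  obtain \<D> where \<D>: "countable \<D>" "\<D> \<subseteq> Pow \<Omega>" "\<And>X. X \<in> \<D> \<Longrightarrow> \<exists>a b. X = cbox a b" "\<Union>\<D> = \<Omega>"
    using open_countable_Union_open_cbox[OF \<Omega>] by metis
  show ?thesis
  proof (cases "\<D> = {}")
    case True
    then have "f = (\<lambda>_. 0)" using f(2) \<D>(4) by auto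
    then show ?thesis using test_functions_L2_closure[OF test_functions_zero] by simp
  next
    case False
    define X where "X = from_nat_into \<D>"
    have X: "X i \<in> \<D>" for i using False by (simp add: X_def from_nat_into)
    have UX: "(\<Union>i. X i) = \<Omega>" using \<D>(4) range_from_nat_into[OF False \<D>(1)] by (simp add: X_def)
    have [measurable]: "X i \<in> sets borel" for i using \<D>(3)[OF X[of i]] by auto
    have fm [measurable]: "f \<in> borel_measurable borel" using f by (simp add: square_integrable_def)
    have restrict: "square_integrable lborel (\<lambda>x. indicator A x * f x)" if [measurable]: "A \<in> sets borel" for A
      by (rule square_integrable_dominated[OF f(1), where C = 1]) (auto simp: indicator_def)
    have "(\<lambda>x. indicator (\<Union>i<k. X i) x * f x) \<in> L2_closure \<Omega>" for k
    proof (induction k)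
      case 0
      then show ?case using test_functions_L2_closure[OF test_functions_zero] by simp
    next
      case (Suc k)
      obtain a b where ab: "X k = cbox a b" using \<D>(3)[OF X[of k]] by blast
      have "(\<lambda>x. indicator (X k - (\<Union>i<k. X i)) x * f x) \<in> L2_closure \<Omega>"
      proof (rule on_box[of a b])
        show "cbox a b \<subseteq> \<Omega>" using X[of k] \<D>(2) ab by auto
        show "square_integrable lborel (\<lambda>x. indicator (X k - (\<Union>i<k. X i)) x * f x)"
          by (rule restrict) measurable
      qed (use ab in \<open>auto simp: indicator_def\<close>)
      from L2_closure_add[OF Suc this, of 1]
      have "(\<lambda>x. indicator (\<Union>i<k. X i) x * f x + indicator (X k - (\<Union>i<k. X i)) x * f x) \<in> L2_closure \<Omega>"
        by simp
      moreover have "indicator (\<Union>i<k. X i) x * f x + indicator (X k - (\<Union>i<k. X i)) x * f x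
          = indicator (\<Union>i<Suc k. X i) x * f x" for x
        by (auto simp: indicator_def less_Suc_eq)
      ultimately show ?case by simp
    qed
    then show ?thesis
    proof (rule L2_closure_dominated[OF _ f(1)])
      show "AE x in lborel. (\<lambda>k. indicator (\<Union>i<k. X i) x * f x) \<longlonglongrightarrow> f x"
      proof (rule AE_I2)
        fix x
        show "(\<lambda>k. indicator (\<Union>i<k. X i) x * f x) \<longlonglongrightarrow> f x"
        proof (cases "x \<in> \<Omega>")
          case True
          then obtain i where "x \<in> X i" using UX by blast
          have "\<forall>\<^sub>F k in sequentially. indicator (\<Union>i<k. X i) x * f x = f x"
            using eventually_gt_at_top[of i]
            by (rule eventually_mono) (use \<open>x \<in> X i\<close> in \<open>auto simp: indicator_def\<close>)
          then show ?thesis by (rule tendsto_eventually)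
        qed (use f(2) in auto)
      qed
    qed (auto simp: indicator_def)
  qed
qed

section \<open>Translations and cell averages\<close>

lemma lborel_integral_translate:
  fixes f :: "'a::euclidean_space \<Rightarrow> real"
  assumes "f \<in> borel_measurable borel"
  shows "(\<integral>x. f (x + c) \<partial>lborel) = (\<integral>x. f x \<partial>lborel)"
proof -
  have "(\<integral>x. f x \<partial>lborel) = (\<integral>x. f x \<partial>distr lborel borel ((+) c))" by (simp add: lborel_distr_plus)
  also have "\<dots> = (\<integral>x. f (c + x) \<partial>lborel)" by (rule integral_distr) (use assms in auto)
  finally show ?thesis by (simp add: add.commute)
qed

lemma lborel_integrable_translate:
  fixes f :: "'a::euclidean_space \<Rightarrow> real"
  assumes "integrable lborel f"
  shows "integrable lborel (\<lambda>x. f (x + c))"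
proof -
  have "integrable (distr lborel borel ((+) c)) f" using assms by (simp add: lborel_distr_plus)
  then have "integrable lborel (\<lambda>x. f (c + x))" by (subst (asm) integrable_distr_eq) (use assms in auto)
  then show ?thesis by (simp add: add.commute)
qed

lemma lborel_nn_integral_translate:
  fixes f :: "'a::euclidean_space \<Rightarrow> ennreal"
  assumes "f \<in> borel_measurable borel"
  shows "(\<integral>\<^sup>+x. f (x + c) \<partial>lborel) = (\<integral>\<^sup>+x. f x \<partial>lborel)"
proof -
  have "(\<integral>\<^sup>+x. f x \<partial>lborel) = (\<integral>\<^sup>+x. f x \<partial>distr lborel borel ((+) c))" by (simp add: lborel_distr_plus)
  also have "\<dots> = (\<integral>\<^sup>+x. f (c + x) \<partial>lborel)" by (rule nn_integral_distr) (use assms in auto)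
  finally show ?thesis by (simp add: add.commute)
qed

lemma square_integrable_translate:
  fixes f :: "'a::euclidean_space \<Rightarrow> real"
  assumes "square_integrable lborel f"
  shows "square_integrable lborel (\<lambda>x. f (x + c))"
  using assms lborel_integrable_translate[of "\<lambda>x. (f x)\<^sup>2" c] by (auto simp: square_integrable_def)

lemma test_functions_deriv_line:
  assumes "\<phi> \<in> test_functions \<Omega>"
  shows "((\<lambda>t. \<phi> (x + t *\<^sub>R z)) has_real_derivative frechet_derivative \<phi> (at (x + t *\<^sub>R z)) z) (at t)"
proof -
  have "((\<lambda>t. x + t *\<^sub>R z) has_derivative (\<lambda>h. h *\<^sub>R z)) (at t)"
    by (auto intro!: derivative_eq_intros)
  from has_derivative_compose[OF this test_functions_has_derivative[OF assms]]
  have "((\<lambda>t. \<phi> (x + t *\<^sub>R z)) has_derivative (\<lambda>h. frechet_derivative \<phi> (at (x + t *\<^sub>R z)) (h *\<^sub>R z))) (at t)" .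
  moreover have "(\<lambda>h. frechet_derivative \<phi> (at y) (h *\<^sub>R z)) = (*) (frechet_derivative \<phi> (at y) z)" for y
    by (rule ext, subst linear_scale[OF has_derivative_linear[OF test_functions_has_derivative[OF assms]]])
      simp
  ultimately show ?thesis by (simp only: has_field_derivative_def)
qed

text \<open>Dominated convergence along sequences: the mean value theorem bounds the difference
  quotients of \<open>\<phi>\<close>, and all translates involved are supported in one compact set.
  Asking only for local integrability of \<open>u\<close> admits the constant 1.\<close>

lemma deriv_under_integral:
  fixes u :: "'a::euclidean_space \<Rightarrow> real"
  assumes u: "u \<in> borel_measurable borel"
    and loc: "\<And>K. compact K \<Longrightarrow> integrable lborel (\<lambda>x. indicator K x * u x)"
    and \<phi>: "\<phi> \<in> test_functions UNIV"
  shows "((\<lambda>t. \<integral>x. u x * \<phi> (x + t *\<^sub>R z) \<partial>lborel) has_real_derivative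
    (\<integral>x. u x * frechet_derivative \<phi> (at (x + t *\<^sub>R z)) z \<partial>lborel)) (at t)"
proof -
  let ?D = "\<lambda>x. frechet_derivative \<phi> (at x) z"
  obtain K1 M where K1: "compact K1" "0 \<le> M" "\<And>x. \<bar>?D x\<bar> \<le> M * indicator K1 x"
    by (rule test_functions_bounded[OF test_functions_deriv[OF \<phi>, of z]]) (rule that; assumption)
  obtain K0 M0 where K0: "compact K0" "0 \<le> M0" "\<And>x. \<bar>\<phi> x\<bar> \<le> M0 * indicator K0 x"
    by (rule test_functions_bounded[OF \<phi>]) (rule that; assumption)
  have [measurable]: "\<phi> \<in> borel_measurable borel" "?D \<in> borel_measurable borel"
    by (rule test_functions_measurable[OF \<phi>] test_functions_measurable[OF test_functions_deriv[OF \<phi>]])+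
  note u[measurable]
  have DM: "\<bar>?D x\<bar> \<le> M" for x
    using K1(3)[of x] K1(2) by (cases "x \<in> K1") auto
  have int: "integrable lborel (\<lambda>x. u x * \<phi> (x + s *\<^sub>R z))" for s
  proof (rule Bochner_Integration.integrable_bound)
    have "compact ((\<lambda>y. y - s *\<^sub>R z) ` K0)" using K0(1) by (rule compact_translation_subtract)
    then show "integrable lborel (\<lambda>x. M0 * (indicator ((\<lambda>y. y - s *\<^sub>R z) ` K0) x * u x))"
      using loc by simp
    show "AE x in lborel. norm (u x * \<phi> (x + s *\<^sub>R z)) \<le> norm (M0 * (indicator ((\<lambda>y. y - s *\<^sub>R z) ` K0) x * u x))"
    proof (rule AE_I2)
      fix x
      have "\<bar>\<phi> (x + s *\<^sub>R z)\<bar> \<le> M0 * indicator ((\<lambda>y. y - s *\<^sub>R z) ` K0) x"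
        using K0(3)[of "x + s *\<^sub>R z"] by (force simp: indicator_def image_iff algebra_simps split: if_splits)
      then have "\<bar>u x\<bar> * \<bar>\<phi> (x + s *\<^sub>R z)\<bar> \<le> \<bar>u x\<bar> * (M0 * indicator ((\<lambda>y. y - s *\<^sub>R z) ` K0) x)"
        by (rule mult_left_mono) simp
      then show "norm (u x * \<phi> (x + s *\<^sub>R z)) \<le> norm (M0 * (indicator ((\<lambda>y. y - s *\<^sub>R z) ` K0) x * u x))"
        using K0(2) by (simp add: abs_mult mult_ac)
    qed
  qed measurable
  have "(\<lambda>n. ((\<integral>x. u x * \<phi> (x + (t + S n) *\<^sub>R z) \<partial>lborel) - (\<integral>x. u x * \<phi> (x + t *\<^sub>R z) \<partial>lborel)) / S n)
      \<longlonglongrightarrow> (\<integral>x. u x * ?D (x + t *\<^sub>R z) \<partial>lborel)"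
    if S: "\<And>n. S n \<noteq> 0" "S \<longlonglongrightarrow> 0" for S
  proof -
    obtain R where R: "\<And>n. \<bar>S n\<bar> \<le> R" using convergent_imp_Bseq[of S] S(2) by (auto simp: convergent_def Bseq_def)
    \<comment> \<open>All points that some translation parameter within distance \<open>R\<close> of
      \<open>t\<close> carries into the support; compact as a continuous image of a product.\<close>
    define K where "K = (\<lambda>(y, s). y - s *\<^sub>R z) ` (K0 \<times> {t - R..t + R})"
    have K: "compact K" unfolding K_def
      by (intro compact_continuous_image compact_Times K0 compact_Icc)
        (auto intro!: continuous_intros simp: case_prod_unfold)
    have supp: "\<phi> (x + s *\<^sub>R z) = 0" if "x \<notin> K" "\<bar>s - t\<bar> \<le> R" for x s
    proof -
      have "s \<in> {t - R..t + R}" using that(2) by (auto simp: abs_le_iff)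
      then have "x + s *\<^sub>R z \<notin> K0" using that(1)
        by (force simp: K_def image_iff algebra_simps)
      then show ?thesis using K0(3)[of "x + s *\<^sub>R z"] by simp
    qed
    have R0: "0 \<le> R" using R[of 0] by linarith
    have "(\<lambda>n. \<integral>x. u x * ((\<phi> (x + (t + S n) *\<^sub>R z) - \<phi> (x + t *\<^sub>R z)) / S n) \<partial>lborel)
        \<longlonglongrightarrow> (\<integral>x. u x * ?D (x + t *\<^sub>R z) \<partial>lborel)"
    proof (rule integral_dominated_convergence)
      show "integrable lborel (\<lambda>x. M * \<bar>indicator K x * u x\<bar>)"
        using loc[OF K] by (intro integrable_mult_right integrable_abs)
      show "AE x in lborel. (\<lambda>n. u x * ((\<phi> (x + (t + S n) *\<^sub>R z) - \<phi> (x + t *\<^sub>R z)) / S n))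
          \<longlonglongrightarrow> u x * ?D (x + t *\<^sub>R z)"
      proof (rule AE_I2, rule tendsto_mult_left)
        fix x
        have "(\<lambda>h. (\<phi> (x + (t + h) *\<^sub>R z) - \<phi> (x + t *\<^sub>R z)) / h) \<midarrow>0\<rightarrow> ?D (x + t *\<^sub>R z)"
          using test_functions_deriv_line[OF \<phi>, of x z t] by (simp add: DERIV_def)
        then show "(\<lambda>n. (\<phi> (x + (t + S n) *\<^sub>R z) - \<phi> (x + t *\<^sub>R z)) / S n) \<longlonglongrightarrow> ?D (x + t *\<^sub>R z)"
          using S unfolding LIMSEQ_SEQ_conv[symmetric] by blast
      qed
      show "AE x in lborel. norm (u x * ((\<phi> (x + (t + S n) *\<^sub>R z) - \<phi> (x + t *\<^sub>R z)) / S n))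
          \<le> M * \<bar>indicator K x * u x\<bar>" for n
      proof (rule AE_I2)
        fix x
        have "\<bar>\<phi> (x + (t + S n) *\<^sub>R z) - \<phi> (x + t *\<^sub>R z)\<bar> \<le> M * indicator K x * \<bar>S n\<bar>"
        proof (cases "x \<in> K")
          case True
          have "norm (\<phi> (x + (t + S n) *\<^sub>R z) - \<phi> (x + t *\<^sub>R z)) \<le> M * norm ((t + S n) - t)"
            by (rule field_differentiable_bound[where S = UNIV and f = "\<lambda>s. \<phi> (x + s *\<^sub>R z)"])
              (use test_functions_deriv_line[OF \<phi>] DM in auto)
          then show ?thesis using True by simp
        next
          case False
          then show ?thesis using supp[OF False, of "t + S n"] supp[OF False, of t] R[of n] R0 by simp
        qed
        then have "\<bar>(\<phi> (x + (t + S n) *\<^sub>R z) - \<phi> (x + t *\<^sub>R z)) / S n\<bar> \<le> M * indicator K x"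
          using S(1)[of n] by (simp add: field_simps)
        then have "\<bar>u x\<bar> * \<bar>(\<phi> (x + (t + S n) *\<^sub>R z) - \<phi> (x + t *\<^sub>R z)) / S n\<bar> \<le> \<bar>u x\<bar> * (M * indicator K x)"
          by (rule mult_left_mono) simp
        then show "norm (u x * ((\<phi> (x + (t + S n) *\<^sub>R z) - \<phi> (x + t *\<^sub>R z)) / S n))
            \<le> M * \<bar>indicator K x * u x\<bar>"
          by (simp add: abs_mult mult_ac)
      qed
    qed measurable
    moreover have "(\<integral>x. u x * ((\<phi> (x + (t + S n) *\<^sub>R z) - \<phi> (x + t *\<^sub>R z)) / S n) \<partial>lborel)
        = ((\<integral>x. u x * \<phi> (x + (t + S n) *\<^sub>R z) \<partial>lborel) - (\<integral>x. u x * \<phi> (x + t *\<^sub>R z) \<partial>lborel)) / S n" for n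
    proof -
      have "(\<integral>x. u x * ((\<phi> (x + (t + S n) *\<^sub>R z) - \<phi> (x + t *\<^sub>R z)) / S n) \<partial>lborel)
          = (\<integral>x. (u x * \<phi> (x + (t + S n) *\<^sub>R z) - u x * \<phi> (x + t *\<^sub>R z)) / S n \<partial>lborel)"
        by (simp only: times_divide_eq_right right_diff_distrib)
      also have "\<dots> = (\<integral>x. u x * \<phi> (x + (t + S n) *\<^sub>R z) - u x * \<phi> (x + t *\<^sub>R z) \<partial>lborel) / S n"
        by (rule integral_divide_zero)
      also have "(\<integral>x. u x * \<phi> (x + (t + S n) *\<^sub>R z) - u x * \<phi> (x + t *\<^sub>R z) \<partial>lborel)
          = (\<integral>x. u x * \<phi> (x + (t + S n) *\<^sub>R z) \<partial>lborel) - (\<integral>x. u x * \<phi> (x + t *\<^sub>R z) \<partial>lborel)"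
        by (rule Bochner_Integration.integral_diff[OF int int])
      finally show ?thesis .
    qed
    ultimately show ?thesis by (simp only:)
  qed
  then show ?thesis unfolding DERIV_def LIMSEQ_SEQ_conv[symmetric] by blast
qed

text \<open>The integral of a translate does not depend on the translation, so its derivative in the
  parameter is 0; applied to a product of two functions this gives integration by parts.\<close>

lemma integral_test_derivative:
  assumes \<phi>: "\<phi> \<in> test_functions UNIV"
  shows "(\<integral>x. frechet_derivative \<phi> (at x) z \<partial>lborel) = 0"
proof -
  have "((\<lambda>t. \<integral>x. 1 * \<phi> (x + t *\<^sub>R z) \<partial>lborel) has_real_derivative
      (\<integral>x. 1 * frechet_derivative \<phi> (at (x + 0 *\<^sub>R z)) z \<partial>lborel)) (at 0)"
    by (intro deriv_under_integral \<phi>)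
      (auto intro!: integrable_real_indicator borel_compact
        simp: emeasure_compact_finite[unfolded infinity_ennreal_def])
  moreover have "(\<integral>x. 1 * \<phi> (x + t *\<^sub>R z) \<partial>lborel) = (\<integral>x. \<phi> x \<partial>lborel)" for t
    using lborel_integral_translate[OF test_functions_measurable[OF \<phi>], of "t *\<^sub>R z"] by simp
  ultimately have "((\<lambda>t. \<integral>x. \<phi> x \<partial>lborel) has_real_derivative (\<integral>x. frechet_derivative \<phi> (at x) z \<partial>lborel)) (at 0)"
    by simp
  then show ?thesis using DERIV_unique[OF _ DERIV_const] by blast
qed

lemma test_integration_by_parts:
  assumes \<phi>: "\<phi> \<in> test_functions \<Omega>" and \<xi>: "\<xi> \<in> test_functions \<Omega>'"
  shows "(\<integral>x. \<phi> x * frechet_derivative \<xi> (at x) z \<partial>lborel) = - (\<integral>x. frechet_derivative \<phi> (at x) z * \<xi> x \<partial>lborel)"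
proof -
  have prod: "(\<lambda>x. \<phi> x * \<xi> x) \<in> test_functions UNIV"
    using test_functions_mult[OF \<phi> test_functions_Ck[OF \<xi>]] by (rule test_functions_mono) simp
  have "frechet_derivative (\<lambda>x. \<phi> x * \<xi> x) (at x) z
      = \<phi> x * frechet_derivative \<xi> (at x) z + frechet_derivative \<phi> (at x) z * \<xi> x" for x
    using frechet_derivative_at[OF has_derivative_mult[OF test_functions_has_derivative[OF \<phi>, of x]
        test_functions_has_derivative[OF \<xi>, of x]], symmetric] by simp
  then have "(\<integral>x. \<phi> x * frechet_derivative \<xi> (at x) z + frechet_derivative \<phi> (at x) z * \<xi> x \<partial>lborel) = 0"
    using integral_test_derivative[OF prod, of z] by simp
  moreover have "integrable lborel (\<lambda>x. \<phi> x * frechet_derivative \<xi> (at x) z)"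
    "integrable lborel (\<lambda>x. frechet_derivative \<phi> (at x) z * \<xi> x)"
    by (intro square_integrable_mult test_functions_square_integrable[OF \<phi>] test_functions_square_integrable[OF \<xi>]
      test_functions_square_integrable[OF test_functions_deriv[OF \<phi>]]
      test_functions_square_integrable[OF test_functions_deriv[OF \<xi>]])+
  ultimately show ?thesis by simp
qed

text \<open>The weak derivative is only tested against smooth functions, so the difference quotient is
  estimated by duality: \<open>t \<mapsto> \<integral> u(x) \<phi>(x - t z) dx\<close> has derivative \<open>\<integral> (g(x) \<bullet> z) \<phi>(x - t z) dx\<close>.\<close>
lemma translation_estimate:
  fixes u :: "'a::euclidean_space \<Rightarrow> real" and g :: "'a \<Rightarrow> 'a"
  assumes u: "square_integrable lborel u" and g: "square_integrable lborel g"
    and weak: "\<And>\<phi> b. \<phi> \<in> test_functions UNIV \<Longrightarrow> b \<in> Basis \<Longrightarrow>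
      (\<integral>x. u x * frechet_derivative \<phi> (at x) b \<partial>lborel) = - (\<integral>x. (g x \<bullet> b) * \<phi> x \<partial>lborel)"
  shows "(\<integral>x. (u (x + z) - u x)\<^sup>2 \<partial>lborel) \<le> (norm z)\<^sup>2 * (\<integral>x. (norm (g x))\<^sup>2 \<partial>lborel)"
proof -
  define G where "G = (norm z)\<^sup>2 * (\<integral>x. (norm (g x))\<^sup>2 \<partial>lborel)"
  have um[measurable]: "u \<in> borel_measurable borel" using u by (simp add: square_integrable_def)
  have weak_z: "(\<integral>x. u x * frechet_derivative \<phi> (at x) y \<partial>lborel) = - (\<integral>x. (g x \<bullet> y) * \<phi> x \<partial>lborel)"
    if \<phi>: "\<phi> \<in> test_functions UNIV" for \<phi> y
  proof -
    have i1: "integrable lborel (\<lambda>x. u x * frechet_derivative \<phi> (at x) b)" for b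
      by (intro square_integrable_mult u test_functions_square_integrable[OF test_functions_deriv[OF \<phi>]])
    have i2: "integrable lborel (\<lambda>x. (g x \<bullet> b) * \<phi> x)" for b
      by (intro square_integrable_mult square_integrable_inner_const g test_functions_square_integrable[OF \<phi>])
    have "(\<integral>x. u x * frechet_derivative \<phi> (at x) y \<partial>lborel)
        = (\<integral>x. (\<Sum>b\<in>Basis. (y \<bullet> b) * (u x * frechet_derivative \<phi> (at x) b)) \<partial>lborel)"
      by (subst test_functions_partial_sum[OF \<phi>]) (simp add: sum_distrib_left mult_ac)
    also have "\<dots> = (\<Sum>b\<in>Basis. (y \<bullet> b) * (\<integral>x. u x * frechet_derivative \<phi> (at x) b \<partial>lborel))"
      using i1 by (subst Bochner_Integration.integral_sum) auto
    also have "\<dots> = (\<Sum>b\<in>Basis. (y \<bullet> b) * - (\<integral>x. (g x \<bullet> b) * \<phi> x \<partial>lborel))"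
      by (intro sum.cong refl) (simp add: weak[OF \<phi>])
    also have "\<dots> = - (\<integral>x. (\<Sum>b\<in>Basis. (y \<bullet> b) * ((g x \<bullet> b) * \<phi> x)) \<partial>lborel)"
      using i2 by (subst Bochner_Integration.integral_sum) (auto simp: sum_negf)
    also have "(\<lambda>x. \<Sum>b\<in>Basis. (y \<bullet> b) * ((g x \<bullet> b) * \<phi> x)) = (\<lambda>x. (g x \<bullet> y) * \<phi> x)"
      by (subst (2) euclidean_inner) (simp add: sum_distrib_left sum_distrib_right mult_ac)
    finally show ?thesis .
  qed
  define w where "w = (\<lambda>x. u (x + z) - u x)"
  have w: "square_integrable lborel w" unfolding w_def
    by (intro square_integrable_diff square_integrable_translate u)
  have w_test: "(\<integral>x. w x * \<phi> x \<partial>lborel)\<^sup>2 \<le> G * (\<integral>x. (\<phi> x)\<^sup>2 \<partial>lborel)" if \<phi>: "\<phi> \<in> test_functions UNIV" for \<phi>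
  proof -
    note [measurable] = test_functions_measurable[OF \<phi>]
    have \<phi>sq: "square_integrable lborel \<phi>" by (rule test_functions_square_integrable[OF \<phi>])
    let ?F = "\<lambda>t. \<integral>x. u x * \<phi> (x + t *\<^sub>R (- z)) \<partial>lborel"
    let ?F' = "\<lambda>t. \<integral>x. u x * frechet_derivative \<phi> (at (x + t *\<^sub>R (- z))) (- z) \<partial>lborel"
    have F: "(?F has_real_derivative ?F' t) (at t)" for t
    proof (rule deriv_under_integral[OF um _ \<phi>])
      show "integrable lborel (\<lambda>x. indicator K x * u x)" if "compact K" for K
        by (intro square_integrable_mult u square_integrable_indicator_compact that)
    qed
    have F': "(?F' t)\<^sup>2 \<le> G * (\<integral>x. (\<phi> x)\<^sup>2 \<partial>lborel)" for t
    proof -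
      let ?\<phi>t = "\<lambda>x. \<phi> (x + t *\<^sub>R (- z))"
      have \<phi>t: "?\<phi>t \<in> test_functions UNIV" by (rule test_functions_translate[OF \<phi>])
      have "frechet_derivative ?\<phi>t (at x) = frechet_derivative \<phi> (at (x + t *\<^sub>R (- z)))" for x
      proof -
        have "((\<lambda>x. x + t *\<^sub>R (- z)) has_derivative (\<lambda>h. h)) (at x)" by (auto intro!: derivative_eq_intros)
        from has_derivative_compose[OF this test_functions_has_derivative[OF \<phi>]]
        show ?thesis using frechet_derivative_at by (metis (no_types, lifting))
      qed
      then have "?F' t = - (\<integral>x. (g x \<bullet> (- z)) * ?\<phi>t x \<partial>lborel)" using weak_z[OF \<phi>t, of "- z"] by simp
      then have "(?F' t)\<^sup>2 = (\<integral>x. (g x \<bullet> (- z)) * ?\<phi>t x \<partial>lborel)\<^sup>2" by simp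
      also have "\<dots> \<le> (\<integral>x. (g x \<bullet> (- z))\<^sup>2 \<partial>lborel) * (\<integral>x. (?\<phi>t x)\<^sup>2 \<partial>lborel)"
        by (intro L2_Cauchy_Schwarz square_integrable_inner_const g test_functions_square_integrable[OF \<phi>t])
      also have "\<dots> \<le> G * (\<integral>x. (?\<phi>t x)\<^sup>2 \<partial>lborel)"
        using L2_norm_inner_le[OF g, of "- z"] by (intro mult_right_mono) (auto simp: G_def)
      also have "(\<integral>x. (?\<phi>t x)\<^sup>2 \<partial>lborel) = (\<integral>x. (\<phi> x)\<^sup>2 \<partial>lborel)"
        by (rule lborel_integral_translate) measurable
      finally show ?thesis .
    qed
    have G0: "0 \<le> G * (\<integral>x. (\<phi> x)\<^sup>2 \<partial>lborel)" by (rule order_trans[OF zero_le_power2 F'[of 0]])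
    have "norm (?F 1 - ?F 0) \<le> sqrt (G * (\<integral>x. (\<phi> x)\<^sup>2 \<partial>lborel)) * norm (1 - 0 :: real)"
    proof (rule field_differentiable_bound[where S = UNIV and f' = ?F'])
      show "norm (?F' t) \<le> sqrt (G * (\<integral>x. (\<phi> x)\<^sup>2 \<partial>lborel))" for t
        using real_sqrt_le_mono[OF F'[of t]] by simp
    qed (use F in auto)
    then have "\<bar>?F 1 - ?F 0\<bar>\<^sup>2 \<le> (sqrt (G * (\<integral>x. (\<phi> x)\<^sup>2 \<partial>lborel)))\<^sup>2"
      by (intro power_mono) auto
    then have le: "(?F 1 - ?F 0)\<^sup>2 \<le> G * (\<integral>x. (\<phi> x)\<^sup>2 \<partial>lborel)" using G0 by simp
    have "?F 1 = (\<integral>x. u (x + z) * \<phi> x \<partial>lborel)"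
      using lborel_integral_translate[of "\<lambda>x. u x * \<phi> (x - z)" z] by simp
    moreover have "integrable lborel (\<lambda>x. u (x + z) * \<phi> x)" "integrable lborel (\<lambda>x. u x * \<phi> x)"
      by (intro square_integrable_mult square_integrable_translate u \<phi>sq)+
    ultimately have "?F 1 - ?F 0 = (\<integral>x. w x * \<phi> x \<partial>lborel)"
      by (simp add: w_def left_diff_distrib)
    then show ?thesis using le by simp
  qed
  have G0: "0 \<le> G" by (simp add: G_def)
  have "(\<integral>x. (w x)\<^sup>2 \<partial>lborel) \<le> G + e" if e: "e > 0" for e
  proof -
    have "w \<in> L2_closure UNIV" by (rule test_functions_dense[OF open_UNIV w]) simp
    then obtain \<phi> where \<phi>: "\<phi> \<in> test_functions UNIV" "(\<integral>x. (w x - \<phi> x)\<^sup>2 \<partial>lborel) < e"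
      using e by (auto simp: L2_closure_def)
    have \<phi>sq: "square_integrable lborel \<phi>" by (rule test_functions_square_integrable[OF \<phi>(1)])
    define \<Phi> where "\<Phi> = (\<integral>x. (\<phi> x)\<^sup>2 \<partial>lborel)"
    have \<Phi>: "0 \<le> \<Phi>" by (simp add: \<Phi>_def)
    have "integrable lborel (\<lambda>x. (w x)\<^sup>2)" "integrable lborel (\<lambda>x. (\<phi> x)\<^sup>2)" "integrable lborel (\<lambda>x. w x * \<phi> x)"
      using w \<phi>sq square_integrable_mult[OF w \<phi>sq] by (auto simp: square_integrable_def)
    then have "(\<integral>x. (w x - \<phi> x)\<^sup>2 \<partial>lborel) = (\<integral>x. (w x)\<^sup>2 \<partial>lborel) + \<Phi> - 2 * (\<integral>x. w x * \<phi> x \<partial>lborel)"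
      by (simp add: power2_diff \<Phi>_def mult.assoc)
    \<comment> \<open>The term \<open>\<Phi>\<close> reappears in the expanded square with the
      opposite effect and cancels, so no division by the norm of \<open>\<phi>\<close>
      occurs.\<close>
    moreover have "2 * (\<integral>x. w x * \<phi> x \<partial>lborel) \<le> G + \<Phi>"
    proof -
      have "(\<integral>x. w x * \<phi> x \<partial>lborel) \<le> sqrt G * sqrt \<Phi>"
        using w_test[OF \<phi>(1)] G0 \<Phi> by (simp add: \<Phi>_def[symmetric] real_sqrt_mult[symmetric] real_le_rsqrt)
      moreover have "2 * (sqrt G * sqrt \<Phi>) \<le> G + \<Phi>"
        using sum_squares_bound[of "sqrt G" "sqrt \<Phi>"] G0 \<Phi> by simp
      ultimately show ?thesis by linarith
    qed
    ultimately show ?thesis using \<phi>(2) by linarith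
  qed
  then have "(\<integral>x. (w x)\<^sup>2 \<partial>lborel) \<le> G" by (rule field_le_epsilon)
  then show ?thesis by (simp add: w_def G_def)
qed

text \<open>The cube of side \<open>h\<close> containing \<open>x\<close> in the grid anchored at
  the origin. The cubes are half-open, so they partition the space, and the grids of sides
  \<open>h\<close> and \<open>h / 2\<close> are nested.\<close>

definition cell :: "real \<Rightarrow> 'a::euclidean_space \<Rightarrow> 'a set" where
  "cell h x = {y. \<forall>b\<in>Basis. \<lfloor>y \<bullet> b / h\<rfloor> = \<lfloor>x \<bullet> b / h\<rfloor>}"

text \<open>The conditional expectation of \<open>u\<close> with respect to the grid.\<close>

definition cell_avg :: "real \<Rightarrow> ('a::euclidean_space \<Rightarrow> real) \<Rightarrow> 'a \<Rightarrow> real" where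
  "cell_avg h u x = (\<integral>y. indicator (cell h x) y * u y \<partial>lborel) / h ^ DIM('a)"

lemma cell_self: "x \<in> cell h x" by (simp add: cell_def)

lemma cell_eq: "y \<in> cell h x \<Longrightarrow> cell h y = cell h x" by (auto simp: cell_def)

lemma cell_sets [measurable]: "cell h x \<in> sets borel"
proof -
  have "{y \<in> space borel. \<forall>b\<in>Basis. \<lfloor>y \<bullet> b / h\<rfloor> = \<lfloor>x \<bullet> b / h\<rfloor>} \<in> sets borel" by measurable
  then show ?thesis by (simp add: cell_def)
qed

text \<open>Joint measurability in both points, from which averages are measurable in
  \<open>x\<close>.\<close>

lemma cell_pair_measurable [measurable]:
  "(\<lambda>(x, y). indicator (cell h x) y :: real) \<in> borel_measurable (lborel \<Otimes>\<^sub>M lborel)"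
proof -
  have "{p \<in> space (lborel \<Otimes>\<^sub>M lborel). \<forall>b\<in>Basis. \<lfloor>snd p \<bullet> b / h\<rfloor> = \<lfloor>fst p \<bullet> b / h\<rfloor>} \<in> sets (lborel \<Otimes>\<^sub>M lborel)"
    by measurable
  then have "(indicator {p \<in> space (lborel \<Otimes>\<^sub>M lborel). \<forall>b\<in>Basis. \<lfloor>snd p \<bullet> b / h\<rfloor> = \<lfloor>fst p \<bullet> b / h\<rfloor>} :: _ \<Rightarrow> real)
      \<in> borel_measurable (lborel \<Otimes>\<^sub>M lborel)" by (rule borel_measurable_indicator)
  moreover have eq: "indicator {p \<in> space (lborel \<Otimes>\<^sub>M lborel). \<forall>b\<in>Basis. \<lfloor>snd p \<bullet> b / h\<rfloor> = \<lfloor>fst p \<bullet> b / h\<rfloor>}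
      = (\<lambda>(x, y). indicator (cell h x) y :: real)"
    by (auto simp: fun_eq_iff indicator_def cell_def space_pair_measure)
  ultimately show ?thesis by (simp only: eq)
qed

lemma cell_emeasure:
  fixes x :: "'a::euclidean_space"
  assumes h: "h > 0"
  shows "emeasure lborel (cell h x) = ennreal (h ^ DIM('a))" "measure lborel (cell h x) = h ^ DIM('a)"
    "integrable lborel (\<lambda>y. indicator (cell h x) y :: real)"
proof -
  define l where "l = (\<Sum>b\<in>Basis. (of_int \<lfloor>x \<bullet> b / h\<rfloor> * h) *\<^sub>R b)"
  define r where "r = l + h *\<^sub>R One"
  have lr: "l \<bullet> b = of_int \<lfloor>x \<bullet> b / h\<rfloor> * h" "r \<bullet> b = (of_int \<lfloor>x \<bullet> b / h\<rfloor> + 1) * h" if "b \<in> Basis" for b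
    using that by (auto simp: l_def r_def inner_add_left algebra_simps)
  have cell: "y \<in> cell h x \<longleftrightarrow> (\<forall>b\<in>Basis. l \<bullet> b \<le> y \<bullet> b \<and> y \<bullet> b < r \<bullet> b)" for y
    using h by (auto simp: cell_def lr floor_eq_iff field_simps)
  have "box l r \<subseteq> cell h x" "cell h x \<subseteq> cbox l r" by (auto simp: cell mem_box less_imp_le)
  moreover have "l \<bullet> b \<le> r \<bullet> b" if "b \<in> Basis" for b using that h by (simp add: lr)
  then have "emeasure lborel (box l r) = ennreal (h ^ DIM('a))" "emeasure lborel (cbox l r) = ennreal (h ^ DIM('a))"
    by (auto simp: emeasure_lborel_box emeasure_lborel_cbox inner_diff_left lr algebra_simps)
  ultimately show e: "emeasure lborel (cell h x) = ennreal (h ^ DIM('a))"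
    using emeasure_mono[of "box l r" "cell h x" lborel] emeasure_mono[of "cell h x" "cbox l r" lborel]
    by (simp add: antisym)
  then show "measure lborel (cell h x) = h ^ DIM('a)" using h by (simp add: measure_def)
  show "integrable lborel (\<lambda>y. indicator (cell h x) y :: real)"
    using e by (intro integrable_real_indicator) auto
qed

lemma cell_square_integrable:
  assumes h: "h > 0"
  shows "square_integrable lborel (\<lambda>y. indicator (cell h x) y :: real)"
proof -
  have "(\<lambda>y. (indicator (cell h x) y :: real)\<^sup>2) = indicator (cell h x)" by (auto simp: indicator_def)
  then show ?thesis using cell_emeasure(3)[OF h, of x] by (simp add: square_integrable_def)
qed

lemma cell_integral_sq:
  fixes f :: "'a::euclidean_space \<Rightarrow> real"
  assumes h: "h > 0" and f: "square_integrable lborel (\<lambda>y. indicator (cell h x) y * f y)"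
  shows "(\<integral>y. indicator (cell h x) y * f y \<partial>lborel)\<^sup>2
    \<le> h ^ DIM('a) * (\<integral>y. indicator (cell h x) y * (f y)\<^sup>2 \<partial>lborel)"
proof -
  have "(\<integral>y. indicator (cell h x) y * (indicator (cell h x) y * f y) \<partial>lborel)\<^sup>2
      \<le> (\<integral>y. (indicator (cell h x) y)\<^sup>2 \<partial>lborel) * (\<integral>y. (indicator (cell h x) y * f y)\<^sup>2 \<partial>lborel)"
    by (rule L2_Cauchy_Schwarz[OF cell_square_integrable[OF h] f])
  moreover have "(\<lambda>y. indicator (cell h x) y * (indicator (cell h x) y * f y)) = (\<lambda>y. indicator (cell h x) y * f y)"
    "(\<lambda>y. (indicator (cell h x) y :: real)\<^sup>2) = indicator (cell h x)"
    "(\<lambda>y. (indicator (cell h x) y * f y)\<^sup>2) = (\<lambda>y. indicator (cell h x) y * (f y)\<^sup>2)"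
    by (auto simp: indicator_def)
  ultimately show ?thesis using cell_emeasure(2)[OF h, of x] by simp
qed

lemma square_integrable_indicator_mult:
  fixes f :: "'a \<Rightarrow> real"
  shows "A \<in> sets M \<Longrightarrow> square_integrable M f \<Longrightarrow> square_integrable M (\<lambda>y. indicator A y * f y)"
  by (rule square_integrable_dominated[where C = 1 and g = f])
    (auto simp: square_integrable_def indicator_def)

lemma cell_avg_bound:
  fixes u :: "'a::euclidean_space \<Rightarrow> real"
  assumes h: "h > 0" and u: "square_integrable lborel u"
  shows "(cell_avg h u x)\<^sup>2 \<le> (\<integral>y. (u y)\<^sup>2 \<partial>lborel) / h ^ DIM('a)"
proof -
  have "(\<integral>y. indicator (cell h x) y * u y \<partial>lborel)\<^sup>2
      \<le> h ^ DIM('a) * (\<integral>y. indicator (cell h x) y * (u y)\<^sup>2 \<partial>lborel)"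
    by (intro cell_integral_sq h square_integrable_indicator_mult u) simp
  also have "\<dots> \<le> h ^ DIM('a) * (\<integral>y. (u y)\<^sup>2 \<partial>lborel)"
    using h u by (intro mult_left_mono integral_mono')
      (auto simp: square_integrable_def indicator_def)
  finally show ?thesis using h
    by (simp add: cell_avg_def power_divide divide_le_eq power2_eq_square field_simps)
qed

lemma cell_avg_measurable:
  assumes [measurable]: "u \<in> borel_measurable borel"
  shows "cell_avg h u \<in> borel_measurable borel"
proof -
  have "(\<lambda>(x, y). indicator (cell h x) y * u y) \<in> borel_measurable (lborel \<Otimes>\<^sub>M lborel)"
    using borel_measurable_times[OF cell_pair_measurable[of h], of "\<lambda>p. u (snd p)"]
    by (simp add: case_prod_unfold)
  then have "(\<lambda>x. \<integral>y. indicator (cell h x) y * u y \<partial>lborel) \<in> borel_measurable lborel"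
    by (rule lborel.borel_measurable_lebesgue_integral)
  then show ?thesis unfolding cell_avg_def[abs_def] by simp
qed

lemma cell_subset_cbox:
  fixes h :: real
  assumes h: "h > 0" and y: "y \<in> cell h x"
  shows "y - x \<in> cbox (- h *\<^sub>R One) (h *\<^sub>R One)"
proof -
  have "\<bar>y \<bullet> b - x \<bullet> b\<bar> \<le> h" if b: "b \<in> Basis" for b
  proof -
    have "\<lfloor>y \<bullet> b / h\<rfloor> = \<lfloor>x \<bullet> b / h\<rfloor>" using y b by (simp add: cell_def)
    then have "\<bar>y \<bullet> b / h - x \<bullet> b / h\<bar> \<le> 1" by linarith
    then show ?thesis using h by (simp add: diff_divide_distrib[symmetric] field_simps)
  qed
  then have "- h \<le> y \<bullet> b - x \<bullet> b \<and> y \<bullet> b - x \<bullet> b \<le> h" if "b \<in> Basis" for b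
    using that by (metis abs_le_iff minus_le_iff)
  then show ?thesis by (simp add: mem_box inner_diff_left)
qed

text \<open>A Poincare inequality obtained from translations. Differences within a cell lie in the
  cube \<open>?Q\<close> of side \<open>2 * h\<close>; exchanging the integrals leaves, for each
  such \<open>z\<close>, a translation of \<open>u\<close> with
  \<open>(norm z)^2 \<le> N * h^2\<close>. The volume of \<open>?Q\<close> over that of a cell gives
  the factor \<open>2 ^ N\<close>.\<close>

lemma cell_deviation:
  fixes u :: "'a::euclidean_space \<Rightarrow> real" and h G :: real
  assumes h: "h > 0" and u: "square_integrable lborel u"
    and trans: "\<And>z. (\<integral>x. (u (x + z) - u x)\<^sup>2 \<partial>lborel) \<le> (norm z)\<^sup>2 * G"
  shows "square_integrable lborel (\<lambda>x. u x - cell_avg h u x)"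
    "(\<integral>x. (u x - cell_avg h u x)\<^sup>2 \<partial>lborel) \<le> 2 ^ DIM('a) * DIM('a) * h\<^sup>2 * G"
proof -
  define V where "V = h ^ DIM('a)"
  have V: "V > 0" using h by (simp add: V_def)
  note um[measurable] = u[unfolded square_integrable_def, THEN conjunct1]
  have um'[measurable]: "u \<in> borel_measurable borel" using um by simp
  have am[measurable]: "cell_avg h u \<in> borel_measurable borel" by (rule cell_avg_measurable) measurable
  have G0: "0 \<le> G"
  proof -
    obtain b :: 'a where b: "b \<in> Basis" using nonempty_Basis by blast
    have "0 \<le> (norm b)\<^sup>2 * G" by (rule order_trans[OF _ trans[of b]]) simp
    then show ?thesis using b by simp
  qed
  let ?Q = "cbox (- h *\<^sub>R One) (h *\<^sub>R One) :: 'a set"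
  \<comment> \<open>Cauchy-Schwarz on the cell, followed by enlarging the cell to a translate of the
    fixed cube, so that the inner integral can be rewritten over translations.\<close>
  have pointwise: "ennreal ((u x - cell_avg h u x)\<^sup>2)
      \<le> ennreal (1 / V) * (\<integral>\<^sup>+y. indicator ?Q (y - x) * ennreal ((u x - u y)\<^sup>2) \<partial>lborel)" for x
  proof -
    let ?I = "indicator (cell h x) :: 'a \<Rightarrow> real"
    have sq: "square_integrable lborel (\<lambda>y. ?I y * (u x - u y))"
    proof -
      have "square_integrable lborel (\<lambda>y. u x *\<^sub>R ?I y - ?I y * u y)"
        by (intro square_integrable_diff square_integrable_scaleR cell_square_integrable h
            square_integrable_indicator_mult u) simp
      then show ?thesis by (simp add: algebra_simps)
    qed
    have int: "integrable lborel (\<lambda>y. ?I y * (u x - u y)\<^sup>2)"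
    proof -
      have "(\<lambda>y. (?I y * (u x - u y))\<^sup>2) = (\<lambda>y. ?I y * (u x - u y)\<^sup>2)" by (auto simp: indicator_def)
      then show ?thesis using sq by (simp add: square_integrable_def)
    qed
    have "integrable lborel (\<lambda>y. ?I y * u y)"
      using square_integrable_mult[OF cell_square_integrable[OF h] u] .
    then have "(\<integral>y. ?I y * (u x - u y) \<partial>lborel) = V * u x - (\<integral>y. ?I y * u y \<partial>lborel)"
      using cell_emeasure(2,3)[OF h, of x] by (simp add: right_diff_distrib V_def)
    also have "\<dots> = V * (u x - cell_avg h u x)"
      using V by (simp add: cell_avg_def V_def[symmetric] field_simps)
    finally have "(V * (u x - cell_avg h u x))\<^sup>2 \<le> V * (\<integral>y. ?I y * (u x - u y)\<^sup>2 \<partial>lborel)"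
      using cell_integral_sq[OF h sq] by (simp add: V_def)
    then have "V * (V * (u x - cell_avg h u x)\<^sup>2) \<le> V * (\<integral>y. ?I y * (u x - u y)\<^sup>2 \<partial>lborel)"
      by (simp add: power_mult_distrib power2_eq_square mult_ac)
    then have "(u x - cell_avg h u x)\<^sup>2 \<le> 1 / V * (\<integral>y. ?I y * (u x - u y)\<^sup>2 \<partial>lborel)"
      using V by (simp add: field_simps)
    then have "ennreal ((u x - cell_avg h u x)\<^sup>2) \<le> ennreal (1 / V * (\<integral>y. ?I y * (u x - u y)\<^sup>2 \<partial>lborel))"
      by (rule ennreal_leI)
    also have "\<dots> = ennreal (1 / V) * (\<integral>\<^sup>+y. ennreal (?I y * (u x - u y)\<^sup>2) \<partial>lborel)"
      using V int by (subst ennreal_mult) (auto simp: nn_integral_eq_integral)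
    also have "\<dots> \<le> ennreal (1 / V) * (\<integral>\<^sup>+y. indicator ?Q (y - x) * ennreal ((u x - u y)\<^sup>2) \<partial>lborel)"
    proof (intro mult_left_mono nn_integral_mono)
      fix y
      show "ennreal (?I y * (u x - u y)\<^sup>2) \<le> indicator ?Q (y - x) * ennreal ((u x - u y)\<^sup>2)"
        using cell_subset_cbox[OF h, of y x] by (cases "y \<in> cell h x") auto
    qed simp
    finally show ?thesis .
  qed
  have nn_trans: "(\<integral>\<^sup>+x. ennreal ((u x - u (x + z))\<^sup>2) \<partial>lborel) \<le> ennreal ((norm z)\<^sup>2 * G)" for z
  proof -
    have "square_integrable lborel (\<lambda>x. u (x + z) - u x)"
      by (intro square_integrable_diff square_integrable_translate u)
    then have "(\<integral>\<^sup>+x. ennreal ((u (x + z) - u x)\<^sup>2) \<partial>lborel) = ennreal (\<integral>x. (u (x + z) - u x)\<^sup>2 \<partial>lborel)"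
      by (intro nn_integral_eq_integral) (auto simp: square_integrable_def)
    moreover have "(u x - u (x + z))\<^sup>2 = (u (x + z) - u x)\<^sup>2" for x by (rule power2_commute)
    ultimately show ?thesis using ennreal_leI[OF trans[of z]] by (simp only:)
  qed
  have normQ: "(norm z)\<^sup>2 \<le> DIM('a) * h\<^sup>2" if "z \<in> ?Q" for z
  proof -
    have "(norm z)\<^sup>2 = (\<Sum>b\<in>Basis. (z \<bullet> b) * (z \<bullet> b))"
      using euclidean_inner[of z z] by (simp only: power2_norm_eq_inner)
    also have "\<dots> = (\<Sum>b\<in>Basis. (z \<bullet> b)\<^sup>2)" by (simp only: power2_eq_square)
    also have "\<dots> \<le> (\<Sum>b\<in>(Basis::'a set). h\<^sup>2)"
    proof (rule sum_mono)
      fix b :: 'a assume "b \<in> Basis"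
      then have "\<bar>z \<bullet> b\<bar> \<le> \<bar>h\<bar>" using that h by (auto simp: mem_box abs_le_iff)
      then show "(z \<bullet> b)\<^sup>2 \<le> h\<^sup>2" by (simp add: abs_le_square_iff)
    qed
    finally show ?thesis by simp
  qed
  have Qm: "emeasure lborel ?Q = ennreal ((2 * h) ^ DIM('a))"
  proof -
    have "(\<Prod>b\<in>(Basis :: 'a set). (h *\<^sub>R One - (- h) *\<^sub>R One) \<bullet> b) = (\<Prod>b\<in>(Basis :: 'a set). 2 * h)"
      by (intro prod.cong refl) (simp add: inner_diff_left inner_add_left)
    then show ?thesis using h by (subst emeasure_lborel_cbox) simp_all
  qed
  have "(\<integral>\<^sup>+x. ennreal ((u x - cell_avg h u x)\<^sup>2) \<partial>lborel)
      \<le> (\<integral>\<^sup>+x. ennreal (1 / V) * (\<integral>\<^sup>+y. indicator ?Q (y - x) * ennreal ((u x - u y)\<^sup>2) \<partial>lborel) \<partial>lborel)"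
    by (intro nn_integral_mono pointwise)
  also have "\<dots> = (\<integral>\<^sup>+x. ennreal (1 / V) * (\<integral>\<^sup>+z. indicator ?Q z * ennreal ((u x - u (x + z))\<^sup>2) \<partial>lborel) \<partial>lborel)"
  proof (intro nn_integral_cong)
    fix x
    have "(\<integral>\<^sup>+z. indicator ?Q ((z + x) - x) * ennreal ((u x - u (z + x))\<^sup>2) \<partial>lborel)
        = (\<integral>\<^sup>+y. indicator ?Q (y - x) * ennreal ((u x - u y)\<^sup>2) \<partial>lborel)"
      by (rule lborel_nn_integral_translate[of "\<lambda>y. indicator ?Q (y - x) * ennreal ((u x - u y)\<^sup>2)" x]) measurable
    then have "(\<integral>\<^sup>+y. indicator ?Q (y - x) * ennreal ((u x - u y)\<^sup>2) \<partial>lborel)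
        = (\<integral>\<^sup>+z. indicator ?Q z * ennreal ((u x - u (x + z))\<^sup>2) \<partial>lborel)"
      by (simp add: add.commute)
    then show "ennreal (1 / V) * (\<integral>\<^sup>+y. indicator ?Q (y - x) * ennreal ((u x - u y)\<^sup>2) \<partial>lborel)
        = ennreal (1 / V) * (\<integral>\<^sup>+z. indicator ?Q z * ennreal ((u x - u (x + z))\<^sup>2) \<partial>lborel)"
      by (simp only:)
  qed
  also have "\<dots> = ennreal (1 / V) * (\<integral>\<^sup>+x. (\<integral>\<^sup>+z. indicator ?Q z * ennreal ((u x - u (x + z))\<^sup>2) \<partial>lborel) \<partial>lborel)"
    by (rule nn_integral_cmult) measurable
  also have "(\<integral>\<^sup>+x. (\<integral>\<^sup>+z. indicator ?Q z * ennreal ((u x - u (x + z))\<^sup>2) \<partial>lborel) \<partial>lborel)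
      = (\<integral>\<^sup>+z. (\<integral>\<^sup>+x. indicator ?Q z * ennreal ((u x - u (x + z))\<^sup>2) \<partial>lborel) \<partial>lborel)"
    by (rule lborel_pair.Fubini') measurable
  also have "\<dots> = (\<integral>\<^sup>+z. indicator ?Q z * (\<integral>\<^sup>+x. ennreal ((u x - u (x + z))\<^sup>2) \<partial>lborel) \<partial>lborel)"
    by (intro nn_integral_cong nn_integral_cmult) measurable
  also have "\<dots> \<le> (\<integral>\<^sup>+z. ennreal (DIM('a) * h\<^sup>2 * G) * indicator ?Q z \<partial>lborel)"
  proof (rule nn_integral_mono)
    fix z
    show "indicator ?Q z * (\<integral>\<^sup>+x. ennreal ((u x - u (x + z))\<^sup>2) \<partial>lborel)
        \<le> ennreal (DIM('a) * h\<^sup>2 * G) * indicator ?Q z"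
    proof (cases "z \<in> ?Q")
      case True
      have "(norm z)\<^sup>2 * G \<le> DIM('a) * h\<^sup>2 * G" using normQ[OF True] G0 by (rule mult_right_mono)
      then have "(\<integral>\<^sup>+x. ennreal ((u x - u (x + z))\<^sup>2) \<partial>lborel) \<le> ennreal (DIM('a) * h\<^sup>2 * G)"
        using nn_trans[of z] by (meson ennreal_leI order_trans)
      then show ?thesis using True by simp
    qed simp
  qed
  also have "\<dots> = ennreal (DIM('a) * h\<^sup>2 * G) * ennreal ((2 * h) ^ DIM('a))"
    using Qm by (simp add: nn_integral_cmult_indicator)
  also have "ennreal (1 / V) * \<dots> = ennreal (2 ^ DIM('a) * DIM('a) * h\<^sup>2 * G)"
    using V G0 h by (simp add: ennreal_mult[symmetric] V_def power_mult_distrib field_simps)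
  finally have le: "(\<integral>\<^sup>+x. ennreal ((u x - cell_avg h u x)\<^sup>2) \<partial>lborel)
      \<le> ennreal (2 ^ DIM('a) * DIM('a) * h\<^sup>2 * G)"
    by (simp add: mult_left_mono)
  have int: "integrable lborel (\<lambda>x. (u x - cell_avg h u x)\<^sup>2)"
    by (rule integrableI_nonneg) (use le in \<open>auto simp: order_le_less_trans\<close>)
  then show "square_integrable lborel (\<lambda>x. u x - cell_avg h u x)"
    by (simp add: square_integrable_def)
  show "(\<integral>x. (u x - cell_avg h u x)\<^sup>2 \<partial>lborel) \<le> 2 ^ DIM('a) * DIM('a) * h\<^sup>2 * G"
    using le G0 nn_integral_eq_integral[OF int] by simp
qed

lemma cell_avg_const: "y \<in> cell h x \<Longrightarrow> cell_avg h u y = cell_avg h u x"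
  by (simp add: cell_avg_def cell_eq)

text \<open>Halving the side doubles the argument of the floor, and \<open>div 2\<close> recovers
  the coarser floor.\<close>

lemma cell_half_subset: "h > 0 \<Longrightarrow> cell (h / 2) x \<subseteq> cell h x"
proof
  fix y assume h: "h > 0" and y: "y \<in> cell (h / 2) x"
  have half: "\<lfloor>t / h\<rfloor> = \<lfloor>t / (h / 2)\<rfloor> div 2" for t
    using floor_divide_real_eq_div[of 2 "t / (h / 2)"] by simp
  show "y \<in> cell h x" unfolding cell_def
    by (intro CollectI ballI) (simp only: half, use y in \<open>simp add: cell_def\<close>)
qed

text \<open>The coarse average is constant on the half cell, so the increment is the fine average of
  the deviation, and an average is bounded pointwise by the L^2 norm and the volume.\<close>

lemma cell_avg_step:
  fixes u :: "'a::euclidean_space \<Rightarrow> real" and h G :: real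
  assumes h: "h > 0" and u: "square_integrable lborel u"
    and dev: "square_integrable lborel (\<lambda>x. u x - cell_avg h u x)"
  shows "(cell_avg (h / 2) u x - cell_avg h u x)\<^sup>2
    \<le> (\<integral>y. (u y - cell_avg h u y)\<^sup>2 \<partial>lborel) / (h / 2) ^ DIM('a)"
proof -
  have h2: "h / 2 > 0" using h by simp
  let ?I = "indicator (cell (h / 2) x) :: 'a \<Rightarrow> real"
  have "?I y * (u y - cell_avg h u y) = ?I y * u y - cell_avg h u x * ?I y" for y
    using cell_avg_const[of y h x u] cell_half_subset[OF h, of x] by (auto simp: indicator_def)
  moreover have "integrable lborel (\<lambda>y. ?I y * u y)"
    using square_integrable_mult[OF cell_square_integrable[OF h2] u] .
  ultimately have "(\<integral>y. ?I y * (u y - cell_avg h u y) \<partial>lborel)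
      = (\<integral>y. ?I y * u y \<partial>lborel) - cell_avg h u x * (h / 2) ^ DIM('a)"
    using cell_emeasure(2,3)[OF h2, of x] by simp
  then have "cell_avg (h / 2) (\<lambda>y. u y - cell_avg h u y) x = cell_avg (h / 2) u x - cell_avg h u x"
    using h by (simp add: cell_avg_def diff_divide_distrib)
  then show ?thesis using cell_avg_bound[OF h2 dev, of x] by simp
qed

text \<open>Cauchy-Schwarz twice with weights \<open>s ^ k\<close>, \<open>s = 9/10\<close>: first
  to \<open>\<Sum> d^2 / s^2\<close>, then, writing its terms as \<open>s\<close> times
  \<open>d^2 / s^3\<close>, to \<open>\<Sum> d^4 / s^6\<close>. Each use costs
  \<open>\<Sum> s^2 \<le> 6\<close>, the first one squared, hence \<open>216 = 6^3\<close>. The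
  weights must decay slowly enough for a decay \<open>(1/2) ^ k\<close> of the fourth powers to beat
  \<open>s ^ (6 k)\<close>.\<close>

lemma sum_weighted_power4:
  fixes d :: "nat \<Rightarrow> real"
  shows "(\<Sum>k<n. d k) ^ 4 \<le> 216 * (\<Sum>k<n. d k ^ 4 / (9 / 10) ^ (6 * k))"
proof -
  let ?s = "\<lambda>k. (9 / 10 :: real) ^ k"
  have s: "?s k \<noteq> 0" for k by simp
  have S: "(\<Sum>k<n. (?s k)\<^sup>2) \<le> 6"
  proof -
    have "(\<Sum>k<n. (?s k)\<^sup>2) = (\<Sum>k<n. (81 / 100) ^ k)"
      by (simp add: power_mult_distrib[symmetric] power2_eq_square)
    also have "\<dots> \<le> (\<Sum>k. (81 / 100 :: real) ^ k)" by (intro sum_le_suminf summable_geometric) auto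
    also have "\<dots> \<le> 6" by (simp add: suminf_geometric)
    finally show ?thesis .
  qed
  have S0: "0 \<le> (\<Sum>k<n. (?s k)\<^sup>2)" by (intro sum_nonneg) simp
  let ?A = "\<Sum>k<n. (d k)\<^sup>2 / (?s k)\<^sup>2" and ?B = "\<Sum>k<n. d k ^ 4 / (9 / 10) ^ (6 * k)"
  have A: "(\<Sum>k<n. d k)\<^sup>2 \<le> 6 * ?A"
  proof -
    have "(\<Sum>k<n. ?s k * (d k / ?s k))\<^sup>2 \<le> (\<Sum>k<n. (?s k)\<^sup>2) * (\<Sum>k<n. (d k / ?s k)\<^sup>2)"
      by (rule Cauchy_Schwarz_ineq_sum)
    also have "\<dots> \<le> 6 * (\<Sum>k<n. (d k / ?s k)\<^sup>2)" by (intro mult_right_mono S sum_nonneg) simp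
    finally show ?thesis using s by (simp add: power_divide power_mult_distrib)
  qed
  have B: "?A\<^sup>2 \<le> 6 * ?B"
  proof -
    have "(\<Sum>k<n. ?s k * ((d k)\<^sup>2 / ?s k ^ 3))\<^sup>2 \<le> (\<Sum>k<n. (?s k)\<^sup>2) * (\<Sum>k<n. ((d k)\<^sup>2 / ?s k ^ 3)\<^sup>2)"
      by (rule Cauchy_Schwarz_ineq_sum)
    also have "\<dots> \<le> 6 * (\<Sum>k<n. ((d k)\<^sup>2 / ?s k ^ 3)\<^sup>2)" by (intro mult_right_mono S sum_nonneg) simp
    also have "(\<Sum>k<n. ((d k)\<^sup>2 / ?s k ^ 3)\<^sup>2) = ?B"
      by (intro sum.cong refl) (simp add: power_divide power_mult_distrib power_mult[symmetric] mult.commute)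
    finally show ?thesis using s by (simp add: power2_eq_square power3_eq_cube field_simps)
  qed
  have "(\<Sum>k<n. d k) ^ 4 = ((\<Sum>k<n. d k)\<^sup>2)\<^sup>2" by simp
  also have "\<dots> \<le> (6 * ?A)\<^sup>2" by (intro power_mono A) simp
  also have "\<dots> = 36 * ?A\<^sup>2" by (simp add: power_mult_distrib)
  also have "\<dots> \<le> 36 * (6 * ?B)" using B by simp
  finally show ?thesis by simp
qed

text \<open>Chaining over dyadic scales: the increments \<open>E\<^bsub>k+1\<^esub>u - E\<^sub>ku\<close> of the cell averages of side
  \<open>1 / 2 ^ k\<close> are bounded in \<open>L2\<close> by \<open>2 ^ (-k)\<close> and uniformly by \<open>2 ^ (-k) * 2 ^ (k N / 2)\<close>, so
  their fourth powers integrate to \<open>O(2 ^ ((N - 4) k))\<close>; this is where \<open>N \<le> 3\<close> enters.\<close>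
theorem L4_bound:
  fixes u :: "'a::euclidean_space \<Rightarrow> real" and h G :: real
  assumes dim: "DIM('a) \<le> 3" and u: "square_integrable lborel u"
    and trans: "\<And>z. (\<integral>x. (u (x + z) - u x)\<^sup>2 \<partial>lborel) \<le> (norm z)\<^sup>2 * G"
  shows "integrable lborel (\<lambda>x. u x ^ 4)"
    "(\<integral>x. u x ^ 4 \<partial>lborel) \<le> 10 ^ 9 * ((\<integral>x. (u x)\<^sup>2 \<partial>lborel) + G)\<^sup>2"
proof -
  define W where "W = (\<integral>x. (u x)\<^sup>2 \<partial>lborel)"
  define E where "E = (\<lambda>k. cell_avg ((1/2) ^ k) u)"
  define d where "d = (\<lambda>k x. E (Suc k) x - E k x)"
  \<comment> \<open>The value of \<open>2 ^ N * N\<close> at \<open>N = 3\<close>, which bounds the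
    factor in the cell deviation for all \<open>N \<le> 3\<close>.\<close>
  define K where "K = (24 :: real)"
  have h: "(1/2 :: real) ^ k > 0" for k by simp
  have W: "0 \<le> W" by (simp add: W_def)
  have G: "0 \<le> G"
  proof -
    obtain b :: 'a where b: "b \<in> Basis" using nonempty_Basis by blast
    have "0 \<le> (norm b)\<^sup>2 * G" by (rule order_trans[OF _ trans[of b]]) simp
    then show ?thesis using b by simp
  qed
  note um = u[unfolded square_integrable_def, THEN conjunct1]
  have [measurable]: "u \<in> borel_measurable borel" "E k \<in> borel_measurable borel" for k
    using um unfolding E_def by (auto intro: cell_avg_measurable)
  have dev: "square_integrable lborel (\<lambda>x. u x - E k x)"
    and dev_le: "(\<integral>x. (u x - E k x)\<^sup>2 \<partial>lborel) \<le> K * G * (1/4) ^ k" for k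
  proof -
    show "square_integrable lborel (\<lambda>x. u x - E k x)"
      unfolding E_def by (rule cell_deviation[OF h u trans])
    have "(\<integral>x. (u x - E k x)\<^sup>2 \<partial>lborel) \<le> 2 ^ DIM('a) * DIM('a) * ((1/2) ^ k)\<^sup>2 * G"
      unfolding E_def by (rule cell_deviation[OF h u trans])
    also have "2 ^ DIM('a) * real DIM('a) \<le> 2 ^ 3 * 3"
      using dim by (intro mult_mono power_increasing) auto
    then have "2 ^ DIM('a) * real DIM('a) * (((1/2) ^ k)\<^sup>2 * G) \<le> 2 ^ 3 * 3 * (((1/2) ^ k)\<^sup>2 * G)"
      using G by (intro mult_right_mono) auto
    then have "2 ^ DIM('a) * DIM('a) * ((1/2) ^ k)\<^sup>2 * G \<le> K * G * (1/4) ^ k"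
      by (simp add: K_def power_mult_distrib[symmetric] power2_eq_square mult_ac)
    finally show "(\<integral>x. (u x - E k x)\<^sup>2 \<partial>lborel) \<le> K * G * (1/4) ^ k" .
  qed
  have Esq: "square_integrable lborel (E k)" for k
    using square_integrable_diff[OF u dev[of k]] by simp
  have dsq: "square_integrable lborel (d k)" for k
    unfolding d_def by (intro square_integrable_diff Esq)
  have d2: "(\<integral>x. (d k x)\<^sup>2 \<partial>lborel) \<le> 4 * K * G * (1/4) ^ k" for k
  proof -
    have "(\<integral>x. (norm ((u x - E k x) - (u x - E (Suc k) x)))\<^sup>2 \<partial>lborel)
        \<le> 2 * (\<integral>x. (norm (u x - E k x))\<^sup>2 \<partial>lborel) + 2 * (\<integral>x. (norm (u x - E (Suc k) x))\<^sup>2 \<partial>lborel)"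
      by (rule L2_norm_diff_le[OF dev dev])
    then have "(\<integral>x. (d k x)\<^sup>2 \<partial>lborel)
        \<le> 2 * (\<integral>x. (u x - E k x)\<^sup>2 \<partial>lborel) + 2 * (\<integral>x. (u x - E (Suc k) x)\<^sup>2 \<partial>lborel)"
      by (simp add: d_def)
    then have "(\<integral>x. (d k x)\<^sup>2 \<partial>lborel) \<le> 2 * (K * G * (1/4) ^ k) + 2 * (K * G * (1/4) ^ Suc k)"
      using dev_le[of k] dev_le[of "Suc k"] by linarith
    moreover have "0 \<le> K * G * (1/4) ^ k" using G by (simp add: K_def)
    ultimately show ?thesis unfolding power_Suc by linarith
  qed
  have dsup: "(d k x)\<^sup>2 \<le> 8 * K * G * 2 ^ k" for k x
  proof -
    have "(d k x)\<^sup>2 \<le> (\<integral>y. (u y - E k y)\<^sup>2 \<partial>lborel) / ((1/2) ^ k / 2) ^ DIM('a)"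
      using cell_avg_step[OF h u, of k x] dev[of k] by (simp add: d_def E_def)
    also have "\<dots> \<le> (K * G * (1/4) ^ k) / ((1/2) ^ k / 2) ^ DIM('a)"
      by (intro divide_right_mono dev_le) simp
    \<comment> \<open>The base is at most 1, so raising the exponent to 3 shrinks the denominator;
      then \<open>(1/4) ^ k\<close> against \<open>8 ^ k\<close> leaves
      \<open>2 ^ k\<close>.\<close>
    also have "\<dots> \<le> (K * G * (1/4) ^ k) / ((1/2) ^ k / 2) ^ 3"
    proof (intro divide_left_mono)
      show "((1/2) ^ k / 2) ^ 3 \<le> ((1/2 :: real) ^ k / 2) ^ DIM('a)"
        using dim power_le_one[of "1/2::real" k] by (intro power_decreasing) auto
    qed (use G in \<open>auto simp: K_def\<close>)
    also have "\<dots> = 8 * K * G * ((1/4) ^ k * (2 ^ k) ^ 3)"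
      by (simp add: power_divide)
    also have "(1/4 :: real) ^ k * (2 ^ k) ^ 3 = 2 ^ k"
    proof -
      have "(1/4 :: real) ^ k * (2 ^ k) ^ 3 = ((1/4) * 2 ^ 3) ^ k"
        by (simp only: power_mult_distrib power_mult[symmetric] mult.commute)
      then show ?thesis by simp
    qed
    finally show ?thesis .
  qed
  have d4_int: "integrable lborel (\<lambda>x. d k x ^ 4)"
    and d4: "(\<integral>x. d k x ^ 4 \<partial>lborel) \<le> 32 * K\<^sup>2 * G\<^sup>2 * (1/2) ^ k" for k
  proof -
    have le: "d k x ^ 4 \<le> 8 * K * G * 2 ^ k * (d k x)\<^sup>2" for x
      using mult_right_mono[OF dsup[of k x], of "(d k x)\<^sup>2"] by (simp add: power2_eq_square power4_eq_xxxx mult_ac)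
    have i2: "integrable lborel (\<lambda>x. 8 * K * G * 2 ^ k * (d k x)\<^sup>2)"
      using dsq[of k] by (simp add: square_integrable_def)
    show int: "integrable lborel (\<lambda>x. d k x ^ 4)"
      by (rule Bochner_Integration.integrable_bound[OF i2])
        (use le dsq[of k] G in \<open>auto simp: square_integrable_def K_def abs_mult\<close>)
    have "(\<integral>x. d k x ^ 4 \<partial>lborel) \<le> (\<integral>x. 8 * K * G * 2 ^ k * (d k x)\<^sup>2 \<partial>lborel)"
      by (intro integral_mono int i2 le)
    also have "\<dots> = 8 * K * G * 2 ^ k * (\<integral>x. (d k x)\<^sup>2 \<partial>lborel)" by simp
    also have "\<dots> \<le> 8 * K * G * 2 ^ k * (4 * K * G * (1/4) ^ k)"
      using G by (intro mult_left_mono d2) (auto simp: K_def)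
    also have "\<dots> = 32 * K\<^sup>2 * G\<^sup>2 * (2 ^ k * (1/4) ^ k)" by (simp add: power2_eq_square)
    also have "(2::real) ^ k * (1/4) ^ k = (1/2) ^ k" by (simp add: power_mult_distrib[symmetric])
    finally show "(\<integral>x. d k x ^ 4 \<partial>lborel) \<le> 32 * K\<^sup>2 * G\<^sup>2 * (1/2) ^ k" .
  qed
  have E0_4: "E 0 x ^ 4 \<le> W * (E 0 x)\<^sup>2" for x
  proof -
    have "(E 0 x)\<^sup>2 \<le> W" using cell_avg_bound[OF h[of 0] u, of x] by (simp add: E_def W_def)
    from mult_right_mono[OF this, of "(E 0 x)\<^sup>2"] show ?thesis
      by (simp add: power2_eq_square power4_eq_xxxx mult_ac)
  qed
  have iE0: "integrable lborel (\<lambda>x. W * (E 0 x)\<^sup>2)" using Esq[of 0] by (simp add: square_integrable_def)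
  have E0_int: "integrable lborel (\<lambda>x. E 0 x ^ 4)"
    by (rule Bochner_Integration.integrable_bound[OF iE0]) (use E0_4 W in \<open>auto simp: abs_mult\<close>)
  have E0: "(\<integral>x. E 0 x ^ 4 \<partial>lborel) \<le> W * (2 * W + 2 * K * G)"
  proof -
    have "(\<integral>x. (norm (u x - (u x - E 0 x)))\<^sup>2 \<partial>lborel)
        \<le> 2 * (\<integral>x. (norm (u x))\<^sup>2 \<partial>lborel) + 2 * (\<integral>x. (norm (u x - E 0 x))\<^sup>2 \<partial>lborel)"
      by (rule L2_norm_diff_le[OF u dev])
    then have "(\<integral>x. (E 0 x)\<^sup>2 \<partial>lborel) \<le> 2 * W + 2 * K * G"
      using dev_le[of 0] by (simp add: W_def)
    then have "W * (\<integral>x. (E 0 x)\<^sup>2 \<partial>lborel) \<le> W * (2 * W + 2 * K * G)"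
      using W by (rule mult_left_mono)
    moreover have "(\<integral>x. E 0 x ^ 4 \<partial>lborel) \<le> (\<integral>x. W * (E 0 x)\<^sup>2 \<partial>lborel)"
      by (intro integral_mono E0_int iE0 E0_4)
    ultimately show ?thesis by simp
  qed
  have En: "E n x = E 0 x + (\<Sum>k<n. d k x)" for n x
    by (induction n) (auto simp: d_def)
  \<comment> \<open>The decay 1/2 of the fourth powers per scale against the loss from the weights.
    The ratio is about 0.941, and 17 exceeds \<open>1 / (1 - q)\<close>.\<close>
  define q where "q = (1/2) / (9/10 :: real) ^ 6"
  have q: "0 \<le> q" "q < 1" by (simp_all add: q_def power_divide)
  have qsum: "(\<Sum>k<n. q ^ k) \<le> 17" for n
  proof -
    have "(\<Sum>k<n. q ^ k) \<le> (\<Sum>k. q ^ k)" using q by (intro sum_le_suminf summable_geometric) auto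
    also have "\<dots> = 1 / (1 - q)" using q by (intro suminf_geometric) auto
    also have "\<dots> \<le> 17" by (simp add: q_def power_divide)
    finally show ?thesis .
  qed
  have sum4: "(a + b) ^ 4 \<le> 8 * a ^ 4 + 8 * b ^ 4" for a b :: real
  proof -
    have ab: "(a + b)\<^sup>2 \<le> 2 * (a\<^sup>2 + b\<^sup>2)" for a b :: real
      using sum_squares_bound[of a b] by (simp add: power2_sum)
    have "(a + b) ^ 4 = ((a + b)\<^sup>2)\<^sup>2" by simp
    also have "\<dots> \<le> (2 * (a\<^sup>2 + b\<^sup>2))\<^sup>2" by (intro power_mono ab) simp
    also have "\<dots> = 4 * (a\<^sup>2 + b\<^sup>2)\<^sup>2" unfolding power_mult_distrib by simp
    also have "\<dots> \<le> 4 * (2 * ((a\<^sup>2)\<^sup>2 + (b\<^sup>2)\<^sup>2))" using ab[of "a\<^sup>2" "b\<^sup>2"] by simp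
    finally show ?thesis by simp
  qed
  let ?R = "\<lambda>n x. 8 * E 0 x ^ 4 + 8 * (216 * (\<Sum>k<n. d k x ^ 4 / (9 / 10) ^ (6 * k)))"
  have E4: "E n x ^ 4 \<le> ?R n x" for n x
    using sum4[of "E 0 x" "\<Sum>k<n. d k x"] sum_weighted_power4[of "\<lambda>k. d k x" n] En[of n x] by simp
  have R_int: "integrable lborel (?R n)" for n
    using E0_int d4_int by simp
  have E4_int: "integrable lborel (\<lambda>x. E n x ^ 4)" for n
    by (rule Bochner_Integration.integrable_bound[OF R_int[of n]]) (use E4 in \<open>auto intro!: AE_I2 order_trans[OF _ abs_ge_self]\<close>)
  define C where "C = 8 * (W * (2 * W + 2 * K * G)) + 8 * (216 * (32 * K\<^sup>2 * G\<^sup>2 * 17))"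
  have bound: "(\<integral>x. E n x ^ 4 \<partial>lborel) \<le> C" for n
  proof -
    have "(\<integral>x. E n x ^ 4 \<partial>lborel) \<le> (\<integral>x. ?R n x \<partial>lborel)" by (intro integral_mono E4_int R_int E4)
    also have "\<dots> = 8 * (\<integral>x. E 0 x ^ 4 \<partial>lborel)
        + 8 * (216 * (\<Sum>k<n. (\<integral>x. d k x ^ 4 \<partial>lborel) / (9 / 10) ^ (6 * k)))"
      using E0_int d4_int by simp
    also have "(\<Sum>k<n. (\<integral>x. d k x ^ 4 \<partial>lborel) / (9 / 10) ^ (6 * k))
        \<le> (\<Sum>k<n. 32 * K\<^sup>2 * G\<^sup>2 * (1/2) ^ k / (9 / 10) ^ (6 * k))"
      by (intro sum_mono divide_right_mono d4) simp
    also have "\<dots> = 32 * K\<^sup>2 * G\<^sup>2 * (\<Sum>k<n. q ^ k)"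
    proof -
      have "q ^ k = (1/2) ^ k / (9 / 10) ^ (6 * k)" for k
        unfolding q_def by (simp only: power_divide power_mult)
      then show ?thesis by (simp add: sum_distrib_left)
    qed
    also have "\<dots> \<le> 32 * K\<^sup>2 * G\<^sup>2 * 17" by (intro mult_left_mono qsum) (simp add: K_def)
    finally show ?thesis using E0 by (simp add: C_def)
  qed
  have "AE x in lborel. summable (\<lambda>k. (u x - E k x)\<^sup>2)"
  proof (rule AE_summable[OF _ _ dev_le])
    show "integrable lborel (\<lambda>x. (u x - E k x)\<^sup>2)" for k using dev[of k] by (simp add: square_integrable_def)
    show "summable (\<lambda>k. K * G * (1/4) ^ k)" by (intro summable_mult summable_geometric) simp
  qed simp
  then have lim: "AE x in lborel. (\<lambda>k. E k x ^ 4) \<longlonglongrightarrow> u x ^ 4"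
  proof eventually_elim
    case (elim x)
    then have "(\<lambda>k. sqrt ((u x - E k x)\<^sup>2)) \<longlonglongrightarrow> sqrt 0"
      by (intro tendsto_real_sqrt summable_LIMSEQ_zero)
    then have "(\<lambda>k. u x - E k x) \<longlonglongrightarrow> 0" by (simp add: tendsto_rabs_zero_iff)
    then have "(\<lambda>k. u x - (u x - E k x)) \<longlonglongrightarrow> u x - 0" by (intro tendsto_intros)
    then have "(\<lambda>k. E k x) \<longlonglongrightarrow> u x" by simp
    then show ?case by (rule tendsto_power)
  qed
  have Fatou: "integrable lborel (\<lambda>x. u x ^ 4)" "(\<integral>x. u x ^ 4 \<partial>lborel) \<le> C"
    by (rule Fatou_bound[where h = "\<lambda>k x. E k x ^ 4" and C = C]; use E4_int bound lim in simp)+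
  show "integrable lborel (\<lambda>x. u x ^ 4)" by fact
  \<comment> \<open>The coefficients after inserting \<open>K = 24\<close>; \<open>10 ^ 9\<close> is
    a round number above the largest of them.\<close>
  have "C = 16 * W\<^sup>2 + 384 * (W * G) + 541458432 * G\<^sup>2"
    by (simp add: C_def K_def power2_eq_square algebra_simps)
  also have "\<dots> \<le> 10 ^ 9 * (W + G)\<^sup>2"
    using W G mult_nonneg_nonneg[OF W G] zero_le_power2[of W] zero_le_power2[of G]
    by (simp add: power2_sum)
  finally show "(\<integral>x. u x ^ 4 \<partial>lborel) \<le> 10 ^ 9 * ((\<integral>x. (u x)\<^sup>2 \<partial>lborel) + G)\<^sup>2"
    using Fatou(2) by (simp add: W_def)
qed

section \<open>Local control by finitely many cell integrals\<close>

lemma finite_cells_cball: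
  fixes h R :: real
  assumes h: "h > 0"
  shows "finite (cell h ` cball (0::'a::euclidean_space) R)"
proof -
  let ?Z = "Pi\<^sub>E (Basis :: 'a set) (\<lambda>_. {\<lfloor>- R / h\<rfloor>..\<lfloor>R / h\<rfloor>})"
  have "cell h ` cball 0 R \<subseteq> (\<lambda>f. {y. \<forall>b\<in>Basis. \<lfloor>y \<bullet> b / h\<rfloor> = f b}) ` ?Z"
  proof (rule image_subsetI)
    fix x :: 'a assume x: "x \<in> cball 0 R"
    let ?f = "restrict (\<lambda>b. \<lfloor>x \<bullet> b / h\<rfloor>) Basis"
    have "?f \<in> ?Z"
    proof (rule restrict_PiE_iff[THEN iffD2], intro ballI)
      fix b :: 'a assume b: "b \<in> Basis"
      have "\<bar>x \<bullet> b\<bar> \<le> R" using Basis_le_norm[OF b, of x] x by simp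
      then have "- R / h \<le> x \<bullet> b / h" "x \<bullet> b / h \<le> R / h"
        using h divide_right_mono[of "- R" "x \<bullet> b" h] divide_right_mono[of "x \<bullet> b" R h]
        by (auto simp: abs_le_iff)
      then show "\<lfloor>x \<bullet> b / h\<rfloor> \<in> {\<lfloor>- R / h\<rfloor>..\<lfloor>R / h\<rfloor>}" by (auto intro: floor_mono)
    qed
    moreover have "cell h x = {y. \<forall>b\<in>Basis. \<lfloor>y \<bullet> b / h\<rfloor> = ?f b}" by (auto simp: cell_def)
    ultimately show "cell h x \<in> (\<lambda>f. {y. \<forall>b\<in>Basis. \<lfloor>y \<bullet> b / h\<rfloor> = f b}) ` ?Z" by blast
  qed
  then show ?thesis by (rule finite_subset) (auto intro!: finite_imageI finite_PiE)
qed

text \<open>A quantitative Rellich theorem: \<open>u\<close> is its deviation from the cell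
  averages, of order \<open>h\<close>, plus the averages, of which a ball sees only finitely many.
  The integrals over cells are the functionals behind the compactness assumption.\<close>

lemma local_L2_bound:
  fixes u :: "'a::euclidean_space \<Rightarrow> real" and h G :: real
  assumes h: "h > 0" and u: "square_integrable lborel u"
    and trans: "\<And>z. (\<integral>x. (u (x + z) - u x)\<^sup>2 \<partial>lborel) \<le> (norm z)\<^sup>2 * G"
  shows "(\<integral>x. indicator (cball 0 R) x * (u x)\<^sup>2 \<partial>lborel) \<le> 2 * (2 ^ DIM('a) * DIM('a) * h\<^sup>2 * G)
    + 2 / h ^ DIM('a) * (\<Sum>Q\<in>cell h ` cball 0 R. (\<integral>x. indicator Q x * u x \<partial>lborel)\<^sup>2)"
proof -
  let ?\<Q> = "cell h ` cball (0::'a) R" and ?V = "h ^ DIM('a)"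
  have V: "?V > 0" using h by simp
  have fin: "finite ?\<Q>" by (rule finite_cells_cball[OF h])
  let ?l = "\<lambda>Q. (\<integral>x. indicator Q x * u x \<partial>lborel)"
  have Q: "integrable lborel (\<lambda>x. indicator Q x :: real)" "(\<integral>x. indicator Q x \<partial>lborel) = ?V" if "Q \<in> ?\<Q>" for Q
    using that cell_emeasure(2,3)[OF h] by auto
  note dev = cell_deviation[OF h u trans]
  have usq: "integrable lborel (\<lambda>x. (u x)\<^sup>2)" using u by (simp add: square_integrable_def)
  have devsq: "integrable lborel (\<lambda>x. (u x - cell_avg h u x)\<^sup>2)" using dev(1) by (simp add: square_integrable_def)
  have "indicator (cball 0 R) x * (u x)\<^sup>2
      \<le> 2 * (u x - cell_avg h u x)\<^sup>2 + 2 * (\<Sum>Q\<in>?\<Q>. (?l Q / ?V)\<^sup>2 * indicator Q x)" for x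
  proof (cases "x \<in> cball 0 R")
    case True
    have "(cell_avg h u x)\<^sup>2 = (?l (cell h x) / ?V)\<^sup>2 * indicator (cell h x) x"
      by (simp add: cell_avg_def cell_self)
    also have "\<dots> \<le> (\<Sum>Q\<in>?\<Q>. (?l Q / ?V)\<^sup>2 * indicator Q x)"
      using True by (intro member_le_sum fin) auto
    finally have le: "(cell_avg h u x)\<^sup>2 \<le> (\<Sum>Q\<in>?\<Q>. (?l Q / ?V)\<^sup>2 * indicator Q x)" .
    have "(u x)\<^sup>2 = ((u x - cell_avg h u x) + cell_avg h u x)\<^sup>2" by simp
    also have "\<dots> \<le> 2 * (u x - cell_avg h u x)\<^sup>2 + 2 * (cell_avg h u x)\<^sup>2"
      unfolding power2_sum using sum_squares_bound[of "u x - cell_avg h u x" "cell_avg h u x"] by linarith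
    finally show ?thesis using le True by simp
  next
    case False
    have "0 \<le> (\<Sum>Q\<in>?\<Q>. (?l Q / ?V)\<^sup>2 * indicator Q x)" by (intro sum_nonneg) simp
    then show ?thesis using False by simp
  qed
  moreover have "integrable lborel (\<lambda>x. indicator (cball 0 R) x * (u x)\<^sup>2)"
    using usq by (rule integrable_mult_indicator[where 'b = real, simplified real_scaleR_def, rotated]) simp
  moreover have "integrable lborel (\<lambda>x. 2 * (u x - cell_avg h u x)\<^sup>2 + 2 * (\<Sum>Q\<in>?\<Q>. (?l Q / ?V)\<^sup>2 * indicator Q x))"
    using devsq Q(1) by (intro Bochner_Integration.integrable_add integrable_mult_right Bochner_Integration.integrable_sum)
  ultimately have "(\<integral>x. indicator (cball 0 R) x * (u x)\<^sup>2 \<partial>lborel)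
      \<le> (\<integral>x. 2 * (u x - cell_avg h u x)\<^sup>2 + 2 * (\<Sum>Q\<in>?\<Q>. (?l Q / ?V)\<^sup>2 * indicator Q x) \<partial>lborel)"
    by (intro integral_mono)
  also have "\<dots> = 2 * (\<integral>x. (u x - cell_avg h u x)\<^sup>2 \<partial>lborel) + 2 * (\<Sum>Q\<in>?\<Q>. (?l Q / ?V)\<^sup>2 * ?V)"
    using devsq Q by (subst Bochner_Integration.integral_add) (auto intro!: sum.cong)
  also have "\<dots> \<le> 2 * (2 ^ DIM('a) * DIM('a) * h\<^sup>2 * G) + 2 * (\<Sum>Q\<in>?\<Q>. (?l Q / ?V)\<^sup>2 * ?V)"
    using dev(2) by simp
  also have "2 * (\<Sum>Q\<in>?\<Q>. (?l Q / ?V)\<^sup>2 * ?V) = 2 / ?V * (\<Sum>Q\<in>?\<Q>. (?l Q)\<^sup>2)"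
    using h by (simp add: sum_distrib_left power2_eq_square)
  finally show ?thesis .
qed

section \<open>Sobolev spaces\<close>

lemma tendsto_0_le:
  fixes f g :: "nat \<Rightarrow> real"
  assumes "\<And>k. 0 \<le> f k" "\<And>k. f k \<le> C * g k" "g \<longlonglongrightarrow> 0"
  shows "f \<longlonglongrightarrow> 0"
proof -
  have "(\<lambda>k. C * g k) \<longlonglongrightarrow> C * 0" by (intro tendsto_intros assms)
  then have lim: "(\<lambda>k. C * g k) \<longlonglongrightarrow> 0" by simp
  show ?thesis by (rule tendsto_sandwich[OF _ _ tendsto_const lim]) (use assms in auto)
qed

definition energy_form ::
  "'a::euclidean_space set \<Rightarrow> real \<Rightarrow> ('a \<Rightarrow> real) \<Rightarrow> ('a \<Rightarrow> real) \<Rightarrow> real" where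
  "energy_form \<Omega> lam u v =
    (\<integral>x. weak_gradient \<Omega> u x \<bullet> weak_gradient \<Omega> v x + lam * u x * v x \<partial>lebesgue_on \<Omega>)"

lemma H1_norm_eq: "H1_norm \<Omega> u = sqrt (energy_form \<Omega> 1 u u)"
  by (simp add: H1_norm_def energy_form_def power2_norm_eq_inner power2_eq_square[of "u _"] add.commute)

lemma has_weak_gradient_AE_cong:
  fixes u v :: "'a::euclidean_space \<Rightarrow> real"
  assumes "AE x in lebesgue_on \<Omega>. u x = v x"
    "u \<in> borel_measurable (lebesgue_on \<Omega>)" "v \<in> borel_measurable (lebesgue_on \<Omega>)"
    and test: "\<And>\<phi> b. \<phi> \<in> test_functions \<Omega> \<Longrightarrow>
      (\<lambda>x. frechet_derivative \<phi> (at x) b) \<in> borel_measurable (lebesgue_on \<Omega>)"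
  shows "has_weak_gradient \<Omega> u = has_weak_gradient \<Omega> v"
proof -
  have "(\<integral>x. u x * frechet_derivative \<phi> (at x) b \<partial>lebesgue_on \<Omega>)
      = (\<integral>x. v x * frechet_derivative \<phi> (at x) b \<partial>lebesgue_on \<Omega>)" if "\<phi> \<in> test_functions \<Omega>" for \<phi> b
    using assms(2,3) test[OF that, of b] by (intro integral_cong_AE) (use assms(1) in auto)
  then show ?thesis unfolding has_weak_gradient_def by (intro ext) auto
qed

context
  fixes \<Omega> :: "'a::euclidean_space set"
  assumes \<Omega>: "open \<Omega>"
begin

section \<open>Passing between the domain and the whole space\<close>

lemma domain_sets: "\<Omega> \<in> sets lebesgue" "\<Omega> \<in> sets borel"
  using \<Omega> by (auto intro: lmeasurable_open)

lemma borel_imp_measurable_on: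
  "f \<in> borel_measurable borel \<Longrightarrow> f \<in> borel_measurable (lebesgue_on \<Omega>)"
  by (intro measurable_restrict_space1 measurable_completion) simp

lemma AE_lborel_imp_on: "AE x in lborel. Q x \<Longrightarrow> AE x in lebesgue_on \<Omega>. Q x"
  using AE_completion[of Q lborel] domain_sets by (subst AE_restrict_space_iff) auto

lemma integral_on_eq_lborel:
  fixes f :: "'a \<Rightarrow> real"
  assumes "f \<in> borel_measurable borel"
  shows "(\<integral>x. f x \<partial>lebesgue_on \<Omega>) = (\<integral>x. indicator \<Omega> x * f x \<partial>lborel)"
    "integrable (lebesgue_on \<Omega>) f \<longleftrightarrow> integrable lborel (\<lambda>x. indicator \<Omega> x * f x)"
proof -
  have m: "(\<lambda>x. indicator \<Omega> x * f x) \<in> borel_measurable lborel"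
    using assms domain_sets by auto
  show "(\<integral>x. f x \<partial>lebesgue_on \<Omega>) = (\<integral>x. indicator \<Omega> x * f x \<partial>lborel)"
    using domain_sets integral_completion[OF m] by (subst integral_restrict_space) auto
  show "integrable (lebesgue_on \<Omega>) f \<longleftrightarrow> integrable lborel (\<lambda>x. indicator \<Omega> x * f x)"
    using domain_sets integrable_completion[OF m] by (subst integrable_restrict_space) auto
qed

lemma integral_on_eq_lborel_supported:
  fixes f :: "'a \<Rightarrow> real"
  assumes "f \<in> borel_measurable borel" "\<And>x. x \<notin> \<Omega> \<Longrightarrow> f x = 0"
  shows "(\<integral>x. f x \<partial>lebesgue_on \<Omega>) = (\<integral>x. f x \<partial>lborel)"
    "integrable (lebesgue_on \<Omega>) f \<longleftrightarrow> integrable lborel f"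
proof -
  have "indicator \<Omega> x * f x = f x" for x using assms(2)[of x] by (cases "x \<in> \<Omega>") auto
  then have "(\<lambda>x. indicator \<Omega> x * f x) = f" by blast
  then show "(\<integral>x. f x \<partial>lebesgue_on \<Omega>) = (\<integral>x. f x \<partial>lborel)"
    "integrable (lebesgue_on \<Omega>) f \<longleftrightarrow> integrable lborel f"
    using integral_on_eq_lborel[OF assms(1)] by auto
qed

lemma square_integrable_lborel_imp_on:
  fixes f :: "'a \<Rightarrow> real"
  assumes "square_integrable lborel f"
  shows "square_integrable (lebesgue_on \<Omega>) f"
proof -
  have f: "f \<in> borel_measurable borel" using assms by (simp add: square_integrable_def)
  have "integrable lborel (\<lambda>x. indicator \<Omega> x *\<^sub>R (f x)\<^sup>2)"
    using assms domain_sets by (intro integrable_mult_indicator) (auto simp: square_integrable_def)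
  then have "integrable (lebesgue_on \<Omega>) (\<lambda>x. (f x)\<^sup>2)"
    using f by (subst integral_on_eq_lborel(2)) auto
  then show ?thesis using borel_imp_measurable_on[OF f] by (simp add: square_integrable_def)
qed

lemma test_square_integrable_on:
  assumes "\<phi> \<in> test_functions \<Omega>'"
  shows "square_integrable (lebesgue_on \<Omega>) \<phi>"
    "square_integrable (lebesgue_on \<Omega>) (\<lambda>x. frechet_derivative \<phi> (at x) z)"
  using test_functions_square_integrable[OF assms] test_functions_square_integrable[OF test_functions_deriv[OF assms]]
  by (auto intro: square_integrable_lborel_imp_on)

text \<open>Functions on the domain are Lebesgue measurable and arbitrary outside it; the estimates
  by translation require Borel functions on the whole space. The representative is also the
  extension by zero.\<close>

lemma borel_representative:
  fixes u :: "'a \<Rightarrow> real"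
  assumes "u \<in> borel_measurable (lebesgue_on \<Omega>)"
  obtains u' where "u' \<in> borel_measurable borel" "\<And>x. x \<notin> \<Omega> \<Longrightarrow> u' x = 0" "AE x in lebesgue_on \<Omega>. u x = u' x"
proof -
  have "(\<lambda>x. indicator \<Omega> x *\<^sub>R u x) \<in> borel_measurable lebesgue"
    using assms domain_sets by (subst borel_measurable_restrict_space_iff[symmetric]) auto
  then obtain v where v: "v \<in> borel_measurable lborel" "AE x in lborel. indicator \<Omega> x *\<^sub>R u x = v x"
    using completion_ex_borel_measurable_real by blast
  have "AE x in lebesgue_on \<Omega>. indicator \<Omega> x *\<^sub>R u x = v x" by (rule AE_lborel_imp_on[OF v(2)])
  then have "AE x in lebesgue_on \<Omega>. u x = indicator \<Omega> x * v x"
    using AE_space[of "lebesgue_on \<Omega>"] by eventually_elim (auto simp: space_restrict_space)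
  moreover have "(\<lambda>x. indicator \<Omega> x * v x) \<in> borel_measurable borel" using v(1) domain_sets by auto
  ultimately show thesis by (intro that[of "\<lambda>x. indicator \<Omega> x * v x"]) auto
qed

lemma L2_representative:
  fixes u :: "'a \<Rightarrow> real"
  assumes u: "square_integrable (lebesgue_on \<Omega>) u"
  obtains u' where "square_integrable lborel u'" "\<And>x. x \<notin> \<Omega> \<Longrightarrow> u' x = 0" "AE x in lebesgue_on \<Omega>. u x = u' x"
proof -
  have um: "u \<in> borel_measurable (lebesgue_on \<Omega>)" and ui: "integrable (lebesgue_on \<Omega>) (\<lambda>x. (u x)\<^sup>2)"
    using u by (auto simp: square_integrable_def)
  obtain u' where u': "u' \<in> borel_measurable borel" "\<And>x. x \<notin> \<Omega> \<Longrightarrow> u' x = 0" "AE x in lebesgue_on \<Omega>. u x = u' x"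
    by (rule borel_representative[OF um]) (rule that; assumption)
  have "integrable (lebesgue_on \<Omega>) (\<lambda>x. (u' x)\<^sup>2)"
    using ui by (rule integrable_cong_AE_imp)
      (use u' borel_imp_measurable_on[OF u'(1)] in \<open>auto elim: eventually_mono\<close>)
  then have "integrable lborel (\<lambda>x. (u' x)\<^sup>2)"
    using u' by (subst (asm) integral_on_eq_lborel_supported(2)) auto
  then show thesis using u' by (intro that[of u']) (auto simp: square_integrable_def)
qed

text \<open>The fundamental lemma of the calculus of variations, by density: by Pythagoras an
  approximation of \<open>g\<close> by a function orthogonal to it has squared error at least the
  squared norm of \<open>g\<close>.\<close>

lemma orthogonal_to_test_functions:
  fixes g :: "'a \<Rightarrow> real"
  assumes g: "square_integrable (lebesgue_on \<Omega>) g"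
    and orth: "\<And>\<phi>. \<phi> \<in> test_functions \<Omega> \<Longrightarrow> (\<integral>x. g x * \<phi> x \<partial>lebesgue_on \<Omega>) = 0"
  shows "AE x in lebesgue_on \<Omega>. g x = 0"
proof -
  obtain g' where g': "square_integrable lborel g'" "\<And>x. x \<notin> \<Omega> \<Longrightarrow> g' x = 0" "AE x in lebesgue_on \<Omega>. g x = g' x"
    by (rule L2_representative[OF g]) (rule that; assumption)
  have g'm: "g' \<in> borel_measurable borel" and g'i: "integrable lborel (\<lambda>x. (g' x)\<^sup>2)"
    using g'(1) by (auto simp: square_integrable_def)
  have "(\<integral>x. (g' x)\<^sup>2 \<partial>lborel) \<le> 0 + e" if e: "e > 0" for e
  proof -
    have "g' \<in> L2_closure \<Omega>" by (rule test_functions_dense[OF \<Omega> g'(1,2)])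
    then obtain \<phi> where \<phi>: "\<phi> \<in> test_functions \<Omega>" "(\<integral>x. (g' x - \<phi> x)\<^sup>2 \<partial>lborel) < e"
      using e by (auto simp: L2_closure_def)
    have \<phi>sq: "square_integrable lborel \<phi>" by (rule test_functions_square_integrable[OF \<phi>(1)])
    have \<phi>m: "\<phi> \<in> borel_measurable borel" by (rule test_functions_measurable[OF \<phi>(1)])
    have "(\<integral>x. g' x * \<phi> x \<partial>lborel) = (\<integral>x. g' x * \<phi> x \<partial>lebesgue_on \<Omega>)"
      using g'm \<phi>m g'(2) by (intro integral_on_eq_lborel_supported(1)[symmetric]) auto
    also have "\<dots> = (\<integral>x. g x * \<phi> x \<partial>lebesgue_on \<Omega>)"
      using g'(3) g borel_imp_measurable_on[OF g'm] borel_imp_measurable_on[OF \<phi>m]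
      by (intro integral_cong_AE) (auto simp: square_integrable_def)
    also have "\<dots> = 0" by (rule orth[OF \<phi>(1)])
    finally have zero: "(\<integral>x. g' x * \<phi> x \<partial>lborel) = 0" .
    have "integrable lborel (\<lambda>x. (\<phi> x)\<^sup>2)" using \<phi>sq by (simp add: square_integrable_def)
    then have "(\<integral>x. (g' x - \<phi> x)\<^sup>2 \<partial>lborel) = (\<integral>x. (g' x)\<^sup>2 \<partial>lborel) + (\<integral>x. (\<phi> x)\<^sup>2 \<partial>lborel)"
      using g'i square_integrable_mult[OF g'(1) \<phi>sq] zero by (simp add: power2_diff mult.assoc)
    moreover have "0 \<le> (\<integral>x. (\<phi> x)\<^sup>2 \<partial>lborel)" by simp
    ultimately show ?thesis using \<phi>(2) by linarith
  qed
  then have "(\<integral>x. (g' x)\<^sup>2 \<partial>lborel) \<le> 0" by (rule field_le_epsilon)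
  moreover have "0 \<le> (\<integral>x. (g' x)\<^sup>2 \<partial>lborel)" by simp
  ultimately have "(\<integral>x. (g' x)\<^sup>2 \<partial>lborel) = 0" by simp
  then have "AE x in lborel. (g' x)\<^sup>2 = 0" using integral_nonneg_eq_0_iff_AE[OF g'i] by simp
  then have "AE x in lebesgue_on \<Omega>. (g' x)\<^sup>2 = 0" by (rule AE_lborel_imp_on)
  then show ?thesis using g'(3) by eventually_elim simp
qed

text \<open>\<open>weak_gradient\<close> is a choice; uniqueness almost everywhere is what relates
  the gradients chosen for \<open>u\<close>, \<open>v\<close> and \<open>u + r v\<close>.\<close>

lemma has_weak_gradient_unique:
  assumes g: "g \<in> L2 \<Omega>" "has_weak_gradient \<Omega> u g" and h: "h \<in> L2 \<Omega>" "has_weak_gradient \<Omega> u h"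
  shows "AE x in lebesgue_on \<Omega>. g x = h x"
proof -
  have sq: "square_integrable (lebesgue_on \<Omega>) (\<lambda>x. g x \<bullet> b)" "square_integrable (lebesgue_on \<Omega>) (\<lambda>x. h x \<bullet> b)" for b
    using g h by (auto simp: L2_iff intro: square_integrable_inner_const)
  have "AE x in lebesgue_on \<Omega>. g x \<bullet> b - h x \<bullet> b = 0" if b: "b \<in> Basis" for b
  proof (rule orthogonal_to_test_functions)
    show "square_integrable (lebesgue_on \<Omega>) (\<lambda>x. g x \<bullet> b - h x \<bullet> b)"
      by (intro square_integrable_diff sq)
    fix \<phi> :: "'a \<Rightarrow> real" assume \<phi>: "\<phi> \<in> test_functions \<Omega>"
    have "(\<integral>x. (g x \<bullet> b) * \<phi> x \<partial>lebesgue_on \<Omega>) = (\<integral>x. (h x \<bullet> b) * \<phi> x \<partial>lebesgue_on \<Omega>)"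
      using g(2) h(2) \<phi> b unfolding has_weak_gradient_def by force
    then show "(\<integral>x. (g x \<bullet> b - h x \<bullet> b) * \<phi> x \<partial>lebesgue_on \<Omega>) = 0"
      using square_integrable_mult[OF sq(1) test_square_integrable_on(1)[OF \<phi>], of b]
        square_integrable_mult[OF sq(2) test_square_integrable_on(1)[OF \<phi>], of b]
      by (simp add: left_diff_distrib)
  qed
  then have "AE x in lebesgue_on \<Omega>. \<forall>b\<in>Basis. g x \<bullet> b - h x \<bullet> b = 0"
    by (intro AE_finite_allI) auto
  then show ?thesis by eventually_elim (auto intro: euclidean_eqI)
qed

lemma has_weak_gradient_add:
  assumes u: "square_integrable (lebesgue_on \<Omega>) u" and v: "square_integrable (lebesgue_on \<Omega>) v"
    and g: "square_integrable (lebesgue_on \<Omega>) g" "has_weak_gradient \<Omega> u g"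
    and h: "square_integrable (lebesgue_on \<Omega>) h" "has_weak_gradient \<Omega> v h"
  shows "has_weak_gradient \<Omega> (\<lambda>x. u x + r * v x) (\<lambda>x. g x + r *\<^sub>R h x)"
  unfolding has_weak_gradient_def
proof (intro ballI)
  fix \<phi> :: "'a \<Rightarrow> real" and b :: 'a assume \<phi>: "\<phi> \<in> test_functions \<Omega>" and b: "b \<in> Basis"
  note t = test_square_integrable_on[OF \<phi>]
  have "(\<integral>x. (u x + r * v x) * frechet_derivative \<phi> (at x) b \<partial>lebesgue_on \<Omega>)
      = (\<integral>x. u x * frechet_derivative \<phi> (at x) b \<partial>lebesgue_on \<Omega>) + r * (\<integral>x. v x * frechet_derivative \<phi> (at x) b \<partial>lebesgue_on \<Omega>)"
    using square_integrable_mult[OF u t(2), of b] square_integrable_mult[OF v t(2), of b]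
    by (simp add: distrib_right mult.assoc)
  moreover have "(\<integral>x. ((g x + r *\<^sub>R h x) \<bullet> b) * \<phi> x \<partial>lebesgue_on \<Omega>)
      = (\<integral>x. (g x \<bullet> b) * \<phi> x \<partial>lebesgue_on \<Omega>) + r * (\<integral>x. (h x \<bullet> b) * \<phi> x \<partial>lebesgue_on \<Omega>)"
    using square_integrable_mult[OF square_integrable_inner_const[OF g(1)] t(1), of b]
      square_integrable_mult[OF square_integrable_inner_const[OF h(1)] t(1), of b]
    by (simp add: inner_add_left distrib_right mult.assoc)
  ultimately show "(\<integral>x. (u x + r * v x) * frechet_derivative \<phi> (at x) b \<partial>lebesgue_on \<Omega>)
      = - (\<integral>x. ((g x + r *\<^sub>R h x) \<bullet> b) * \<phi> x \<partial>lebesgue_on \<Omega>)"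
    using g(2) h(2) \<phi> b by (simp add: has_weak_gradient_def)
qed

section \<open>The space H^1 and its energy form\<close>

lemma H1_square_integrable: "u \<in> H1 \<Omega> \<Longrightarrow> square_integrable (lebesgue_on \<Omega>) u"
  by (simp add: H1_def L2_iff)

lemma weak_gradient:
  assumes "u \<in> H1 \<Omega>"
  shows "square_integrable (lebesgue_on \<Omega>) (weak_gradient \<Omega> u)" "has_weak_gradient \<Omega> u (weak_gradient \<Omega> u)"
proof -
  have "\<exists>g. g \<in> L2 \<Omega> \<and> has_weak_gradient \<Omega> u g" using assms by (auto simp: H1_def)
  from someI_ex[OF this] show "square_integrable (lebesgue_on \<Omega>) (weak_gradient \<Omega> u)"
    "has_weak_gradient \<Omega> u (weak_gradient \<Omega> u)"
    by (simp_all add: weak_gradient_def L2_iff)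
qed

lemma weak_gradient_eqI:
  assumes "square_integrable (lebesgue_on \<Omega>) u" "square_integrable (lebesgue_on \<Omega>) g" "has_weak_gradient \<Omega> u g"
  shows "u \<in> H1 \<Omega>" "AE x in lebesgue_on \<Omega>. weak_gradient \<Omega> u x = g x"
proof -
  show u: "u \<in> H1 \<Omega>" using assms by (auto simp: H1_def L2_iff)
  show "AE x in lebesgue_on \<Omega>. weak_gradient \<Omega> u x = g x"
    using weak_gradient[OF u] assms by (intro has_weak_gradient_unique[of _ u]) (auto simp: L2_iff)
qed

lemma H1_add:
  assumes u: "u \<in> H1 \<Omega>" and v: "v \<in> H1 \<Omega>"
  shows "(\<lambda>x. u x + r * v x) \<in> H1 \<Omega>"
    "AE x in lebesgue_on \<Omega>. weak_gradient \<Omega> (\<lambda>x. u x + r * v x) x = weak_gradient \<Omega> u x + r *\<^sub>R weak_gradient \<Omega> v x"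
proof -
  have sq: "square_integrable (lebesgue_on \<Omega>) (\<lambda>x. u x + r * v x)"
    using square_integrable_add[OF H1_square_integrable[OF u] H1_square_integrable[OF v], of r] by simp
  show "(\<lambda>x. u x + r * v x) \<in> H1 \<Omega>"
    "AE x in lebesgue_on \<Omega>. weak_gradient \<Omega> (\<lambda>x. u x + r * v x) x = weak_gradient \<Omega> u x + r *\<^sub>R weak_gradient \<Omega> v x"
    by (rule weak_gradient_eqI[OF sq square_integrable_add[OF weak_gradient(1)[OF u] weak_gradient(1)[OF v]]
          has_weak_gradient_add[OF H1_square_integrable[OF u] H1_square_integrable[OF v]
            weak_gradient[OF u] weak_gradient[OF v]]])+
qed

lemma H1_zero: "(\<lambda>_. 0) \<in> H1 \<Omega>"
  by (rule weak_gradient_eqI(1)[where g = "\<lambda>_. 0"]) (auto simp: square_integrable_def has_weak_gradient_def)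

lemma energy_integrable:
  assumes u: "u \<in> H1 \<Omega>" and v: "v \<in> H1 \<Omega>"
  shows "integrable (lebesgue_on \<Omega>) (\<lambda>x. weak_gradient \<Omega> u x \<bullet> weak_gradient \<Omega> v x)"
    "integrable (lebesgue_on \<Omega>) (\<lambda>x. u x * v x)"
    "integrable (lebesgue_on \<Omega>) (\<lambda>x. weak_gradient \<Omega> u x \<bullet> weak_gradient \<Omega> v x + lam * u x * v x)"
proof -
  show 1: "integrable (lebesgue_on \<Omega>) (\<lambda>x. weak_gradient \<Omega> u x \<bullet> weak_gradient \<Omega> v x)"
    by (intro square_integrable_inner weak_gradient u v)
  show 2: "integrable (lebesgue_on \<Omega>) (\<lambda>x. u x * v x)"
    by (intro square_integrable_mult H1_square_integrable u v)
  show "integrable (lebesgue_on \<Omega>) (\<lambda>x. weak_gradient \<Omega> u x \<bullet> weak_gradient \<Omega> v x + lam * u x * v x)"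
    using 1 integrable_mult_right[OF 2, of lam] by (simp add: mult.assoc)
qed

lemma energy_form_eq:
  assumes u: "u \<in> H1 \<Omega>" and v: "v \<in> H1 \<Omega>"
  shows "energy_form \<Omega> lam u v = (\<integral>x. weak_gradient \<Omega> u x \<bullet> weak_gradient \<Omega> v x \<partial>lebesgue_on \<Omega>)
    + lam * (\<integral>x. u x * v x \<partial>lebesgue_on \<Omega>)"
  using energy_integrable[OF u v] by (simp add: energy_form_def mult.assoc)

lemma energy_form_self:
  assumes u: "u \<in> H1 \<Omega>"
  shows "energy_form \<Omega> lam u u = (\<integral>x. (norm (weak_gradient \<Omega> u x))\<^sup>2 \<partial>lebesgue_on \<Omega>)
    + lam * (\<integral>x. (u x)\<^sup>2 \<partial>lebesgue_on \<Omega>)"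
  using energy_form_eq[OF u u, of lam] by (simp add: power2_norm_eq_inner power2_eq_square[of "u _"])

lemma pos_form_energy:
  assumes lam: "lam \<ge> 0"
  shows "pos_form (H1 \<Omega>) (energy_form \<Omega> lam)"
proof
  show "(\<lambda>_. 0) \<in> H1 \<Omega>" by (rule H1_zero)
  show "(\<lambda>x. u x + r * v x) \<in> H1 \<Omega>" if "u \<in> H1 \<Omega>" "v \<in> H1 \<Omega>" for u v r
    by (rule H1_add[OF that])
  show "energy_form \<Omega> lam u v = energy_form \<Omega> lam v u" for u v
    by (simp add: energy_form_def inner_commute mult_ac)
  show "energy_form \<Omega> lam (\<lambda>x. u x + r * v x) w = energy_form \<Omega> lam u w + r * energy_form \<Omega> lam v w"
    if u: "u \<in> H1 \<Omega>" and v: "v \<in> H1 \<Omega>" and w: "w \<in> H1 \<Omega>" for u v w r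
  proof -
    have meas: "weak_gradient \<Omega> f \<in> borel_measurable (lebesgue_on \<Omega>)" if "f \<in> H1 \<Omega>" for f
      using weak_gradient(1)[OF that] by (simp add: square_integrable_def)
    have "(\<integral>x. weak_gradient \<Omega> (\<lambda>x. u x + r * v x) x \<bullet> weak_gradient \<Omega> w x \<partial>lebesgue_on \<Omega>)
        = (\<integral>x. weak_gradient \<Omega> u x \<bullet> weak_gradient \<Omega> w x + r * (weak_gradient \<Omega> v x \<bullet> weak_gradient \<Omega> w x) \<partial>lebesgue_on \<Omega>)"
    proof (rule integral_cong_AE)
      show "AE x in lebesgue_on \<Omega>. weak_gradient \<Omega> (\<lambda>x. u x + r * v x) x \<bullet> weak_gradient \<Omega> w x
          = weak_gradient \<Omega> u x \<bullet> weak_gradient \<Omega> w x + r * (weak_gradient \<Omega> v x \<bullet> weak_gradient \<Omega> w x)"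
        using H1_add(2)[OF u v, of r] by eventually_elim (simp add: inner_add_left)
    qed (use meas[OF H1_add(1)[OF u v, of r]] meas[OF u] meas[OF v] meas[OF w] in auto)
    moreover have "(\<integral>x. (u x + r * v x) * w x \<partial>lebesgue_on \<Omega>)
        = (\<integral>x. u x * w x \<partial>lebesgue_on \<Omega>) + r * (\<integral>x. v x * w x \<partial>lebesgue_on \<Omega>)"
      using energy_integrable(2)[OF u w] energy_integrable(2)[OF v w] by (simp add: distrib_right mult.assoc)
    ultimately show ?thesis
      using energy_integrable(1)[OF u w] energy_integrable(1)[OF v w]
      by (simp add: energy_form_eq u v w H1_add(1) algebra_simps)
  qed
  show "0 \<le> energy_form \<Omega> lam u u" if "u \<in> H1 \<Omega>" for u
    using lam by (simp add: energy_form_self[OF that])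
qed

lemma test_functions_H1:
  assumes \<phi>: "\<phi> \<in> test_functions \<Omega>"
  shows "\<phi> \<in> H1 \<Omega>"
    "b \<in> Basis \<Longrightarrow> AE x in lebesgue_on \<Omega>. weak_gradient \<Omega> \<phi> x \<bullet> b = frechet_derivative \<phi> (at x) b"
proof -
  define g where "g = (\<lambda>x. \<Sum>b\<in>Basis. frechet_derivative \<phi> (at x) b *\<^sub>R b)"
  have gb: "g x \<bullet> b = frechet_derivative \<phi> (at x) b" if "b \<in> Basis" for x b
    using that by (simp add: g_def inner_sum_left inner_Basis if_distrib[of "\<lambda>t. _ * t"] cong: if_cong)
  have sq: "square_integrable (lebesgue_on \<Omega>) (\<lambda>x. frechet_derivative \<phi> (at x) b)" for b
    by (rule test_square_integrable_on(2)[OF \<phi>])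
  have g: "square_integrable (lebesgue_on \<Omega>) g"
    unfolding square_integrable_def
  proof
    show "g \<in> borel_measurable (lebesgue_on \<Omega>)"
      unfolding g_def by (intro borel_measurable_sum borel_measurable_scaleR borel_measurable_const)
        (use sq in \<open>auto simp: square_integrable_def\<close>)
    have "(norm (g x))\<^sup>2 = (\<Sum>b\<in>Basis. (frechet_derivative \<phi> (at x) b)\<^sup>2)" for x
    proof -
      have "(norm (g x))\<^sup>2 = (\<Sum>b\<in>Basis. (g x \<bullet> b) * (g x \<bullet> b))"
        using euclidean_inner[of "g x" "g x"] by (simp only: power2_norm_eq_inner)
      then show ?thesis by (simp add: gb power2_eq_square)
    qed
    then show "integrable (lebesgue_on \<Omega>) (\<lambda>x. (norm (g x))\<^sup>2)"
      using sq by (simp add: square_integrable_def)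
  qed
  have weak: "has_weak_gradient \<Omega> \<phi> g"
    unfolding has_weak_gradient_def
  proof (intro ballI)
    fix \<xi> :: "'a \<Rightarrow> real" and b :: 'a assume \<xi>: "\<xi> \<in> test_functions \<Omega>" and b: "b \<in> Basis"
    have supp: "f x = 0" if "f \<in> test_functions \<Omega>" "x \<notin> \<Omega>" for f x
      using that by (auto simp: test_functions_iff)
    have m: "f \<in> borel_measurable borel" "(\<lambda>x. frechet_derivative f (at x) b) \<in> borel_measurable borel"
      if "f \<in> test_functions \<Omega>" for f
      using test_functions_measurable[OF that] test_functions_measurable[OF test_functions_deriv[OF that]] by auto
    have "(\<integral>x. \<phi> x * frechet_derivative \<xi> (at x) b \<partial>lebesgue_on \<Omega>) = (\<integral>x. \<phi> x * frechet_derivative \<xi> (at x) b \<partial>lborel)"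
      using m[OF \<phi>] m[OF \<xi>] supp[OF \<phi>] by (intro integral_on_eq_lborel_supported) auto
    also have "\<dots> = - (\<integral>x. frechet_derivative \<phi> (at x) b * \<xi> x \<partial>lborel)"
      by (rule test_integration_by_parts[OF \<phi> \<xi>])
    also have "(\<integral>x. frechet_derivative \<phi> (at x) b * \<xi> x \<partial>lborel) = (\<integral>x. frechet_derivative \<phi> (at x) b * \<xi> x \<partial>lebesgue_on \<Omega>)"
      using m[OF \<phi>] m[OF \<xi>] supp[OF \<xi>] by (intro integral_on_eq_lborel_supported[symmetric]) auto
    finally show "(\<integral>x. \<phi> x * frechet_derivative \<xi> (at x) b \<partial>lebesgue_on \<Omega>) = - (\<integral>x. (g x \<bullet> b) * \<xi> x \<partial>lebesgue_on \<Omega>)"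
      by (simp add: gb b)
  qed
  show "\<phi> \<in> H1 \<Omega>"
    by (rule weak_gradient_eqI(1)[OF test_square_integrable_on(1)[OF \<phi>] g weak])
  show "AE x in lebesgue_on \<Omega>. weak_gradient \<Omega> \<phi> x \<bullet> b = frechet_derivative \<phi> (at x) b" if "b \<in> Basis"
    using weak_gradient_eqI(2)[OF test_square_integrable_on(1)[OF \<phi>] g weak]
    by eventually_elim (simp add: gb that)
qed

lemma H1_0_iff:
  "u \<in> H1_0 \<Omega> \<longleftrightarrow> u \<in> H1 \<Omega> \<and> (\<exists>\<phi>::nat \<Rightarrow> 'a \<Rightarrow> real. (\<forall>k. \<phi> k \<in> test_functions \<Omega>) \<and>
    (\<lambda>k. energy_form \<Omega> 1 (\<lambda>x. u x - \<phi> k x) (\<lambda>x. u x - \<phi> k x)) \<longlonglongrightarrow> 0)"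
proof -
  interpret P: pos_form "H1 \<Omega>" "energy_form \<Omega> 1" by (rule pos_form_energy) simp
  have "((\<lambda>k. H1_norm \<Omega> (\<lambda>x. u x - \<phi> k x)) \<longlonglongrightarrow> 0)
      \<longleftrightarrow> ((\<lambda>k. energy_form \<Omega> 1 (\<lambda>x. u x - \<phi> k x) (\<lambda>x. u x - \<phi> k x)) \<longlonglongrightarrow> 0)"
    if u: "u \<in> H1 \<Omega>" and \<phi>: "\<forall>k. \<phi> k \<in> test_functions \<Omega>" for \<phi> :: "nat \<Rightarrow> 'a \<Rightarrow> real"
  proof -
    let ?E = "\<lambda>k. energy_form \<Omega> 1 (\<lambda>x. u x - \<phi> k x) (\<lambda>x. u x - \<phi> k x)"
    have nn: "0 \<le> ?E k" for k
      using \<phi> by (intro P.nonneg P.diff_mem u test_functions_H1(1)) auto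
    show ?thesis unfolding H1_norm_eq
    proof
      assume "(\<lambda>k. sqrt (?E k)) \<longlonglongrightarrow> 0"
      then have "(\<lambda>k. (sqrt (?E k))\<^sup>2) \<longlonglongrightarrow> 0\<^sup>2" by (intro tendsto_power)
      then show "?E \<longlonglongrightarrow> 0" using nn by simp
    next
      assume "?E \<longlonglongrightarrow> 0"
      then have "(\<lambda>k. sqrt (?E k)) \<longlonglongrightarrow> sqrt 0" by (rule tendsto_real_sqrt)
      then show "(\<lambda>k. sqrt (?E k)) \<longlonglongrightarrow> 0" by simp
    qed
  qed
  then show ?thesis unfolding H1_0_def by blast
qed

section \<open>The space H\<close>

lemma Hspace_H1: "u \<in> Hspace \<Omega> \<Longrightarrow> u \<in> H1 \<Omega>"
  by (auto simp: Hspace_def H1_radial_def H1_0_def split: if_splits)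

lemma Hspace_zero: "(\<lambda>_. 0) \<in> Hspace \<Omega>"
proof (cases "\<Omega> = UNIV")
  case True
  then show ?thesis using H1_zero by (auto simp: Hspace_def H1_radial_def)
next
  case False
  interpret P: pos_form "H1 \<Omega>" "energy_form \<Omega> 1" by (rule pos_form_energy) simp
  have "(\<lambda>_. 0) \<in> H1_0 \<Omega>"
    unfolding H1_0_iff using H1_zero test_functions_zero P.zero_left[OF H1_zero]
    by (auto intro!: exI[of _ "\<lambda>_ _. 0"])
  then show ?thesis using False by (simp add: Hspace_def)
qed

lemma Hspace_add:
  assumes u: "u \<in> Hspace \<Omega>" and v: "v \<in> Hspace \<Omega>"
  shows "(\<lambda>x. u x + r * v x) \<in> Hspace \<Omega>"
proof (cases "\<Omega> = UNIV")
  case True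
  then obtain h k where h: "AE x in lebesgue. u x = h (norm x)" and k: "AE x in lebesgue. v x = k (norm x)"
    using u v by (auto simp: Hspace_def H1_radial_def)
  have "AE x in lebesgue. u x + r * v x = h (norm x) + r * k (norm x)"
    using h k by eventually_elim simp
  then show ?thesis using True H1_add(1)[OF Hspace_H1[OF u] Hspace_H1[OF v], of r]
    by (auto simp: Hspace_def H1_radial_def intro!: exI[of _ "\<lambda>t. h t + r * k t"])
next
  case False
  interpret P: pos_form "H1 \<Omega>" "energy_form \<Omega> 1" by (rule pos_form_energy) simp
  have uH: "u \<in> H1 \<Omega>" and vH: "v \<in> H1 \<Omega>" using u v by (auto intro: Hspace_H1)
  obtain \<phi> \<xi> where \<phi>: "\<And>k. \<phi> k \<in> test_functions \<Omega>"
      "(\<lambda>k. energy_form \<Omega> 1 (\<lambda>x. u x - \<phi> k x) (\<lambda>x. u x - \<phi> k x)) \<longlonglongrightarrow> 0"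
    and \<xi>: "\<And>k. \<xi> k \<in> test_functions \<Omega>"
      "(\<lambda>k. energy_form \<Omega> 1 (\<lambda>x. v x - \<xi> k x) (\<lambda>x. v x - \<xi> k x)) \<longlonglongrightarrow> 0"
  proof -
    have "u \<in> H1_0 \<Omega>" "v \<in> H1_0 \<Omega>" using u v False by (auto simp: Hspace_def)
    then show thesis using that unfolding H1_0_iff by blast
  qed
  let ?d = "\<lambda>k x. u x - \<phi> k x" and ?e = "\<lambda>k x. v x - \<xi> k x"
  have d: "?d k \<in> H1 \<Omega>" and e: "?e k \<in> H1 \<Omega>" for k
    by (intro P.diff_mem uH vH test_functions_H1(1) \<phi> \<xi>)+
  let ?E = "\<lambda>w. energy_form \<Omega> 1 w w"
  have w: "(\<lambda>x. (u x + r * v x) - (\<phi> k x + r * \<xi> k x)) = (\<lambda>x. ?d k x - (- r) * ?e k x)" for k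
    by (simp add: algebra_simps)
  have le: "?E (\<lambda>x. ?d k x - (- r) * ?e k x) \<le> 1 * (2 * ?E (?d k) + 2 * (r\<^sup>2 * ?E (?e k)))" for k
  proof -
    have "?E (\<lambda>x. (- r) * ?e k x) = r\<^sup>2 * ?E (?e k)"
      using P.scale_left[OF e[of k] P.scale_mem[OF e[of k], of "- r"], of "- r"]
        P.scale_right[OF e[of k] e[of k], of "- r"]
      by (simp add: power2_eq_square)
    then show ?thesis using P.diff_le[OF d[of k] P.scale_mem[OF e[of k], of "- r"]] by simp
  qed
  have nn: "0 \<le> ?E (\<lambda>x. ?d k x - (- r) * ?e k x)" for k
    by (rule P.nonneg[OF P.diff_mem[OF d P.scale_mem[OF e]]])
  have "(\<lambda>k. 2 * ?E (?d k) + 2 * (r\<^sup>2 * ?E (?e k))) \<longlonglongrightarrow> 2 * 0 + 2 * (r\<^sup>2 * 0)"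
    by (intro tendsto_intros \<phi> \<xi>)
  then have lim: "(\<lambda>k. 2 * ?E (?d k) + 2 * (r\<^sup>2 * ?E (?e k))) \<longlonglongrightarrow> 0" by (simp only: mult_zero_right add_0)
  have "(\<lambda>k. ?E (\<lambda>x. (u x + r * v x) - (\<phi> k x + r * \<xi> k x))) \<longlonglongrightarrow> 0"
    unfolding w by (rule tendsto_0_le[OF nn le lim])
  then have "(\<lambda>x. u x + r * v x) \<in> H1_0 \<Omega>"
    unfolding H1_0_iff using H1_add(1)[OF uH vH, of r] test_functions_add_scaled[OF \<phi>(1) \<xi>(1), of _ r]
    by (intro conjI exI[of _ "\<lambda>k x. \<phi> k x + r * \<xi> k x"] allI)
  then show ?thesis using False by (simp add: Hspace_def)
qed

lemma pos_form_Hspace: "lam \<ge> 0 \<Longrightarrow> pos_form (Hspace \<Omega>) (energy_form \<Omega> lam)"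
proof -
  assume "lam \<ge> 0"
  then interpret P: pos_form "H1 \<Omega>" "energy_form \<Omega> lam" by (rule pos_form_energy)
  show ?thesis
    by unfold_locales (auto intro: Hspace_zero Hspace_add P.sym P.lincomb P.nonneg Hspace_H1)
qed

text \<open>Since the two predicates are equal, the choice operator returns literally the same
  gradient for both functions, not merely one that agrees almost everywhere.\<close>

lemma weak_gradient_AE_cong:
  assumes v: "square_integrable (lebesgue_on \<Omega>) v" and uv: "AE x in lebesgue_on \<Omega>. u x = v x"
    and u: "u \<in> borel_measurable (lebesgue_on \<Omega>)"
  shows "square_integrable (lebesgue_on \<Omega>) u" "has_weak_gradient \<Omega> u = has_weak_gradient \<Omega> v"
    "weak_gradient \<Omega> u = weak_gradient \<Omega> v"
proof -
  show "square_integrable (lebesgue_on \<Omega>) u"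
    by (rule square_integrable_dominated[OF v u, where C = 1]) (use uv in auto)
  have vm: "v \<in> borel_measurable (lebesgue_on \<Omega>)" using v by (simp add: square_integrable_def)
  show eq: "has_weak_gradient \<Omega> u = has_weak_gradient \<Omega> v"
    by (rule has_weak_gradient_AE_cong[OF uv u vm])
      (use test_square_integrable_on(2) in \<open>auto simp: square_integrable_def\<close>)
  show "weak_gradient \<Omega> u = weak_gradient \<Omega> v" by (simp add: weak_gradient_def eq)
qed

end

lemma L2_inner_limit:
  fixes f :: "nat \<Rightarrow> 'a \<Rightarrow> real"
  assumes f: "\<And>k. square_integrable M (f k)" and g: "square_integrable M g" and w: "square_integrable M w"
    and lim: "(\<lambda>k. \<integral>x. (f k x - g x)\<^sup>2 \<partial>M) \<longlonglongrightarrow> 0"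
  shows "(\<lambda>k. \<integral>x. f k x * w x \<partial>M) \<longlonglongrightarrow> (\<integral>x. g x * w x \<partial>M)"
proof -
  have "((\<integral>x. f k x * w x \<partial>M) - (\<integral>x. g x * w x \<partial>M))\<^sup>2
      \<le> (\<integral>x. (f k x - g x)\<^sup>2 \<partial>M) * (\<integral>x. (w x)\<^sup>2 \<partial>M)" for k
    using L2_Cauchy_Schwarz[OF square_integrable_diff[OF f g] w, of k]
      square_integrable_mult[OF f w, of k] square_integrable_mult[OF g w]
    by (simp add: left_diff_distrib)
  then have "(\<lambda>k. ((\<integral>x. f k x * w x \<partial>M) - (\<integral>x. g x * w x \<partial>M))\<^sup>2) \<longlonglongrightarrow> 0"
    by (intro tendsto_0_le[OF _ _ lim, where C = "\<integral>x. (w x)\<^sup>2 \<partial>M"]) (simp_all add: mult.commute)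
  then have "(\<lambda>k. sqrt (((\<integral>x. f k x * w x \<partial>M) - (\<integral>x. g x * w x \<partial>M))\<^sup>2)) \<longlonglongrightarrow> sqrt 0"
    by (rule tendsto_real_sqrt)
  then show ?thesis by (simp add: tendsto_rabs_zero_iff LIM_zero_iff)
qed

section \<open>Null sets, completeness and extension by zero\<close>

context
  fixes \<Omega> :: "'a::euclidean_space set"
  assumes \<Omega>: "open \<Omega>"
begin

lemma measurable_on_AE:
  fixes u v :: "'a \<Rightarrow> real"
  assumes u: "u \<in> borel_measurable (lebesgue_on \<Omega>)" and uv: "AE x in lebesgue_on \<Omega>. u x = v x"
  shows "v \<in> borel_measurable (lebesgue_on \<Omega>)"
proof -
  note dom = domain_sets[OF \<Omega>]
  have "(\<lambda>x. indicator \<Omega> x *\<^sub>R u x) \<in> borel_measurable lebesgue"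
    using u dom by (subst borel_measurable_restrict_space_iff[symmetric]) auto
  moreover have "AE x in lebesgue. indicator \<Omega> x *\<^sub>R u x = indicator \<Omega> x *\<^sub>R v x"
    using uv dom by (subst (asm) AE_restrict_space_iff) (auto elim!: eventually_mono simp: indicator_def)
  ultimately have "(\<lambda>x. indicator \<Omega> x *\<^sub>R v x) \<in> borel_measurable lebesgue" by (rule borel_measurable_AE)
  then show ?thesis using dom by (subst borel_measurable_restrict_space_iff) auto
qed

lemma H1_AE_cong:
  assumes u: "u \<in> H1 \<Omega>" and uv: "AE x in lebesgue_on \<Omega>. u x = v x"
  shows "v \<in> H1 \<Omega>" "weak_gradient \<Omega> v = weak_gradient \<Omega> u"
proof -
  note sq = H1_square_integrable[OF \<Omega> u]
  have vm: "v \<in> borel_measurable (lebesgue_on \<Omega>)"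
    using measurable_on_AE[OF _ uv] sq by (simp add: square_integrable_def)
  have vu: "AE x in lebesgue_on \<Omega>. v x = u x" using uv by eventually_elim simp
  note cong = weak_gradient_AE_cong[OF \<Omega> sq vu vm]
  show "v \<in> H1 \<Omega>" using u cong(1,2) by (auto simp: H1_def L2_iff)
  show "weak_gradient \<Omega> v = weak_gradient \<Omega> u" by (rule cong(3))
qed

lemma energy_form_AE_cong:
  assumes u: "u \<in> H1 \<Omega>" and uv: "AE x in lebesgue_on \<Omega>. u x = v x" and w: "w \<in> H1 \<Omega>"
  shows "energy_form \<Omega> lam v w = energy_form \<Omega> lam u w"
proof -
  note v = H1_AE_cong[OF u uv]
  have m: "f \<in> borel_measurable (lebesgue_on \<Omega>)" "weak_gradient \<Omega> f \<in> borel_measurable (lebesgue_on \<Omega>)"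
    if "f \<in> H1 \<Omega>" for f
    using H1_square_integrable[OF \<Omega> that] weak_gradient(1)[OF \<Omega> that] by (auto simp: square_integrable_def)
  show ?thesis unfolding energy_form_def v(2)
    by (rule integral_cong_AE) (use m[OF u] m[OF w] m[OF v(1)] uv in \<open>auto elim: eventually_mono\<close>)
qed

lemma Hspace_AE_cong:
  assumes u: "u \<in> Hspace \<Omega>" and uv: "AE x in lebesgue_on \<Omega>. u x = v x"
  shows "v \<in> Hspace \<Omega>"
proof (cases "\<Omega> = UNIV")
  case True
  then obtain h where "AE x in lebesgue. u x = h (norm x)" using u by (auto simp: Hspace_def H1_radial_def)
  moreover have "AE x in lebesgue. u x = v x" using uv unfolding True lebesgue_on_UNIV_eq .
  ultimately have "AE x in lebesgue. v x = h (norm x)" by eventually_elim simp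
  then show ?thesis using True H1_AE_cong(1)[OF Hspace_H1[OF \<Omega> u] uv] by (auto simp: Hspace_def H1_radial_def)
next
  case False
  interpret P: pos_form "H1 \<Omega>" "energy_form \<Omega> 1" by (rule pos_form_energy[OF \<Omega>]) simp
  have uH: "u \<in> H1 \<Omega>" by (rule Hspace_H1[OF \<Omega> u])
  have "u \<in> H1_0 \<Omega>" using u False by (simp add: Hspace_def)
  then obtain \<phi> where \<phi>: "\<And>k. \<phi> k \<in> test_functions \<Omega>"
      "(\<lambda>k. energy_form \<Omega> 1 (\<lambda>x. u x - \<phi> k x) (\<lambda>x. u x - \<phi> k x)) \<longlonglongrightarrow> 0"
    unfolding H1_0_iff[OF \<Omega>] by blast
  have "energy_form \<Omega> 1 (\<lambda>x. v x - \<phi> k x) (\<lambda>x. v x - \<phi> k x) = energy_form \<Omega> 1 (\<lambda>x. u x - \<phi> k x) (\<lambda>x. u x - \<phi> k x)" for k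
  proof -
    have d: "(\<lambda>x. u x - \<phi> k x) \<in> H1 \<Omega>" by (intro P.diff_mem uH test_functions_H1(1)[OF \<Omega>] \<phi>)
    have AE: "AE x in lebesgue_on \<Omega>. u x - \<phi> k x = v x - \<phi> k x" using uv by eventually_elim simp
    note dv = H1_AE_cong(1)[OF d AE]
    show ?thesis
      using energy_form_AE_cong[OF d AE dv] energy_form_AE_cong[OF d AE d] P.sym[OF d dv] by simp
  qed
  then have "v \<in> H1_0 \<Omega>" unfolding H1_0_iff[OF \<Omega>] using \<phi> H1_AE_cong(1)[OF uH uv]
    by (intro conjI exI[of _ \<phi>] allI) simp_all
  then show ?thesis using False by (simp add: Hspace_def)
qed

lemma energy_bounds:
  assumes u: "u \<in> H1 \<Omega>" and lam: "lam > 0"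
  shows "(\<integral>x. (norm (weak_gradient \<Omega> u x))\<^sup>2 \<partial>lebesgue_on \<Omega>) \<le> energy_form \<Omega> lam u u"
    "(\<integral>x. (u x)\<^sup>2 \<partial>lebesgue_on \<Omega>) \<le> 1 / lam * energy_form \<Omega> lam u u"
    "energy_form \<Omega> 1 u u \<le> (1 + 1 / lam) * energy_form \<Omega> lam u u"
proof -
  let ?G = "\<integral>x. (norm (weak_gradient \<Omega> u x))\<^sup>2 \<partial>lebesgue_on \<Omega>" and ?W = "\<integral>x. (u x)\<^sup>2 \<partial>lebesgue_on \<Omega>"
  have nn: "0 \<le> ?G" "0 \<le> ?W" by simp_all
  note E = energy_form_self[OF \<Omega> u]
  show G: "?G \<le> energy_form \<Omega> lam u u" using nn lam by (simp add: E)
  show W: "?W \<le> 1 / lam * energy_form \<Omega> lam u u" using nn lam by (simp add: E field_simps)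
  show "energy_form \<Omega> 1 u u \<le> (1 + 1 / lam) * energy_form \<Omega> lam u u"
    using G W E[of 1] by (simp add: distrib_right)
qed

lemma weak_gradient_diff_integral:
  assumes u: "u \<in> H1 \<Omega>" and v: "v \<in> H1 \<Omega>"
  shows "(\<integral>x. (norm (weak_gradient \<Omega> (\<lambda>x. u x - v x) x))\<^sup>2 \<partial>lebesgue_on \<Omega>)
    = (\<integral>x. (norm (weak_gradient \<Omega> u x - weak_gradient \<Omega> v x))\<^sup>2 \<partial>lebesgue_on \<Omega>)"
proof (rule integral_cong_AE)
  have d: "(\<lambda>x. u x - v x) \<in> H1 \<Omega>" using H1_add(1)[OF \<Omega> u v, of "-1"] by simp
  have m: "weak_gradient \<Omega> f \<in> borel_measurable (lebesgue_on \<Omega>)" if "f \<in> H1 \<Omega>" for f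
    using weak_gradient(1)[OF \<Omega> that] by (auto simp: square_integrable_def)
  show "(\<lambda>x. (norm (weak_gradient \<Omega> (\<lambda>x. u x - v x) x))\<^sup>2) \<in> borel_measurable (lebesgue_on \<Omega>)"
    "(\<lambda>x. (norm (weak_gradient \<Omega> u x - weak_gradient \<Omega> v x))\<^sup>2) \<in> borel_measurable (lebesgue_on \<Omega>)"
    using m[OF d] m[OF u] m[OF v] by auto
  have "AE x in lebesgue_on \<Omega>. weak_gradient \<Omega> (\<lambda>x. u x - v x) x = weak_gradient \<Omega> u x - weak_gradient \<Omega> v x"
    using H1_add(2)[OF \<Omega> u v, of "-1"] by simp
  then show "AE x in lebesgue_on \<Omega>. (norm (weak_gradient \<Omega> (\<lambda>x. u x - v x) x))\<^sup>2
      = (norm (weak_gradient \<Omega> u x - weak_gradient \<Omega> v x))\<^sup>2"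
    by eventually_elim simp
qed

lemma H1_limit:
  assumes u: "\<And>k. u k \<in> H1 \<Omega>" and v: "square_integrable (lebesgue_on \<Omega>) v"
    and g: "square_integrable (lebesgue_on \<Omega>) g"
    and lim: "(\<lambda>k. \<integral>x. (u k x - v x)\<^sup>2 \<partial>lebesgue_on \<Omega>) \<longlonglongrightarrow> 0"
      "(\<lambda>k. \<integral>x. (norm (weak_gradient \<Omega> (u k) x - g x))\<^sup>2 \<partial>lebesgue_on \<Omega>) \<longlonglongrightarrow> 0"
    and w: "square_integrable (lebesgue_on \<Omega>) w" and b: "b \<in> Basis"
  shows "(\<lambda>k. \<integral>x. u k x * w x \<partial>lebesgue_on \<Omega>) \<longlonglongrightarrow> (\<integral>x. v x * w x \<partial>lebesgue_on \<Omega>)"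
    "(\<lambda>k. \<integral>x. (weak_gradient \<Omega> (u k) x \<bullet> b) * w x \<partial>lebesgue_on \<Omega>) \<longlonglongrightarrow> (\<integral>x. (g x \<bullet> b) * w x \<partial>lebesgue_on \<Omega>)"
proof -
  show "(\<lambda>k. \<integral>x. u k x * w x \<partial>lebesgue_on \<Omega>) \<longlonglongrightarrow> (\<integral>x. v x * w x \<partial>lebesgue_on \<Omega>)"
    by (rule L2_inner_limit[OF H1_square_integrable[OF \<Omega> u] v w lim(1)])
  have gu: "square_integrable (lebesgue_on \<Omega>) (\<lambda>x. weak_gradient \<Omega> (u k) x - g x)" for k
    by (intro square_integrable_diff weak_gradient(1)[OF \<Omega>] u g)
  have "(\<lambda>k. \<integral>x. (weak_gradient \<Omega> (u k) x \<bullet> b - g x \<bullet> b)\<^sup>2 \<partial>lebesgue_on \<Omega>) \<longlonglongrightarrow> 0"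
  proof (rule tendsto_0_le[OF _ _ lim(2)])
    show "(\<integral>x. (weak_gradient \<Omega> (u k) x \<bullet> b - g x \<bullet> b)\<^sup>2 \<partial>lebesgue_on \<Omega>)
        \<le> (norm b)\<^sup>2 * (\<integral>x. (norm (weak_gradient \<Omega> (u k) x - g x))\<^sup>2 \<partial>lebesgue_on \<Omega>)" for k
      using L2_norm_inner_le[OF gu, of k b] by (simp add: inner_diff_left)
  qed simp
  then show "(\<lambda>k. \<integral>x. (weak_gradient \<Omega> (u k) x \<bullet> b) * w x \<partial>lebesgue_on \<Omega>) \<longlonglongrightarrow> (\<integral>x. (g x \<bullet> b) * w x \<partial>lebesgue_on \<Omega>)"
    by (intro L2_inner_limit square_integrable_inner_const weak_gradient(1)[OF \<Omega>] u g w)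
qed

text \<open>The functions and their gradients converge separately in L^2, and the limit of the
  gradients is the gradient of the limit because the test identity passes to the limit. What remains
  is that radial symmetry, respectively approximability by test functions, survives.\<close>

lemma Hspace_complete:
  assumes lam: "lam > 0" and f: "\<And>k::nat. f k \<in> Hspace \<Omega>"
    and Cauchy: "\<And>e. e > 0 \<Longrightarrow> \<exists>N. \<forall>k\<ge>N. \<forall>l\<ge>N. energy_form \<Omega> lam (\<lambda>x. f k x - f l x) (\<lambda>x. f k x - f l x) < e"
  shows "\<exists>u\<in>Hspace \<Omega>. (\<lambda>k. energy_form \<Omega> lam (\<lambda>x. f k x - u x) (\<lambda>x. f k x - u x)) \<longlonglongrightarrow> 0"
proof -
  interpret P: pos_form "H1 \<Omega>" "energy_form \<Omega> 1" by (rule pos_form_energy[OF \<Omega>]) simp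
  have fH: "f k \<in> H1 \<Omega>" for k by (rule Hspace_H1[OF \<Omega> f])
  have dH: "(\<lambda>x. f k x - f l x) \<in> H1 \<Omega>" for k l by (rule P.diff_mem[OF fH fH])
  obtain u r where u: "square_integrable (lebesgue_on \<Omega>) u" "(\<lambda>k. \<integral>x. (norm (f k x - u x))\<^sup>2 \<partial>lebesgue_on \<Omega>) \<longlonglongrightarrow> 0"
    "strict_mono (r::nat \<Rightarrow> nat)" "AE x in lebesgue_on \<Omega>. (\<lambda>k. f (r k) x) \<longlonglongrightarrow> u x"
  proof (rule L2_complete[of "lebesgue_on \<Omega>" f])
    show "square_integrable (lebesgue_on \<Omega>) (f k)" for k by (rule H1_square_integrable[OF \<Omega> fH])
    fix e :: real assume "e > 0"
    then have "lam * e > 0" using lam by simp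
    then obtain N where N: "\<forall>k\<ge>N. \<forall>l\<ge>N. energy_form \<Omega> lam (\<lambda>x. f k x - f l x) (\<lambda>x. f k x - f l x) < lam * e"
      using Cauchy by blast
    have "(\<integral>x. (norm (f k x - f l x))\<^sup>2 \<partial>lebesgue_on \<Omega>) < e" if "k \<ge> N" "l \<ge> N" for k l
    proof -
      have "(\<integral>x. (f k x - f l x)\<^sup>2 \<partial>lebesgue_on \<Omega>) \<le> 1 / lam * energy_form \<Omega> lam (\<lambda>x. f k x - f l x) (\<lambda>x. f k x - f l x)"
        by (rule energy_bounds(2)[OF dH lam])
      also have "\<dots> < 1 / lam * (lam * e)" using N that lam by (intro mult_strict_left_mono) auto
      finally show ?thesis using lam by simp
    qed
    then show "\<exists>N. \<forall>k\<ge>N. \<forall>l\<ge>N. (\<integral>x. (norm (f k x - f l x))\<^sup>2 \<partial>lebesgue_on \<Omega>) < e" by blast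
  qed
  obtain g where g: "square_integrable (lebesgue_on \<Omega>) g"
    "(\<lambda>k. \<integral>x. (norm (weak_gradient \<Omega> (f k) x - g x))\<^sup>2 \<partial>lebesgue_on \<Omega>) \<longlonglongrightarrow> 0"
  proof (rule L2_complete[of "lebesgue_on \<Omega>" "\<lambda>k. weak_gradient \<Omega> (f k)"])
    show "square_integrable (lebesgue_on \<Omega>) (weak_gradient \<Omega> (f k))" for k by (rule weak_gradient(1)[OF \<Omega> fH])
    fix e :: real assume "e > 0"
    then obtain N where N: "\<forall>k\<ge>N. \<forall>l\<ge>N. energy_form \<Omega> lam (\<lambda>x. f k x - f l x) (\<lambda>x. f k x - f l x) < e"
      using Cauchy by blast
    have "(\<integral>x. (norm (weak_gradient \<Omega> (f k) x - weak_gradient \<Omega> (f l) x))\<^sup>2 \<partial>lebesgue_on \<Omega>) < e"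
      if "k \<ge> N" "l \<ge> N" for k l
      using energy_bounds(1)[OF dH lam, of k l] N that
      unfolding weak_gradient_diff_integral[OF fH fH] by (meson le_less_trans)
    then show "\<exists>N. \<forall>k\<ge>N. \<forall>l\<ge>N. (\<integral>x. (norm (weak_gradient \<Omega> (f k) x - weak_gradient \<Omega> (f l) x))\<^sup>2 \<partial>lebesgue_on \<Omega>) < e"
      by blast
  qed blast
  have lim_u: "(\<lambda>k. \<integral>x. (f k x - u x)\<^sup>2 \<partial>lebesgue_on \<Omega>) \<longlonglongrightarrow> 0" using u(2) by simp
  have weak: "has_weak_gradient \<Omega> u g"
    unfolding has_weak_gradient_def
  proof (intro ballI)
    fix \<phi> :: "'a \<Rightarrow> real" and b :: 'a assume \<phi>: "\<phi> \<in> test_functions \<Omega>" and b: "b \<in> Basis"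
    note t = test_square_integrable_on[OF \<Omega> \<phi>]
    have "(\<lambda>k. \<integral>x. f k x * frechet_derivative \<phi> (at x) b \<partial>lebesgue_on \<Omega>)
        \<longlonglongrightarrow> (\<integral>x. u x * frechet_derivative \<phi> (at x) b \<partial>lebesgue_on \<Omega>)"
      by (rule H1_limit(1)[OF fH u(1) g(1) lim_u g(2) t(2) b])
    moreover have "(\<lambda>k. - (\<integral>x. (weak_gradient \<Omega> (f k) x \<bullet> b) * \<phi> x \<partial>lebesgue_on \<Omega>))
        \<longlonglongrightarrow> - (\<integral>x. (g x \<bullet> b) * \<phi> x \<partial>lebesgue_on \<Omega>)"
      by (intro tendsto_minus H1_limit(2)[OF fH u(1) g(1) lim_u g(2) t(1) b])
    moreover have "(\<integral>x. f k x * frechet_derivative \<phi> (at x) b \<partial>lebesgue_on \<Omega>)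
        = - (\<integral>x. (weak_gradient \<Omega> (f k) x \<bullet> b) * \<phi> x \<partial>lebesgue_on \<Omega>)" for k
      using weak_gradient(2)[OF \<Omega> fH] \<phi> b by (simp add: has_weak_gradient_def)
    ultimately show "(\<integral>x. u x * frechet_derivative \<phi> (at x) b \<partial>lebesgue_on \<Omega>) = - (\<integral>x. (g x \<bullet> b) * \<phi> x \<partial>lebesgue_on \<Omega>)"
      using LIMSEQ_unique by simp
  qed
  note uH = weak_gradient_eqI(1)[OF \<Omega> u(1) g(1) weak]
  have wg: "(\<integral>x. (norm (weak_gradient \<Omega> (f k) x - weak_gradient \<Omega> u x))\<^sup>2 \<partial>lebesgue_on \<Omega>)
      = (\<integral>x. (norm (weak_gradient \<Omega> (f k) x - g x))\<^sup>2 \<partial>lebesgue_on \<Omega>)" for k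
  proof (rule integral_cong_AE)
    show "AE x in lebesgue_on \<Omega>. (norm (weak_gradient \<Omega> (f k) x - weak_gradient \<Omega> u x))\<^sup>2
        = (norm (weak_gradient \<Omega> (f k) x - g x))\<^sup>2"
      using weak_gradient_eqI(2)[OF \<Omega> u(1) g(1) weak] by eventually_elim simp
  qed (use g(1) weak_gradient(1)[OF \<Omega> fH, of k] weak_gradient(1)[OF \<Omega> uH] in \<open>auto simp: square_integrable_def\<close>)
  have lim: "(\<lambda>k. energy_form \<Omega> l (\<lambda>x. f k x - u x) (\<lambda>x. f k x - u x)) \<longlonglongrightarrow> 0" for l
  proof -
    have "energy_form \<Omega> l (\<lambda>x. f k x - u x) (\<lambda>x. f k x - u x)
        = (\<integral>x. (norm (weak_gradient \<Omega> (f k) x - g x))\<^sup>2 \<partial>lebesgue_on \<Omega>) + l * (\<integral>x. (f k x - u x)\<^sup>2 \<partial>lebesgue_on \<Omega>)" for k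
      unfolding energy_form_self[OF \<Omega> P.diff_mem[OF fH uH]] weak_gradient_diff_integral[OF fH uH] wg ..
    moreover have "(\<lambda>k. (\<integral>x. (norm (weak_gradient \<Omega> (f k) x - g x))\<^sup>2 \<partial>lebesgue_on \<Omega>) + l * (\<integral>x. (f k x - u x)\<^sup>2 \<partial>lebesgue_on \<Omega>))
        \<longlonglongrightarrow> 0 + l * 0"
      by (intro tendsto_intros g(2) lim_u)
    ultimately show ?thesis by simp
  qed
  have "u \<in> Hspace \<Omega>"
  proof (cases "\<Omega> = UNIV")
    case True
    have "\<forall>k. \<exists>h. AE x in lebesgue. f k x = h (norm x)"
      using f True by (auto simp: Hspace_def H1_radial_def)
    then obtain h where h: "\<And>k. AE x in lebesgue. f k x = h k (norm x)" by metis
    have "AE x in lebesgue. \<forall>k. f k x = h k (norm x)" using h by (simp add: AE_all_countable)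
    moreover have "AE x in lebesgue. (\<lambda>k. f (r k) x) \<longlonglongrightarrow> u x" using u(4) unfolding True lebesgue_on_UNIV_eq .
    ultimately have "AE x in lebesgue. u x = lim (\<lambda>k. h (r k) (norm x))"
    proof eventually_elim
      case (elim x)
      then have "(\<lambda>k. h (r k) (norm x)) \<longlonglongrightarrow> u x" by simp
      then show ?case by (simp add: limI)
    qed
    then show ?thesis using True uH
      by (auto simp: Hspace_def H1_radial_def intro!: exI[of _ "\<lambda>t. lim (\<lambda>k. h (r k) t)"])
  next
    case False
    let ?E = "\<lambda>v. energy_form \<Omega> 1 v v"
    \<comment> \<open>One test function for each \<open>f k\<close>, at energy less than
      \<open>1 / (k + 1)\<close>; this diagonal choice approximates the limit \<open>u\<close> as
      well.\<close>
    have "\<exists>\<phi>. \<phi> \<in> test_functions \<Omega> \<and> ?E (\<lambda>x. f k x - \<phi> x) < inverse (real (Suc k))" for k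
    proof -
      have "f k \<in> H1_0 \<Omega>" using f[of k] False by (simp add: Hspace_def)
      then obtain \<phi> where \<phi>: "\<forall>j. \<phi> j \<in> test_functions \<Omega>" "(\<lambda>j. ?E (\<lambda>x. f k x - \<phi> j x)) \<longlonglongrightarrow> 0"
        unfolding H1_0_iff[OF \<Omega>] by blast
      have "0 < inverse (real (Suc k))" by simp
      then have "\<forall>\<^sub>F j in sequentially. ?E (\<lambda>x. f k x - \<phi> j x) < inverse (real (Suc k))"
        by (rule order_tendstoD(2)[OF \<phi>(2)])
      then obtain j where "?E (\<lambda>x. f k x - \<phi> j x) < inverse (real (Suc k))"
        using eventually_happens by fastforce
      then show ?thesis using \<phi>(1) by blast
    qed
    then obtain \<phi> where \<phi>: "\<And>k. \<phi> k \<in> test_functions \<Omega>" "\<And>k. ?E (\<lambda>x. f k x - \<phi> k x) < inverse (real (Suc k))"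
      by metis
    have \<phi>H: "\<phi> k \<in> H1 \<Omega>" for k by (rule test_functions_H1(1)[OF \<Omega> \<phi>(1)])
    have "?E (\<lambda>x. u x - \<phi> k x) \<le> 2 * (?E (\<lambda>x. f k x - u x) + inverse (real (Suc k)))" for k
    proof -
      have "?E (\<lambda>x. (f k x - \<phi> k x) - (f k x - u x)) \<le> 2 * ?E (\<lambda>x. f k x - \<phi> k x) + 2 * ?E (\<lambda>x. f k x - u x)"
        by (rule P.diff_le[OF P.diff_mem[OF fH \<phi>H] P.diff_mem[OF fH uH]])
      then show ?thesis using \<phi>(2)[of k] by simp
    qed
    moreover have "(\<lambda>k. ?E (\<lambda>x. f k x - u x) + inverse (real (Suc k))) \<longlonglongrightarrow> 0"
      using tendsto_add[OF lim[of 1] LIMSEQ_inverse_real_of_nat] by simp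
    ultimately have "(\<lambda>k. ?E (\<lambda>x. u x - \<phi> k x)) \<longlonglongrightarrow> 0"
      by (rule tendsto_0_le[OF P.nonneg[OF P.diff_mem[OF uH \<phi>H]]])
    then have "u \<in> H1_0 \<Omega>" unfolding H1_0_iff[OF \<Omega>] using \<phi>(1) uH by blast
    then show ?thesis using False by (simp add: Hspace_def)
  qed
  then show ?thesis using lim by blast
qed

text \<open>The test functions here need not vanish at the boundary. For the approximating functions
  supported in the domain this is integration by parts on the whole space, and it passes to the
  limit. It is how the boundary condition enters: the extension by zero is weakly
  differentiable.\<close>

lemma Hspace_weak_gradient_global:
  assumes u: "u \<in> Hspace \<Omega>" and \<xi>: "\<xi> \<in> test_functions UNIV" and b: "b \<in> Basis"
  shows "(\<integral>x. u x * frechet_derivative \<xi> (at x) b \<partial>lebesgue_on \<Omega>)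
    = - (\<integral>x. (weak_gradient \<Omega> u x \<bullet> b) * \<xi> x \<partial>lebesgue_on \<Omega>)"
proof (cases "\<Omega> = UNIV")
  case True
  then show ?thesis using weak_gradient(2)[OF \<Omega> Hspace_H1[OF \<Omega> u]] \<xi> b by (simp add: has_weak_gradient_def)
next
  case False
  interpret P: pos_form "H1 \<Omega>" "energy_form \<Omega> 1" by (rule pos_form_energy[OF \<Omega>]) simp
  have uH: "u \<in> H1 \<Omega>" by (rule Hspace_H1[OF \<Omega> u])
  have "u \<in> H1_0 \<Omega>" using u False by (simp add: Hspace_def)
  then obtain \<phi> where \<phi>: "\<And>k. \<phi> k \<in> test_functions \<Omega>"
      "(\<lambda>k. energy_form \<Omega> 1 (\<lambda>x. u x - \<phi> k x) (\<lambda>x. u x - \<phi> k x)) \<longlonglongrightarrow> 0"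
    unfolding H1_0_iff[OF \<Omega>] by blast
  have \<phi>H: "\<phi> k \<in> H1 \<Omega>" for k by (rule test_functions_H1(1)[OF \<Omega> \<phi>(1)])
  have E: "energy_form \<Omega> 1 (\<lambda>x. \<phi> k x - u x) (\<lambda>x. \<phi> k x - u x) = energy_form \<Omega> 1 (\<lambda>x. u x - \<phi> k x) (\<lambda>x. u x - \<phi> k x)" for k
  proof -
    note d = P.diff_mem[OF uH \<phi>H, of k]
    show ?thesis using P.scale_left[OF d P.scale_mem[OF d, of "-1"], of "-1"] P.scale_right[OF d d, of "-1"] by simp
  qed
  have dH: "(\<lambda>x. \<phi> k x - u x) \<in> H1 \<Omega>" for k by (rule P.diff_mem[OF \<phi>H uH])
  have lim: "(\<lambda>k. \<integral>x. (\<phi> k x - u x)\<^sup>2 \<partial>lebesgue_on \<Omega>) \<longlonglongrightarrow> 0"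
    "(\<lambda>k. \<integral>x. (norm (weak_gradient \<Omega> (\<phi> k) x - weak_gradient \<Omega> u x))\<^sup>2 \<partial>lebesgue_on \<Omega>) \<longlonglongrightarrow> 0"
    by (rule tendsto_0_le[OF _ _ \<phi>(2), where C = 1];
        use energy_bounds(1,2)[OF dH, of 1] E weak_gradient_diff_integral[OF \<phi>H uH] in simp)+
  note t = test_square_integrable_on[OF \<Omega> \<xi>]
  note L = H1_limit[OF \<phi>H H1_square_integrable[OF \<Omega> uH] weak_gradient(1)[OF \<Omega> uH] lim _ b]
  have "(\<integral>x. \<phi> k x * frechet_derivative \<xi> (at x) b \<partial>lebesgue_on \<Omega>)
      = - (\<integral>x. (weak_gradient \<Omega> (\<phi> k) x \<bullet> b) * \<xi> x \<partial>lebesgue_on \<Omega>)" for k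
  proof -
    have supp: "f x = 0" if "f \<in> test_functions \<Omega>" "x \<notin> \<Omega>" for f x
      using that by (auto simp: test_functions_iff)
    have m: "f \<in> borel_measurable borel" "(\<lambda>x. frechet_derivative f (at x) b) \<in> borel_measurable borel"
      if "f \<in> test_functions \<Omega>'" for f \<Omega>'
      using test_functions_measurable[OF that] test_functions_measurable[OF test_functions_deriv[OF that]] by auto
    have "(\<integral>x. \<phi> k x * frechet_derivative \<xi> (at x) b \<partial>lebesgue_on \<Omega>) = (\<integral>x. \<phi> k x * frechet_derivative \<xi> (at x) b \<partial>lborel)"
      using m[OF \<phi>(1)] m[OF \<xi>] supp[OF \<phi>(1)] by (intro integral_on_eq_lborel_supported[OF \<Omega>]) auto
    also have "\<dots> = - (\<integral>x. frechet_derivative (\<phi> k) (at x) b * \<xi> x \<partial>lborel)"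
      by (rule test_integration_by_parts[OF \<phi>(1) \<xi>])
    also have "(\<integral>x. frechet_derivative (\<phi> k) (at x) b * \<xi> x \<partial>lborel) = (\<integral>x. frechet_derivative (\<phi> k) (at x) b * \<xi> x \<partial>lebesgue_on \<Omega>)"
      using m[OF \<phi>(1)] m[OF \<xi>] supp[OF test_functions_deriv[OF \<phi>(1)]]
      by (intro integral_on_eq_lborel_supported[OF \<Omega>, symmetric]) auto
    also have "\<dots> = (\<integral>x. (weak_gradient \<Omega> (\<phi> k) x \<bullet> b) * \<xi> x \<partial>lebesgue_on \<Omega>)"
    proof (rule integral_cong_AE)
      show "AE x in lebesgue_on \<Omega>. frechet_derivative (\<phi> k) (at x) b * \<xi> x = (weak_gradient \<Omega> (\<phi> k) x \<bullet> b) * \<xi> x"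
        using test_functions_H1(2)[OF \<Omega> \<phi>(1) b, of k] by eventually_elim simp
    qed (use t(1) test_square_integrable_on(2)[OF \<Omega> \<phi>(1)[of k], of b] weak_gradient(1)[OF \<Omega> \<phi>H[of k]]
        in \<open>auto simp: square_integrable_def\<close>)
    finally show ?thesis .
  qed
  then have "(\<lambda>k. \<integral>x. \<phi> k x * frechet_derivative \<xi> (at x) b \<partial>lebesgue_on \<Omega>)
      \<longlonglongrightarrow> - (\<integral>x. (weak_gradient \<Omega> u x \<bullet> b) * \<xi> x \<partial>lebesgue_on \<Omega>)"
    using tendsto_minus[OF L(2)[OF t(1)]] by simp
  then show ?thesis using LIMSEQ_unique[OF L(1)[OF t(2)]] by blast
qed

text \<open>Carries the estimates on the whole space over to \<open>H\<close> without any regularity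
  of the boundary.\<close>

lemma Hspace_extension:
  assumes u: "u \<in> Hspace \<Omega>"
  obtains u' where "square_integrable lborel u'" "\<And>x. x \<notin> \<Omega> \<Longrightarrow> u' x = 0" "AE x in lebesgue_on \<Omega>. u x = u' x"
    "\<And>z. (\<integral>x. (u' (x + z) - u' x)\<^sup>2 \<partial>lborel) \<le> (norm z)\<^sup>2 * (\<integral>x. (norm (weak_gradient \<Omega> u x))\<^sup>2 \<partial>lebesgue_on \<Omega>)"
proof -
  have uH: "u \<in> H1 \<Omega>" by (rule Hspace_H1[OF \<Omega> u])
  note usq = H1_square_integrable[OF \<Omega> uH] and gsq = weak_gradient(1)[OF \<Omega> uH]
  obtain u' where u': "square_integrable lborel u'" "\<And>x. x \<notin> \<Omega> \<Longrightarrow> u' x = 0" "AE x in lebesgue_on \<Omega>. u x = u' x"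
    by (rule L2_representative[OF \<Omega> usq]) (rule that; assumption)
  \<comment> \<open>Representatives are available for real functions, so the gradient is treated by
    components and reassembled.\<close>
  have "\<exists>g'. square_integrable lborel g' \<and> (\<forall>x. x \<notin> \<Omega> \<longrightarrow> g' x = 0) \<and> (AE x in lebesgue_on \<Omega>. weak_gradient \<Omega> u x \<bullet> b = g' x)" for b
    by (rule L2_representative[OF \<Omega> square_integrable_inner_const[OF gsq, of b]]) blast
  then obtain G where G: "\<And>b. square_integrable lborel (G b)" "\<And>b x. x \<notin> \<Omega> \<Longrightarrow> G b x = 0"
    "\<And>b. AE x in lebesgue_on \<Omega>. weak_gradient \<Omega> u x \<bullet> b = G b x" by metis
  define g where "g = (\<lambda>x. \<Sum>b\<in>Basis. G b x *\<^sub>R b)"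
  have gb: "g x \<bullet> b = G b x" if "b \<in> Basis" for x b
    using that by (simp add: g_def inner_sum_left inner_Basis if_distrib[of "\<lambda>t. _ * t"] cong: if_cong)
  have ng: "(norm (g x))\<^sup>2 = (\<Sum>b\<in>Basis. (G b x)\<^sup>2)" for x
  proof -
    have "(norm (g x))\<^sup>2 = (\<Sum>b\<in>Basis. (g x \<bullet> b) * (g x \<bullet> b))"
      using euclidean_inner[of "g x" "g x"] by (simp only: power2_norm_eq_inner)
    then show ?thesis by (simp add: gb power2_eq_square)
  qed
  have gm: "g \<in> borel_measurable lborel"
    unfolding g_def by (intro borel_measurable_sum borel_measurable_scaleR borel_measurable_const)
      (use G(1) in \<open>auto simp: square_integrable_def\<close>)
  have g: "square_integrable lborel g"
    using gm G(1) by (simp add: square_integrable_def ng)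
  have ngm: "(\<lambda>x. (norm (g x))\<^sup>2) \<in> borel_measurable borel" using gm by auto
  have "AE x in lebesgue_on \<Omega>. \<forall>b\<in>Basis. weak_gradient \<Omega> u x \<bullet> b = G b x"
    using G(3) by (intro AE_finite_allI) auto
  then have gAE: "AE x in lebesgue_on \<Omega>. weak_gradient \<Omega> u x = g x"
    by eventually_elim (auto intro: euclidean_eqI simp: gb)
  have "(\<integral>x. (norm (g x))\<^sup>2 \<partial>lborel) = (\<integral>x. (norm (g x))\<^sup>2 \<partial>lebesgue_on \<Omega>)"
    using ngm G(2) by (intro integral_on_eq_lborel_supported(1)[OF \<Omega>, symmetric]) (auto simp: ng)
  also have "\<dots> = (\<integral>x. (norm (weak_gradient \<Omega> u x))\<^sup>2 \<partial>lebesgue_on \<Omega>)"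
    using gAE borel_imp_measurable_on[OF \<Omega> ngm] gsq
    by (intro integral_cong_AE) (auto simp: square_integrable_def elim: eventually_mono)
  finally have norm_g: "(\<integral>x. (norm (g x))\<^sup>2 \<partial>lborel) = (\<integral>x. (norm (weak_gradient \<Omega> u x))\<^sup>2 \<partial>lebesgue_on \<Omega>)" .
  have u'm: "u' \<in> borel_measurable borel" using u'(1) by (simp add: square_integrable_def)
  have Gm: "G b \<in> borel_measurable borel" for b using G(1)[of b] by (simp add: square_integrable_def)
  have "(\<integral>x. u' x * frechet_derivative \<xi> (at x) b \<partial>lborel) = - (\<integral>x. (g x \<bullet> b) * \<xi> x \<partial>lborel)"
    if \<xi>: "\<xi> \<in> test_functions UNIV" and b: "b \<in> Basis" for \<xi> b
  proof -
    note m = test_functions_measurable[OF \<xi>] test_functions_measurable[OF test_functions_deriv[OF \<xi>], of b]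
    have "(\<integral>x. u' x * frechet_derivative \<xi> (at x) b \<partial>lborel) = (\<integral>x. u' x * frechet_derivative \<xi> (at x) b \<partial>lebesgue_on \<Omega>)"
      using u'm m u'(2) by (intro integral_on_eq_lborel_supported(1)[OF \<Omega>, symmetric]) auto
    also have "\<dots> = (\<integral>x. u x * frechet_derivative \<xi> (at x) b \<partial>lebesgue_on \<Omega>)"
      using u'(3) usq borel_imp_measurable_on[OF \<Omega> u'm] borel_imp_measurable_on[OF \<Omega> m(2)]
      by (intro integral_cong_AE) (auto simp: square_integrable_def elim: eventually_mono)
    also have "\<dots> = - (\<integral>x. (weak_gradient \<Omega> u x \<bullet> b) * \<xi> x \<partial>lebesgue_on \<Omega>)"
      by (rule Hspace_weak_gradient_global[OF u \<xi> b])
    also have "(\<integral>x. (weak_gradient \<Omega> u x \<bullet> b) * \<xi> x \<partial>lebesgue_on \<Omega>) = (\<integral>x. G b x * \<xi> x \<partial>lebesgue_on \<Omega>)"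
      using G(3)[of b] gsq borel_imp_measurable_on[OF \<Omega> Gm, of b] borel_imp_measurable_on[OF \<Omega> m(1)]
      by (intro integral_cong_AE) (auto simp: square_integrable_def elim: eventually_mono)
    also have "\<dots> = (\<integral>x. G b x * \<xi> x \<partial>lborel)"
      using Gm m G(2) by (intro integral_on_eq_lborel_supported(1)[OF \<Omega>]) auto
    finally show ?thesis by (simp add: gb b)
  qed
  then have "(\<integral>x. (u' (x + z) - u' x)\<^sup>2 \<partial>lborel) \<le> (norm z)\<^sup>2 * (\<integral>x. (norm (g x))\<^sup>2 \<partial>lborel)" for z
    by (rule translation_estimate[OF u'(1) g])
  then show thesis using that[of u'] u' norm_g by simp
qed

lemma Hspace_L4:
  assumes dim: "DIM('a) \<le> 3" and u: "u \<in> Hspace \<Omega>"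
  shows "integrable (lebesgue_on \<Omega>) (\<lambda>x. u x ^ 4)"
    "(\<integral>x. u x ^ 4 \<partial>lebesgue_on \<Omega>) \<le> 10 ^ 9 * (energy_form \<Omega> 1 u u)\<^sup>2"
proof -
  have uH: "u \<in> H1 \<Omega>" by (rule Hspace_H1[OF \<Omega> u])
  note usq = H1_square_integrable[OF \<Omega> uH]
  obtain u' where u': "square_integrable lborel u'" "\<And>x. x \<notin> \<Omega> \<Longrightarrow> u' x = 0" "AE x in lebesgue_on \<Omega>. u x = u' x"
    "\<And>z. (\<integral>x. (u' (x + z) - u' x)\<^sup>2 \<partial>lborel) \<le> (norm z)\<^sup>2 * (\<integral>x. (norm (weak_gradient \<Omega> u x))\<^sup>2 \<partial>lebesgue_on \<Omega>)"
    by (rule Hspace_extension[OF u]) (rule that; assumption)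
  note L4 = L4_bound[OF dim u'(1,4)]
  have u'm: "u' \<in> borel_measurable borel" using u'(1) by (simp add: square_integrable_def)
  have u'm': "u' \<in> borel_measurable (lebesgue_on \<Omega>)" by (rule borel_imp_measurable_on[OF \<Omega> u'm])
  have um: "u \<in> borel_measurable (lebesgue_on \<Omega>)" using usq by (simp add: square_integrable_def)
  have AE4: "AE x in lebesgue_on \<Omega>. u' x ^ k = u x ^ k" for k using u'(3) by eventually_elim simp
  have i: "integrable (lebesgue_on \<Omega>) (\<lambda>x. u' x ^ 4)" "(\<integral>x. u' x ^ 4 \<partial>lebesgue_on \<Omega>) = (\<integral>x. u' x ^ 4 \<partial>lborel)"
    using integral_on_eq_lborel_supported[OF \<Omega>, of "\<lambda>x. u' x ^ 4"] L4(1) u'm u'(2) by auto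
  show "integrable (lebesgue_on \<Omega>) (\<lambda>x. u x ^ 4)"
    by (rule integrable_cong_AE_imp[OF i(1)]) (use um AE4 in auto)
  have "(\<integral>x. u x ^ 4 \<partial>lebesgue_on \<Omega>) = (\<integral>x. u' x ^ 4 \<partial>lebesgue_on \<Omega>)"
    using um u'm' u'(3) by (intro integral_cong_AE) (auto elim: eventually_mono)
  also have "\<dots> \<le> 10 ^ 9 * ((\<integral>x. (u' x)\<^sup>2 \<partial>lborel) + (\<integral>x. (norm (weak_gradient \<Omega> u x))\<^sup>2 \<partial>lebesgue_on \<Omega>))\<^sup>2"
    using L4(2) i(2) by simp
  also have "(\<integral>x. (u' x)\<^sup>2 \<partial>lborel) = (\<integral>x. (u' x)\<^sup>2 \<partial>lebesgue_on \<Omega>)"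
    using u'm u'(2) by (intro integral_on_eq_lborel_supported(1)[OF \<Omega>, symmetric]) auto
  also have "\<dots> = (\<integral>x. (u x)\<^sup>2 \<partial>lebesgue_on \<Omega>)"
    using um u'm' u'(3) by (intro integral_cong_AE) (auto elim: eventually_mono)
  finally show "(\<integral>x. u x ^ 4 \<partial>lebesgue_on \<Omega>) \<le> 10 ^ 9 * (energy_form \<Omega> 1 u u)\<^sup>2"
    by (simp add: energy_form_self[OF \<Omega> uH] add.commute)
qed

text \<open>AM-GM on the L^4 bound. Every quartic integrand in the energy and its variations is a
  product of two such products.\<close>

lemma Hspace_mult_square_integrable:
  assumes dim: "DIM('a) \<le> 3" and u: "u \<in> Hspace \<Omega>" and v: "v \<in> Hspace \<Omega>"
  shows "square_integrable (lebesgue_on \<Omega>) (\<lambda>x. u x * v x)"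
proof -
  have m: "f \<in> borel_measurable (lebesgue_on \<Omega>)" if "f \<in> Hspace \<Omega>" for f
    using H1_square_integrable[OF \<Omega> Hspace_H1[OF \<Omega> that]] by (simp add: square_integrable_def)
  have "integrable (lebesgue_on \<Omega>) (\<lambda>x. (u x * v x)\<^sup>2)"
  proof (rule Bochner_Integration.integrable_bound)
    show "integrable (lebesgue_on \<Omega>) (\<lambda>x. u x ^ 4 + v x ^ 4)"
      using Hspace_L4(1)[OF dim u] Hspace_L4(1)[OF dim v] by simp
    have "(u x * v x)\<^sup>2 \<le> u x ^ 4 + v x ^ 4" for x
    proof -
      have "2 * (u x * v x)\<^sup>2 \<le> u x ^ 4 + v x ^ 4"
        using sum_squares_bound[of "(u x)\<^sup>2" "(v x)\<^sup>2"] by (simp add: power_mult_distrib)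
      then show ?thesis using zero_le_power2[of "u x * v x"] by linarith
    qed
    then show "AE x in lebesgue_on \<Omega>. norm ((u x * v x)\<^sup>2) \<le> norm (u x ^ 4 + v x ^ 4)" by simp
  qed (use m[OF u] m[OF v] in simp)
  then show ?thesis using m[OF u] m[OF v] by (simp add: square_integrable_def)
qed

end

section \<open>The weighted form\<close>

definition weighted_form ::
  "'a::euclidean_space set \<Rightarrow> ('a \<Rightarrow> real) \<Rightarrow> ('a \<Rightarrow> real) \<Rightarrow> ('a \<Rightarrow> real) \<Rightarrow> real" where
  "weighted_form \<Omega> U u v = (\<integral>x. (U x)\<^sup>2 * u x * v x \<partial>lebesgue_on \<Omega>)"

context
  fixes \<Omega> :: "'a::euclidean_space set"
  assumes \<Omega>: "open \<Omega>" and dim: "DIM('a) \<le> 3"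
begin

lemma Hspace_prod4_integrable:
  assumes "a \<in> Hspace \<Omega>" "b \<in> Hspace \<Omega>" "c \<in> Hspace \<Omega>" "d \<in> Hspace \<Omega>"
  shows "integrable (lebesgue_on \<Omega>) (\<lambda>x. (a x * b x) * (c x * d x))"
  by (intro square_integrable_mult Hspace_mult_square_integrable[OF \<Omega> dim] assms)

lemma weighted_integrable:
  assumes "U \<in> Hspace \<Omega>" "u \<in> Hspace \<Omega>" "v \<in> Hspace \<Omega>"
  shows "integrable (lebesgue_on \<Omega>) (\<lambda>x. (U x)\<^sup>2 * u x * v x)"
  using Hspace_prod4_integrable[OF assms(1,1,2,3)] by (simp add: power2_eq_square mult_ac)

lemma pos_form_weighted:
  assumes U: "U \<in> Hspace \<Omega>"
  shows "pos_form (Hspace \<Omega>) (weighted_form \<Omega> U)"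
proof
  show "(\<lambda>_. 0) \<in> Hspace \<Omega>" by (rule Hspace_zero[OF \<Omega>])
  show "(\<lambda>x. u x + r * v x) \<in> Hspace \<Omega>" if "u \<in> Hspace \<Omega>" "v \<in> Hspace \<Omega>" for u v r
    by (rule Hspace_add[OF \<Omega> that])
  show "weighted_form \<Omega> U u v = weighted_form \<Omega> U v u" for u v
    by (simp add: weighted_form_def mult_ac)
  show "weighted_form \<Omega> U (\<lambda>x. u x + r * v x) w = weighted_form \<Omega> U u w + r * weighted_form \<Omega> U v w"
    if "u \<in> Hspace \<Omega>" "v \<in> Hspace \<Omega>" "w \<in> Hspace \<Omega>" for u v w r
  proof -
    have "(U x)\<^sup>2 * (u x + r * v x) * w x = (U x)\<^sup>2 * u x * w x + r * ((U x)\<^sup>2 * v x * w x)" for x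
      by (simp add: algebra_simps)
    then show ?thesis
      using weighted_integrable[OF U that(1,3)] weighted_integrable[OF U that(2,3)]
      by (simp add: weighted_form_def)
  qed
  show "0 \<le> weighted_form \<Omega> U u u" for u
    by (simp add: weighted_form_def mult.assoc)
qed

lemma L2_weight_bound:
  assumes w: "square_integrable (lebesgue_on \<Omega>) w" and u: "u \<in> Hspace \<Omega>"
  shows "(\<integral>x. w x * (u x)\<^sup>2 \<partial>lebesgue_on \<Omega>)
    \<le> sqrt (\<integral>x. (w x)\<^sup>2 \<partial>lebesgue_on \<Omega>) * (10 ^ 5 * energy_form \<Omega> 1 u u)"
proof (rule power2_le_imp_le)
  let ?E = "energy_form \<Omega> 1 u u" and ?W = "\<integral>x. (w x)\<^sup>2 \<partial>lebesgue_on \<Omega>"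
  have E: "0 \<le> ?E" using pos_form.nonneg[OF pos_form_energy[OF \<Omega>, of 1] Hspace_H1[OF \<Omega> u]] by simp
  have W: "0 \<le> ?W" by simp
  have u2: "square_integrable (lebesgue_on \<Omega>) (\<lambda>x. (u x)\<^sup>2)"
    using Hspace_mult_square_integrable[OF \<Omega> dim u u] by (simp add: power2_eq_square)
  have "(\<integral>x. w x * (u x)\<^sup>2 \<partial>lebesgue_on \<Omega>)\<^sup>2 \<le> ?W * (\<integral>x. ((u x)\<^sup>2)\<^sup>2 \<partial>lebesgue_on \<Omega>)"
    by (rule L2_Cauchy_Schwarz[OF w u2])
  also have "(\<integral>x. ((u x)\<^sup>2)\<^sup>2 \<partial>lebesgue_on \<Omega>) \<le> 10 ^ 9 * ?E\<^sup>2"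
    using Hspace_L4(2)[OF \<Omega> dim u] by simp
  \<comment> \<open>\<open>10 ^ 9 \<le> (10 ^ 5)^2\<close>, so that the square root of the constant
    stays an integer.\<close>
  also have "\<dots> \<le> (10 ^ 5 * ?E)\<^sup>2" by (simp add: power_mult_distrib)
  finally show "(\<integral>x. w x * (u x)\<^sup>2 \<partial>lebesgue_on \<Omega>)\<^sup>2 \<le> (sqrt ?W * (10 ^ 5 * ?E))\<^sup>2"
    using W by (simp add: power_mult_distrib mult_left_mono)
  show "0 \<le> sqrt ?W * (10 ^ 5 * ?E)" using E W by simp
qed

lemma weighted_form_le:
  assumes lam: "lam > 0" and U: "U \<in> Hspace \<Omega>"
  shows "\<exists>C\<ge>0. \<forall>u\<in>Hspace \<Omega>. weighted_form \<Omega> U u u \<le> C * energy_form \<Omega> lam u u"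
proof -
  let ?W = "\<integral>x. ((U x)\<^sup>2)\<^sup>2 \<partial>lebesgue_on \<Omega>"
  define C where "C = sqrt ?W * 10 ^ 5 * (1 + 1 / lam)"
  have C: "C \<ge> 0" using lam by (simp add: C_def)
  have w: "square_integrable (lebesgue_on \<Omega>) (\<lambda>x. (U x)\<^sup>2)"
    using Hspace_mult_square_integrable[OF \<Omega> dim U U] by (simp add: power2_eq_square)
  have "weighted_form \<Omega> U u u \<le> C * energy_form \<Omega> lam u u" if u: "u \<in> Hspace \<Omega>" for u
  proof -
    have "weighted_form \<Omega> U u u = (\<integral>x. (U x)\<^sup>2 * (u x)\<^sup>2 \<partial>lebesgue_on \<Omega>)"
      by (simp add: weighted_form_def power2_eq_square[of "u _"] mult.assoc)
    also have "\<dots> \<le> sqrt ?W * (10 ^ 5 * energy_form \<Omega> 1 u u)" by (rule L2_weight_bound[OF w u])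
    also have "\<dots> \<le> sqrt ?W * (10 ^ 5 * ((1 + 1 / lam) * energy_form \<Omega> lam u u))"
      using energy_bounds(3)[OF \<Omega> Hspace_H1[OF \<Omega> u] lam] by (intro mult_left_mono) auto
    finally show ?thesis unfolding C_def by (simp only: mult.assoc)
  qed
  then show ?thesis using C by blast
qed

text \<open>Dominated convergence, with height and radius cut at the same \<open>k\<close>. The
  truncated weight is bounded and lives on a ball, where cell integrals give control.\<close>

lemma truncated_weight:
  fixes w :: "'a \<Rightarrow> real" and e :: real
  assumes w: "square_integrable (lebesgue_on \<Omega>) w" and e: "e > 0"
  obtains k :: nat where
    "square_integrable (lebesgue_on \<Omega>) (\<lambda>x. indicator {x. \<bar>w x\<bar> \<le> k \<and> norm x \<le> k} x * w x)"
    "(\<integral>x. (w x - indicator {x. \<bar>w x\<bar> \<le> k \<and> norm x \<le> k} x * w x)\<^sup>2 \<partial>lebesgue_on \<Omega>) < e"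
proof -
  have wm[measurable]: "w \<in> borel_measurable (lebesgue_on \<Omega>)" and wi: "integrable (lebesgue_on \<Omega>) (\<lambda>x. (w x)\<^sup>2)"
    using w by (auto simp: square_integrable_def)
  have nm[measurable]: "(\<lambda>x. norm x) \<in> borel_measurable (lebesgue_on \<Omega>)"
    by (rule borel_imp_measurable_on[OF \<Omega>]) simp
  let ?t = "\<lambda>k::nat. \<lambda>x. indicator {x. \<bar>w x\<bar> \<le> k \<and> norm x \<le> k} x * w x"
  have tm[measurable]: "?t k \<in> borel_measurable (lebesgue_on \<Omega>)" for k
  proof -
    have "(\<lambda>x. if \<bar>w x\<bar> \<le> k \<and> norm x \<le> k then w x else 0) \<in> borel_measurable (lebesgue_on \<Omega>)" by measurable
    moreover have "(\<lambda>x. if \<bar>w x\<bar> \<le> k \<and> norm x \<le> k then w x else 0) = ?t k" by (auto simp: indicator_def)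
    ultimately show ?thesis by simp
  qed
  have tsq: "square_integrable (lebesgue_on \<Omega>) (?t k)" for k
    by (rule square_integrable_dominated[OF w tm, where C = 1]) (auto simp: indicator_def)
  have "(\<lambda>k. \<integral>x. (w x - ?t k x)\<^sup>2 \<partial>lebesgue_on \<Omega>) \<longlonglongrightarrow> (\<integral>x. 0 \<partial>lebesgue_on \<Omega>)"
  proof (rule integral_dominated_convergence[OF _ _ wi])
    show "AE x in lebesgue_on \<Omega>. (\<lambda>k. (w x - ?t k x)\<^sup>2) \<longlonglongrightarrow> 0"
    proof (rule AE_I2, rule tendsto_eventually)
      fix x
      have "\<forall>\<^sub>F k in sequentially. real k \<ge> max \<bar>w x\<bar> (norm x)"
        using filterlim_real_sequentially unfolding filterlim_at_top by blast
      then show "\<forall>\<^sub>F k in sequentially. (w x - ?t k x)\<^sup>2 = 0"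
        by eventually_elim (simp add: indicator_def)
    qed
    show "AE x in lebesgue_on \<Omega>. norm ((w x - ?t k x)\<^sup>2) \<le> (w x)\<^sup>2" for k
      by (auto simp: indicator_def)
  qed measurable
  then have "\<forall>\<^sub>F k in sequentially. (\<integral>x. (w x - ?t k x)\<^sup>2 \<partial>lebesgue_on \<Omega>) < e"
    by (intro order_tendstoD(2)[where y = "\<integral>x. 0 \<partial>lebesgue_on \<Omega>"]) (use e in auto)
  then obtain k where "(\<integral>x. (w x - ?t k x)\<^sup>2 \<partial>lebesgue_on \<Omega>) < e"
    using eventually_happens by fastforce
  then show thesis using that[OF tsq] by blast
qed

lemma Hspace_local_bound:
  fixes h R :: real
  assumes h: "h > 0" and u: "u \<in> Hspace \<Omega>" and lam: "lam > 0"
  shows "(\<integral>x. indicator (cball 0 R) x * (u x)\<^sup>2 \<partial>lebesgue_on \<Omega>)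
    \<le> 2 * (2 ^ DIM('a) * DIM('a) * h\<^sup>2 * energy_form \<Omega> lam u u)
      + 2 / h ^ DIM('a) * (\<Sum>Q\<in>cell h ` cball 0 R. (\<integral>x. indicator Q x * u x \<partial>lebesgue_on \<Omega>)\<^sup>2)"
proof -
  let ?G = "\<integral>x. (norm (weak_gradient \<Omega> u x))\<^sup>2 \<partial>lebesgue_on \<Omega>"
  have uH: "u \<in> H1 \<Omega>" by (rule Hspace_H1[OF \<Omega> u])
  have um: "u \<in> borel_measurable (lebesgue_on \<Omega>)"
    using H1_square_integrable[OF \<Omega> uH] by (simp add: square_integrable_def)
  obtain u' where u': "square_integrable lborel u'" "\<And>x. x \<notin> \<Omega> \<Longrightarrow> u' x = 0" "AE x in lebesgue_on \<Omega>. u x = u' x"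
    "\<And>z. (\<integral>x. (u' (x + z) - u' x)\<^sup>2 \<partial>lborel) \<le> (norm z)\<^sup>2 * ?G"
    by (rule Hspace_extension[OF \<Omega> u]) (rule that; assumption)
  have u'm: "u' \<in> borel_measurable borel" using u'(1) by (simp add: square_integrable_def)
  have u'm': "u' \<in> borel_measurable (lebesgue_on \<Omega>)" by (rule borel_imp_measurable_on[OF \<Omega> u'm])
  have ind: "(\<lambda>x. indicator A x :: real) \<in> borel_measurable borel"
    "(\<lambda>x. indicator A x :: real) \<in> borel_measurable (lebesgue_on \<Omega>)" if "A \<in> sets borel" for A
    using that by (auto intro: borel_imp_measurable_on[OF \<Omega>])
  have eq: "(\<integral>x. indicator A x * (u x) ^ k \<partial>lebesgue_on \<Omega>) = (\<integral>x. indicator A x * (u' x) ^ k \<partial>lborel)"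
    if A: "A \<in> sets borel" and k: "k > 0" for A and k :: nat
  proof -
    have "(\<integral>x. indicator A x * (u x) ^ k \<partial>lebesgue_on \<Omega>) = (\<integral>x. indicator A x * (u' x) ^ k \<partial>lebesgue_on \<Omega>)"
      using ind[OF A] um u'm' u'(3) by (intro integral_cong_AE) (auto elim: eventually_mono)
    also have "\<dots> = (\<integral>x. indicator A x * (u' x) ^ k \<partial>lborel)"
      using ind[OF A] u'm u'(2) k by (intro integral_on_eq_lborel_supported(1)[OF \<Omega>]) auto
    finally show ?thesis .
  qed
  have cells: "Q \<in> sets borel" if "Q \<in> cell h ` cball 0 R" for Q :: "'a set" using that by auto
  have "(\<integral>x. indicator (cball 0 R) x * (u x)\<^sup>2 \<partial>lebesgue_on \<Omega>) = (\<integral>x. indicator (cball 0 R) x * (u' x)\<^sup>2 \<partial>lborel)"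
    by (rule eq) auto
  also have "\<dots> \<le> 2 * (2 ^ DIM('a) * DIM('a) * h\<^sup>2 * ?G)
      + 2 / h ^ DIM('a) * (\<Sum>Q\<in>cell h ` cball 0 R. (\<integral>x. indicator Q x * u' x \<partial>lborel)\<^sup>2)"
    by (rule local_L2_bound[OF h u'(1,4)])
  also have "(\<Sum>Q\<in>cell h ` cball 0 R. (\<integral>x. indicator Q x * u' x \<partial>lborel)\<^sup>2)
      = (\<Sum>Q\<in>cell h ` cball 0 R. (\<integral>x. indicator Q x * u x \<partial>lebesgue_on \<Omega>)\<^sup>2)"
    by (intro sum.cong refl arg_cong[where f = "\<lambda>t. t\<^sup>2"]) (use eq[OF cells, of _ 1] in simp)
  also have "2 * (2 ^ DIM('a) * DIM('a) * h\<^sup>2 * ?G) \<le> 2 * (2 ^ DIM('a) * DIM('a) * h\<^sup>2 * energy_form \<Omega> lam u u)"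
    using energy_bounds(1)[OF \<Omega> uH lam] by (intro mult_left_mono) auto
  finally show ?thesis by simp
qed

text \<open>The weight U^2 is split by truncation. The remainder, small in L^2, is absorbed through
  the L^4 bound. The truncated part is at most \<open>k\<close> on a ball, where fine cells leave a
  small multiple of \<open>P\<close> and the squares of finitely many cell integrals, which become
  the functionals. Either part takes at most \<open>e / 2\<close> of \<open>P\<close>.\<close>

theorem compact_pair_Hspace:
  assumes lam: "lam > 0" and U: "U \<in> Hspace \<Omega>"
  shows "compact_pair (Hspace \<Omega>) (energy_form \<Omega> lam) (weighted_form \<Omega> U)"
proof -
  let ?P = "energy_form \<Omega> lam" and ?B = "weighted_form \<Omega> U" and ?H = "Hspace \<Omega>"
  interpret P: pos_form ?H ?P by (rule pos_form_Hspace[OF \<Omega>]) (use lam in simp)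
  interpret B: pos_form ?H ?B by (rule pos_form_weighted[OF U])
  define w where "w = (\<lambda>x. (U x)\<^sup>2)"
  have w: "square_integrable (lebesgue_on \<Omega>) w"
    using Hspace_mult_square_integrable[OF \<Omega> dim U U] by (simp add: w_def power2_eq_square)
  have "\<exists>(p::nat) l C. C \<ge> 0 \<and>
      (\<forall>i<p. \<forall>u\<in>?H. \<forall>v\<in>?H. \<forall>r. l i (\<lambda>x. u x + r * v x) = l i u + r * l i v) \<and>
      (\<forall>i<p. \<exists>D\<ge>0. \<forall>u\<in>?H. (l i u)\<^sup>2 \<le> D * ?P u u) \<and>
      (\<forall>u\<in>?H. ?B u u \<le> e * ?P u u + C * (\<Sum>i<p. (l i u)\<^sup>2))" if e: "e > 0" for e
  proof -
    \<comment> \<open>\<open>M\<close> turns the L^4 estimate, stated for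
      \<open>energy_form \<Omega> 1\<close>, into one for \<open>energy_form \<Omega> lam\<close>;
      with \<open>\<delta> = e / (2 * M)\<close> the remainder costs \<open>e / 2\<close>.\<close>
    define M where "M = 10 ^ 5 * (1 + 1 / lam)"
    have M: "M > 0" using lam by (simp add: M_def add_pos_pos)
    define \<delta> where "\<delta> = e / (2 * M)"
    have \<delta>: "\<delta> > 0" using e M by (simp add: \<delta>_def)
    obtain k :: nat where k: "square_integrable (lebesgue_on \<Omega>) (\<lambda>x. indicator {x. \<bar>w x\<bar> \<le> k \<and> norm x \<le> k} x * w x)"
      "(\<integral>x. (w x - indicator {x. \<bar>w x\<bar> \<le> k \<and> norm x \<le> k} x * w x)\<^sup>2 \<partial>lebesgue_on \<Omega>) < \<delta>\<^sup>2"
      by (rule truncated_weight[OF w, of "\<delta>\<^sup>2"]) (use \<delta> in \<open>auto intro: that\<close>)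
    let ?t = "\<lambda>x. indicator {x. \<bar>w x\<bar> \<le> real k \<and> norm x \<le> real k} x * w x"
    let ?K = "2 ^ DIM('a) * real DIM('a)"
    have K: "?K > 0" by simp
    \<comment> \<open>Chosen so that \<open>k * (2 * ?K * h^2) \<le> e / 2\<close>; the summand 1
      keeps the quotient defined for \<open>k = 0\<close>.\<close>
    define h where "h = sqrt (e / (4 * (real k + 1) * ?K))"
    have h: "h > 0" unfolding h_def using e K by (intro real_sqrt_gt_zero divide_pos_pos mult_pos_pos) auto
    have h2: "h\<^sup>2 = e / (4 * (real k + 1) * ?K)" using e K by (simp add: h_def)
    let ?\<Q> = "cell h ` cball (0::'a) (real k)"
    let ?l = "\<lambda>Q u. \<integral>x. indicator Q x * u x \<partial>lebesgue_on \<Omega>"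
    have fin: "finite ?\<Q>" by (rule finite_cells_cball[OF h])
    have Qsq: "square_integrable (lebesgue_on \<Omega>) (\<lambda>x. indicator Q x :: real)" if "Q \<in> ?\<Q>" for Q
      using that cell_square_integrable[OF h] square_integrable_lborel_imp_on[OF \<Omega>] by auto
    have usq: "square_integrable (lebesgue_on \<Omega>) u" if "u \<in> ?H" for u
      by (rule H1_square_integrable[OF \<Omega> Hspace_H1[OF \<Omega> that]])
    have lin: "?l Q (\<lambda>x. u x + r * v x) = ?l Q u + r * ?l Q v" if "Q \<in> ?\<Q>" "u \<in> ?H" "v \<in> ?H" for Q u v r
      using square_integrable_mult[OF Qsq usq, OF that(1,2)] square_integrable_mult[OF Qsq usq, OF that(1,3)]
      by (simp add: distrib_left mult.left_commute)
    have bdd: "\<exists>D\<ge>0. \<forall>u\<in>?H. (?l Q u)\<^sup>2 \<le> D * ?P u u" if Q: "Q \<in> ?\<Q>" for Q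
    proof -
      let ?q = "\<integral>x. (indicator Q x :: real)\<^sup>2 \<partial>lebesgue_on \<Omega>"
      have "(?l Q u)\<^sup>2 \<le> ?q * (1 / lam) * ?P u u" if u: "u \<in> ?H" for u
      proof -
        have "(?l Q u)\<^sup>2 \<le> ?q * (\<integral>x. (u x)\<^sup>2 \<partial>lebesgue_on \<Omega>)" by (rule L2_Cauchy_Schwarz[OF Qsq[OF Q] usq[OF u]])
        also have "\<dots> \<le> ?q * (1 / lam * ?P u u)"
          using energy_bounds(2)[OF \<Omega> Hspace_H1[OF \<Omega> u] lam] by (intro mult_left_mono) auto
        finally show ?thesis by simp
      qed
      moreover have "0 \<le> ?q * (1 / lam)" using lam by simp
      ultimately show ?thesis by blast
    qed
    define C where "C = real k * (2 / h ^ DIM('a))"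
    have C: "C \<ge> 0" using h by (simp add: C_def)
    have main: "?B u u \<le> e * ?P u u + C * (\<Sum>Q\<in>?\<Q>. (?l Q u)\<^sup>2)" if u: "u \<in> ?H" for u
    proof -
      have P0: "0 \<le> ?P u u" by (rule P.nonneg[OF u])
      have u2: "square_integrable (lebesgue_on \<Omega>) (\<lambda>x. (u x)\<^sup>2)"
        using Hspace_mult_square_integrable[OF \<Omega> dim u u] by (simp add: power2_eq_square)
      have rest: "square_integrable (lebesgue_on \<Omega>) (\<lambda>x. w x - ?t x)" by (intro square_integrable_diff w k(1))
      have "?B u u = (\<integral>x. (w x - ?t x) * (u x)\<^sup>2 + ?t x * (u x)\<^sup>2 \<partial>lebesgue_on \<Omega>)"
        unfolding weighted_form_def w_def
        by (intro Bochner_Integration.integral_cong refl) (simp add: algebra_simps power2_eq_square[of "u _"])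
      also have "\<dots> = (\<integral>x. (w x - ?t x) * (u x)\<^sup>2 \<partial>lebesgue_on \<Omega>) + (\<integral>x. ?t x * (u x)\<^sup>2 \<partial>lebesgue_on \<Omega>)"
        by (intro Bochner_Integration.integral_add square_integrable_mult rest u2 k(1))
      finally have split: "?B u u = \<dots>" .
      have "(\<integral>x. (w x - ?t x) * (u x)\<^sup>2 \<partial>lebesgue_on \<Omega>)
          \<le> sqrt (\<integral>x. (w x - ?t x)\<^sup>2 \<partial>lebesgue_on \<Omega>) * (10 ^ 5 * energy_form \<Omega> 1 u u)"
        by (rule L2_weight_bound[OF rest u])
      also have "\<dots> \<le> \<delta> * (M * ?P u u)"
      proof (rule mult_mono)
        show "sqrt (\<integral>x. (w x - ?t x)\<^sup>2 \<partial>lebesgue_on \<Omega>) \<le> \<delta>"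
          using k(2) \<delta> by (intro real_le_lsqrt) auto
        show "10 ^ 5 * energy_form \<Omega> 1 u u \<le> M * ?P u u"
          unfolding M_def mult.assoc
          by (rule mult_left_mono[OF energy_bounds(3)[OF \<Omega> Hspace_H1[OF \<Omega> u] lam]]) simp
        show "0 \<le> 10 ^ 5 * energy_form \<Omega> 1 u u"
          using pos_form.nonneg[OF pos_form_energy[OF \<Omega>, of 1] Hspace_H1[OF \<Omega> u]] by simp
      qed (use \<delta> in simp)
      also have "\<dots> = e / 2 * ?P u u" using M by (simp add: \<delta>_def)
      finally have 1: "(\<integral>x. (w x - ?t x) * (u x)\<^sup>2 \<partial>lebesgue_on \<Omega>) \<le> e / 2 * ?P u u" .
      have ui: "integrable (lebesgue_on \<Omega>) (\<lambda>x. (u x)\<^sup>2)" using usq[OF u] by (simp add: square_integrable_def)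
      have cb: "cball 0 (real k) \<inter> \<Omega> \<in> sets (lebesgue_on \<Omega>)"
        using domain_sets[OF \<Omega>] by (auto simp: sets_restrict_space intro!: image_eqI[of _ _ "cball 0 (real k)"])
      have ind: "(indicator (cball 0 (real k)) x :: real) * (u x)\<^sup>2 = indicator (cball 0 (real k) \<inter> \<Omega>) x * (u x)\<^sup>2"
        if "x \<in> \<Omega>" for x using that by (auto simp: indicator_def)
      have bi: "integrable (lebesgue_on \<Omega>) (\<lambda>x. indicator (cball 0 (real k)) x * (u x)\<^sup>2)"
      proof -
        have "integrable (lebesgue_on \<Omega>) (\<lambda>x. indicator (cball 0 (real k) \<inter> \<Omega>) x *\<^sub>R (u x)\<^sup>2)"
          by (rule integrable_mult_indicator[OF cb ui])
        then show ?thesis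
          by (rule Bochner_Integration.integrable_cong[THEN iffD1, rotated -1]) (auto simp: ind space_restrict_space)
      qed
      have "(\<integral>x. ?t x * (u x)\<^sup>2 \<partial>lebesgue_on \<Omega>) \<le> (\<integral>x. real k * (indicator (cball 0 (real k)) x * (u x)\<^sup>2) \<partial>lebesgue_on \<Omega>)"
      proof (rule integral_mono)
        show "integrable (lebesgue_on \<Omega>) (\<lambda>x. ?t x * (u x)\<^sup>2)" by (rule square_integrable_mult[OF k(1) u2])
        show "integrable (lebesgue_on \<Omega>) (\<lambda>x. real k * (indicator (cball 0 (real k)) x * (u x)\<^sup>2))"
          using bi by (rule integrable_mult_right)
        show "?t x * (u x)\<^sup>2 \<le> real k * (indicator (cball 0 (real k)) x * (u x)\<^sup>2)" for x
        proof (cases "\<bar>w x\<bar> \<le> real k \<and> norm x \<le> real k")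
          case True
          then have "w x * (u x)\<^sup>2 \<le> real k * (u x)\<^sup>2" by (intro mult_right_mono) auto
          then show ?thesis using True by simp
        next
          case False
          then show ?thesis by simp
        qed
      qed
      also have "\<dots> = real k * (\<integral>x. indicator (cball 0 (real k)) x * (u x)\<^sup>2 \<partial>lebesgue_on \<Omega>)" by simp
      also have "\<dots> \<le> real k * (2 * (?K * h\<^sup>2 * ?P u u) + 2 / h ^ DIM('a) * (\<Sum>Q\<in>?\<Q>. (?l Q u)\<^sup>2))"
        using Hspace_local_bound[OF h u lam, of "real k"] by (intro mult_left_mono) auto
      also have "\<dots> = real k * (2 * ?K * h\<^sup>2) * ?P u u + C * (\<Sum>Q\<in>?\<Q>. (?l Q u)\<^sup>2)"
        by (simp add: C_def algebra_simps)
      also have "real k * (2 * ?K * h\<^sup>2) * ?P u u \<le> e / 2 * ?P u u"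
      proof (rule mult_right_mono[OF _ P0])
        have *: "t * (2 * L * (e / (4 * q * L))) = t / q * (e / 2)" if "q > 0" "L > 0" for t q L :: real
          using that by (simp add: field_simps)
        have "real k * (2 * ?K * h\<^sup>2) = real k / (real k + 1) * (e / 2)"
          unfolding h2 by (rule *) (use K in simp_all)
        also have "\<dots> \<le> 1 * (e / 2)" using e by (intro mult_right_mono) auto
        finally show "real k * (2 * ?K * h\<^sup>2) \<le> e / 2" by simp
      qed
      finally have "(\<integral>x. ?t x * (u x)\<^sup>2 \<partial>lebesgue_on \<Omega>) \<le> e / 2 * ?P u u + C * (\<Sum>Q\<in>?\<Q>. (?l Q u)\<^sup>2)" by simp
      then show ?thesis using 1 split by (simp add: field_simps)
    qed
    obtain \<beta> where \<beta>: "bij_betw \<beta> {..<card ?\<Q>} ?\<Q>"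
      using ex_bij_betw_nat_finite[OF fin] by (auto simp: atLeast0LessThan)
    have \<beta>Q: "\<beta> i \<in> ?\<Q>" if "i < card ?\<Q>" for i using \<beta> that by (auto simp: bij_betw_def)
    have "(\<Sum>i<card ?\<Q>. (?l (\<beta> i) u)\<^sup>2) = (\<Sum>Q\<in>?\<Q>. (?l Q u)\<^sup>2)" for u :: "'a \<Rightarrow> real"
      by (rule sum.reindex_bij_betw[OF \<beta>])
    then have main': "\<forall>u\<in>?H. ?B u u \<le> e * ?P u u + C * (\<Sum>i<card ?\<Q>. (?l (\<beta> i) u)\<^sup>2)" using main by simp
    have lin': "\<forall>i<card ?\<Q>. \<forall>u\<in>?H. \<forall>v\<in>?H. \<forall>r. ?l (\<beta> i) (\<lambda>x. u x + r * v x) = ?l (\<beta> i) u + r * ?l (\<beta> i) v"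
      by (intro allI impI ballI, rule lin[OF \<beta>Q]) assumption+
    have bdd': "\<forall>i<card ?\<Q>. \<exists>D\<ge>0. \<forall>u\<in>?H. (?l (\<beta> i) u)\<^sup>2 \<le> D * ?P u u"
      by (intro allI impI, rule bdd[OF \<beta>Q])
    show ?thesis
      by (rule exI[of _ "card ?\<Q>"], rule exI[of _ "\<lambda>i. ?l (\<beta> i)"], rule exI[of _ C], intro conjI C lin' bdd' main')
  qed
  then show ?thesis
    by unfold_locales (use weighted_form_le[OF lam U] Hspace_complete[OF \<Omega> lam] in blast)+
qed

end

section \<open>The second variation of the energy\<close>

text \<open>Along a line the energy is a polynomial of degree 4 in the parameter, so
  \<open>deriv\<close> merely reads off a coefficient and no differentiation under the integral
  takes place.\<close>

lemma deriv_poly4: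
  fixes F :: "real \<Rightarrow> real"
  assumes "\<And>t. F t = c0 + t * c1 + t\<^sup>2 * c2 + t ^ 3 * c3 + t ^ 4 * c4"
  shows "deriv F 0 = c1"
proof -
  have "F = (\<lambda>t. c0 + t * c1 + t\<^sup>2 * c2 + t ^ 3 * c3 + t ^ 4 * c4)" using assms by blast
  moreover have "((\<lambda>t. c0 + t * c1 + t\<^sup>2 * c2 + t ^ 3 * c3 + t ^ 4 * c4) has_real_derivative c1) (at 0)"
    by (auto intro!: derivative_eq_intros)
  ultimately show ?thesis by (simp add: DERIV_imp_deriv)
qed

lemma integral_mult_expand:
  fixes f0 f1 f2 g0 g1 g2 :: "'a \<Rightarrow> real"
  assumes f: "square_integrable M f0" "square_integrable M f1" "square_integrable M f2"
    and g: "square_integrable M g0" "square_integrable M g1" "square_integrable M g2"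
  shows "(\<integral>x. (f0 x + t * f1 x + t\<^sup>2 * f2 x) * (g0 x + t * g1 x + t\<^sup>2 * g2 x) \<partial>M)
    = (\<integral>x. f0 x * g0 x \<partial>M) + t * ((\<integral>x. f0 x * g1 x \<partial>M) + (\<integral>x. f1 x * g0 x \<partial>M))
      + t\<^sup>2 * ((\<integral>x. f0 x * g2 x \<partial>M) + (\<integral>x. f1 x * g1 x \<partial>M) + (\<integral>x. f2 x * g0 x \<partial>M))
      + t ^ 3 * ((\<integral>x. f1 x * g2 x \<partial>M) + (\<integral>x. f2 x * g1 x \<partial>M)) + t ^ 4 * (\<integral>x. f2 x * g2 x \<partial>M)"
    "integrable M (\<lambda>x. (f0 x + t * f1 x + t\<^sup>2 * f2 x) * (g0 x + t * g1 x + t\<^sup>2 * g2 x))"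
proof -
  have sum: "(f0 x + t * f1 x + t\<^sup>2 * f2 x) * (g0 x + t * g1 x + t\<^sup>2 * g2 x)
      = f0 x * g0 x + t * (f0 x * g1 x + f1 x * g0 x) + t\<^sup>2 * (f0 x * g2 x + f1 x * g1 x + f2 x * g0 x)
        + t ^ 3 * (f1 x * g2 x + f2 x * g1 x) + t ^ 4 * (f2 x * g2 x)" for x
    by (simp add: algebra_simps power2_eq_square power3_eq_cube power4_eq_xxxx)
  note i = square_integrable_mult[OF f(1) g(1)] square_integrable_mult[OF f(1) g(2)] square_integrable_mult[OF f(1) g(3)]
    square_integrable_mult[OF f(2) g(1)] square_integrable_mult[OF f(2) g(2)] square_integrable_mult[OF f(2) g(3)]
    square_integrable_mult[OF f(3) g(1)] square_integrable_mult[OF f(3) g(2)] square_integrable_mult[OF f(3) g(3)]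
  show "(\<integral>x. (f0 x + t * f1 x + t\<^sup>2 * f2 x) * (g0 x + t * g1 x + t\<^sup>2 * g2 x) \<partial>M)
    = (\<integral>x. f0 x * g0 x \<partial>M) + t * ((\<integral>x. f0 x * g1 x \<partial>M) + (\<integral>x. f1 x * g0 x \<partial>M))
      + t\<^sup>2 * ((\<integral>x. f0 x * g2 x \<partial>M) + (\<integral>x. f1 x * g1 x \<partial>M) + (\<integral>x. f2 x * g0 x \<partial>M))
      + t ^ 3 * ((\<integral>x. f1 x * g2 x \<partial>M) + (\<integral>x. f2 x * g1 x \<partial>M)) + t ^ 4 * (\<integral>x. f2 x * g2 x \<partial>M)"
    unfolding sum using i by simp
  show "integrable M (\<lambda>x. (f0 x + t * f1 x + t\<^sup>2 * f2 x) * (g0 x + t * g1 x + t\<^sup>2 * g2 x))"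
    unfolding sum using i by simp
qed

context
  fixes \<Omega> :: "'a::euclidean_space set" and lam :: real and n :: nat and a :: "nat \<Rightarrow> nat \<Rightarrow> real"
  assumes \<Omega>: "open \<Omega>" and dim: "DIM('a) \<le> 3" and lam: "lam > 0"
    and a_sym: "\<And>i j. i \<in> {1..n} \<Longrightarrow> j \<in> {1..n} \<Longrightarrow> a i j = a j i"
begin

lemma energy_first_variation:
  assumes v: "v \<in> Hvec \<Omega> n" and \<psi>: "\<psi> \<in> Hvec \<Omega> n"
  shows "deriv (\<lambda>t. energy \<Omega> lam n a (\<lambda>i x. v i x + t * \<psi> i x)) 0
    = (\<Sum>i=1..n. energy_form \<Omega> lam (v i) (\<psi> i))
      - (\<Sum>i=1..n. \<Sum>j=1..n. a i j * (\<integral>x. (v i x * \<psi> i x) * (v j x)\<^sup>2 \<partial>lebesgue_on \<Omega>))"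
proof -
  interpret P: pos_form "Hspace \<Omega>" "energy_form \<Omega> lam" by (rule pos_form_Hspace[OF \<Omega>]) (use lam in simp)
  have vH: "v i \<in> Hspace \<Omega>" and \<psi>H: "\<psi> i \<in> Hspace \<Omega>" if "i \<in> {1..n}" for i
    using v \<psi> that by (auto simp: Hvec_def)
  let ?J = "\<lambda>f g. \<integral>x. f x * g x \<partial>lebesgue_on \<Omega>"
  let ?f0 = "\<lambda>i x. (v i x)\<^sup>2" and ?f1 = "\<lambda>i x. 2 * (v i x * \<psi> i x)" and ?f2 = "\<lambda>i x. (\<psi> i x)\<^sup>2"
  have sq: "square_integrable (lebesgue_on \<Omega>) (?f0 i)" "square_integrable (lebesgue_on \<Omega>) (?f1 i)"
    "square_integrable (lebesgue_on \<Omega>) (?f2 i)" if i: "i \<in> {1..n}" for i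
    using Hspace_mult_square_integrable[OF \<Omega> dim vH[OF i] vH[OF i]]
      square_integrable_scaleR[OF Hspace_mult_square_integrable[OF \<Omega> dim vH[OF i] \<psi>H[OF i]], of 2]
      Hspace_mult_square_integrable[OF \<Omega> dim \<psi>H[OF i] \<psi>H[OF i]]
    by (simp_all add: power2_eq_square)
  have quad: "(\<integral>x. (norm (weak_gradient \<Omega> (\<lambda>x. v i x + t * \<psi> i x) x))\<^sup>2 + lam * (v i x + t * \<psi> i x)\<^sup>2 \<partial>lebesgue_on \<Omega>)
      = energy_form \<Omega> lam (v i) (v i) + 2 * t * energy_form \<Omega> lam (v i) (\<psi> i) + t\<^sup>2 * energy_form \<Omega> lam (\<psi> i) (\<psi> i)"
    if i: "i \<in> {1..n}" for i t
  proof -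
    have "(\<integral>x. (norm (weak_gradient \<Omega> (\<lambda>x. v i x + t * \<psi> i x) x))\<^sup>2 + lam * (v i x + t * \<psi> i x)\<^sup>2 \<partial>lebesgue_on \<Omega>)
        = energy_form \<Omega> lam (\<lambda>x. v i x + t * \<psi> i x) (\<lambda>x. v i x + t * \<psi> i x)"
      unfolding energy_form_def power2_norm_eq_inner by (simp only: power2_eq_square mult.assoc)
    then show ?thesis using P.quadratic[OF vH[OF i] \<psi>H[OF i], of t] by simp
  qed
  define q where "q = (\<lambda>t i j x. (?f0 i x + t * ?f1 i x + t\<^sup>2 * ?f2 i x) * (?f0 j x + t * ?f1 j x + t\<^sup>2 * ?f2 j x))"
  have q: "(v i x + t * \<psi> i x)\<^sup>2 * (v j x + t * \<psi> j x)\<^sup>2 = q t i j x" for t i j x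
    by (simp add: q_def algebra_simps power2_eq_square)
  have qi: "integrable (lebesgue_on \<Omega>) (q t i j)" if "i \<in> {1..n}" "j \<in> {1..n}" for t i j
    unfolding q_def by (rule integral_mult_expand(2)[OF sq sq, OF that(1) that(1) that(1) that(2) that(2) that(2)])
  have quartic: "(\<integral>x. (\<Sum>i=1..n. \<Sum>j=1..n. a i j * (v i x + t * \<psi> i x)\<^sup>2 * (v j x + t * \<psi> j x)\<^sup>2) \<partial>lebesgue_on \<Omega>)
      = (\<Sum>i=1..n. \<Sum>j=1..n. a i j * (\<integral>x. q t i j x \<partial>lebesgue_on \<Omega>))" for t
  proof -
    have "(\<integral>x. (\<Sum>i=1..n. \<Sum>j=1..n. a i j * q t i j x) \<partial>lebesgue_on \<Omega>)
        = (\<Sum>i=1..n. (\<integral>x. (\<Sum>j=1..n. a i j * q t i j x) \<partial>lebesgue_on \<Omega>))"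
      by (rule Bochner_Integration.integral_sum) (intro Bochner_Integration.integrable_sum integrable_mult_right qi)
    also have "\<dots> = (\<Sum>i=1..n. \<Sum>j=1..n. (\<integral>x. a i j * q t i j x \<partial>lebesgue_on \<Omega>))"
      by (intro sum.cong refl Bochner_Integration.integral_sum integrable_mult_right qi)
    finally show ?thesis by (simp add: q mult.assoc)
  qed
  define A where "A = (\<lambda>k i j. if k = 0 then ?J (?f0 i) (?f0 j) else if k = (1::nat) then ?J (?f0 i) (?f1 j) + ?J (?f1 i) (?f0 j)
    else if k = 2 then ?J (?f0 i) (?f2 j) + ?J (?f1 i) (?f1 j) + ?J (?f2 i) (?f0 j)
    else if k = 3 then ?J (?f1 i) (?f2 j) + ?J (?f2 i) (?f1 j) else ?J (?f2 i) (?f2 j))"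
  have qA: "(\<integral>x. q t i j x \<partial>lebesgue_on \<Omega>) = A 0 i j + t * A 1 i j + t\<^sup>2 * A 2 i j + t ^ 3 * A 3 i j + t ^ 4 * A 4 i j"
    if "i \<in> {1..n}" "j \<in> {1..n}" for t i j
    unfolding q_def A_def
    using integral_mult_expand(1)[OF sq sq, OF that(1) that(1) that(1) that(2) that(2) that(2), of t] by simp
  define S where "S = (\<lambda>k. \<Sum>i=1..n. \<Sum>j=1..n. a i j * A k i j)"
  have "(\<Sum>i=1..n. \<Sum>j=1..n. a i j * (\<integral>x. q t i j x \<partial>lebesgue_on \<Omega>))
      = (\<Sum>i=1..n. \<Sum>j=1..n. a i j * (A 0 i j + t * A 1 i j + t\<^sup>2 * A 2 i j + t ^ 3 * A 3 i j + t ^ 4 * A 4 i j))" for t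
    by (intro sum.cong refl) (simp only: qA)
  then have SA: "(\<Sum>i=1..n. \<Sum>j=1..n. a i j * (\<integral>x. q t i j x \<partial>lebesgue_on \<Omega>))
      = S 0 + t * S 1 + t\<^sup>2 * S 2 + t ^ 3 * S 3 + t ^ 4 * S 4" for t
    by (simp add: S_def distrib_left sum.distrib sum_distrib_left mult.left_commute)
  define E0 E1 E2 where "E0 = (\<Sum>i=1..n. energy_form \<Omega> lam (v i) (v i))"
    and "E1 = (\<Sum>i=1..n. energy_form \<Omega> lam (v i) (\<psi> i))"
    and "E2 = (\<Sum>i=1..n. energy_form \<Omega> lam (\<psi> i) (\<psi> i))"
  have EE: "(\<Sum>i=1..n. \<integral>x. (norm (weak_gradient \<Omega> (\<lambda>x. v i x + t * \<psi> i x) x))\<^sup>2 + lam * (v i x + t * \<psi> i x)\<^sup>2 \<partial>lebesgue_on \<Omega>)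
      = E0 + t * (2 * E1) + t\<^sup>2 * E2" for t
    by (simp add: quad E0_def E1_def E2_def sum.distrib sum_distrib_left mult_ac del: One_nat_def)
  have "energy \<Omega> lam n a (\<lambda>i x. v i x + t * \<psi> i x) = (1/2 * E0 - 1/4 * S 0) + t * (E1 - 1/4 * S 1)
      + t\<^sup>2 * (1/2 * E2 - 1/4 * S 2) + t ^ 3 * (- 1/4 * S 3) + t ^ 4 * (- 1/4 * S 4)" for t
    unfolding energy_def EE quartic SA by (simp add: algebra_simps)
  then have "deriv (\<lambda>t. energy \<Omega> lam n a (\<lambda>i x. v i x + t * \<psi> i x)) 0 = E1 - 1/4 * S 1"
    by (rule deriv_poly4)
  \<comment> \<open>By symmetry of \<open>a\<close> the two linear contributions agree; the
    resulting 4 cancels the factor 1/4 of the energy.\<close>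
  moreover have "S 1 = 4 * (\<Sum>i=1..n. \<Sum>j=1..n. a i j * (\<integral>x. (v i x * \<psi> i x) * (v j x)\<^sup>2 \<partial>lebesgue_on \<Omega>))"
  proof -
    let ?K = "\<lambda>i j. \<integral>x. (v i x * \<psi> i x) * (v j x)\<^sup>2 \<partial>lebesgue_on \<Omega>"
    have A1: "A 1 i j = 2 * ?K j i + 2 * ?K i j" for i j
      unfolding A_def by (simp add: mult_ac)
    have "S 1 = 2 * (\<Sum>i=1..n. \<Sum>j=1..n. a i j * ?K j i) + 2 * (\<Sum>i=1..n. \<Sum>j=1..n. a i j * ?K i j)"
      unfolding S_def A1 by (simp add: distrib_left sum.distrib sum_distrib_left mult.left_commute)
    also have "(\<Sum>i=1..n. \<Sum>j=1..n. a i j * ?K j i) = (\<Sum>i=1..n. \<Sum>j=1..n. a i j * ?K i j)"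
      by (subst sum.swap) (intro sum.cong refl, simp add: a_sym)
    finally show ?thesis by simp
  qed
  ultimately show ?thesis by (simp add: E1_def)
qed

text \<open>The first variation at \<open>u + s * \<phi>\<close> is cubic in \<open>s\<close>, so
  the second derivative is once more a coefficient.\<close>

lemma energy''_eq:
  assumes u: "u \<in> Hvec \<Omega> n" and \<phi>: "\<phi> \<in> Hvec \<Omega> n" and \<psi>: "\<psi> \<in> Hvec \<Omega> n"
  shows "energy'' \<Omega> lam n a u \<phi> \<psi> = (\<Sum>i=1..n. energy_form \<Omega> lam (\<phi> i) (\<psi> i))
    - (\<Sum>i=1..n. \<Sum>j=1..n. a i j * (\<integral>x. (\<phi> i x * \<psi> i x) * (u j x)\<^sup>2 \<partial>lebesgue_on \<Omega>)
        + 2 * a i j * (\<integral>x. (u i x * \<psi> i x) * (u j x * \<phi> j x) \<partial>lebesgue_on \<Omega>))"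
proof -
  interpret P: pos_form "Hspace \<Omega>" "energy_form \<Omega> lam" by (rule pos_form_Hspace[OF \<Omega>]) (use lam in simp)
  have uH: "u i \<in> Hspace \<Omega>" and \<phi>H: "\<phi> i \<in> Hspace \<Omega>" and \<psi>H: "\<psi> i \<in> Hspace \<Omega>" if "i \<in> {1..n}" for i
    using u \<phi> \<psi> that by (auto simp: Hvec_def)
  let ?J = "\<lambda>f g. \<integral>x. f x * g x \<partial>lebesgue_on \<Omega>"
  have vH: "(\<lambda>i x. u i x + s * \<phi> i x) \<in> Hvec \<Omega> n" for s
    using uH \<phi>H by (auto simp: Hvec_def intro: P.lincomb_mem)
  have inner: "deriv (\<lambda>t. energy \<Omega> lam n a (\<lambda>i x. u i x + s * \<phi> i x + t * \<psi> i x)) 0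
      = (\<Sum>i=1..n. energy_form \<Omega> lam (\<lambda>x. u i x + s * \<phi> i x) (\<psi> i))
        - (\<Sum>i=1..n. \<Sum>j=1..n. a i j * (\<integral>x. ((u i x + s * \<phi> i x) * \<psi> i x) * (u j x + s * \<phi> j x)\<^sup>2 \<partial>lebesgue_on \<Omega>))" for s
    by (rule energy_first_variation[OF vH \<psi>])
  let ?f0 = "\<lambda>i x. u i x * \<psi> i x" and ?f1 = "\<lambda>i x. \<phi> i x * \<psi> i x"
  let ?g0 = "\<lambda>j x. (u j x)\<^sup>2" and ?g1 = "\<lambda>j x. 2 * (u j x * \<phi> j x)" and ?g2 = "\<lambda>j x. (\<phi> j x)\<^sup>2"
  have sqf: "square_integrable (lebesgue_on \<Omega>) (?f0 i)" "square_integrable (lebesgue_on \<Omega>) (?f1 i)" if i: "i \<in> {1..n}" for i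
    by (intro Hspace_mult_square_integrable[OF \<Omega> dim] uH \<phi>H \<psi>H i)+
  have sqg: "square_integrable (lebesgue_on \<Omega>) (?g0 i)" "square_integrable (lebesgue_on \<Omega>) (?g1 i)"
    "square_integrable (lebesgue_on \<Omega>) (?g2 i)" if i: "i \<in> {1..n}" for i
    using Hspace_mult_square_integrable[OF \<Omega> dim uH[OF i] uH[OF i]]
      square_integrable_scaleR[OF Hspace_mult_square_integrable[OF \<Omega> dim uH[OF i] \<phi>H[OF i]], of 2]
      Hspace_mult_square_integrable[OF \<Omega> dim \<phi>H[OF i] \<phi>H[OF i]]
    by (simp_all add: power2_eq_square)
  \<comment> \<open>The factor \<open>(u + s * \<phi>) * \<psi>\<close> is affine in
    \<open>s\<close>; a zero quadratic coefficient fits it to the general expansion.\<close>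
  have sq0: "square_integrable (lebesgue_on \<Omega>) (\<lambda>x. 0 :: real)" by (simp add: square_integrable_def)
  define A where "A = (\<lambda>k i j. if k = 0 then ?J (?f0 i) (?g0 j) else if k = (1::nat) then ?J (?f0 i) (?g1 j) + ?J (?f1 i) (?g0 j)
    else if k = 2 then ?J (?f0 i) (?g2 j) + ?J (?f1 i) (?g1 j) else ?J (?f1 i) (?g2 j))"
  have qA: "(\<integral>x. ((u i x + s * \<phi> i x) * \<psi> i x) * (u j x + s * \<phi> j x)\<^sup>2 \<partial>lebesgue_on \<Omega>)
      = A 0 i j + s * A 1 i j + s\<^sup>2 * A 2 i j + s ^ 3 * A 3 i j" if "i \<in> {1..n}" "j \<in> {1..n}" for s i j
  proof -
    have "((u i x + s * \<phi> i x) * \<psi> i x) * (u j x + s * \<phi> j x)\<^sup>2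
        = (?f0 i x + s * ?f1 i x + s\<^sup>2 * 0) * (?g0 j x + s * ?g1 j x + s\<^sup>2 * ?g2 j x)" for x
      by (simp add: algebra_simps power2_eq_square)
    then show ?thesis
      using integral_mult_expand(1)[OF sqf(1)[OF that(1)] sqf(2)[OF that(1)] sq0 sqg(1)[OF that(2)] sqg(2)[OF that(2)] sqg(3)[OF that(2)], of s]
      by (simp add: A_def)
  qed
  define S where "S = (\<lambda>k. \<Sum>i=1..n. \<Sum>j=1..n. a i j * A k i j)"
  have "(\<Sum>i=1..n. \<Sum>j=1..n. a i j * (\<integral>x. ((u i x + s * \<phi> i x) * \<psi> i x) * (u j x + s * \<phi> j x)\<^sup>2 \<partial>lebesgue_on \<Omega>))
      = (\<Sum>i=1..n. \<Sum>j=1..n. a i j * (A 0 i j + s * A 1 i j + s\<^sup>2 * A 2 i j + s ^ 3 * A 3 i j))" for s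
    by (intro sum.cong refl) (simp only: qA)
  then have SA: "(\<Sum>i=1..n. \<Sum>j=1..n. a i j * (\<integral>x. ((u i x + s * \<phi> i x) * \<psi> i x) * (u j x + s * \<phi> j x)\<^sup>2 \<partial>lebesgue_on \<Omega>))
      = S 0 + s * S 1 + s\<^sup>2 * S 2 + s ^ 3 * S 3" for s
    by (simp add: S_def distrib_left sum.distrib sum_distrib_left mult.left_commute)
  have E: "(\<Sum>i=1..n. energy_form \<Omega> lam (\<lambda>x. u i x + s * \<phi> i x) (\<psi> i))
      = (\<Sum>i=1..n. energy_form \<Omega> lam (u i) (\<psi> i)) + s * (\<Sum>i=1..n. energy_form \<Omega> lam (\<phi> i) (\<psi> i))" for s
    using uH \<phi>H \<psi>H by (simp add: P.lincomb sum.distrib sum_distrib_left del: One_nat_def)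
  have "deriv (\<lambda>s. deriv (\<lambda>t. energy \<Omega> lam n a (\<lambda>i x. u i x + s * \<phi> i x + t * \<psi> i x)) 0) 0
      = (\<Sum>i=1..n. energy_form \<Omega> lam (\<phi> i) (\<psi> i)) - S 1"
  proof (rule deriv_poly4)
    show "deriv (\<lambda>t. energy \<Omega> lam n a (\<lambda>i x. u i x + s * \<phi> i x + t * \<psi> i x)) 0
        = ((\<Sum>i=1..n. energy_form \<Omega> lam (u i) (\<psi> i)) - S 0)
          + s * ((\<Sum>i=1..n. energy_form \<Omega> lam (\<phi> i) (\<psi> i)) - S 1) + s\<^sup>2 * (- S 2) + s ^ 3 * (- S 3) + s ^ 4 * 0" for s
      unfolding inner SA E by (simp add: algebra_simps)
  qed
  moreover have "S 1 = (\<Sum>i=1..n. \<Sum>j=1..n. a i j * (\<integral>x. (\<phi> i x * \<psi> i x) * (u j x)\<^sup>2 \<partial>lebesgue_on \<Omega>)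
        + 2 * a i j * (\<integral>x. (u i x * \<psi> i x) * (u j x * \<phi> j x) \<partial>lebesgue_on \<Omega>))"
  proof -
    have "?J (?f0 i) (?g1 j) = 2 * ?J (?f0 i) (\<lambda>x. u j x * \<phi> j x)" for i j
      by (simp add: mult.left_commute)
    then show ?thesis unfolding S_def A_def by (intro sum.cong refl) (simp add: algebra_simps)
  qed
  ultimately show ?thesis by (simp add: energy''_def)
qed

text \<open>The terms with \<open>\<phi> i * \<psi> i\<close> put
  \<open>\<Sum>k. a i k * (c k)^2\<close> on the diagonal of the coefficient matrix, while the
  coupling supplies \<open>2 * a i j * c i * c j\<close> everywhere, the diagonal included.\<close>

lemma energy''_proportional:
  assumes U: "U \<in> Hspace \<Omega>" and \<phi>: "\<phi> \<in> Hvec \<Omega> n" and \<psi>: "\<psi> \<in> Hvec \<Omega> n"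
  shows "energy'' \<Omega> lam n a (\<lambda>i x. c i * U x) \<phi> \<psi> = (\<Sum>i=1..n. energy_form \<Omega> lam (\<phi> i) (\<psi> i))
    - (\<Sum>i=1..n. \<Sum>j=1..n. Bcoeff n a c i j * weighted_form \<Omega> U (\<phi> j) (\<psi> i))"
proof -
  interpret P: pos_form "Hspace \<Omega>" "energy_form \<Omega> lam" by (rule pos_form_Hspace[OF \<Omega>]) (use lam in simp)
  let ?W = "weighted_form \<Omega> U"
  have u: "(\<lambda>i x. c i * U x) \<in> Hvec \<Omega> n" using P.scale_mem[OF U] by (simp add: Hvec_def)
  have 1: "(\<integral>x. (\<phi> i x * \<psi> i x) * (c j * U x)\<^sup>2 \<partial>lebesgue_on \<Omega>) = (c j)\<^sup>2 * ?W (\<phi> i) (\<psi> i)" for i j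
  proof -
    have eq: "(\<phi> i x * \<psi> i x) * (c j * U x)\<^sup>2 = (c j)\<^sup>2 * ((U x)\<^sup>2 * \<phi> i x * \<psi> i x)" for x
      by (simp add: power_mult_distrib mult_ac)
    show ?thesis unfolding weighted_form_def eq by (rule integral_mult_right_zero)
  qed
  have 2: "(\<integral>x. (c i * U x * \<psi> i x) * (c j * U x * \<phi> j x) \<partial>lebesgue_on \<Omega>) = c i * c j * ?W (\<phi> j) (\<psi> i)" for i j
  proof -
    have eq: "(c i * U x * \<psi> i x) * (c j * U x * \<phi> j x) = (c i * c j) * ((U x)\<^sup>2 * \<phi> j x * \<psi> i x)" for x
      by (simp add: power2_eq_square mult_ac)
    show ?thesis unfolding weighted_form_def eq by (rule integral_mult_right_zero)
  qed
  have "(\<Sum>j=1..n. a i j * ((c j)\<^sup>2 * ?W (\<phi> i) (\<psi> i)) + 2 * a i j * (c i * c j * ?W (\<phi> j) (\<psi> i)))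
      = (\<Sum>j=1..n. Bcoeff n a c i j * ?W (\<phi> j) (\<psi> i))" if i: "i \<in> {1..n}" for i
  proof -
    have B: "Bcoeff n a c i j * ?W (\<phi> j) (\<psi> i)
        = 2 * a i j * (c i * c j * ?W (\<phi> j) (\<psi> i)) + (if j = i then (\<Sum>k=1..n. a i k * (c k)\<^sup>2) * ?W (\<phi> i) (\<psi> i) else 0)" for j
      by (auto simp: Bcoeff_def power2_eq_square algebra_simps)
    have "(\<Sum>j=1..n. if j = i then (\<Sum>k=1..n. a i k * (c k)\<^sup>2) * ?W (\<phi> i) (\<psi> i) else 0)
        = (\<Sum>k=1..n. a i k * (c k)\<^sup>2) * ?W (\<phi> i) (\<psi> i)" using i by simp
    then show ?thesis unfolding B sum.distrib by (simp add: sum_distrib_right mult.assoc)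
  qed
  then show ?thesis unfolding energy''_eq[OF u \<phi> \<psi>] 1 2 by simp
qed

end

section \<open>The coupled quadratic form\<close>

text \<open>The interface between analysis and counting. \<open>b k\<close> for \<open>k > m\<close>
  stands for b_kk, \<open>PU\<close> says that \<open>U\<close> is an eigenfunction for the
  eigenvalue 1, \<open>gap\<close> is what Morse index 1 of \<open>U\<close> provides, and
  \<open>row\<close> is the system evaluated at the solution.\<close>

locale coupled_system = eigen_family H P B "{1..}" \<omega> \<psi>
  for H :: "('x \<Rightarrow> real) set" and P B \<omega> \<psi> +
  fixes U :: "'x \<Rightarrow> real" and m n :: nat and a :: "nat \<Rightarrow> nat \<Rightarrow> real" and b c :: "nat \<Rightarrow> real"
  assumes U_mem: "U \<in> H" and PU: "v \<in> H \<Longrightarrow> P U v = B U v" and UU: "B U U > 0"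
    and null: "f \<in> H \<Longrightarrow> v \<in> H \<Longrightarrow> B f f = 0 \<Longrightarrow> P f v = 0"
    and gap: "v \<in> H \<Longrightarrow> B v U = 0 \<Longrightarrow> 3 * B v v \<le> P v v"
    and mn: "m \<le> n"
    and a_sym: "i \<in> {1..m} \<Longrightarrow> j \<in> {1..m} \<Longrightarrow> a i j = a j i"
    and a_nonneg: "i \<in> {1..m} \<Longrightarrow> j \<in> {1..m} \<Longrightarrow> a i j \<ge> 0"
    and c_pos: "i \<in> {1..m} \<Longrightarrow> c i > 0"
    and row: "i \<in> {1..m} \<Longrightarrow> (\<Sum>j=1..m. a i j * (c j)\<^sup>2) = 1"
begin

text \<open>The second variation after simplification by \<open>row\<close>: for
  \<open>i \<le> m\<close> the diagonal entry is \<open>1 + 2 * a i i * (c i)^2\<close>, where the 1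
  goes into \<open>P - B\<close> and the rest into the coupling sum, whose index pair
  \<open>i = j\<close> is included.\<close>

definition Q :: "(nat \<Rightarrow> 'x \<Rightarrow> real) \<Rightarrow> (nat \<Rightarrow> 'x \<Rightarrow> real) \<Rightarrow> real" where
  "Q \<phi> \<xi> = (\<Sum>i=m+1..n. P (\<phi> i) (\<xi> i) - b i * B (\<phi> i) (\<xi> i))
    + ((\<Sum>i=1..m. P (\<phi> i) (\<xi> i) - B (\<phi> i) (\<xi> i))
      - 2 * (\<Sum>i=1..m. \<Sum>j=1..m. a i j * c i * c j * B (\<phi> j) (\<xi> i)))"

definition coef :: "('x \<Rightarrow> real) \<Rightarrow> real" where "coef f = B f U / B U U"

definition rest :: "('x \<Rightarrow> real) \<Rightarrow> 'x \<Rightarrow> real" where "rest f = (\<lambda>x. f x - coef f * U x)"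

lemma rest_mem: "f \<in> H \<Longrightarrow> rest f \<in> H"
  unfolding rest_def by (intro P.diff_mem P.scale_mem U_mem)

text \<open>Since \<open>U\<close> is an eigenvector, \<open>B\<close>-orthogonality to
  \<open>U\<close> is also \<open>P\<close>-orthogonality, so one decomposition splits both
  forms.\<close>

lemma rest_U:
  assumes f: "f \<in> H"
  shows "B (rest f) U = 0" "B U (rest f) = 0" "P (rest f) U = 0" "P U (rest f) = 0"
proof -
  show 1: "B (rest f) U = 0"
    unfolding rest_def using B.diff_left[OF f B.scale_mem[OF U_mem] U_mem, of "coef f"] B.scale_left[OF U_mem U_mem, of "coef f"] UU
    by (simp add: coef_def)
  show 2: "B U (rest f) = 0" using 1 B.sym[OF U_mem rest_mem[OF f]] by simp
  show 3: "P U (rest f) = 0" using 2 PU[OF rest_mem[OF f]] by simp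
  show "P (rest f) U = 0" using 3 P.sym[OF U_mem rest_mem[OF f]] by simp
qed

lemma decompose: "f = (\<lambda>x. rest f x + coef f * U x)"
  by (simp add: rest_def)

lemma split_forms:
  assumes f: "f \<in> H" and g: "g \<in> H"
  shows "B f g = B (rest f) (rest g) + coef f * coef g * B U U"
    "P f g = P (rest f) (rest g) + coef f * coef g * B U U"
    "P f (rest g) = P (rest f) (rest g)" "B f (rest g) = B (rest f) (rest g)"
proof -
  note r = rest_mem[OF f] rest_mem[OF g]
  have B1: "B f w = B (rest f) w + coef f * B U w" and P1: "P f w = P (rest f) w + coef f * P U w" if "w \<in> H" for w
    using B.lincomb[OF r(1) U_mem that, of "coef f"] P.lincomb[OF r(1) U_mem that, of "coef f"] decompose[of f] by simp_all
  have B2: "B w g = B w (rest g) + coef g * B w U" and P2: "P w g = P w (rest g) + coef g * P w U" if "w \<in> H" for w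
    using B.lincomb_right[OF r(2) U_mem that, of "coef g"] P.lincomb_right[OF r(2) U_mem that, of "coef g"] decompose[of g] by simp_all
  show "B f (rest g) = B (rest f) (rest g)" "P f (rest g) = P (rest f) (rest g)"
    using B1[OF r(2)] P1[OF r(2)] rest_U[OF g] by simp_all
  show "B f g = B (rest f) (rest g) + coef f * coef g * B U U"
    using B1[OF g] B2[OF r(1)] B2[OF U_mem] rest_U[OF f] rest_U[OF g] by simp
  show "P f g = P (rest f) (rest g) + coef f * coef g * B U U"
    using P1[OF g] P2[OF r(1)] P2[OF U_mem] rest_U[OF f] rest_U[OF g] PU[OF U_mem] by simp
qed

text \<open>The vector \<open>c\<close> is a positive eigenvector of the nonnegative coupling matrix
  \<open>a i j * c i * c j\<close>, with eigenvalue 1, so the matrix is bounded by the identity.\<close>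
lemma coupling_le:
  assumes \<zeta>: "\<And>i. i \<in> {1..m} \<Longrightarrow> f i \<in> H"
  shows "(\<Sum>i=1..m. \<Sum>j=1..m. a i j * c i * c j * B (f j) (f i)) \<le> (\<Sum>i=1..m. B (f i) (f i))"
proof -
  \<comment> \<open>\<open>B s s \<ge> 0\<close> for \<open>s = c j * f i - c i * f j\<close>,
    multiplied by \<open>a i j \<ge> 0\<close>. The weights make the sums over a row of
    \<open>a i j * (c j)^2\<close> appear, which equal 1.\<close>
  have "2 * (a i j * c i * c j * B (f j) (f i)) \<le> a i j * (c j)\<^sup>2 * B (f i) (f i) + a j i * (c i)\<^sup>2 * B (f j) (f j)"
    if i: "i \<in> {1..m}" and j: "j \<in> {1..m}" for i j
  proof -
    let ?s = "\<lambda>x. c j * f i x + (- c i) * f j x"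
    have s: "?s \<in> H" "(\<lambda>x. c j * f i x) \<in> H" by (intro P.lincomb_mem P.scale_mem \<zeta> i j)+
    have "B ?s ?s = (c j)\<^sup>2 * B (f i) (f i) - 2 * c i * c j * B (f i) (f j) + (c i)\<^sup>2 * B (f j) (f j)"
      using B.quadratic[OF s(2) \<zeta>[OF j], of "- c i"] B.scale_left[OF \<zeta>[OF i] s(2), of "c j"]
        B.scale_right[OF \<zeta>[OF i] \<zeta>[OF i], of "c j"] B.scale_left[OF \<zeta>[OF i] \<zeta>[OF j], of "c j"]
      by (simp add: power2_eq_square)
    then have "0 \<le> (c j)\<^sup>2 * B (f i) (f i) - 2 * c i * c j * B (f j) (f i) + (c i)\<^sup>2 * B (f j) (f j)"
      using B.nonneg[OF s(1)] B.sym[OF \<zeta>[OF i] \<zeta>[OF j]] by simp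
    then have "0 \<le> a i j * ((c j)\<^sup>2 * B (f i) (f i) - 2 * c i * c j * B (f j) (f i) + (c i)\<^sup>2 * B (f j) (f j))"
      using a_nonneg[OF i j] by (rule mult_nonneg_nonneg[rotated])
    then show ?thesis using a_sym[OF i j] by (simp add: algebra_simps)
  qed
  then have "(\<Sum>i=1..m. \<Sum>j=1..m. 2 * (a i j * c i * c j * B (f j) (f i)))
      \<le> (\<Sum>i=1..m. \<Sum>j=1..m. a i j * (c j)\<^sup>2 * B (f i) (f i) + a j i * (c i)\<^sup>2 * B (f j) (f j))"
    by (intro sum_mono) auto
  also have "\<dots> = (\<Sum>i=1..m. \<Sum>j=1..m. a i j * (c j)\<^sup>2 * B (f i) (f i)) + (\<Sum>i=1..m. \<Sum>j=1..m. a j i * (c i)\<^sup>2 * B (f j) (f j))"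
    by (simp add: sum.distrib)
  also have "(\<Sum>i=1..m. \<Sum>j=1..m. a j i * (c i)\<^sup>2 * B (f j) (f j)) = (\<Sum>i=1..m. \<Sum>j=1..m. a i j * (c j)\<^sup>2 * B (f i) (f i))"
    by (rule sum.swap)
  also have "(\<Sum>i=1..m. \<Sum>j=1..m. a i j * (c j)\<^sup>2 * B (f i) (f i)) = (\<Sum>i=1..m. B (f i) (f i))"
    by (intro sum.cong refl) (use row in \<open>simp add: sum_distrib_right[symmetric]\<close>)
  finally show ?thesis by (simp add: sum_distrib_left[symmetric])
qed

text \<open>On the parts along \<open>U\<close> the difference \<open>P - B\<close> cancels; only
  the coupling sees them, leaving the form of \<open>A_m\<close> in the variables
  \<open>c i * coef (\<phi> i)\<close>.\<close>

lemma block_eq: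
  assumes \<phi>: "\<And>i. i \<in> {1..m} \<Longrightarrow> \<phi> i \<in> H"
  shows "(\<Sum>i=1..m. P (\<phi> i) (\<phi> i) - B (\<phi> i) (\<phi> i)) - 2 * (\<Sum>i=1..m. \<Sum>j=1..m. a i j * c i * c j * B (\<phi> j) (\<phi> i))
    = (\<Sum>i=1..m. P (rest (\<phi> i)) (rest (\<phi> i)) - B (rest (\<phi> i)) (rest (\<phi> i)))
      - 2 * (\<Sum>i=1..m. \<Sum>j=1..m. a i j * c i * c j * B (rest (\<phi> j)) (rest (\<phi> i)))
      - 2 * (\<Sum>i=1..m. \<Sum>j=1..m. a i j * (c i * coef (\<phi> i)) * (c j * coef (\<phi> j))) * B U U"
proof -
  have "(\<Sum>i=1..m. P (\<phi> i) (\<phi> i) - B (\<phi> i) (\<phi> i)) = (\<Sum>i=1..m. P (rest (\<phi> i)) (rest (\<phi> i)) - B (rest (\<phi> i)) (rest (\<phi> i)))"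
    by (intro sum.cong refl) (simp add: split_forms(1,2)[OF \<phi> \<phi>])
  moreover have "(\<Sum>i=1..m. \<Sum>j=1..m. a i j * c i * c j * B (\<phi> j) (\<phi> i))
      = (\<Sum>i=1..m. \<Sum>j=1..m. a i j * c i * c j * B (rest (\<phi> j)) (rest (\<phi> i)) + a i j * (c i * coef (\<phi> i)) * (c j * coef (\<phi> j)) * B U U)"
    by (intro sum.cong refl) (simp add: split_forms(1)[OF \<phi> \<phi>] algebra_simps)
  ultimately show ?thesis by (simp add: sum.distrib sum_distrib_right)
qed

text \<open>The rests lose one copy of \<open>B\<close> in \<open>P - B\<close> and at most two more
  in twice the coupling; \<open>gap\<close> provides exactly these three.\<close>

lemma block_ge:
  assumes \<phi>: "\<And>i. i \<in> {1..m} \<Longrightarrow> \<phi> i \<in> H"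
  shows "(\<Sum>i=1..m. P (\<phi> i) (\<phi> i) - B (\<phi> i) (\<phi> i)) - 2 * (\<Sum>i=1..m. \<Sum>j=1..m. a i j * c i * c j * B (\<phi> j) (\<phi> i))
    \<ge> - 2 * (\<Sum>i=1..m. \<Sum>j=1..m. a i j * (c i * coef (\<phi> i)) * (c j * coef (\<phi> j))) * B U U"
proof -
  have "0 \<le> (\<Sum>i=1..m. P (rest (\<phi> i)) (rest (\<phi> i)) - 3 * B (rest (\<phi> i)) (rest (\<phi> i)))"
    by (intro sum_nonneg) (use gap[OF rest_mem rest_U(1)] \<phi> in auto)
  then show ?thesis
    using block_eq[OF \<phi>] coupling_le[of "\<lambda>i. rest (\<phi> i)"] rest_mem[OF \<phi>]
    by (simp add: sum_subtractf sum_distrib_left[symmetric])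
qed

text \<open>The case of equality in \<open>block_ge\<close> makes each \<open>rest\<close> a minimizer of \<open>P - 3 B\<close> on the complement of
  \<open>U\<close>, hence an eigenfunction for the eigenvalue 3.\<close>
lemma kernel_components:
  assumes \<phi>: "\<And>i. i \<in> {1..n} \<Longrightarrow> \<phi> i \<in> H"
    and ker: "\<And>\<xi>. (\<And>i. i \<in> {1..n} \<Longrightarrow> \<xi> i \<in> H) \<Longrightarrow> Q \<phi> \<xi> = 0"
    and no3: "\<And>f. f \<in> H \<Longrightarrow> (\<And>v. v \<in> H \<Longrightarrow> P f v = 3 * B f v) \<Longrightarrow> B f f = 0"
  shows "k \<in> {m+1..n} \<Longrightarrow> v \<in> H \<Longrightarrow> P (\<phi> k) v = b k * B (\<phi> k) v"
    "i \<in> {1..m} \<Longrightarrow> B (rest (\<phi> i)) (rest (\<phi> i)) = 0"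
    "i \<in> {1..m} \<Longrightarrow> (\<Sum>j=1..m. a i j * (c j * coef (\<phi> j))) = 0"
proof -
  have \<phi>m: "\<phi> i \<in> H" if "i \<in> {1..m}" for i using that mn by (intro \<phi>) auto
  have zr: "B w (\<lambda>_. 0) = 0" "P w (\<lambda>_. 0) = 0" if "w \<in> H" for w
    using B.zero_left[OF that] P.zero_left[OF that] B.sym[OF that B.zero_mem] P.sym[OF that P.zero_mem] by simp_all
  have single: "(if k \<in> {m+1..n} then P (\<phi> k) v - b k * B (\<phi> k) v else 0)
      + ((if k \<in> {1..m} then P (\<phi> k) v - B (\<phi> k) v else 0)
        - 2 * (if k \<in> {1..m} then \<Sum>j=1..m. a k j * c k * c j * B (\<phi> j) v else 0)) = 0"
    if k: "k \<in> {1..n}" and v: "v \<in> H" for k v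
  proof -
    \<comment> \<open>Testing with a vector that has a single nonzero component separates the
      equations.\<close>
    let ?\<xi> = "\<lambda>i. if i = k then v else (\<lambda>_. 0)"
    have "Q \<phi> ?\<xi> = 0" by (rule ker) (use v P.zero_mem in auto)
    moreover have "(\<Sum>i=m+1..n. P (\<phi> i) (?\<xi> i) - b i * B (\<phi> i) (?\<xi> i))
        = (\<Sum>i=m+1..n. if i = k then P (\<phi> k) v - b k * B (\<phi> k) v else 0)"
      by (intro sum.cong refl) (use zr \<phi> in auto)
    moreover have "(\<Sum>i=1..m. P (\<phi> i) (?\<xi> i) - B (\<phi> i) (?\<xi> i)) = (\<Sum>i=1..m. if i = k then P (\<phi> k) v - B (\<phi> k) v else 0)"
      by (intro sum.cong refl) (use zr \<phi>m in auto)
    moreover have "(\<Sum>i=1..m. \<Sum>j=1..m. a i j * c i * c j * B (\<phi> j) (?\<xi> i))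
        = (\<Sum>i=1..m. if i = k then \<Sum>j=1..m. a k j * c k * c j * B (\<phi> j) v else 0)"
      by (intro sum.cong refl) (use zr \<phi>m in auto)
    ultimately show ?thesis unfolding Q_def by (simp only: sum.delta' sum.delta finite_atLeastAtMost)
  qed
  show "P (\<phi> k) v = b k * B (\<phi> k) v" if "k \<in> {m+1..n}" "v \<in> H" for k v
    using single[of k v] that by simp
  have blk: "P (\<phi> i) v - B (\<phi> i) v - 2 * (\<Sum>j=1..m. a i j * c i * c j * B (\<phi> j) v) = 0" if "i \<in> {1..m}" "v \<in> H" for i v
    using single[of i v] that mn by simp
  let ?\<zeta> = "\<lambda>i. rest (\<phi> i)"
  note \<zeta> = rest_mem[OF \<phi>m]
  have "(\<Sum>i=1..m. P (?\<zeta> i) (?\<zeta> i) - B (?\<zeta> i) (?\<zeta> i) - 2 * (\<Sum>j=1..m. a i j * c i * c j * B (?\<zeta> j) (?\<zeta> i))) = 0"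
  proof (intro sum.neutral ballI)
    fix i assume i: "i \<in> {1..m}"
    have "(\<Sum>j=1..m. a i j * c i * c j * B (\<phi> j) (?\<zeta> i)) = (\<Sum>j=1..m. a i j * c i * c j * B (?\<zeta> j) (?\<zeta> i))"
      by (intro sum.cong refl) (simp add: split_forms(4)[OF \<phi>m \<phi>m[OF i]])
    then show "P (?\<zeta> i) (?\<zeta> i) - B (?\<zeta> i) (?\<zeta> i) - 2 * (\<Sum>j=1..m. a i j * c i * c j * B (?\<zeta> j) (?\<zeta> i)) = 0"
      using blk[OF i \<zeta>[OF i]] split_forms(3,4)[OF \<phi>m[OF i] \<phi>m[OF i]] by simp
  qed
  then have "(\<Sum>i=1..m. P (?\<zeta> i) (?\<zeta> i) - 3 * B (?\<zeta> i) (?\<zeta> i)) \<le> 0"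
    using coupling_le[of ?\<zeta>, OF \<zeta>] by (simp add: sum_subtractf sum_distrib_left[symmetric])
  moreover have nn: "0 \<le> P (?\<zeta> i) (?\<zeta> i) - 3 * B (?\<zeta> i) (?\<zeta> i)" if "i \<in> {1..m}" for i
    using gap[OF \<zeta>[OF that] rest_U(1)[OF \<phi>m[OF that]]] by simp
  ultimately have "(\<Sum>i=1..m. P (?\<zeta> i) (?\<zeta> i) - 3 * B (?\<zeta> i) (?\<zeta> i)) = 0"
    by (intro antisym sum_nonneg) auto
  then have eq: "P (?\<zeta> i) (?\<zeta> i) - 3 * B (?\<zeta> i) (?\<zeta> i) = 0" if "i \<in> {1..m}" for i
    using sum_nonneg_eq_0_iff[of "{1..m}" "\<lambda>i. P (?\<zeta> i) (?\<zeta> i) - 3 * B (?\<zeta> i) (?\<zeta> i)"] nn that by auto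
  define M where "M = {v\<in>H. B v U = 0}"
  interpret N: pos_form M "\<lambda>u v. P u v - 3 * B u v"
  proof
    show "P u v - 3 * B u v = P v u - 3 * B v u" if "u \<in> M" "v \<in> M" for u v
      using that P.sym[of u v] B.sym[of u v] by (simp add: M_def)
    show "(\<lambda>x. u x + r * v x) \<in> M" if "u \<in> M" "v \<in> M" for u v r
      using that U_mem by (simp add: M_def P.lincomb_mem B.lincomb)
    show "(\<lambda>_. 0) \<in> M" by (simp add: M_def P.zero_mem B.zero_left[OF U_mem])
    show "0 \<le> P u u - 3 * B u u" if "u \<in> M" for u
      using gap[of u] that by (simp add: M_def)
  qed (auto simp: M_def P.lincomb B.lincomb algebra_simps)
  show null': "B (?\<zeta> i) (?\<zeta> i) = 0" if i: "i \<in> {1..m}" for i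
  proof (rule no3[OF \<zeta>[OF i]])
    fix v assume v: "v \<in> H"
    have "?\<zeta> i \<in> M" "rest v \<in> M" using \<zeta>[OF i] rest_mem[OF v] rest_U(1)[OF \<phi>m[OF i]] rest_U(1)[OF v] by (auto simp: M_def)
    then have "P (?\<zeta> i) (rest v) - 3 * B (?\<zeta> i) (rest v) = 0" by (rule N.null_left[OF _ _ eq[OF i]])
    moreover have "P (?\<zeta> i) v = P (?\<zeta> i) (rest v)" "B (?\<zeta> i) v = B (?\<zeta> i) (rest v)"
      using decompose[of v] P.lincomb_right[OF rest_mem[OF v] U_mem \<zeta>[OF i], of "coef v"]
        B.lincomb_right[OF rest_mem[OF v] U_mem \<zeta>[OF i], of "coef v"] rest_U[OF \<phi>m[OF i]] by simp_all
    ultimately show "P (?\<zeta> i) v = 3 * B (?\<zeta> i) v" by simp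
  qed
  \<comment> \<open>The i-th equation is tested with \<open>U\<close>: there \<open>P - B\<close>
    contributes nothing, and the coupling leaves the coefficients along \<open>U\<close> with the
    common factor \<open>c i * B U U\<close>.\<close>
  show "(\<Sum>j=1..m. a i j * (c j * coef (\<phi> j))) = 0" if i: "i \<in> {1..m}" for i
  proof -
    have BU: "B (\<phi> j) U = coef (\<phi> j) * B U U" "P (\<phi> j) U = coef (\<phi> j) * B U U" if "j \<in> {1..m}" for j
      using UU PU[OF \<phi>m[OF that]] P.sym[OF \<phi>m[OF that] U_mem] B.sym[OF \<phi>m[OF that] U_mem] by (simp_all add: coef_def)
    have "(\<Sum>j=1..m. a i j * c i * c j * B (\<phi> j) U) = (\<Sum>j=1..m. c i * B U U * (a i j * (c j * coef (\<phi> j))))"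
      by (intro sum.cong refl) (simp add: BU)
    then have "(\<Sum>j=1..m. a i j * c i * c j * B (\<phi> j) U) = c i * B U U * (\<Sum>j=1..m. a i j * (c j * coef (\<phi> j)))"
      by (simp only: sum_distrib_left)
    then have "c i * B U U * (\<Sum>j=1..m. a i j * (c j * coef (\<phi> j))) = 0"
      using blk[OF i U_mem] BU[OF i] by linarith
    then show ?thesis using c_pos[OF i] UU by simp
  qed
qed

text \<open>The diagonal terms vanish by \<open>PU\<close>. The division by \<open>c j\<close>
  cancels the factor \<open>c j\<close> of the coupling, which leaves row \<open>i\<close> of
  \<open>A_m\<close> applied to \<open>\<gamma>\<close>.\<close>

lemma Q_generator_block:
  assumes \<gamma>: "\<And>i. i \<in> {1..m} \<Longrightarrow> (\<Sum>j=1..m. a i j * \<gamma> j) = 0" and \<xi>: "\<And>i. i \<in> {1..n} \<Longrightarrow> \<xi> i \<in> H"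
  shows "Q (\<lambda>i x. if i \<in> {1..m} then \<gamma> i / c i * U x else 0) \<xi> = 0"
proof -
  let ?\<phi> = "\<lambda>i x. if i \<in> {1..m} then \<gamma> i / c i * U x else 0"
  have \<xi>m: "\<xi> i \<in> H" if "i \<in> {1..m}" for i using that mn by (intro \<xi>) auto
  have in_m: "?\<phi> i = (\<lambda>x. \<gamma> i / c i * U x)" if "i \<in> {1..m}" for i using that by auto
  have out: "?\<phi> i = (\<lambda>_. 0)" if "i \<in> {m+1..n}" for i using that by auto
  have "(\<Sum>i=m+1..n. P (?\<phi> i) (\<xi> i) - b i * B (?\<phi> i) (\<xi> i)) = 0"
  proof (intro sum.neutral ballI)
    fix i assume i: "i \<in> {m+1..n}"
    show "P (?\<phi> i) (\<xi> i) - b i * B (?\<phi> i) (\<xi> i) = 0"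
      unfolding out[OF i] using i by (simp add: P.zero_left B.zero_left \<xi>)
  qed
  moreover have "(\<Sum>i=1..m. P (?\<phi> i) (\<xi> i) - B (?\<phi> i) (\<xi> i)) = 0"
  proof (intro sum.neutral ballI)
    fix i assume i: "i \<in> {1..m}"
    show "P (?\<phi> i) (\<xi> i) - B (?\<phi> i) (\<xi> i) = 0"
      unfolding in_m[OF i] by (simp only: P.scale_left[OF U_mem \<xi>m[OF i]] B.scale_left[OF U_mem \<xi>m[OF i]] PU[OF \<xi>m[OF i]] diff_self)
  qed
  moreover have "(\<Sum>i=1..m. \<Sum>j=1..m. a i j * c i * c j * B (?\<phi> j) (\<xi> i)) = 0"
  proof (rule sum.neutral, rule ballI)
    fix i assume i: "i \<in> {1..m}"
    have "(\<Sum>j=1..m. a i j * c i * c j * B (?\<phi> j) (\<xi> i)) = (\<Sum>j=1..m. c i * B U (\<xi> i) * (a i j * \<gamma> j))"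
    proof (intro sum.cong refl)
      fix j assume j: "j \<in> {1..m}"
      have "B (?\<phi> j) (\<xi> i) = \<gamma> j / c j * B U (\<xi> i)"
        unfolding in_m[OF j] by (rule B.scale_left[OF U_mem \<xi>m[OF i]])
      then show "a i j * c i * c j * B (?\<phi> j) (\<xi> i) = c i * B U (\<xi> i) * (a i j * \<gamma> j)"
        using c_pos[OF j] by simp
    qed
    also have "\<dots> = c i * B U (\<xi> i) * (\<Sum>j=1..m. a i j * \<gamma> j)" by (simp only: sum_distrib_left)
    finally show "(\<Sum>j=1..m. a i j * c i * c j * B (?\<phi> j) (\<xi> i)) = 0" using \<gamma>[OF i] by simp
  qed
  ultimately show ?thesis unfolding Q_def by (simp only: add_0 diff_0_right mult_zero_right)
qed

lemma Q_generator_single: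
  assumes k: "k \<in> {m+1..n}" and f: "f \<in> H" "\<And>v. v \<in> H \<Longrightarrow> P f v = b k * B f v"
    and \<xi>: "\<And>i. i \<in> {1..n} \<Longrightarrow> \<xi> i \<in> H"
  shows "Q (\<lambda>i x. if i = k then f x else 0) \<xi> = 0"
proof -
  let ?\<phi> = "\<lambda>i x. if i = k then f x else 0"
  have \<xi>m: "\<xi> i \<in> H" if "i \<in> {1..m}" for i using that mn by (intro \<xi>) auto
  have out: "?\<phi> i = (\<lambda>_. 0)" if "i \<in> {1..m}" for i using that k by auto
  have 1: "P (?\<phi> i) (\<xi> i) - b i * B (?\<phi> i) (\<xi> i) = 0" if i: "i \<in> {m+1..n}" for i
    using f(2)[OF \<xi>, of i] i P.zero_left[OF \<xi>, of i] B.zero_left[OF \<xi>, of i] by (cases "i = k") auto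
  have 2: "P (?\<phi> i) (\<xi> i) - B (?\<phi> i) (\<xi> i) = 0" if i: "i \<in> {1..m}" for i
    unfolding out[OF i] by (simp add: P.zero_left B.zero_left \<xi>m[OF i])
  have 3: "a i j * c i * c j * B (?\<phi> j) (\<xi> i) = 0" if i: "i \<in> {1..m}" and j: "j \<in> {1..m}" for i j
    unfolding out[OF j] by (simp add: B.zero_left \<xi>m[OF i])
  show ?thesis unfolding Q_def by (simp add: 1 2 3 del: One_nat_def)
qed

lemma Q_sum_left:
  assumes F: "finite F" "\<And>w i. w \<in> F \<Longrightarrow> i \<in> {1..n} \<Longrightarrow> w i \<in> H" and \<xi>: "\<And>i. i \<in> {1..n} \<Longrightarrow> \<xi> i \<in> H"
  shows "Q (\<lambda>i x. \<Sum>w\<in>F. r w * w i x) \<xi> = (\<Sum>w\<in>F. r w * Q w \<xi>)"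
proof -
  have Fm: "w i \<in> H" if "w \<in> F" "i \<in> {1..m}" for w i using that mn by (intro F(2)) auto
  have Fn: "w i \<in> H" if "w \<in> F" "i \<in> {m+1..n}" for w i using that by (intro F(2)) auto
  have \<xi>m: "\<xi> i \<in> H" if "i \<in> {1..m}" for i using that mn by (intro \<xi>) auto
  have \<xi>n: "\<xi> i \<in> H" if "i \<in> {m+1..n}" for i using that by (intro \<xi>) auto
  have "(\<Sum>i=m+1..n. P (\<lambda>x. \<Sum>w\<in>F. r w * w i x) (\<xi> i) - b i * B (\<lambda>x. \<Sum>w\<in>F. r w * w i x) (\<xi> i))
      = (\<Sum>i=m+1..n. \<Sum>w\<in>F. r w * (P (w i) (\<xi> i) - b i * B (w i) (\<xi> i)))"
  proof (intro sum.cong refl)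
    fix i assume i: "i \<in> {m+1..n}"
    show "P (\<lambda>x. \<Sum>w\<in>F. r w * w i x) (\<xi> i) - b i * B (\<lambda>x. \<Sum>w\<in>F. r w * w i x) (\<xi> i)
        = (\<Sum>w\<in>F. r w * (P (w i) (\<xi> i) - b i * B (w i) (\<xi> i)))"
    proof -
      have "P (\<lambda>x. \<Sum>w\<in>F. r w * w i x) (\<xi> i) = (\<Sum>w\<in>F. r w * P (w i) (\<xi> i))"
        by (rule P.sum_left) (use F(1) Fn[OF _ i] \<xi>n[OF i] in auto)
      moreover have "B (\<lambda>x. \<Sum>w\<in>F. r w * w i x) (\<xi> i) = (\<Sum>w\<in>F. r w * B (w i) (\<xi> i))"
        by (rule B.sum_left) (use F(1) Fn[OF _ i] \<xi>n[OF i] in auto)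
      ultimately show ?thesis by (simp add: sum_distrib_left sum_subtractf algebra_simps)
    qed
  qed
  then have 1: "(\<Sum>i=m+1..n. P (\<lambda>x. \<Sum>w\<in>F. r w * w i x) (\<xi> i) - b i * B (\<lambda>x. \<Sum>w\<in>F. r w * w i x) (\<xi> i))
      = (\<Sum>w\<in>F. r w * (\<Sum>i=m+1..n. P (w i) (\<xi> i) - b i * B (w i) (\<xi> i)))"
    unfolding sum_distrib_left by (subst sum.swap) simp
  have "(\<Sum>i=1..m. P (\<lambda>x. \<Sum>w\<in>F. r w * w i x) (\<xi> i) - B (\<lambda>x. \<Sum>w\<in>F. r w * w i x) (\<xi> i))
      = (\<Sum>i=1..m. \<Sum>w\<in>F. r w * (P (w i) (\<xi> i) - B (w i) (\<xi> i)))"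
  proof (intro sum.cong refl)
    fix i assume i: "i \<in> {1..m}"
    show "P (\<lambda>x. \<Sum>w\<in>F. r w * w i x) (\<xi> i) - B (\<lambda>x. \<Sum>w\<in>F. r w * w i x) (\<xi> i)
        = (\<Sum>w\<in>F. r w * (P (w i) (\<xi> i) - B (w i) (\<xi> i)))"
    proof -
      have "P (\<lambda>x. \<Sum>w\<in>F. r w * w i x) (\<xi> i) = (\<Sum>w\<in>F. r w * P (w i) (\<xi> i))"
        by (rule P.sum_left) (use F(1) Fm[OF _ i] \<xi>m[OF i] in auto)
      moreover have "B (\<lambda>x. \<Sum>w\<in>F. r w * w i x) (\<xi> i) = (\<Sum>w\<in>F. r w * B (w i) (\<xi> i))"
        by (rule B.sum_left) (use F(1) Fm[OF _ i] \<xi>m[OF i] in auto)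
      ultimately show ?thesis by (simp add: sum_subtractf algebra_simps)
    qed
  qed
  then have 2: "(\<Sum>i=1..m. P (\<lambda>x. \<Sum>w\<in>F. r w * w i x) (\<xi> i) - B (\<lambda>x. \<Sum>w\<in>F. r w * w i x) (\<xi> i))
      = (\<Sum>w\<in>F. r w * (\<Sum>i=1..m. P (w i) (\<xi> i) - B (w i) (\<xi> i)))"
    unfolding sum_distrib_left by (subst sum.swap) simp
  have "(\<Sum>i=1..m. \<Sum>j=1..m. a i j * c i * c j * B (\<lambda>x. \<Sum>w\<in>F. r w * w j x) (\<xi> i))
      = (\<Sum>i=1..m. \<Sum>j=1..m. \<Sum>w\<in>F. r w * (a i j * c i * c j * B (w j) (\<xi> i)))"
  proof (intro sum.cong refl)
    fix i j assume i: "i \<in> {1..m}" and j: "j \<in> {1..m}"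
    show "a i j * c i * c j * B (\<lambda>x. \<Sum>w\<in>F. r w * w j x) (\<xi> i) = (\<Sum>w\<in>F. r w * (a i j * c i * c j * B (w j) (\<xi> i)))"
    proof -
      have "B (\<lambda>x. \<Sum>w\<in>F. r w * w j x) (\<xi> i) = (\<Sum>w\<in>F. r w * B (w j) (\<xi> i))"
        by (rule B.sum_left) (use F(1) Fm[OF _ j] \<xi>m[OF i] in auto)
      then show ?thesis by (simp add: sum_distrib_left algebra_simps)
    qed
  qed
  also have "\<dots> = (\<Sum>i=1..m. \<Sum>w\<in>F. \<Sum>j=1..m. r w * (a i j * c i * c j * B (w j) (\<xi> i)))"
    by (rule sum.cong[OF refl], rule sum.swap)
  also have "\<dots> = (\<Sum>w\<in>F. \<Sum>i=1..m. \<Sum>j=1..m. r w * (a i j * c i * c j * B (w j) (\<xi> i)))"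
    by (rule sum.swap)
  finally have 3: "(\<Sum>i=1..m. \<Sum>j=1..m. a i j * c i * c j * B (\<lambda>x. \<Sum>w\<in>F. r w * w j x) (\<xi> i))
      = (\<Sum>w\<in>F. r w * (\<Sum>i=1..m. \<Sum>j=1..m. a i j * c i * c j * B (w j) (\<xi> i)))"
    by (simp only: sum_distrib_left)
  show ?thesis unfolding Q_def 1 2 3
    by (simp add: sum.distrib sum_subtractf distrib_left right_diff_distrib sum_distrib_left mult.left_commute del: One_nat_def)
qed

end

section \<open>Counting negative directions\<close>

context coupled_system begin

text \<open>Its cardinality is the claimed Morse index. The tag 0 cannot clash with a component,
  since these are at least \<open>m + 1\<close>.\<close>

definition neg_index :: "(nat \<Rightarrow> real) \<Rightarrow> (nat \<times> nat) set" where
  "neg_index \<kappa> = Pair 0 ` {l\<in>{..<m}. \<kappa> l > 0} \<union> (SIGMA k:{m+1..n}. {i\<in>{1..}. \<omega> i < b k})"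

text \<open>The pairs with first component \<open>0\<close> stand for the positive eigenvectors \<open>v l\<close> of the matrix, the
  others for the eigenfunctions in the components that vanish.\<close>
definition neg_vec :: "(nat \<Rightarrow> nat \<Rightarrow> real) \<Rightarrow> nat \<times> nat \<Rightarrow> nat \<Rightarrow> 'x \<Rightarrow> real" where
  "neg_vec v s = (if fst s = 0 then (\<lambda>j x. if j \<in> {1..m} then v (snd s) j / c j * U x else 0)
    else (\<lambda>j x. if j = fst s then \<psi> (snd s) x else 0))"

lemma finite_neg_index: "finite (neg_index \<kappa>)"
  unfolding neg_index_def by (intro finite_UnI finite_imageI finite_SigmaI finite_eigenvalues_below) auto

lemma sum_neg_index:
  "(\<Sum>s\<in>neg_index \<kappa>. f s) = (\<Sum>l | l < m \<and> \<kappa> l > 0. f (0, l)) + (\<Sum>k=m+1..n. \<Sum>i\<in>{i\<in>{1..}. \<omega> i < b k}. f (k, i))"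
  for f :: "nat \<times> nat \<Rightarrow> 'z::comm_monoid_add"
proof -
  have "(\<Sum>s\<in>neg_index \<kappa>. f s) = sum f (Pair 0 ` {l\<in>{..<m}. \<kappa> l > 0}) + sum f (SIGMA k:{m+1..n}. {i\<in>{1..}. \<omega> i < b k})"
    unfolding neg_index_def
  proof (rule sum.union_disjoint)
    show "finite (SIGMA k:{m+1..n}. {i\<in>{1..}. \<omega> i < b k})"
      by (rule finite_SigmaI[OF _ finite_eigenvalues_below]) simp
  qed auto
  moreover have "sum f (Pair 0 ` {l\<in>{..<m}. \<kappa> l > 0}) = (\<Sum>l | l < m \<and> \<kappa> l > 0. f (0, l))"
    by (subst sum.reindex) (auto simp: inj_on_def)
  moreover have "sum f (SIGMA k:{m+1..n}. {i\<in>{1..}. \<omega> i < b k}) = (\<Sum>k=m+1..n. \<Sum>i\<in>{i\<in>{1..}. \<omega> i < b k}. f (k, i))"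
  proof -
    have "\<forall>k\<in>{m+1..n}. finite {i\<in>{1..}. \<omega> i < b k}" by (intro ballI finite_eigenvalues_below)
    from sum.Sigma[OF finite_atLeastAtMost this, of "\<lambda>k i. f (k, i)"]
    show ?thesis by (simp only: split_def prod.collapse)
  qed
  ultimately show ?thesis by simp
qed

lemma card_neg_index:
  "card (neg_index \<kappa>) = card {l\<in>{..<m}. \<kappa> l > 0} + (\<Sum>k=m+1..n. card {i\<in>{1..}. \<omega> i < b k})"
  using sum_neg_index[of "\<lambda>_. 1 :: nat" \<kappa>] by simp

lemma neg_vec_mem: "s \<in> neg_index \<kappa> \<Longrightarrow> neg_vec v s j \<in> H"
proof -
  assume s: "s \<in> neg_index \<kappa>"
  have "neg_vec v s j = (if fst s = 0 then (if j \<in> {1..m} then \<lambda>x. v (snd s) j / c j * U x else (\<lambda>_. 0))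
      else if j = fst s then \<psi> (snd s) else (\<lambda>_. 0))"
    by (auto simp: neg_vec_def)
  moreover have "fst s = 0 \<or> snd s \<in> {1..}" using s by (auto simp: neg_index_def)
  moreover have "(\<lambda>x. v (snd s) j / c j * U x) \<in> H" by (rule P.scale_mem[OF U_mem])
  ultimately show ?thesis using eig_mem[of "snd s"] P.zero_mem
    by (cases "fst s = 0"; cases "j \<in> {1..m}"; cases "j = fst s") (simp_all only: if_True if_False simp_thms)
qed

text \<open>One linear condition per element of \<open>neg_index\<close>. Those from the matrix
  remove the positive squares from the diagonalized form of \<open>A_m\<close>, which enters with
  the factor -2; the others put each remaining component into the scope of
  \<open>nonneg_on_complement\<close>.\<close>

lemma Q_nonneg_on_complement:
  assumes \<phi>: "\<And>i. i \<in> {1..n} \<Longrightarrow> \<phi> i \<in> H"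
    and diag: "\<And>x. (\<Sum>i=1..m. \<Sum>j=1..m. a i j * x i * x j) = (\<Sum>l<m. \<kappa> l * (\<Sum>i=1..m. v l i * x i)\<^sup>2)"
    and perp: "\<And>l. l < m \<Longrightarrow> \<kappa> l > 0 \<Longrightarrow> (\<Sum>i=1..m. v l i * c i * B (\<phi> i) U) = 0"
      "\<And>k i. k \<in> {m+1..n} \<Longrightarrow> i \<in> {1..} \<Longrightarrow> \<omega> i < b k \<Longrightarrow> B (\<phi> k) (\<psi> i) = 0"
  shows "0 \<le> Q \<phi> \<phi>"
proof -
  have \<phi>m: "\<phi> i \<in> H" if "i \<in> {1..m}" for i using that mn by (intro \<phi>) auto
  have "0 \<le> (\<Sum>i=m+1..n. P (\<phi> i) (\<phi> i) - b i * B (\<phi> i) (\<phi> i))"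
  proof (rule sum_nonneg)
    fix k assume k: "k \<in> {m+1..n}"
    have "b k * B (\<phi> k) (\<phi> k) \<le> P (\<phi> k) (\<phi> k)"
      by (rule nonneg_on_complement) (use k \<phi> perp(2)[OF k] in auto)
    then show "0 \<le> P (\<phi> k) (\<phi> k) - b k * B (\<phi> k) (\<phi> k)" by simp
  qed
  moreover have "(\<Sum>i=1..m. \<Sum>j=1..m. a i j * (c i * coef (\<phi> i)) * (c j * coef (\<phi> j))) \<le> 0"
  proof -
    have "\<kappa> l * (\<Sum>i=1..m. v l i * (c i * coef (\<phi> i)))\<^sup>2 \<le> 0" if l: "l < m" for l
    proof (cases "\<kappa> l > 0")
      case True
      have "(\<Sum>i=1..m. v l i * (c i * coef (\<phi> i))) = (\<Sum>i=1..m. v l i * c i * B (\<phi> i) U) / B U U"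
        by (simp add: coef_def sum_divide_distrib mult.assoc)
      then show ?thesis using perp(1)[OF l True] by simp
    next
      case False
      then show ?thesis by (simp add: mult_nonpos_nonneg)
    qed
    then show ?thesis unfolding diag[of "\<lambda>i. c i * coef (\<phi> i)"] by (intro sum_nonpos) auto
  qed
  then have "- 2 * (\<Sum>i=1..m. \<Sum>j=1..m. a i j * (c i * coef (\<phi> i)) * (c j * coef (\<phi> j))) * B U U \<ge> 0"
    using UU by (simp add: mult_nonpos_nonneg)
  ultimately show ?thesis unfolding Q_def using block_ge[of \<phi>, OF \<phi>m] by linarith
qed

text \<open>The matrix part and the components beyond \<open>m\<close> do not interact in
  \<open>Q\<close>. Each contributes at most 0, and the one that carries a nonzero coefficient
  contributes strictly less.\<close>

lemma Q_negative_on_span: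
  assumes diag: "\<And>x. (\<Sum>i=1..m. \<Sum>j=1..m. a i j * x i * x j) = (\<Sum>l<m. \<kappa> l * (\<Sum>i=1..m. v l i * x i)\<^sup>2)"
    and orth: "\<And>l l'. l < m \<Longrightarrow> l' < m \<Longrightarrow> (\<Sum>i=1..m. v l i * v l' i) = (if l = l' then 1 else 0)"
    and r: "\<exists>s\<in>neg_index \<kappa>. r s \<noteq> 0"
  defines "\<phi> \<equiv> (\<lambda>j x. \<Sum>s\<in>neg_index \<kappa>. r s * neg_vec v s j x)"
  shows "Q \<phi> \<phi> < 0"
proof -
  let ?L = "{l. l < m \<and> \<kappa> l > 0}" and ?I = "\<lambda>k. {i\<in>{1..}. \<omega> i < b k}"
  \<comment> \<open>The division by \<open>c j\<close> in \<open>neg_vec\<close> undoes the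
    congruence by diag(c), so the coupling becomes the form of \<open>A_m\<close> at
    \<open>y\<close>.\<close>
  define y where "y = (\<lambda>j. \<Sum>l\<in>?L. r (0, l) * v l j)"
  have low: "\<phi> j = (\<lambda>x. y j / c j * U x)" if j: "j \<in> {1..m}" for j
  proof
    fix x
    have "\<phi> j x = (\<Sum>l\<in>?L. r (0, l) * (v l j / c j * U x)) + (\<Sum>k=m+1..n. \<Sum>i\<in>?I k. 0)"
      unfolding \<phi>_def sum_neg_index using j
      by (intro arg_cong2[where f = "(+)"] sum.cong refl) (auto simp: neg_vec_def)
    then show "\<phi> j x = y j / c j * U x" by (simp add: y_def sum_distrib_right sum_divide_distrib mult.assoc)
  qed
  have high: "\<phi> k = (\<lambda>x. \<Sum>i\<in>?I k. r (k, i) * \<psi> i x)" if k: "k \<in> {m+1..n}" for k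
  proof
    fix x
    have "\<phi> k x = (\<Sum>l\<in>?L. 0) + (\<Sum>k'=m+1..n. if k' = k then \<Sum>i\<in>?I k. r (k, i) * \<psi> i x else 0)"
      unfolding \<phi>_def sum_neg_index using k
      by (intro arg_cong2[where f = "(+)"] sum.cong refl) (auto simp: neg_vec_def)
    then show "\<phi> k x = (\<Sum>i\<in>?I k. r (k, i) * \<psi> i x)" using k by simp
  qed
  have fin: "finite (?I k)" for k by (rule finite_eigenvalues_below)
  have Pk: "P (\<phi> k) (\<phi> k) - b k * B (\<phi> k) (\<phi> k) \<le> 0 \<and>
      ((\<exists>i\<in>?I k. r (k, i) \<noteq> 0) \<longrightarrow> P (\<phi> k) (\<phi> k) - b k * B (\<phi> k) (\<phi> k) < 0)" if k: "k \<in> {m+1..n}" for k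
  proof (cases "\<exists>i\<in>?I k. r (k, i) \<noteq> 0")
    case True
    then have "P (\<phi> k) (\<phi> k) < b k * B (\<phi> k) (\<phi> k)"
      unfolding high[OF k] by (intro negative_on_span fin) auto
    then show ?thesis by simp
  next
    case False
    then have "\<phi> k = (\<lambda>_. 0)" unfolding high[OF k] by (intro ext sum.neutral) auto
    then show ?thesis using False P.zero_left[OF P.zero_mem] B.zero_left[OF P.zero_mem] by simp
  qed
  have 1: "(\<Sum>i=1..m. P (\<phi> i) (\<phi> i) - B (\<phi> i) (\<phi> i)) = 0"
  proof (intro sum.neutral ballI)
    fix i assume i: "i \<in> {1..m}"
    show "P (\<phi> i) (\<phi> i) - B (\<phi> i) (\<phi> i) = 0"
      unfolding low[OF i]
      by (simp only: P.scale_left[OF U_mem P.scale_mem[OF U_mem]] B.scale_left[OF U_mem P.scale_mem[OF U_mem]]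
          PU[OF P.scale_mem[OF U_mem]] diff_self)
  qed
  have "a i j * c i * c j * B (\<phi> j) (\<phi> i) = a i j * y i * y j * B U U" if i: "i \<in> {1..m}" and j: "j \<in> {1..m}" for i j
  proof -
    have "B (\<phi> j) (\<phi> i) = y j / c j * (y i / c i * B U U)"
      unfolding low[OF i] low[OF j]
      by (simp only: B.scale_left[OF U_mem P.scale_mem[OF U_mem]] B.scale_right[OF U_mem U_mem])
    then show ?thesis using c_pos[OF i] c_pos[OF j] by simp
  qed
  then have "(\<Sum>i=1..m. \<Sum>j=1..m. a i j * c i * c j * B (\<phi> j) (\<phi> i)) = (\<Sum>i=1..m. \<Sum>j=1..m. a i j * y i * y j * B U U)"
    by (intro sum.cong refl)
  also have "\<dots> = (\<Sum>i=1..m. \<Sum>j=1..m. a i j * y i * y j) * B U U" by (simp add: sum_distrib_right)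
  also have "\<dots> = (\<Sum>l<m. \<kappa> l * (\<Sum>i=1..m. v l i * y i)\<^sup>2) * B U U" unfolding diag ..
  also have "(\<Sum>l<m. \<kappa> l * (\<Sum>i=1..m. v l i * y i)\<^sup>2) = (\<Sum>l<m. if l \<in> ?L then \<kappa> l * (r (0, l))\<^sup>2 else 0)"
  proof (intro sum.cong refl)
    fix l assume "l \<in> {..<m}"
    then have l: "l < m" by simp
    have "(\<Sum>i=1..m. v l i * y i) = (\<Sum>i=1..m. \<Sum>l'\<in>?L. r (0, l') * (v l i * v l' i))"
      by (simp add: y_def sum_distrib_left mult.left_commute)
    also have "\<dots> = (\<Sum>l'\<in>?L. \<Sum>i=1..m. r (0, l') * (v l i * v l' i))" by (rule sum.swap)
    also have "\<dots> = (\<Sum>l'\<in>?L. r (0, l') * (\<Sum>i=1..m. v l i * v l' i))" by (simp only: sum_distrib_left)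
    also have "\<dots> = (\<Sum>l'\<in>?L. if l' = l then r (0, l) else 0)"
      by (intro sum.cong refl) (use orth[OF l] in auto)
    also have "\<dots> = (if l \<in> ?L then r (0, l) else 0)" by simp
    finally show "\<kappa> l * (\<Sum>i=1..m. v l i * y i)\<^sup>2 = (if l \<in> ?L then \<kappa> l * (r (0, l))\<^sup>2 else 0)" by simp
  qed
  also have "(\<Sum>l<m. if l \<in> ?L then \<kappa> l * (r (0, l))\<^sup>2 else 0) = (\<Sum>l\<in>?L. \<kappa> l * (r (0, l))\<^sup>2)"
    by (rule sum.mono_neutral_cong_right) auto
  finally have 2: "(\<Sum>i=1..m. \<Sum>j=1..m. a i j * c i * c j * B (\<phi> j) (\<phi> i)) = (\<Sum>l\<in>?L. \<kappa> l * (r (0, l))\<^sup>2) * B U U" .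
  have Qeq: "Q \<phi> \<phi> = (\<Sum>k=m+1..n. P (\<phi> k) (\<phi> k) - b k * B (\<phi> k) (\<phi> k)) - 2 * ((\<Sum>l\<in>?L. \<kappa> l * (r (0, l))\<^sup>2) * B U U)"
    unfolding Q_def 1 2 by simp
  have nonpos: "(\<Sum>k=m+1..n. P (\<phi> k) (\<phi> k) - b k * B (\<phi> k) (\<phi> k)) \<le> 0" using Pk by (intro sum_nonpos) auto
  have nonneg: "0 \<le> (\<Sum>l\<in>?L. \<kappa> l * (r (0, l))\<^sup>2)" by (intro sum_nonneg) auto
  obtain s where s: "s \<in> neg_index \<kappa>" "r s \<noteq> 0" using r by blast
  then consider l where "l \<in> ?L" "s = (0, l)" | k i where "k \<in> {m+1..n}" "i \<in> ?I k" "s = (k, i)"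
    by (auto simp: neg_index_def)
  then show ?thesis
  proof cases
    case 1
    have "0 < \<kappa> l * (r (0, l))\<^sup>2" using 1 s by auto
    also have "\<dots> \<le> (\<Sum>l\<in>?L. \<kappa> l * (r (0, l))\<^sup>2)" using 1 by (intro member_le_sum) auto
    finally have "0 < (\<Sum>l\<in>?L. \<kappa> l * (r (0, l))\<^sup>2) * B U U" using UU by simp
    then show ?thesis using Qeq nonpos by linarith
  next
    case 2
    have "(\<Sum>k=m+1..n. P (\<phi> k) (\<phi> k) - b k * B (\<phi> k) (\<phi> k)) < (\<Sum>k=m+1..n. 0)"
    proof (rule sum_strict_mono_ex1)
      show "\<exists>k\<in>{m+1..n}. P (\<phi> k) (\<phi> k) - b k * B (\<phi> k) (\<phi> k) < 0"
        by (rule bexI[OF _ 2(1)]) (use Pk[OF 2(1)] 2(2,3) s(2) in blast)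
    qed (use Pk in auto)
    moreover have "0 \<le> (\<Sum>l\<in>?L. \<kappa> l * (r (0, l))\<^sup>2) * B U U" using nonneg UU by simp
    ultimately show ?thesis using Qeq by simp
  qed
qed

text \<open>More vectors than linear conditions: some nontrivial combination meets all the
  conditions under which \<open>Q\<close> is nonnegative.\<close>

lemma exists_nonneg_direction:
  assumes W: "\<And>p i. p < K \<Longrightarrow> i \<in> {1..n} \<Longrightarrow> W p i \<in> H" and K: "card (neg_index \<kappa>) < K"
    and diag: "\<And>x. (\<Sum>i=1..m. \<Sum>j=1..m. a i j * x i * x j) = (\<Sum>l<m. \<kappa> l * (\<Sum>i=1..m. v l i * x i)\<^sup>2)"
  shows "\<exists>r. (\<exists>p<K. r p \<noteq> 0) \<and> 0 \<le> Q (\<lambda>i x. \<Sum>p<K. r p * W p i x) (\<lambda>i x. \<Sum>p<K. r p * W p i x)"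
proof -
  define l where "l = (\<lambda>s p. if fst s = 0 then \<Sum>i=1..m. v (snd s) i * c i * B (W p i) U else B (W p (fst s)) (\<psi> (snd s)))"
  obtain r where r: "\<exists>p\<in>{..<K}. r p \<noteq> 0" "\<forall>s\<in>neg_index \<kappa>. (\<Sum>p<K. l s p * r p) = 0"
    using underdetermined_system[OF finite_neg_index, of "{..<K}" \<kappa> l] K by auto
  let ?\<phi> = "\<lambda>i x. \<Sum>p<K. r p * W p i x"
  have "0 \<le> Q ?\<phi> ?\<phi>"
  proof (rule Q_nonneg_on_complement[OF _ diag])
    show "?\<phi> i \<in> H" if "i \<in> {1..n}" for i by (rule P.sum_mem) (use W that in auto)
    have left: "B (?\<phi> i) f = (\<Sum>p<K. r p * B (W p i) f)" if "i \<in> {1..n}" "f \<in> H" for i f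
      by (rule B.sum_left) (use W that in auto)
    show "(\<Sum>i=1..m. v j i * c i * B (?\<phi> i) U) = 0" if j: "j < m" "\<kappa> j > 0" for j
    proof -
      have "(\<Sum>i=1..m. v j i * c i * B (?\<phi> i) U) = (\<Sum>i=1..m. \<Sum>p<K. v j i * c i * B (W p i) U * r p)"
        by (intro sum.cong refl) (use left[OF _ U_mem] mn in \<open>simp add: sum_distrib_left mult_ac\<close>)
      also have "\<dots> = (\<Sum>p<K. \<Sum>i=1..m. v j i * c i * B (W p i) U * r p)" by (rule sum.swap)
      also have "\<dots> = (\<Sum>p<K. l (0, j) p * r p)" by (simp add: l_def sum_distrib_right)
      also have "\<dots> = 0" by (rule bspec[OF r(2)]) (use j in \<open>auto simp: neg_index_def\<close>)
      finally show ?thesis .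
    qed
    show "B (?\<phi> k) (\<psi> i) = 0" if k: "k \<in> {m+1..n}" and i: "i \<in> {1..}" "\<omega> i < b k" for k i
    proof -
      have "B (?\<phi> k) (\<psi> i) = (\<Sum>p<K. l (k, i) p * r p)"
        using left[of k "\<psi> i"] k eig_mem[OF i(1)] by (simp add: l_def mult.commute)
      also have "\<dots> = 0" by (rule bspec[OF r(2)]) (use k i in \<open>auto simp: neg_index_def\<close>)
      finally show ?thesis .
    qed
  qed
  then show ?thesis using r(1) by blast
qed

end

section \<open>Morse index and linearized kernel\<close>

text \<open>Negativity for every nonzero coefficient vector already yields independence, because a
  combination vanishing almost everywhere would have second variation 0. The basis may be indexed by
  any finite set, which suits pairs.\<close>

lemma morse_index_ge:
  assumes S: "finite S" "\<And>s. s \<in> S \<Longrightarrow> w s \<in> Hvec \<Omega> n"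
    and neg: "\<And>r. \<exists>s\<in>S. r s \<noteq> 0 \<Longrightarrow>
      energy'' \<Omega> lam n a u (\<lambda>i x. \<Sum>s\<in>S. r s * w s i x) (\<lambda>i x. \<Sum>s\<in>S. r s * w s i x) < 0"
    and zero: "\<And>\<phi>. \<phi> \<in> Hvec \<Omega> n \<Longrightarrow> vzero \<Omega> n \<phi> \<Longrightarrow> energy'' \<Omega> lam n a u \<phi> \<phi> = 0"
    and sum_mem: "\<And>r. (\<lambda>i x. \<Sum>s\<in>S. r s * w s i x) \<in> Hvec \<Omega> n"
  shows "enat (card S) \<le> morse_index \<Omega> lam n a u"
proof -
  obtain \<beta> where \<beta>: "bij_betw \<beta> {..<card S} S"
    using ex_bij_betw_nat_finite[OF S(1)] by (auto simp: atLeast0LessThan)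
  let ?\<beta>' = "the_inv_into {..<card S} \<beta>"
  have inv: "?\<beta>' (\<beta> p) = p" if "p < card S" for p
    using the_inv_into_f_f[of \<beta> "{..<card S}" p] \<beta> that by (simp add: bij_betw_def)
  have \<beta>S: "\<beta> p \<in> S" if "p < card S" for p using \<beta> that by (auto simp: bij_betw_def)
  have sum: "(\<lambda>i x. \<Sum>p<card S. r p * w (\<beta> p) i x) = (\<lambda>i x. \<Sum>s\<in>S. r (?\<beta>' s) * w s i x)" for r
  proof (intro ext)
    fix i x
    have "(\<Sum>s\<in>S. r (?\<beta>' s) * w s i x) = (\<Sum>p<card S. r (?\<beta>' (\<beta> p)) * w (\<beta> p) i x)"
      by (rule sum.reindex_bij_betw[OF \<beta>, symmetric])
    then show "(\<Sum>p<card S. r p * w (\<beta> p) i x) = (\<Sum>s\<in>S. r (?\<beta>' s) * w s i x)" by (simp add: inv)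
  qed
  have neg': "energy'' \<Omega> lam n a u (\<lambda>i x. \<Sum>p<card S. r p * w (\<beta> p) i x) (\<lambda>i x. \<Sum>p<card S. r p * w (\<beta> p) i x) < 0"
    if p: "p < card S" "r p \<noteq> 0" for r p
    unfolding sum using inv[OF p(1)] p(2) \<beta>S[OF p(1)] by (intro neg bexI[of _ "\<beta> p"]) auto
  show ?thesis
    unfolding morse_index_def
  proof (rule SUP_upper, rule CollectI, intro exI[of _ "\<lambda>p. w (\<beta> p)"] conjI allI impI)
    show "w (\<beta> p) \<in> Hvec \<Omega> n" if "p < card S" for p by (rule S(2)[OF \<beta>S[OF that]])
    show "r p = 0" if "vzero \<Omega> n (\<lambda>i x. \<Sum>p<card S. r p * w (\<beta> p) i x)" "p < card S" for r p
    proof (rule ccontr)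
      assume "r p \<noteq> 0"
      moreover have "energy'' \<Omega> lam n a u (\<lambda>i x. \<Sum>p<card S. r p * w (\<beta> p) i x) (\<lambda>i x. \<Sum>p<card S. r p * w (\<beta> p) i x) = 0"
        by (rule zero[OF _ that(1)]) (simp only: sum sum_mem)
      ultimately show False using neg'[OF that(2)] by fastforce
    qed
    show "let \<phi> = \<lambda>i x. \<Sum>p<card S. r p * w (\<beta> p) i x in \<not> vzero \<Omega> n \<phi> \<longrightarrow> energy'' \<Omega> lam n a u \<phi> \<phi> < 0" for r
      unfolding Let_def
    proof
      assume nz: "\<not> vzero \<Omega> n (\<lambda>i x. \<Sum>p<card S. r p * w (\<beta> p) i x)"
      have "\<exists>p<card S. r p \<noteq> 0"
      proof (rule ccontr)
        assume "\<not> (\<exists>p<card S. r p \<noteq> 0)"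
        then have "(\<Sum>p<card S. r p * w (\<beta> p) i x) = 0" for i x by simp
        then show False using nz by (simp add: vzero_def)
      qed
      then show "energy'' \<Omega> lam n a u (\<lambda>i x. \<Sum>p<card S. r p * w (\<beta> p) i x) (\<lambda>i x. \<Sum>p<card S. r p * w (\<beta> p) i x) < 0"
        using neg' by blast
    qed
  qed
qed

text \<open>Independence makes a nontrivial combination nonzero as a function, so one with
  nonnegative second variation excludes the dimension \<open>k\<close>.\<close>

lemma morse_index_le:
  assumes "\<And>k W. (\<And>p. p < k \<Longrightarrow> W p \<in> Hvec \<Omega> n) \<Longrightarrow> K < k \<Longrightarrow>
    \<exists>r. (\<exists>p<k. r p \<noteq> 0) \<and> 0 \<le> energy'' \<Omega> lam n a u (\<lambda>i x. \<Sum>p<k. r p * W p i x) (\<lambda>i x. \<Sum>p<k. r p * W p i x)"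
  shows "morse_index \<Omega> lam n a u \<le> enat K"
  unfolding morse_index_def
proof (rule SUP_least, clarify)
  fix k and W :: "nat \<Rightarrow> nat \<Rightarrow> 'a \<Rightarrow> real"
  assume W: "\<forall>p<k. W p \<in> Hvec \<Omega> n"
    and ind: "\<forall>r. vzero \<Omega> n (\<lambda>i x. \<Sum>p<k. r p * W p i x) \<longrightarrow> (\<forall>p<k. r p = 0)"
    and neg: "\<forall>r. let \<phi> = \<lambda>i x. \<Sum>p<k. r p * W p i x in \<not> vzero \<Omega> n \<phi> \<longrightarrow> energy'' \<Omega> lam n a u \<phi> \<phi> < 0"
  show "enat k \<le> enat K"
  proof (rule ccontr)
    assume "\<not> enat k \<le> enat K"
    then have "K < k" by simp
    then obtain r where r: "\<exists>p<k. r p \<noteq> 0"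
      "0 \<le> energy'' \<Omega> lam n a u (\<lambda>i x. \<Sum>p<k. r p * W p i x) (\<lambda>i x. \<Sum>p<k. r p * W p i x)"
      using assms[of k W] W by blast
    then have "\<not> vzero \<Omega> n (\<lambda>i x. \<Sum>p<k. r p * W p i x)" using ind by blast
    then show False using neg[rule_format, of r] r(2) by (simp add: Let_def)
  qed
qed

text \<open>By monotonicity the set is an initial segment starting at 1, so its largest index is its
  size; finiteness is what gives \<open>Max\<close> a meaning.\<close>

lemma eigen_count_eq_card:
  assumes mono: "\<And>i j. 1 \<le> i \<Longrightarrow> i \<le> j \<Longrightarrow> \<omega> i \<le> \<omega> j" and fin: "finite {i\<in>{1..}. \<omega> i < x}"
  shows "eigen_count \<omega> x = card {i\<in>{1..}. \<omega> i < x}"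
proof -
  let ?X = "{i. 1 \<le> i \<and> \<omega> i < x}"
  have X: "{i\<in>{1..}. \<omega> i < x} = ?X" by auto
  show ?thesis
  proof (cases "?X = {}")
    case True
    show ?thesis unfolding eigen_count_def X by (simp only: True refl if_True card.empty)
  next
    case False
    have fin': "finite ?X" using fin unfolding X .
    note Max = Max_in[OF fin' False]
    have "?X = {1..Max ?X}"
    proof
      show "?X \<subseteq> {1..Max ?X}" using Max_ge[OF fin'] by auto
      show "{1..Max ?X} \<subseteq> ?X" using mono[of _ "Max ?X"] Max by fastforce
    qed
    then have "card ?X = Max ?X" by (metis card_atLeastAtMost diff_Suc_1)
    then show ?thesis unfolding eigen_count_def X using False by (simp only: if_False)
  qed
qed

section \<open>Spans up to null sets\<close>

lemma ae_span_cong: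
  assumes "\<phi> \<in> ae_span \<Omega> n S" "\<And>i. i \<in> {1..n} \<Longrightarrow> AE x in lebesgue_on \<Omega>. \<phi>' i x = \<phi> i x"
  shows "\<phi>' \<in> ae_span \<Omega> n S"
proof -
  obtain F r where F: "finite F" "F \<subseteq> S" "vzero \<Omega> n (\<lambda>i x. \<phi> i x - (\<Sum>w\<in>F. r w * w i x))"
    using assms(1) by (auto simp: ae_span_def)
  have "vzero \<Omega> n (\<lambda>i x. \<phi>' i x - (\<Sum>w\<in>F. r w * w i x))"
    unfolding vzero_def
  proof
    fix i assume i: "i \<in> {1..n}"
    then have "AE x in lebesgue_on \<Omega>. \<phi> i x - (\<Sum>w\<in>F. r w * w i x) = 0" using F(3) by (simp add: vzero_def)
    then show "AE x in lebesgue_on \<Omega>. \<phi>' i x - (\<Sum>w\<in>F. r w * w i x) = 0"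
      using assms(2)[OF i] by eventually_elim simp
  qed
  then show ?thesis using F by (auto simp: ae_span_def)
qed

lemma ae_span_base: "w \<in> S \<Longrightarrow> (\<lambda>i x. r * w i x) \<in> ae_span \<Omega> n S"
  by (auto simp: ae_span_def vzero_def intro!: exI[of _ "{w}"] exI[of _ "\<lambda>_. r"])

lemma ae_span_add:
  assumes "\<phi> \<in> ae_span \<Omega> n S" "\<xi> \<in> ae_span \<Omega> n S"
  shows "(\<lambda>i x. \<phi> i x + \<xi> i x) \<in> ae_span \<Omega> n S"
proof -
  obtain F r where F: "finite F" "F \<subseteq> S" "vzero \<Omega> n (\<lambda>i x. \<phi> i x - (\<Sum>w\<in>F. r w * w i x))"
    using assms(1) by (auto simp: ae_span_def)
  obtain G s where G: "finite G" "G \<subseteq> S" "vzero \<Omega> n (\<lambda>i x. \<xi> i x - (\<Sum>w\<in>G. s w * w i x))"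
    using assms(2) by (auto simp: ae_span_def)
  define t where "t = (\<lambda>w. (if w \<in> F then r w else 0) + (if w \<in> G then s w else 0))"
  have sum: "(\<Sum>w\<in>F \<union> G. t w * w i x) = (\<Sum>w\<in>F. r w * w i x) + (\<Sum>w\<in>G. s w * w i x)" for i x
  proof -
    have "(\<Sum>w\<in>F \<union> G. t w * w i x) = (\<Sum>w\<in>F \<union> G. (if w \<in> F then r w * w i x else 0)) + (\<Sum>w\<in>F \<union> G. (if w \<in> G then s w * w i x else 0))"
      unfolding sum.distrib[symmetric] t_def by (intro sum.cong refl) (simp add: algebra_simps)
    also have "(\<Sum>w\<in>F \<union> G. (if w \<in> F then r w * w i x else 0)) = (\<Sum>w\<in>F. r w * w i x)"
      using F(1) G(1) by (intro sum.mono_neutral_cong_right) auto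
    also have "(\<Sum>w\<in>F \<union> G. (if w \<in> G then s w * w i x else 0)) = (\<Sum>w\<in>G. s w * w i x)"
      using F(1) G(1) by (intro sum.mono_neutral_cong_right) auto
    finally show ?thesis .
  qed
  have "vzero \<Omega> n (\<lambda>i x. (\<phi> i x + \<xi> i x) - (\<Sum>w\<in>F \<union> G. t w * w i x))"
    unfolding vzero_def
  proof
    fix i assume i: "i \<in> {1..n}"
    have "AE x in lebesgue_on \<Omega>. \<phi> i x - (\<Sum>w\<in>F. r w * w i x) = 0" "AE x in lebesgue_on \<Omega>. \<xi> i x - (\<Sum>w\<in>G. s w * w i x) = 0"
      using F(3) G(3) i by (simp_all add: vzero_def)
    then show "AE x in lebesgue_on \<Omega>. (\<phi> i x + \<xi> i x) - (\<Sum>w\<in>F \<union> G. t w * w i x) = 0"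
      by eventually_elim (simp add: sum)
  qed
  then show ?thesis using F G unfolding ae_span_def by (intro CollectI exI[of _ "F \<union> G"] exI[of _ t]) auto
qed

lemma ae_span_sum:
  "finite I \<Longrightarrow> (\<And>k. k \<in> I \<Longrightarrow> f k \<in> ae_span \<Omega> n S) \<Longrightarrow> (\<lambda>i x. \<Sum>k\<in>I. f k i x) \<in> ae_span \<Omega> n S"
proof (induction I rule: finite_induct)
  case empty
  show ?case by (auto simp: ae_span_def vzero_def intro!: exI[of _ "{}"])
next
  case (insert k I)
  then show ?case using ae_span_add[of "f k" \<Omega> n S "\<lambda>i x. \<Sum>k\<in>I. f k i x"] by simp
qed

theorem theorem2p6:
  fixes \<Omega> :: "'a::euclidean_space set"
    and lam :: real
    and U :: "'a \<Rightarrow> real"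
    and \<omega> :: "nat \<Rightarrow> real"
    and \<psi> :: "nat \<Rightarrow> 'a \<Rightarrow> real"
    and n m :: nat
    and a :: "nat \<Rightarrow> nat \<Rightarrow> real"
    and c :: "nat \<Rightarrow> real"
    and u :: "nat \<Rightarrow> 'a \<Rightarrow> real"
  assumes dim: "DIM('a) \<le> 3"
    and domain: "open \<Omega>" "connected \<Omega>" "\<Omega> \<noteq> {}"
    and lam: "lam > 0"
    and U: "least_energy_positive_solution \<Omega> lam U"
    and U_morse: "scalar_morse_index \<Omega> lam U = 1"
    and eigen: "eigen_listing \<Omega> lam U \<omega> \<psi>"
    and a_sym: "\<And>i j. i \<in> {1..n} \<Longrightarrow> j \<in> {1..n} \<Longrightarrow> a i j = a j i"
    and a_nonneg: "\<And>i j. i \<in> {1..n} \<Longrightarrow> j \<in> {1..n} \<Longrightarrow> a i j \<ge> 0"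
    and m: "1 \<le> m" "m < n"
    and c_pos: "\<And>i. i \<in> {1..m} \<Longrightarrow> c i > 0"
    and c_zero: "\<And>i. i \<in> {m+1..n} \<Longrightarrow> c i = 0"
    and u: "u = (\<lambda>i x. c i * U x)"
    and u_sol: "semi_vector_nonneg_solution \<Omega> lam n a u"
  shows "morse_index \<Omega> lam n a u =
           enat (num_pos_eigenvalues (leading_block m a)
                 + (\<Sum>i=m+1..n. eigen_count \<omega> (Bcoeff n a c i i)))
       \<and> (scalar_nondegenerate \<Omega> lam U \<longrightarrow>
           linearized_kernel \<Omega> lam n a u =
             ae_span \<Omega> n
               ({(\<lambda>i x. if i \<in> {1..m} then \<gamma> i / c i * U x else 0) |\<gamma>::nat \<Rightarrow> real.
                   \<forall>i\<in>{1..m}. (\<Sum>j=1..m. a i j * \<gamma> j) = 0}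
                \<union> (\<Union>k\<in>{m+1..n}.
                     {(\<lambda>i x. if i = k then \<psi> j x else 0) |j. 1 \<le> j \<and> Bcoeff n a c k k = \<omega> j})))
       \<and> (scalar_nondegenerate \<Omega> lam U \<and> Determinant.det (leading_block m a) \<noteq> 0
            \<and> (\<forall>k\<in>{m+1..n}. Bcoeff n a c k k \<notin> \<omega> ` {1..}) \<longrightarrow>
           system_nondegenerate \<Omega> lam n a u)"
proof -

  \<comment> \<open>The two forms and their null functions\<close>
  note \<Omega> = domain(1)
  let ?H = "Hspace \<Omega>" and ?P = "energy_form \<Omega> lam" and ?B = "weighted_form \<Omega> U" and ?M = "lebesgue_on \<Omega>"
  have U_sol: "scalar_solution \<Omega> lam U" and U_pos: "AE x in ?M. U x > 0"
    using U by (auto simp: least_energy_positive_solution_def)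
  have U_mem: "U \<in> ?H" using U_sol by (simp add: system_solution_def Hvec_def)
  have PU: "?P U v = ?B U v" if "v \<in> ?H" for v
  proof -
    have "?P U v = (\<integral>x. U x * (U x)\<^sup>2 * v x \<partial>?M)"
      using U_sol that by (simp add: system_solution_def energy_form_def)
    then show ?thesis by (simp add: weighted_form_def mult.commute)
  qed
  have Hvec_mem: "\<phi> i \<in> ?H" if "\<phi> \<in> Hvec \<Omega> k" "i \<in> {1..k}" for \<phi> k i
    using that by (simp add: Hvec_def)
  interpret CP: compact_pair ?H ?P ?B by (rule compact_pair_Hspace[OF \<Omega> dim lam U_mem])
  \<comment> \<open>Positivity of the weight almost everywhere is what makes \<open>B\<close>-null
    functions vanish.\<close>
  have B_zero_imp: "AE x in ?M. f x = 0" if f: "f \<in> ?H" "?B f f = 0" for f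
  proof -
    have "AE x in ?M. (U x)\<^sup>2 * f x * f x = 0"
      using f(2) integral_nonneg_eq_0_iff_AE[OF weighted_integrable[OF \<Omega> dim U_mem f(1) f(1)]]
      by (simp add: weighted_form_def mult.assoc)
    then show ?thesis using U_pos by eventually_elim auto
  qed
  have B_zero: "?B f v = 0" if "AE x in ?M. f x = 0" for f v
  proof -
    have "AE x in ?M. (U x)\<^sup>2 * f x * v x = 0" using that by eventually_elim simp
    then show ?thesis unfolding weighted_form_def by (rule integral_eq_zero_AE)
  qed
  have P_zero: "?P f v = 0" if "AE x in ?M. f x = 0" "v \<in> ?H" for f v
  proof -
    have "AE x in ?M. 0 = f x" using that(1) by eventually_elim simp
    from energy_form_AE_cong[OF \<Omega> H1_zero[OF \<Omega>] this Hspace_H1[OF \<Omega> that(2)], of lam]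
    show ?thesis using CP.P.zero_left[OF that(2)] by simp
  qed
  \<comment> \<open>Otherwise \<open>U\<close> would be both positive and zero almost everywhere,
    and a nonempty open set would be negligible.\<close>
  have UU: "?B U U > 0"
  proof (rule ccontr)
    assume "\<not> ?B U U > 0"
    then have "?B U U = 0" using CP.B.nonneg[OF U_mem] by simp
    from B_zero_imp[OF U_mem this] have "AE x in ?M. False" using U_pos by eventually_elim simp
    then have "AE x in lebesgue. x \<notin> \<Omega>"
      using domain_sets[OF \<Omega>] by (simp add: AE_restrict_space_iff)
    then have "\<Omega> \<in> null_sets lebesgue"
      using domain_sets[OF \<Omega>] by (simp add: AE_iff_null)
    then show False using open_not_negligible[OF domain(1,3)] by (simp add: negligible_iff_null_sets)
  qed

  \<comment> \<open>The listed eigenfunctions\<close>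
  have \<omega>1: "\<omega> 1 = 1" "\<omega> 1 < \<omega> 2" and \<omega>_step: "\<And>i. i \<ge> 2 \<Longrightarrow> \<omega> i \<le> \<omega> (i + 1)"
    and eig: "\<And>i. i \<ge> 1 \<Longrightarrow> weighted_eigen_eq \<Omega> lam U (\<omega> i) (\<psi> i)"
    and indep: "\<And>F r i. finite F \<Longrightarrow> F \<subseteq> {1..} \<Longrightarrow> AE x in ?M. (\<Sum>i\<in>F. r i * \<psi> i x) = 0 \<Longrightarrow> i \<in> F \<Longrightarrow> r i = 0"
    and all_eig: "\<And>mu p. weighted_eigen_eq \<Omega> lam U mu p \<Longrightarrow> \<exists>F r. finite F \<and> F \<subseteq> {i. 1 \<le> i \<and> \<omega> i = mu} \<and>
           (AE x in ?M. p x = (\<Sum>i\<in>F. r i * \<psi> i x))"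
  proof -
    note E1 = eigen[unfolded eigen_listing_def, THEN conjunct2] and E0 = eigen[unfolded eigen_listing_def, THEN conjunct1]
    note E2 = E1[THEN conjunct2, THEN conjunct2]
    note E3 = E2[THEN conjunct2] and E23 = E2[THEN conjunct1]
    show "\<omega> 1 = 1" by (rule E0)
    show "\<omega> 1 < \<omega> 2" by (rule E1[THEN conjunct1])
    show "\<omega> i \<le> \<omega> (i + 1)" if "i \<ge> 2" for i
      using E1[THEN conjunct2, THEN conjunct1] that by simp
    show "weighted_eigen_eq \<Omega> lam U (\<omega> i) (\<psi> i)" if "i \<ge> 1" for i using E23 that by (simp only:)
    show "r i = 0" if "finite F" "F \<subseteq> {1..}" "AE x in ?M. (\<Sum>i\<in>F. r i * \<psi> i x) = 0" "i \<in> F" for F r i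
      by (rule E3[THEN conjunct1, rule_format, OF conjI[OF that(1) conjI[OF that(2,3)]] that(4)])
    show "\<exists>F r. finite F \<and> F \<subseteq> {i. 1 \<le> i \<and> \<omega> i = mu} \<and>
           (AE x in ?M. p x = (\<Sum>i\<in>F. r i * \<psi> i x))" if "weighted_eigen_eq \<Omega> lam U mu p" for mu p
      by (rule E3[THEN conjunct2, rule_format, OF that])
  qed
  have \<omega>_mono: "\<omega> i \<le> \<omega> j" if "1 \<le> i" "i \<le> j" for i j
    using that(2)
  proof (induction j rule: dec_induct)
    case (step k)
    \<comment> \<open>The listing orders the values only from index 2 on; the step from 1 to 2 is
      \<open>\<omega> 1 < \<omega> 2\<close>.\<close>
    have "\<omega> k \<le> \<omega> (k + 1)" using \<omega>_step[of k] \<omega>1 that(1) step(1) by (cases "k = 1") (auto simp: numeral_2_eq_2)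
    then show ?case using step by simp
  qed simp
  have weq: "weighted_eigen_eq \<Omega> lam U mu p \<longleftrightarrow> p \<in> ?H \<and> (\<forall>v\<in>?H. ?P p v = mu * ?B p v)" for mu p
    by (simp add: weighted_eigen_eq_def energy_form_def weighted_form_def)
  interpret EF: eigen_family ?H ?P ?B "{1..}" \<omega> \<psi>
  proof
    show "\<psi> i \<in> ?H" if "i \<in> {1..}" for i using eig that by (simp add: weq)
    then have sum_mem: "(\<lambda>x. \<Sum>i\<in>F. r i * \<psi> i x) \<in> ?H" if "finite F" "F \<subseteq> {1..}" for F r
      using that by (intro CP.P.sum_mem) auto
    show "?P (\<psi> i) v = \<omega> i * ?B (\<psi> i) v" if "i \<in> {1..}" "v \<in> ?H" for i v using eig that by (simp add: weq)
    show "\<omega> i > 0" if "i \<in> {1..}" for i using \<omega>_mono[of 1 i] \<omega>1 that by simp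
    show "r i = 0" if "finite F" "F \<subseteq> {1..}" "?B (\<lambda>x. \<Sum>i\<in>F. r i * \<psi> i x) (\<lambda>x. \<Sum>i\<in>F. r i * \<psi> i x) = 0" "i \<in> F" for F r i
      by (rule indep[OF that(1,2) B_zero_imp[OF sum_mem[OF that(1,2)] that(3)] that(4)])
    show "\<exists>F r. finite F \<and> F \<subseteq> {i\<in>{1..}. \<omega> i = mu} \<and>
        ?B (\<lambda>x. p x - (\<Sum>i\<in>F. r i * \<psi> i x)) (\<lambda>x. p x - (\<Sum>i\<in>F. r i * \<psi> i x)) = 0"
      if p: "p \<in> ?H" "\<And>v. v \<in> ?H \<Longrightarrow> ?P p v = mu * ?B p v" for mu p
    proof -
      have "weighted_eigen_eq \<Omega> lam U mu p"
        unfolding weq by (intro conjI p(1) ballI p(2))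
      from all_eig[OF this] obtain F r where F: "finite F" "F \<subseteq> {i. 1 \<le> i \<and> \<omega> i = mu}"
        "AE x in ?M. p x = (\<Sum>i\<in>F. r i * \<psi> i x)" by (elim exE conjE)
      have "AE x in ?M. p x - (\<Sum>i\<in>F. r i * \<psi> i x) = 0" using F(3) by eventually_elim simp
      from B_zero[OF this] show ?thesis using F(1,2) by (intro exI[of _ F] exI[of _ r]) auto
    qed
  qed

  \<comment> \<open>The gap given by Morse index 1\<close>
  have \<omega>2: "\<omega> 2 \<ge> 3"
  proof (rule ccontr)
    assume less: "\<not> \<omega> 2 \<ge> 3"
    \<comment> \<open>For \<open>n = 1\<close> and unit coefficients the only entry of
      \<open>Bcoeff\<close> is \<open>2 + 1 = 3\<close>.\<close>
    have e1: "energy'' \<Omega> lam 1 (\<lambda>_ _. 1) (\<lambda>_. U) \<phi> \<phi> = ?P (\<phi> 1) (\<phi> 1) - 3 * ?B (\<phi> 1) (\<phi> 1)"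
      if "\<phi> \<in> Hvec \<Omega> 1" for \<phi>
      using energy''_proportional[OF \<Omega> dim lam _ U_mem that that, of "\<lambda>_ _. 1" "\<lambda>_. 1"] by (simp add: Bcoeff_def)
    have mem: "(\<lambda>i x. \<Sum>s\<in>{1, 2}. r s * \<psi> s x) \<in> Hvec \<Omega> 1" for r
      unfolding Hvec_def by (intro CollectI ballI CP.P.sum_mem EF.eig_mem) auto
    \<comment> \<open>With \<open>\<omega> 2 < 3\<close> the form \<open>P - 3 B\<close> is negative
      on the span of the first two eigenfunctions, so the index would be at least 2.\<close>
    have "enat (card {1::nat, 2}) \<le> scalar_morse_index \<Omega> lam U"
    proof (rule morse_index_ge[where w = "\<lambda>s _. \<psi> s"])
      show "(\<lambda>_. \<psi> s) \<in> Hvec \<Omega> 1" if "s \<in> {1, 2}" for s using that EF.eig_mem by (auto simp: Hvec_def)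
      show "energy'' \<Omega> lam 1 (\<lambda>_ _. 1) (\<lambda>_. U) (\<lambda>i x. \<Sum>s\<in>{1, 2}. r s * \<psi> s x) (\<lambda>i x. \<Sum>s\<in>{1, 2}. r s * \<psi> s x) < 0"
        if "\<exists>s\<in>{1, 2}. r s \<noteq> 0" for r
      proof -
        have "{1, 2} \<subseteq> {i\<in>{1..}. \<omega> i < 3}" using less \<omega>1 by auto
        from EF.negative_on_span[OF _ this that] show ?thesis unfolding e1[OF mem] by simp
      qed
      show "energy'' \<Omega> lam 1 (\<lambda>_ _. 1) (\<lambda>_. U) \<phi> \<phi> = 0" if \<phi>: "\<phi> \<in> Hvec \<Omega> 1" "vzero \<Omega> 1 \<phi>" for \<phi>
      proof -
        have z: "AE x in ?M. \<phi> 1 x = 0" using \<phi>(2) by (simp add: vzero_def)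
        show ?thesis unfolding e1[OF \<phi>(1)] using B_zero[OF z] P_zero[OF z Hvec_mem[OF \<phi>(1)]] by simp
      qed
      show "(\<lambda>i x. \<Sum>s\<in>{1, 2}. r s * \<psi> s x) \<in> Hvec \<Omega> 1" for r by (rule mem)
    qed simp
    then show False unfolding U_morse by (simp add: one_enat_def)
  qed

  \<comment> \<open>Only index 1 can lie below 3. The eigenvalue 1 is simple, so \<open>U\<close>
    is, up to a null function, a nonzero multiple of \<open>\<psi> 1\<close>, and orthogonality to
    \<open>U\<close> is orthogonality to \<open>\<psi> 1\<close>.\<close>
  have gap: "3 * ?B v v \<le> ?P v v" if v: "v \<in> ?H" "?B v U = 0" for v
  proof (rule EF.nonneg_on_complement[OF v(1)])
    fix i assume i: "i \<in> {1..}" "\<omega> i < 3"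
    have i1: "i = 1" using i \<omega>_mono[of 2 i] \<omega>2 by force
    obtain F r where F: "finite F" "F \<subseteq> {i\<in>{1..}. \<omega> i = 1}"
      "?B (\<lambda>x. U x - (\<Sum>i\<in>F. r i * \<psi> i x)) (\<lambda>x. U x - (\<Sum>i\<in>F. r i * \<psi> i x)) = 0"
      using EF.all_eig[OF U_mem, of 1] PU by auto
    have F1: "F \<subseteq> {1}"
    proof
      fix j assume "j \<in> F"
      then have "j \<ge> 1" "\<omega> j = 1" using F(2) by auto
      then show "j \<in> {1}" using \<omega>_mono[of 2 j] \<omega>1 by force
    qed
    have FH: "\<psi> j \<in> ?H" if "j \<in> F" for j using that F(2) EF.eig_mem by auto
    have p: "(\<lambda>x. \<Sum>i\<in>F. r i * \<psi> i x) \<in> ?H" by (rule CP.P.sum_mem[OF F(1) FH])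
    have BU: "?B w U = (\<Sum>i\<in>F. r i * ?B w (\<psi> i))" if w: "w \<in> ?H" for w
    proof -
      note d = CP.P.diff_mem[OF U_mem p]
      have "?B w (\<lambda>x. U x - (\<Sum>i\<in>F. r i * \<psi> i x)) = 0"
        using CP.B.null_left[OF d w F(3)] CP.B.sym[OF d w] by simp
      then show ?thesis using CP.B.diff_right[OF U_mem p w] CP.B.sum_right[OF F(1) FH w, where r = r] by simp
    qed
    have "F \<noteq> {}" using BU[OF U_mem] UU by auto
    then have F_eq: "F = {1}" using F1 by auto
    have "r 1 \<noteq> 0" using BU[OF U_mem] UU F_eq by auto
    then show "?B v (\<psi> i) = 0" using BU[OF v(1)] v(2) F_eq i1 by simp
  qed

  \<comment> \<open>The system at the solution\<close>
  have ui: "u i = (\<lambda>x. c i * U x)" for i by (simp add: u)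
  \<comment> \<open>The i-th equation is tested with \<open>U\<close> and divided by
    \<open>c i\<close> and by the positive value of the weighted form at \<open>U\<close>.\<close>
  have row_n: "(\<Sum>j=1..n. a i j * (c j)\<^sup>2) = 1" if i: "i \<in> {1..m}" for i
  proof -
    have in': "i \<in> {1..n}" using i m by auto
    have "?P (u i) U = (\<integral>x. (\<Sum>j=1..n. a i j * u i x * (u j x)\<^sup>2) * U x \<partial>?M)"
      using u_sol in' U_mem by (simp add: semi_vector_nonneg_solution_def system_solution_def energy_form_def)
    also have "(\<lambda>x. (\<Sum>j=1..n. a i j * u i x * (u j x)\<^sup>2) * U x)
        = (\<lambda>x. ((\<Sum>j=1..n. a i j * (c j)\<^sup>2) * c i) * ((U x)\<^sup>2 * U x * U x))"
      by (simp add: ui sum_distrib_left sum_distrib_right power_mult_distrib mult_ac)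
    also have "(\<integral>x. ((\<Sum>j=1..n. a i j * (c j)\<^sup>2) * c i) * ((U x)\<^sup>2 * U x * U x) \<partial>?M)
        = ((\<Sum>j=1..n. a i j * (c j)\<^sup>2) * c i) * ?B U U"
      unfolding weighted_form_def by (rule integral_mult_right_zero)
    also have "?P (u i) U = c i * ?B U U"
      using CP.P.scale_left[OF U_mem U_mem, of "c i"] PU[OF U_mem] by (simp add: ui)
    finally show ?thesis using c_pos[OF i] UU by simp
  qed
  have split_n: "(\<Sum>i=1..n. f i) = (\<Sum>i=1..m. f i) + (\<Sum>i=m+1..n. f i)" for f :: "nat \<Rightarrow> real"
  proof -
    have "{1..n} = {1..m} \<union> {m+1..n}" using m by auto
    then show ?thesis by (simp add: sum.union_disjoint)
  qed
  define b where "b = (\<lambda>k. Bcoeff n a c k k)"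
  have row: "(\<Sum>j=1..m. a i j * (c j)\<^sup>2) = 1" if "i \<in> {1..m}" for i
    using row_n[OF that] c_zero unfolding split_n by simp
  interpret CS: coupled_system ?H ?P ?B \<omega> \<psi> U m n a b c
  proof
    show "?P f v = 0" if "f \<in> ?H" "v \<in> ?H" "?B f f = 0" for f v
      by (rule P_zero[OF B_zero_imp[OF that(1,3)] that(2)])
  qed (use U_mem PU UU gap m a_sym a_nonneg c_pos row in auto)

  \<comment> \<open>The second variation as the coupled form\<close>
  have E: "energy'' \<Omega> lam n a u \<phi> \<xi> = CS.Q \<phi> \<xi>" if \<phi>: "\<phi> \<in> Hvec \<Omega> n" and \<xi>: "\<xi> \<in> Hvec \<Omega> n" for \<phi> \<xi>
  proof -
    \<comment> \<open>By \<open>row_n\<close> the diagonal entry is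
      \<open>1 + 2 * a i i * (c i)^2\<close>, split between the plain form and the coupling.\<close>
    have low: "(\<Sum>j=1..n. Bcoeff n a c i j * ?B (\<phi> j) (\<xi> i))
        = ?B (\<phi> i) (\<xi> i) + 2 * (\<Sum>j=1..m. a i j * c i * c j * ?B (\<phi> j) (\<xi> i))" if i: "i \<in> {1..m}" for i
    proof -
      have "(\<Sum>j=m+1..n. Bcoeff n a c i j * ?B (\<phi> j) (\<xi> i)) = 0"
        by (intro sum.neutral ballI) (use i c_zero in \<open>auto simp: Bcoeff_def\<close>)
      moreover have "(\<Sum>j=1..m. Bcoeff n a c i j * ?B (\<phi> j) (\<xi> i))
          = (\<Sum>j=1..m. 2 * (a i j * c i * c j * ?B (\<phi> j) (\<xi> i)) + (if j = i then ?B (\<phi> i) (\<xi> i) else 0))"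
        by (intro sum.cong refl) (use row_n[OF i] in \<open>auto simp: Bcoeff_def power2_eq_square algebra_simps\<close>)
      ultimately show ?thesis using i unfolding split_n by (simp add: sum.distrib sum_distrib_left)
    qed
    have high: "(\<Sum>j=1..n. Bcoeff n a c i j * ?B (\<phi> j) (\<xi> i)) = b i * ?B (\<phi> i) (\<xi> i)" if i: "i \<in> {m+1..n}" for i
    proof -
      have "(\<Sum>j=1..n. Bcoeff n a c i j * ?B (\<phi> j) (\<xi> i)) = (\<Sum>j=1..n. if j = i then b i * ?B (\<phi> i) (\<xi> i) else 0)"
        by (intro sum.cong refl) (use c_zero[OF i] in \<open>auto simp: Bcoeff_def b_def\<close>)
      then show ?thesis using i by simp
    qed
    have "energy'' \<Omega> lam n a u \<phi> \<xi> = (\<Sum>i=1..n. ?P (\<phi> i) (\<xi> i)) - (\<Sum>i=1..n. \<Sum>j=1..n. Bcoeff n a c i j * ?B (\<phi> j) (\<xi> i))"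
      unfolding u by (rule energy''_proportional[OF \<Omega> dim lam a_sym U_mem \<phi> \<xi>])
    also have "\<dots> = (\<Sum>i=1..n. ?P (\<phi> i) (\<xi> i) - (\<Sum>j=1..n. Bcoeff n a c i j * ?B (\<phi> j) (\<xi> i)))"
      by (simp add: sum_subtractf)
    also have "\<dots> = (\<Sum>i=1..m. ?P (\<phi> i) (\<xi> i) - (?B (\<phi> i) (\<xi> i) + 2 * (\<Sum>j=1..m. a i j * c i * c j * ?B (\<phi> j) (\<xi> i))))
        + (\<Sum>i=m+1..n. ?P (\<phi> i) (\<xi> i) - b i * ?B (\<phi> i) (\<xi> i))"
      unfolding split_n[of "\<lambda>i. ?P (\<phi> i) (\<xi> i) - (\<Sum>j=1..n. Bcoeff n a c i j * ?B (\<phi> j) (\<xi> i))"]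
      by (intro arg_cong2[where f = "(+)"] sum.cong refl) (simp_all only: low high)
    also have "\<dots> = CS.Q \<phi> \<xi>"
      unfolding CS.Q_def by (simp add: sum_subtractf sum.distrib sum_distrib_left del: One_nat_def)
    finally show ?thesis .
  qed
  have Hvec_sum: "(\<lambda>i x. \<Sum>s\<in>F. r s * w s i x) \<in> Hvec \<Omega> n" if "finite F" "\<And>s. s \<in> F \<Longrightarrow> w s \<in> Hvec \<Omega> n" for F r and w :: "'s \<Rightarrow> nat \<Rightarrow> 'a \<Rightarrow> real"
    unfolding Hvec_def by (intro CollectI ballI CP.P.sum_mem that(1) Hvec_mem[OF that(2)])

  \<comment> \<open>Morse index\<close>
  obtain v \<kappa> where v: "\<And>l l'. l < m \<Longrightarrow> l' < m \<Longrightarrow> (\<Sum>i=1..m. v l i * v l' i) = (if l = l' then 1 else 0)"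
    and diag: "\<And>x. (\<Sum>i=1..m. \<Sum>j=1..m. a i j * x i * x j) = (\<Sum>l<m. \<kappa> l * (\<Sum>i=1..m. v l i * x i)\<^sup>2)"
    and num_pos: "num_pos_eigenvalues (leading_block m a) = card {l\<in>{..<m}. \<kappa> l > 0}"
    by (rule leading_block_diagonalization[of m a]) (use a_sym m in auto)

  have morse: "morse_index \<Omega> lam n a u =
           enat (num_pos_eigenvalues (leading_block m a)
                 + (\<Sum>i=m+1..n. eigen_count \<omega> (Bcoeff n a c i i)))"
  proof -
    let ?S = "CS.neg_index \<kappa>"
    have card: "card ?S = num_pos_eigenvalues (leading_block m a) + (\<Sum>i=m+1..n. eigen_count \<omega> (Bcoeff n a c i i))"
    proof -
      have "eigen_count \<omega> (b i) = card {j\<in>{1..}. \<omega> j < b i}" for i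
        by (rule eigen_count_eq_card[OF \<omega>_mono EF.finite_eigenvalues_below])
      then show ?thesis unfolding CS.card_neg_index num_pos b_def[THEN fun_cong, symmetric] by (simp only:)
    qed
    have w: "CS.neg_vec v s \<in> Hvec \<Omega> n" if "s \<in> ?S" for s
      using CS.neg_vec_mem[OF that] by (simp add: Hvec_def)
    have "morse_index \<Omega> lam n a u \<le> enat (card ?S)"
    proof (rule morse_index_le)
      fix k and W :: "nat \<Rightarrow> nat \<Rightarrow> 'a \<Rightarrow> real"
      assume W: "\<And>p. p < k \<Longrightarrow> W p \<in> Hvec \<Omega> n" and k: "card ?S < k"
      have mem: "(\<lambda>i x. \<Sum>p<k. r p * W p i x) \<in> Hvec \<Omega> n" for r by (rule Hvec_sum) (use W in auto)
      show "\<exists>r. (\<exists>p<k. r p \<noteq> 0) \<and> 0 \<le> energy'' \<Omega> lam n a u (\<lambda>i x. \<Sum>p<k. r p * W p i x) (\<lambda>i x. \<Sum>p<k. r p * W p i x)"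
        unfolding E[OF mem mem] by (rule CS.exists_nonneg_direction[OF Hvec_mem[OF W] k diag])
    qed
    moreover have "enat (card ?S) \<le> morse_index \<Omega> lam n a u"
    proof (rule morse_index_ge[OF CS.finite_neg_index w])
      have mem: "(\<lambda>i x. \<Sum>s\<in>?S. r s * CS.neg_vec v s i x) \<in> Hvec \<Omega> n" for r
        by (rule Hvec_sum[OF CS.finite_neg_index w])
      then show "(\<lambda>i x. \<Sum>s\<in>?S. r s * CS.neg_vec v s i x) \<in> Hvec \<Omega> n" for r .
      show "energy'' \<Omega> lam n a u (\<lambda>i x. \<Sum>s\<in>?S. r s * CS.neg_vec v s i x) (\<lambda>i x. \<Sum>s\<in>?S. r s * CS.neg_vec v s i x) < 0"
        if "\<exists>s\<in>?S. r s \<noteq> 0" for r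
        unfolding E[OF mem mem] by (rule CS.Q_negative_on_span[OF diag v that])
      show "energy'' \<Omega> lam n a u \<phi> \<phi> = 0" if \<phi>: "\<phi> \<in> Hvec \<Omega> n" "vzero \<Omega> n \<phi>" for \<phi>
      proof -
        have z: "AE x in ?M. \<phi> i x = 0" if "i \<in> {1..n}" for i using \<phi>(2) that by (simp add: vzero_def)
        have B0: "?B (\<phi> i) f = 0" if "i \<in> {1..n}" for i f by (rule B_zero[OF z[OF that]])
        have P0: "?P (\<phi> i) (\<phi> i) = 0" if "i \<in> {1..n}" for i by (rule P_zero[OF z[OF that] Hvec_mem[OF \<phi>(1) that]])
        show ?thesis unfolding E[OF \<phi>(1) \<phi>(1)] CS.Q_def using m B0 P0 by simp
      qed
    qed
    ultimately show ?thesis unfolding card[symmetric] by (rule antisym)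
  qed

  \<comment> \<open>Linearized kernel\<close>
  have no3: "?B f f = 0" if nd: "scalar_nondegenerate \<Omega> lam U" and f: "f \<in> ?H" "\<And>v. v \<in> ?H \<Longrightarrow> ?P f v = 3 * ?B f v" for f
    using nd f by (intro B_zero) (auto simp: scalar_nondegenerate_def weq)
  have kernel_iff: "\<phi> \<in> linearized_kernel \<Omega> lam n a u \<longleftrightarrow> \<phi> \<in> Hvec \<Omega> n \<and> (\<forall>\<xi>\<in>Hvec \<Omega> n. CS.Q \<phi> \<xi> = 0)" for \<phi>
    using E by (auto simp: linearized_kernel_def)
  have comp: "k \<in> {m+1..n} \<Longrightarrow> weighted_eigen_eq \<Omega> lam U (b k) (\<phi> k)"
    "i \<in> {1..m} \<Longrightarrow> AE x in ?M. \<phi> i x = CS.coef (\<phi> i) * U x"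
    "i \<in> {1..m} \<Longrightarrow> (\<Sum>j=1..m. a i j * (c j * CS.coef (\<phi> j))) = 0"
    if nd: "scalar_nondegenerate \<Omega> lam U" and ker: "\<phi> \<in> linearized_kernel \<Omega> lam n a u" for \<phi> k i
  proof -
    have \<phi>: "\<phi> i \<in> ?H" if "i \<in> {1..n}" for i using ker that Hvec_mem by (auto simp: kernel_iff)
    have Q0: "CS.Q \<phi> \<xi> = 0" if "\<And>i. i \<in> {1..n} \<Longrightarrow> \<xi> i \<in> ?H" for \<xi>
      using ker that by (auto simp: kernel_iff Hvec_def)
    have K1: "?P (\<phi> k) v = b k * ?B (\<phi> k) v" if k: "k \<in> {m+1..n}" and v: "v \<in> ?H" for k v
      by (rule CS.kernel_components(1)[where \<phi> = \<phi>]) (fact \<phi> Q0 no3[OF nd] k v)+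
    have K2: "?B (CS.rest (\<phi> i)) (CS.rest (\<phi> i)) = 0" if i: "i \<in> {1..m}" for i
      by (rule CS.kernel_components(2)[where \<phi> = \<phi>]) (fact \<phi> Q0 no3[OF nd] i)+
    have K3: "(\<Sum>j=1..m. a i j * (c j * CS.coef (\<phi> j))) = 0" if i: "i \<in> {1..m}" for i
      by (rule CS.kernel_components(3)[where \<phi> = \<phi>]) (fact \<phi> Q0 no3[OF nd] i)+
    show "weighted_eigen_eq \<Omega> lam U (b k) (\<phi> k)" if "k \<in> {m+1..n}"
      unfolding weq using K1[OF that] \<phi>[of k] that m by simp
    show "AE x in ?M. \<phi> i x = CS.coef (\<phi> i) * U x" if i: "i \<in> {1..m}"
    proof -
      have \<phi>i: "\<phi> i \<in> ?H" using i m by (intro \<phi>) auto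
      have "AE x in ?M. CS.rest (\<phi> i) x = 0"
        by (rule B_zero_imp[OF CS.rest_mem[OF \<phi>i] K2[OF i]])
      then show ?thesis by eventually_elim (simp add: CS.rest_def)
    qed
    show "(\<Sum>j=1..m. a i j * (c j * CS.coef (\<phi> j))) = 0" if i: "i \<in> {1..m}"
      by (rule K3[OF i])
  qed

  let ?S1 = "{(\<lambda>i x. if i \<in> {1..m} then \<gamma> i / c i * U x else 0) |\<gamma>::nat \<Rightarrow> real.
                   \<forall>i\<in>{1..m}. (\<Sum>j=1..m. a i j * \<gamma> j) = 0}"
  let ?S2 = "\<Union>k\<in>{m+1..n}. {(\<lambda>i x. if i = k then \<psi> j x else 0) |j. 1 \<le> j \<and> Bcoeff n a c k k = \<omega> j}"
  have kernel: "linearized_kernel \<Omega> lam n a u = ae_span \<Omega> n (?S1 \<union> ?S2)" if nd: "scalar_nondegenerate \<Omega> lam U"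
  proof (intro equalityI subsetI)
    fix \<phi> assume ker: "\<phi> \<in> linearized_kernel \<Omega> lam n a u"
    note C = comp[OF nd ker]
    \<comment> \<open>The generators divide by \<open>c i\<close>, so the coefficients along
      \<open>U\<close> are multiplied by \<open>c\<close>; it is this vector that \<open>A_m\<close>
      annihilates.\<close>
    let ?\<gamma> = "\<lambda>j. c j * CS.coef (\<phi> j)"
    have "(\<lambda>i x. if i \<in> {1..m} then ?\<gamma> i / c i * U x else 0) \<in> ?S1 \<union> ?S2"
      by (intro UnI1 CollectI exI[of _ ?\<gamma>] conjI refl ballI C(3))
    from ae_span_base[OF this, of 1]
    have 1: "(\<lambda>i x. if i \<in> {1..m} then \<phi> i x else 0) \<in> ae_span \<Omega> n (?S1 \<union> ?S2)"
    proof (rule ae_span_cong)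
      show "AE x in ?M. (if i \<in> {1..m} then \<phi> i x else 0) = 1 * (if i \<in> {1..m} then ?\<gamma> i / c i * U x else 0)" for i
      proof (cases "i \<in> {1..m}")
        case True
        then have "c i > 0" by (rule c_pos)
        then show ?thesis using C(2)[OF True] True by (auto elim!: eventually_mono)
      qed (simp only: if_False mult_zero_right AE_I2)
    qed
    have 2: "(\<lambda>i x. if i = k then \<phi> k x else 0) \<in> ae_span \<Omega> n (?S1 \<union> ?S2)" if k: "k \<in> {m+1..n}" for k
    proof -
      obtain F r where F: "finite F" "F \<subseteq> {i. 1 \<le> i \<and> \<omega> i = b k}" "AE x in ?M. \<phi> k x = (\<Sum>i\<in>F. r i * \<psi> i x)"
        using all_eig[OF C(1)[OF k]] by (elim exE conjE)
      have "(\<lambda>i x. \<Sum>j\<in>F. r j * (if i = k then \<psi> j x else 0)) \<in> ae_span \<Omega> n (?S1 \<union> ?S2)"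
      proof (rule ae_span_sum[OF F(1)])
        fix j assume j: "j \<in> F"
        have "(\<lambda>i x. if i = k then \<psi> j x else 0) \<in> ?S1 \<union> ?S2" 
        proof (intro UnI2 UN_I[OF k] CollectI exI[of _ j] conjI refl)
          have "j \<in> {i. 1 \<le> i \<and> \<omega> i = b k}" by (rule subsetD[OF F(2) j])
          then show "1 \<le> j" "Bcoeff n a c k k = \<omega> j" by (simp_all add: b_def)
        qed
        then show "(\<lambda>i x. r j * (if i = k then \<psi> j x else 0)) \<in> ae_span \<Omega> n (?S1 \<union> ?S2)" by (rule ae_span_base)
      qed
      then show ?thesis
      proof (rule ae_span_cong)
        show "AE x in ?M. (if i = k then \<phi> k x else 0) = (\<Sum>j\<in>F. r j * (if i = k then \<psi> j x else 0))" for i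
          using F(3) by (cases "i = k") (simp_all only: simp_thms if_True if_False mult_zero_right sum.neutral_const AE_I2)
      qed
    qed
    from ae_span_add[OF 1 ae_span_sum[OF finite_atLeastAtMost 2]]
    show "\<phi> \<in> ae_span \<Omega> n (?S1 \<union> ?S2)"
    proof (rule ae_span_cong)
      fix i assume i: "i \<in> {1..n}"
      have "\<phi> i x = (if i \<in> {1..m} then \<phi> i x else 0) + (\<Sum>k=m+1..n. if i = k then \<phi> k x else 0)" for x
        using i by auto
      then show "AE x in ?M. \<phi> i x = (if i \<in> {1..m} then \<phi> i x else 0) + (\<Sum>k=m+1..n. if i = k then \<phi> k x else 0)"
        by (rule AE_I2)
    qed
  next
    fix \<phi> assume "\<phi> \<in> ae_span \<Omega> n (?S1 \<union> ?S2)"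
    then obtain F r where F: "finite F" "F \<subseteq> ?S1 \<union> ?S2" "vzero \<Omega> n (\<lambda>i x. \<phi> i x - (\<Sum>w\<in>F. r w * w i x))"
      unfolding ae_span_def by (elim CollectE exE conjE)
    have gen: "w \<in> Hvec \<Omega> n \<and> (\<forall>\<xi>\<in>Hvec \<Omega> n. CS.Q w \<xi> = 0)" if "w \<in> ?S1 \<union> ?S2" for w
      using that
    proof
      assume "w \<in> ?S1"
      then obtain \<gamma> where w: "w = (\<lambda>i x. if i \<in> {1..m} then \<gamma> i / c i * U x else 0)"
        and \<gamma>: "\<forall>i\<in>{1..m}. (\<Sum>j=1..m. a i j * \<gamma> j) = 0" by (elim CollectE exE conjE)
      have "(\<lambda>x. if i \<in> {1..m} then \<gamma> i / c i * U x else 0) \<in> ?H" for i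
        using CP.P.scale_mem[OF U_mem] CP.P.zero_mem by (cases "i \<in> {1..m}") (simp_all only: if_True if_False)
      then have "w \<in> Hvec \<Omega> n" unfolding w Hvec_def by (intro CollectI ballI)
      moreover have "CS.Q w \<xi> = 0" if "\<xi> \<in> Hvec \<Omega> n" for \<xi>
        unfolding w by (rule CS.Q_generator_block) (use \<gamma> Hvec_mem[OF that] in auto)
      ultimately show ?thesis by blast
    next
      assume "w \<in> ?S2"
      then obtain k j where k: "k \<in> {m+1..n}" and j: "1 \<le> j" "b k = \<omega> j"
        and w: "w = (\<lambda>i x. if i = k then \<psi> j x else 0)" unfolding b_def by (elim UN_E CollectE exE conjE)
      have \<psi>j: "\<psi> j \<in> ?H" "\<And>v. v \<in> ?H \<Longrightarrow> ?P (\<psi> j) v = b k * ?B (\<psi> j) v"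
        using EF.eig_mem EF.eig j by auto
      have "(\<lambda>x. if i = k then \<psi> j x else 0) \<in> ?H" for i
        using \<psi>j(1) CP.P.zero_mem by (cases "i = k") simp_all
      then have "w \<in> Hvec \<Omega> n" unfolding w Hvec_def by (intro CollectI ballI)
      moreover have "CS.Q w \<xi> = 0" if "\<xi> \<in> Hvec \<Omega> n" for \<xi>
        unfolding w by (rule CS.Q_generator_single[OF k \<psi>j]) (use Hvec_mem[OF that] in auto)
      ultimately show ?thesis by blast
    qed
    let ?w = "\<lambda>i x. \<Sum>w\<in>F. r w * w i x"
    have F_mem: "w \<in> Hvec \<Omega> n" if "w \<in> F" for w by (rule gen[OF subsetD[OF F(2) that], THEN conjunct1])
    have w_mem: "?w \<in> Hvec \<Omega> n" by (rule Hvec_sum[OF F(1) F_mem])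
    have AE_w: "AE x in ?M. ?w i x = \<phi> i x" if "i \<in> {1..n}" for i
    proof -
      have "AE x in ?M. \<phi> i x - ?w i x = 0" using F(3) that by (simp add: vzero_def)
      then show ?thesis by eventually_elim simp
    qed
    have \<phi>: "\<phi> \<in> Hvec \<Omega> n"
      using Hspace_AE_cong[OF \<Omega> Hvec_mem[OF w_mem] AE_w] by (simp add: Hvec_def)
    have "CS.Q \<phi> \<xi> = 0" if \<xi>: "\<xi> \<in> Hvec \<Omega> n" for \<xi>
    proof -
      \<comment> \<open>An element of the span equals a combination of generators only almost
        everywhere. The forms do not see the difference, so \<open>Q\<close> can be evaluated on the
        combination, where it is linear.\<close>
      have d: "?P (\<phi> i) f = ?P (?w i) f" "?B (\<phi> i) f = ?B (?w i) f" if i: "i \<in> {1..n}" and f: "f \<in> ?H" for i f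
      proof -
        have z: "AE x in ?M. \<phi> i x - ?w i x = 0" using AE_w[OF i] by eventually_elim simp
        show "?P (\<phi> i) f = ?P (?w i) f" "?B (\<phi> i) f = ?B (?w i) f"
          using P_zero[OF z f] B_zero[OF z, of f] CP.P.diff_left[OF Hvec_mem[OF \<phi> i] Hvec_mem[OF w_mem i] f]
            CP.B.diff_left[OF Hvec_mem[OF \<phi> i] Hvec_mem[OF w_mem i] f] by simp_all
      qed
      have "CS.Q \<phi> \<xi> = CS.Q ?w \<xi>"
        unfolding CS.Q_def
        by (intro arg_cong2[where f = "(+)"] arg_cong2[where f = "(-)"] arg_cong2[where f = "(*)"] sum.cong refl d Hvec_mem[OF \<xi>])
          (use m in auto)
      also have "\<dots> = (\<Sum>w\<in>F. r w * CS.Q w \<xi>)"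
        by (rule CS.Q_sum_left[OF F(1)]) (rule Hvec_mem[OF F_mem] Hvec_mem[OF \<xi>], assumption+)+
      also have "\<dots> = 0" 
      proof (intro sum.neutral ballI)
        fix w assume "w \<in> F"
        from gen[OF subsetD[OF F(2) this]] have "CS.Q w \<xi> = 0" using \<xi> by (elim conjE bspec)
        then show "r w * CS.Q w \<xi> = 0" by simp
      qed
      finally show ?thesis .
    qed
    then show "\<phi> \<in> linearized_kernel \<Omega> lam n a u" using \<phi> by (simp add: kernel_iff)
  qed

  \<comment> \<open>Nondegeneracy of the system\<close>
  have nondeg: "system_nondegenerate \<Omega> lam n a u"
    if nd: "scalar_nondegenerate \<Omega> lam U" and det: "Determinant.det (leading_block m a) \<noteq> 0"
      and bk: "\<forall>k\<in>{m+1..n}. Bcoeff n a c k k \<notin> \<omega> ` {1..}"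
    unfolding system_nondegenerate_def vzero_def
  proof (intro ballI)
    fix \<phi> i assume ker: "\<phi> \<in> linearized_kernel \<Omega> lam n a u" and i: "i \<in> {1..n}"
    note C = comp[OF nd ker]
    show "AE x in ?M. \<phi> i x = 0"
    proof (cases "i \<in> {1..m}")
      case True
      let ?x = "\<lambda>j. c j * CS.coef (\<phi> j)"
      \<comment> \<open>Shifted by one, since \<open>leading_block\<close> is indexed from 0 and
        components from 1.\<close>
      define y where "y = Matrix.vec m (\<lambda>j. ?x (j + 1))"
      have A: "leading_block m a \<in> carrier_mat m m" and y: "y \<in> carrier_vec m"
        by (simp_all add: leading_block_def y_def)
      have Ay: "leading_block m a *\<^sub>v y = 0\<^sub>v m"
      proof (rule eq_vecI)
        fix k assume "k < dim_vec (0\<^sub>v m)"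
        then have k: "k < m" by simp
        have "vec_index (leading_block m a *\<^sub>v y) k = (\<Sum>j=0..<m. a (k + 1) (j + 1) * ?x (j + 1))"
          using k by (simp add: leading_block_def y_def scalar_prod_def)
        also have "\<dots> = (\<Sum>j=1..m. a (k + 1) j * ?x j)"
          by (simp add: sum.atLeast1_atMost_eq atLeast0LessThan)
        also have "\<dots> = 0" using C(3)[of "k + 1"] k by simp
        finally show "vec_index (leading_block m a *\<^sub>v y) k = vec_index (0\<^sub>v m) k" using k by simp
      qed (use A in auto)
      have "y = 0\<^sub>v m"
      proof (rule ccontr)
        assume "y \<noteq> 0\<^sub>v m"
        then have "Determinant.det (leading_block m a) = 0"
          unfolding det_0_iff_vec_prod_zero_field[OF A] by (intro exI[of _ y] conjI y Ay)
        then show False using det by simp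
      qed
      moreover have "i - 1 < m" "i - 1 + 1 = i" using True by auto
      ultimately have "?x i = 0" unfolding y_def using index_vec[of "i - 1" m "\<lambda>j. ?x (j + 1)"] by simp
      then have "CS.coef (\<phi> i) = 0" using c_pos[OF True] by simp
      then show ?thesis using C(2)[OF True] by simp
    next
      case False
      then have k: "i \<in> {m+1..n}" using i by auto
      obtain F r where F: "F \<subseteq> {j. 1 \<le> j \<and> \<omega> j = b i}" "AE x in ?M. \<phi> i x = (\<Sum>j\<in>F. r j * \<psi> j x)"
        using all_eig[OF C(1)[OF k]] by (elim exE conjE)
      have "F = {}" using F(1) bk k by (force simp: b_def)
      then show ?thesis using F(2) by simp
    qed
  qed
  show ?thesis
    by (intro conjI impI morse kernel nondeg) (assumption | elim conjE, assumption)+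
qed

end
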